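(* Let $(X_t^i)_{t\ge0}$, $i=1,\dots,n$, be ergodic Feller processes on $E_i$ with generators $\mathcal{L}_i$ and invariant measures $\pi_i$, and assume that each $\mathcal{L}_i$ is invertible on $L_0^2(\pi_i)$, i.e. for all $f\in L^2_0(\pi_i)$ there exists $\phi\in\mathcal{D}(\mathcal{L}_i)\cap L^2_0(\pi_i)$ with $-\mathcal{L}_i\phi=f$. Let $f_i\in L_0^2(\pi_i)$, let $\phi_i\in\mathcal{D}(\mathcal{L}_i)\cap L_0^2(\pi_i)$ be the solution of $-\mathcal{L}_i\phi_i=f_i$, put $\sigma_{f_i}^2=\langle f_i,\phi_i\rangle_{L^2(\pi_i)}$, and let $F=\frac1n\sum_{i=1}^n f_i$. Let $\Gamma\in\mathcal{G}^0$ be an ergodic coupling operator with invariant measure $\bar\pi_\Gamma$, and let $(\bar X_t)_{t\ge0}$ be the process generated by $\bar{\mathcal{L}}_\Gamma$ with $\bar X_0\sim\bar\pi_\Gamma$. Then $$\sqrt T\left(\frac1T\int_0^TF(\bar X_t)\,\mathrm{d}t-\bar\pi_\Gamma(F)\right)\xrightarrow[T\to\infty]{d}\mathcal{N}(0,2\sigma_F^2),$$ where $$\sigma_F^2=\frac1{n^2}\sum_{i=1}^n\sigma_{f_i}^2-\int_{\bar E}\bar{\mathcal{L}}_0\xi\,\mathrm{d}\bar\pi_\Gamma,\qquad \xi=\frac1{n^2}\sum_{i<j}\phi_i\phi_j .$$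
   Context: State spaces $E_i$ are locally compact Polish spaces with a differentiable structure; $\bar E=E_1\times\dots\times E_n$. A Markov process is Feller if its semigroup preserves $C_0$ and is strongly continuous on it; all Feller processes are assumed to have $C_c^\infty$ in the domain of their generator, and $C_c^\infty(E_i)$ is a core for $\mathcal{L}_i$. Functions on $E_i$ are regarded as functions on $\bar E$ depending only on $x_i$, and $\mathcal{L}_i$ acts on the $i$-th variable; $\bar{\mathcal{L}}_0=\sum_{i=1}^n\mathcal{L}_i$ (so that $\bar{\mathcal{L}}_0(\phi_i\phi_j)=(\mathcal{L}_i\phi_i)\phi_j+\phi_i\mathcal{L}_j\phi_j$ for $i\ne j$). Ergodicity of $(X^i_t)$: there is a unique probability measure $\pi_i$ on $E_i$ with $\int\mathcal{L}_if\,\mathrm{d}\pi_i=0$ for $f\in\mathcal{D}(\mathcal{L}_i)$, and $\lim_{T\to\infty}\frac1T\int_0^Tf(X_t^i)\,\mathrm{d}t=\int f\,\mathrm{d}\pi_i$ for $f\in C_b(E_i)$. Coupling operators: $\mathcal{G}$ is the set of linear operators $(\Gamma,\mathcal{D}(\Gamma))$ on $\mathcal{B}_b(\bar E)$ (the bounded Borel measurable functions on $\bar E$) such that (1) for all $i$ and $f\in C_c^\infty(E_i)$, $f\in\mathcal{D}(\Gamma)$ and $\Gamma f=0$; (2) $\bar{\mathcal{L}}_\Gamma=\sum_i\mathcal{L}_i+\Gamma$ with domain $\bigotimes_i\mathcal{D}(\mathcal{L}_i)\cap\mathcal{D}(\Gamma)$ is closable and its closure (denoted by the same symbol) generates a Feller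 process on $\bar E$. The process so generated has the $(X^i_t)$ as its coordinate processes in law. $\mathcal{G}^0\subset\mathcal{G}$ consists of those $\Gamma$ for which the process $(\bar X_t)_{t\ge0}$ generated by $\bar{\mathcal{L}}_\Gamma$ is ergodic, i.e. there is a unique probability measure $\bar\pi_\Gamma$ on $\bar E$ with $\int_{\bar E}\bar{\mathcal{L}}_\Gamma f\,\mathrm{d}\bar\pi_\Gamma=0$ for $f\in\mathcal{D}(\bar{\mathcal{L}}_\Gamma)$, and $\lim_{T\to\infty}\frac1T\int_0^Tf(\bar X_t)\,\mathrm{d}t=\int_{\bar E}f\,\mathrm{d}\bar\pi_\Gamma$ for $f\in C_b(\bar E)$; this unique invariant measure $\bar\pi_\Gamma$ has marginals $\pi_1,\dots,\pi_n$. Semigroups and generators are extended to $L^2(\pi_i)$, $L^2(\bar\pi_\Gamma)$ and denoted by the same letters. $L_0^2(\mu)=\{f\in L^2(\mu):\mu(f)=0\}$. *)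

theory Defs
  imports "HOL-Probability.Probability"
begin

section \<open>State spaces with a differentiable structure\<close>

text \<open>
  The state spaces are topologies, so that finitely many different spaces can live on one type.
  The functions on a space \<open>X\<close> that operators act on are extended by \<open>0\<close> outside
  \<open>topspace X\<close>, so that two of them are equal iff they agree on \<open>topspace X\<close>.
\<close>

definition borel_of :: "'a topology \<Rightarrow> 'a measure" where
  "borel_of X = sigma (topspace X) {U. openin X U}"

definition locally_compact_Polish :: "'a topology \<Rightarrow> bool" where
  "locally_compact_Polish X \<longleftrightarrow>
     completely_metrizable_space X \<and> second_countable X \<and> locally_compact_space X"

definition Bb :: "'a topology \<Rightarrow> ('a \<Rightarrow> real) set" where
  "Bb X = {f. f \<in> borel_measurable (borel_of X) \<and> bounded (range f) \<and> (\<forall>x. x \<notin> topspace X \<longrightarrow> f x = 0)}"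

definition Cb :: "'a topology \<Rightarrow> ('a \<Rightarrow> real) set" where
  "Cb X = {f. continuous_map X euclideanreal f \<and> bounded (range f) \<and> (\<forall>x. x \<notin> topspace X \<longrightarrow> f x = 0)}"

definition C0 :: "'a topology \<Rightarrow> ('a \<Rightarrow> real) set" where
  "C0 X = {f. continuous_map X euclideanreal f \<and>
     (\<forall>e>0. \<exists>K. compactin X K \<and> (\<forall>x\<in>topspace X - K. \<bar>f x\<bar> < e)) \<and>
     (\<forall>x. x \<notin> topspace X \<longrightarrow> f x = 0)}"

text \<open>
  The Euclidean space with finite set \<open>J\<close> of coordinates is the product topology on
  \<open>J \<rightarrow>\<^sub>E UNIV\<close>. Naming coordinates by arbitrary finite sets avoids renumbering them in
  products of spaces of different dimensions.
\<close>

abbreviation Euclid :: "'c set \<Rightarrow> ('c \<Rightarrow> real) topology" where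
  "Euclid J \<equiv> product_topology (\<lambda>_. euclideanreal) J"

primrec Ck_on :: "nat \<Rightarrow> 'c set \<Rightarrow> ('c \<Rightarrow> real) set \<Rightarrow> (('c \<Rightarrow> real) \<Rightarrow> real) \<Rightarrow> bool" where
  "Ck_on 0 J V f \<longleftrightarrow> continuous_map (subtopology (Euclid J) V) euclideanreal f"
| "Ck_on (Suc k) J V f \<longleftrightarrow>
     continuous_map (subtopology (Euclid J) V) euclideanreal f \<and>
     (\<forall>j\<in>J. \<exists>g. Ck_on k J V g \<and>
        (\<forall>y\<in>V. ((\<lambda>t. f (y(j := t))) has_real_derivative g y) (at (y j))))"

definition smooth_on :: "'c set \<Rightarrow> ('c \<Rightarrow> real) set \<Rightarrow> (('c \<Rightarrow> real) \<Rightarrow> real) \<Rightarrow> bool" where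
  "smooth_on J V f \<longleftrightarrow> (\<forall>k. Ck_on k J V f)"

text \<open>A chart consists of its domain, the set of its coordinates, and the coordinate map.\<close>

type_synonym ('a, 'c) chart = "'a set \<times> 'c set \<times> ('a \<Rightarrow> 'c \<Rightarrow> real)"

definition chart_of :: "'a topology \<Rightarrow> ('a, 'c) chart \<Rightarrow> bool" where
  "chart_of X = (\<lambda>(U, J, \<phi>). openin X U \<and> finite J \<and> openin (Euclid J) (\<phi> ` U) \<and>
     homeomorphic_map (subtopology X U) (subtopology (Euclid J) (\<phi> ` U)) \<phi>)"

definition smooth_atlas :: "'a topology \<Rightarrow> ('a, 'c) chart set \<Rightarrow> bool" where
  "smooth_atlas X \<A> \<longleftrightarrow>
     (\<forall>c\<in>\<A>. chart_of X c) \<and> (\<Union>c\<in>\<A>. fst c) = topspace X \<and>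
     (\<forall>(U, J, \<phi>)\<in>\<A>. \<forall>(U', J', \<phi>')\<in>\<A>. \<forall>j\<in>J'.
        smooth_on J (\<phi> ` (U \<inter> U')) (\<lambda>y. \<phi>' (inv_into U \<phi> y) j))"

definition Ccinf :: "'a topology \<Rightarrow> ('a, 'c) chart set \<Rightarrow> ('a \<Rightarrow> real) set" where
  "Ccinf X \<A> = {f. (\<exists>K. compactin X K \<and> (\<forall>x. x \<notin> K \<longrightarrow> f x = 0)) \<and>
     (\<forall>(U, J, \<phi>)\<in>\<A>. smooth_on J (\<phi> ` U) (\<lambda>y. f (inv_into U \<phi> y)))}"

abbreviation prod_space :: "nat \<Rightarrow> (nat \<Rightarrow> 'a topology) \<Rightarrow> (nat \<Rightarrow> 'a) topology" where
  "prod_space n E \<equiv> product_topology E {1..n}"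

definition prod_atlas ::
  "nat \<Rightarrow> (nat \<Rightarrow> ('a, 'c) chart set) \<Rightarrow> (nat \<Rightarrow> 'a, nat \<times> 'c) chart set" where
  "prod_atlas n \<A> =
     {((\<Pi>\<^sub>E i\<in>{1..n}. fst (c i)),
       (SIGMA i:{1..n}. fst (snd (c i))),
       (\<lambda>x. \<lambda>(i, j)\<in>(SIGMA i:{1..n}. fst (snd (c i))). snd (snd (c i)) (x i) j))
      | c. \<forall>i\<in>{1..n}. c i \<in> \<A> i}"

section \<open>Operators given by their graphs\<close>

type_synonym 'a oper = "(('a \<Rightarrow> real) \<times> ('a \<Rightarrow> real)) set"

definition op_span :: "'a oper \<Rightarrow> 'a oper" where
  "op_span A = {(\<lambda>x. \<Sum>k<m. c k * fst (a k) x, \<lambda>x. \<Sum>k<m. c k * snd (a k) x)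
     | (m :: nat) c a. \<forall>k<m. a k \<in> A}"

definition linear_operator :: "'a oper \<Rightarrow> bool" where
  "linear_operator A \<longleftrightarrow> op_span A \<subseteq> A \<and> single_valued A"

definition op_sum :: "'a oper \<Rightarrow> 'a oper \<Rightarrow> 'a oper" where
  "op_sum A B = {(f, \<lambda>x. g x + h x) | f g h. (f, g) \<in> A \<and> (f, h) \<in> B}"

definition op_restrict :: "'a oper \<Rightarrow> ('a \<Rightarrow> real) set \<Rightarrow> 'a oper" where
  "op_restrict A D = {(f, g) \<in> A. f \<in> D}"

definition op_closure :: "'a oper \<Rightarrow> 'a oper" where
  "op_closure A = {(f, g). \<exists>a. (\<forall>k::nat. a k \<in> A) \<and>
     uniform_limit UNIV (\<lambda>k. fst (a k)) f sequentially \<and>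
     uniform_limit UNIV (\<lambda>k. snd (a k)) g sequentially}"

definition closable :: "'a oper \<Rightarrow> bool" where
  "closable A \<longleftrightarrow> single_valued (op_closure A)"

section \<open>Feller processes, generators, ergodicity\<close>

definition transition_kernel :: "'a topology \<Rightarrow> (real \<Rightarrow> 'a \<Rightarrow> 'a measure) \<Rightarrow> bool" where
  "transition_kernel X p \<longleftrightarrow>
     (\<forall>t\<ge>0. p t \<in> borel_of X \<rightarrow>\<^sub>M prob_algebra (borel_of X)) \<and>
     (\<forall>x\<in>topspace X. p 0 x = return (borel_of X) x) \<and>
     (\<forall>s\<ge>0. \<forall>t\<ge>0. \<forall>x\<in>topspace X. p (s + t) x = p s x \<bind> p t)"

definition semigroup_of ::
  "'a topology \<Rightarrow> (real \<Rightarrow> 'a \<Rightarrow> 'a measure) \<Rightarrow> real \<Rightarrow> ('a \<Rightarrow> real) \<Rightarrow> ('a \<Rightarrow> real)" where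
  "semigroup_of X p t f = (\<lambda>x. if x \<in> topspace X then (\<integral>y. f y \<partial>p t x) else 0)"

definition generator :: "'a topology \<Rightarrow> (real \<Rightarrow> 'a \<Rightarrow> 'a measure) \<Rightarrow> 'a oper" where
  "generator X p = {(f, g). f \<in> C0 X \<and> g \<in> C0 X \<and>
     uniform_limit UNIV (\<lambda>t x. (semigroup_of X p t f x - f x) / t) g (at_right 0)}"

definition feller_process ::
  "'a topology \<Rightarrow> ('a, 'c) chart set \<Rightarrow> (real \<Rightarrow> 'a \<Rightarrow> 'a measure) \<Rightarrow> bool" where
  "feller_process X \<A> p \<longleftrightarrow>
     transition_kernel X p \<and>
     (\<forall>t\<ge>0. semigroup_of X p t ` C0 X \<subseteq> C0 X) \<and>
     (\<forall>f\<in>C0 X. uniform_limit UNIV (\<lambda>t. semigroup_of X p t f) f (at_right 0)) \<and>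
     Ccinf X \<A> \<subseteq> Domain (generator X p)"

definition is_core :: "('a \<Rightarrow> real) set \<Rightarrow> 'a oper \<Rightarrow> bool" where
  "is_core D A \<longleftrightarrow> D \<subseteq> Domain A \<and> op_closure (op_restrict A D) = A"

definition natural_filtration ::
  "'w measure \<Rightarrow> 'a topology \<Rightarrow> (real \<Rightarrow> 'w \<Rightarrow> 'a) \<Rightarrow> real \<Rightarrow> 'w measure" where
  "natural_filtration M X Y t =
     sigma (space M) {Y s -` A \<inter> space M | s A. 0 \<le> s \<and> s \<le> t \<and> A \<in> sets (borel_of X)}"

definition cadlag :: "'a topology \<Rightarrow> (real \<Rightarrow> 'a) \<Rightarrow> bool" where
  "cadlag X y \<longleftrightarrow> (\<forall>t\<ge>0. limitin X y (y t) (at_right t)) \<and> (\<forall>t>0. \<exists>l. limitin X y l (at_left t))"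

definition markov_process ::
  "'a topology \<Rightarrow> (real \<Rightarrow> 'a \<Rightarrow> 'a measure) \<Rightarrow> 'a measure \<Rightarrow> 'w measure \<Rightarrow> (real \<Rightarrow> 'w \<Rightarrow> 'a) \<Rightarrow> bool" where
  "markov_process X p \<mu> M Y \<longleftrightarrow>
     prob_space M \<and>
     (\<forall>t\<ge>0. Y t \<in> M \<rightarrow>\<^sub>M borel_of X) \<and>
     distr M (borel_of X) (Y 0) = \<mu> \<and>
     (\<forall>\<omega>\<in>space M. cadlag X (\<lambda>t. Y t \<omega>)) \<and>
     (\<forall>s\<ge>0. \<forall>t\<ge>0. \<forall>A\<in>sets (borel_of X). AE \<omega> in M.
        real_cond_exp M (natural_filtration M X Y s) (\<lambda>\<omega>. indicator A (Y (s + t) \<omega>)) \<omega>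
          = measure (p t (Y s \<omega>)) A)"

definition prob_on :: "'a topology \<Rightarrow> 'a measure \<Rightarrow> bool" where
  "prob_on X \<mu> \<longleftrightarrow> prob_space \<mu> \<and> sets \<mu> = sets (borel_of X)"

definition invariant_for :: "'a topology \<Rightarrow> 'a oper \<Rightarrow> 'a measure \<Rightarrow> bool" where
  "invariant_for X A \<mu> \<longleftrightarrow> prob_on X \<mu> \<and> (\<forall>(f, g)\<in>A. (\<integral>x. g x \<partial>\<mu>) = 0)"

text \<open>
  The time averages converge almost surely, for every initial distribution. The process is
  realised as the coordinate process on its path space; this depends only on its law.
\<close>

definition ergodic ::
  "'a topology \<Rightarrow> 'a oper \<Rightarrow> (real \<Rightarrow> 'a \<Rightarrow> 'a measure) \<Rightarrow> 'a measure \<Rightarrow> bool" where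
  "ergodic X A p \<pi> \<longleftrightarrow>
     (\<forall>\<mu>. invariant_for X A \<mu> \<longleftrightarrow> \<mu> = \<pi>) \<and>
     (\<forall>\<mu> (Pr :: (real \<Rightarrow> 'a) measure). prob_on X \<mu> \<longrightarrow> markov_process X p \<mu> Pr (\<lambda>t \<omega>. \<omega> t) \<longrightarrow>
        (\<forall>f\<in>Cb X. AE \<omega> in Pr.
           ((\<lambda>T. 1 / T * (LINT t:{0..T}|lborel. f (\<omega> t))) \<longlongrightarrow> (\<integral>x. f x \<partial>\<pi>)) at_top))"

section \<open>Extension to square-integrable functions\<close>

definition L2 :: "'a measure \<Rightarrow> ('a \<Rightarrow> real) set" where
  "L2 \<mu> = {f. f \<in> borel_measurable \<mu> \<and> integrable \<mu> (\<lambda>x. (f x)\<^sup>2)}"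

definition L20 :: "'a measure \<Rightarrow> ('a \<Rightarrow> real) set" where
  "L20 \<mu> = {f \<in> L2 \<mu>. (\<integral>x. f x \<partial>\<mu>) = 0}"

text \<open>
  The generator in \<open>L\<^sup>2(\<mu>)\<close> of the semigroup given by the same kernel, for invariant \<open>\<mu>\<close>.
  It relates representatives of the classes modulo almost everywhere equality.
\<close>

definition L2_generator :: "'a topology \<Rightarrow> (real \<Rightarrow> 'a \<Rightarrow> 'a measure) \<Rightarrow> 'a measure \<Rightarrow> 'a oper" where
  "L2_generator X p \<mu> = {(f, g). f \<in> L2 \<mu> \<and> g \<in> L2 \<mu> \<and>
     ((\<lambda>t. \<integral>\<^sup>+ x. ennreal (((semigroup_of X p t f x - f x) / t - g x)\<^sup>2) \<partial>\<mu>) \<longlongrightarrow> 0) (at_right 0)}"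

section \<open>Couplings\<close>

definition lift_fun :: "nat \<Rightarrow> (nat \<Rightarrow> 'a topology) \<Rightarrow> nat \<Rightarrow> ('a \<Rightarrow> real) \<Rightarrow> ((nat \<Rightarrow> 'a) \<Rightarrow> real)" where
  "lift_fun n E i f = (\<lambda>x. if x \<in> topspace (prod_space n E) then f (x i) else 0)"

text \<open>
  The sum of the operators \<open>L i\<close>, each acting on the \<open>i\<close>-th variable, on the algebraic tensor
  product of their domains.
\<close>

definition tensor_sum :: "nat \<Rightarrow> (nat \<Rightarrow> 'a topology) \<Rightarrow> (nat \<Rightarrow> 'a oper) \<Rightarrow> (nat \<Rightarrow> 'a) oper" where
  "tensor_sum n E L = op_span
     {(\<lambda>x. if x \<in> topspace (prod_space n E) then \<Prod>i\<in>{1..n}. u i (x i) else 0,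
       \<lambda>x. if x \<in> topspace (prod_space n E)
           then \<Sum>i\<in>{1..n}. v i (x i) * (\<Prod>j\<in>{1..n} - {i}. u j (x j)) else 0)
      | u v. \<forall>i\<in>{1..n}. (u i, v i) \<in> L i}"

text \<open>
  A function of \<open>x\<^sub>i\<close> alone is a function on the product, i.e. the constant \<open>1\<close> is admitted as a
  factor in the other variables. For a noncompact space it does not vanish at infinity, so that it
  has to be added to the domain of the generator (with value \<open>0\<close>, as kernels have mass one);
  otherwise functions of a single variable would not belong to the tensor product.
\<close>

definition with_const :: "'a topology \<Rightarrow> 'a oper \<Rightarrow> 'a oper" where
  "with_const X A = insert (indicator (topspace X), \<lambda>_. 0) A"

definition coupled_generator ::
  "nat \<Rightarrow> (nat \<Rightarrow> 'a topology) \<Rightarrow> (nat \<Rightarrow> real \<Rightarrow> 'a \<Rightarrow> 'a measure) \<Rightarrow> (nat \<Rightarrow> 'a) oper \<Rightarrow> (nat \<Rightarrow> 'a) oper" where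
  "coupled_generator n E p \<Gamma> =
     op_sum (tensor_sum n E (\<lambda>i. with_const (E i) (generator (E i) (p i)))) \<Gamma>"

text \<open>
  \<open>generates X A p\<close>: the restriction of \<open>A\<close> to functions vanishing at infinity is the generator of
  the Feller semigroup, and the remaining bounded functions in the domain of \<open>A\<close> satisfy the
  Kolmogorov (Dynkin) equation. If the domain of \<open>A\<close> is contained in \<open>C0 X\<close>, the second condition
  follows from the first, and the first one says that \<open>A\<close> is the generator.
\<close>

definition generates :: "'a topology \<Rightarrow> 'a oper \<Rightarrow> (real \<Rightarrow> 'a \<Rightarrow> 'a measure) \<Rightarrow> bool" where
  "generates X A p \<longleftrightarrow>
     op_restrict A (C0 X) = generator X p \<and>
     (\<forall>(f, g)\<in>A. \<forall>t\<ge>0. \<forall>x\<in>topspace X.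
        semigroup_of X p t f x - f x = (LINT s:{0..t}|lborel. semigroup_of X p s g x))"

definition coupling_operators ::
  "nat \<Rightarrow> (nat \<Rightarrow> 'a topology) \<Rightarrow> (nat \<Rightarrow> ('a, 'c) chart set) \<Rightarrow> (nat \<Rightarrow> real \<Rightarrow> 'a \<Rightarrow> 'a measure)
    \<Rightarrow> (nat \<Rightarrow> 'a) oper set" where
  "coupling_operators n E \<A> p = {\<Gamma>.
     linear_operator \<Gamma> \<and> \<Gamma> \<subseteq> Bb (prod_space n E) \<times> Bb (prod_space n E) \<and>
     (\<forall>i\<in>{1..n}. \<forall>f\<in>Ccinf (E i) (\<A> i). (lift_fun n E i f, \<lambda>_. 0) \<in> \<Gamma>) \<and>
     closable (coupled_generator n E p \<Gamma>) \<and>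
     (\<exists>q. feller_process (prod_space n E) (prod_atlas n \<A>) q \<and>
          generates (prod_space n E) (op_closure (coupled_generator n E p \<Gamma>)) q)}"

definition ergodic_coupling_operators ::
  "nat \<Rightarrow> (nat \<Rightarrow> 'a topology) \<Rightarrow> (nat \<Rightarrow> ('a, 'c) chart set) \<Rightarrow> (nat \<Rightarrow> real \<Rightarrow> 'a \<Rightarrow> 'a measure)
    \<Rightarrow> (nat \<Rightarrow> 'a) oper set" where
  "ergodic_coupling_operators n E \<A> p = {\<Gamma> \<in> coupling_operators n E \<A> p.
     \<exists>q \<mu>. feller_process (prod_space n E) (prod_atlas n \<A>) q \<and>
       generates (prod_space n E) (op_closure (coupled_generator n E p \<Gamma>)) q \<and>
       ergodic (prod_space n E) (op_closure (coupled_generator n E p \<Gamma>)) q \<mu>}"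

section \<open>The averaged functional and its Gaussian limit\<close>

definition average_fun :: "nat \<Rightarrow> (nat \<Rightarrow> 'a topology) \<Rightarrow> (nat \<Rightarrow> 'a \<Rightarrow> real) \<Rightarrow> (nat \<Rightarrow> 'a) \<Rightarrow> real" where
  "average_fun n E f = (\<lambda>x. 1 / real n * (\<Sum>i\<in>{1..n}. lift_fun n E i (f i) x))"

definition cross_fun :: "nat \<Rightarrow> (nat \<Rightarrow> 'a topology) \<Rightarrow> (nat \<Rightarrow> 'a \<Rightarrow> real) \<Rightarrow> (nat \<Rightarrow> 'a) \<Rightarrow> real" where
  "cross_fun n E \<phi> = (\<lambda>x. 1 / (real n)\<^sup>2 *
     (\<Sum>j\<in>{1..n}. \<Sum>i\<in>{1..<j}. lift_fun n E i (\<phi> i) x * lift_fun n E j (\<phi> j) x))"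

text \<open>The image of the standard normal law includes the point mass at \<open>0\<close> as variance zero.\<close>

definition centered_normal :: "real \<Rightarrow> real measure" where
  "centered_normal v = distr std_normal_distribution borel (\<lambda>z. sqrt v * z)"

end

theory Submission
  imports Defs
begin

text \<open>
  Put \<open>F = average_fun n E f\<close> and \<open>\<Phi> = average_fun n E \<phi>\<close>. Core property and Dynkin's formula make
  the coordinates of the coupled process Markov with the kernels \<open>p i\<close>, so that
  \<open>-\<L>\<Phi> = F\<close> holds in \<open>L\<^sup>2\<close> of the coupled invariant law and the limit variance is
  \<open>2 \<integral> F \<Phi>\<close>.

  The central limit theorem is proved without martingales. With \<open>S\<close> the integral of \<open>F\<close> along the
  path, \<open>a = \<theta> / sqrt T\<close> and \<open>l = a\<^sup>2 \<integral> F \<Phi>\<close>, consider \<open>U t = exp (l t + i a S t)\<close>. On a fine grid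
  the increments of \<open>U\<close> have first-order part \<open>i a F U\<close>. The Markov property replaces \<open>F\<close> there by
  increments of \<open>-\<Phi>\<close>, and summation by parts moves the increments back to \<open>U\<close>, which leaves
  \<open>-a\<^sup>2 (F \<Phi> - \<integral> F \<Phi>) U\<close>. This averages out over long blocks by ergodicity, because \<open>U\<close> hardly
  varies within a block. Hence the expectation of \<open>U T\<close> tends to \<open>1\<close>.

  The tensor representation of \<open>L0\<xi>\<close> is not unique, and the coupled invariant law need not be
  absolutely continuous with respect to the product law, so null sets must be taken coordinatewise.
\<close>

section \<open>Borel sets and functions vanishing at infinity\<close>

text \<open>Two weaknesses of the data shape the proof. Ergodicity is an almost sure statement about
  bounded continuous functions on path space, while the variance involves \<open>F \<Phi>\<close>, a
  product of square-integrable functions that is merely integrable. So the law is transferred to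
  path space, averages become mean-square limits, and \<open>F \<Phi>\<close> is replaced by a
  centred bounded continuous function at small cost in the mean. Likewise the second-order remainder
  cannot be bounded by its square times \<open>\<Phi>\<close>: the mesh tends to zero first, by
  dominated convergence, and only then does \<open>T\<close> grow.

  The factor \<open>exp (l t)\<close> inverts the expected characteristic function. The sign of
  \<open>\<integral> F \<Phi>\<close> in it is unknown until the limit is established; then it is
  nonnegative because characteristic functions are bounded by one.

  A function of one coordinate need not vanish at infinity on the product, so coordinates are
  reached through Dynkin's formula for the closed operator. The same intertwining argument with the
  identity map identifies the kernel that witnesses ergodicity of \<open>\<Gamma>\<close> with the
  given one.\<close>

lemma space_borel_of [simp]: "space (borel_of X) = topspace X"
  unfolding borel_of_def by (simp add: space_measure_of_conv)

lemma sets_borel_of: "sets (borel_of X) = sigma_sets (topspace X) {U. openin X U}"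
  unfolding borel_of_def by (rule sets_measure_of) (auto dest: openin_subset)

lemma openin_borel_of [measurable]: "openin X U \<Longrightarrow> U \<in> sets (borel_of X)"
  unfolding sets_borel_of by auto

lemma continuous_map_borel_of:
  assumes "continuous_map X Y f"
  shows "f \<in> borel_of X \<rightarrow>\<^sub>M borel_of Y"
  unfolding borel_of_def[of Y]
proof (rule measurable_measure_of)
  show "{U. openin Y U} \<subseteq> Pow (topspace Y)" by (auto dest: openin_subset)
  show "f \<in> space (borel_of X) \<rightarrow> topspace Y"
    using assms by (auto simp: continuous_map_def)
  fix U assume "U \<in> {U. openin Y U}"
  then have "openin X {x \<in> topspace X. f x \<in> U}"
    using assms by (auto simp: continuous_map_def)
  moreover have "{x \<in> topspace X. f x \<in> U} = f -` U \<inter> space (borel_of X)" by auto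
  ultimately show "f -` U \<inter> space (borel_of X) \<in> sets (borel_of X)"
    using openin_borel_of by metis
qed

lemma continuous_map_borel_measurable [measurable_dest]:
  fixes f :: "'a \<Rightarrow> real"
  assumes "continuous_map X euclideanreal f"
  shows "f \<in> borel_measurable (borel_of X)"
proof -
  have "f \<in> borel_of X \<rightarrow>\<^sub>M borel_of euclideanreal" by (rule continuous_map_borel_of[OF assms])
  moreover have "sets (borel_of euclideanreal) = sets (borel :: real measure)"
    unfolding borel_of_def borel_def by simp
  ultimately show ?thesis using measurable_cong_sets by blast
qed

lemma Cb_measurable: "f \<in> Cb X \<Longrightarrow> f \<in> borel_measurable (borel_of X)"
  by (auto simp: Cb_def intro: continuous_map_borel_measurable)

lemma Cb_bounded: assumes "f \<in> Cb X" obtains B where "0 < B" "\<And>x. \<bar>f x\<bar> \<le> B"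
proof -
  from assms obtain B where "\<forall>y\<in>range f. norm y \<le> B" unfolding Cb_def bounded_iff by auto
  then have "\<And>x. \<bar>f x\<bar> \<le> \<bar>B\<bar> + 1" by (smt (verit) rangeI real_norm_def)
  then show ?thesis using that[of "\<bar>B\<bar> + 1"] by auto
qed

lemma C0_subset_Cb: "C0 X \<subseteq> Cb X"
proof
  fix f assume f: "f \<in> C0 X"
  then have c: "continuous_map X euclideanreal f" and z: "\<And>x. x \<notin> topspace X \<Longrightarrow> f x = 0"
    by (auto simp: C0_def)
  from f obtain K where K: "compactin X K" "\<forall>x\<in>topspace X - K. \<bar>f x\<bar> < 1"
    unfolding C0_def by (auto dest!: spec[of _ 1])
  have "compactin euclideanreal (f ` K)" using K(1) c by (rule image_compactin)
  then have "bounded (f ` K)" by (simp add: compact_imp_bounded)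
  then obtain B where B: "\<And>x. x \<in> K \<Longrightarrow> \<bar>f x\<bar> \<le> B" by (auto simp: bounded_iff)
  have "norm (f x) \<le> max \<bar>B\<bar> 1" for x
  proof (cases "x \<in> K")
    case True
    then show ?thesis using B[of x] by auto
  next
    case False
    then show ?thesis using K(2) z[of x] by (cases "x \<in> topspace X") (auto simp: max_def dest!: bspec[of _ _ x])
  qed
  then have "bounded (range f)" unfolding bounded_iff by blast
  with c z show "f \<in> Cb X" by (auto simp: Cb_def)
qed

lemma C0_measurable: "f \<in> C0 X \<Longrightarrow> f \<in> borel_measurable (borel_of X)"
  using C0_subset_Cb Cb_measurable by blast

lemma C0_bounded: assumes "f \<in> C0 X" obtains B where "0 < B" "\<And>x. \<bar>f x\<bar> \<le> B"
  using assms C0_subset_Cb Cb_bounded by blast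

lemma C0I:
  assumes "continuous_map X euclideanreal f"
    "\<And>e. 0 < e \<Longrightarrow> \<exists>K. compactin X K \<and> (\<forall>x\<in>topspace X - K. \<bar>f x\<bar> < e)"
    "\<And>x. x \<notin> topspace X \<Longrightarrow> f x = 0"
  shows "f \<in> C0 X"
  using assms by (auto simp: C0_def)

lemma C0_tailD:
  assumes "f \<in> C0 X" "0 < e" obtains K where "compactin X K" "\<And>x. x \<in> topspace X - K \<Longrightarrow> \<bar>f x\<bar> < e"
  using assms unfolding C0_def by blast

lemma C0_dominated:
  assumes c: "c \<in> C0 X" and f: "continuous_map X euclideanreal f" "\<And>x. x \<notin> topspace X \<Longrightarrow> f x = 0"
    and le: "\<And>x. x \<in> topspace X \<Longrightarrow> \<bar>f x\<bar> \<le> B * \<bar>c x\<bar>"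
  shows "f \<in> C0 X"
proof (rule C0I[OF f(1) _ f(2)])
  fix e :: real assume e: "0 < e"
  \<comment> \<open>Adding 1 keeps the divisor positive when \<open>B\<close> is zero.\<close>
  define e' where "e' = e / (\<bar>B\<bar> + 1)"
  have "0 < e'" using e by (simp add: e'_def)
  then obtain K where K: "compactin X K" "\<And>x. x \<in> topspace X - K \<Longrightarrow> \<bar>c x\<bar> < e'"
    using c unfolding C0_def by blast
  have "\<bar>f x\<bar> < e" if x: "x \<in> topspace X - K" for x
  proof -
    have "\<bar>f x\<bar> \<le> (\<bar>B\<bar> + 1) * \<bar>c x\<bar>" using le[of x] x
      by (smt (verit) DiffD1 abs_ge_zero mult_right_mono)
    also have "\<dots> < (\<bar>B\<bar> + 1) * e'" using K(2)[OF x] by (intro mult_strict_left_mono) auto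
    also have "\<dots> = e" by (simp add: e'_def)
    finally show ?thesis .
  qed
  then show "\<exists>K. compactin X K \<and> (\<forall>x\<in>topspace X - K. \<bar>f x\<bar> < e)" using K(1) by blast
qed auto

lemma C0_add:
  assumes "f \<in> C0 X" "g \<in> C0 X" shows "(\<lambda>x. f x + g x) \<in> C0 X"
proof (rule C0I)
  show "continuous_map X euclideanreal (\<lambda>x. f x + g x)"
    using assms by (auto simp: C0_def intro!: continuous_map_add)
  show "\<And>x. x \<notin> topspace X \<Longrightarrow> f x + g x = 0" using assms by (auto simp: C0_def)
  fix e :: real assume "0 < e"
  then have e2: "0 < e / 2" by simp
  obtain K L where K: "compactin X K" "\<And>x. x \<in> topspace X - K \<Longrightarrow> \<bar>f x\<bar> < e/2"
    and L: "compactin X L" "\<And>x. x \<in> topspace X - L \<Longrightarrow> \<bar>g x\<bar> < e/2"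
    using C0_tailD[OF assms(1) e2] C0_tailD[OF assms(2) e2] by metis
  show "\<exists>K. compactin X K \<and> (\<forall>x\<in>topspace X - K. \<bar>f x + g x\<bar> < e)"
  proof (intro exI[of _ "K \<union> L"] conjI ballI)
    show "compactin X (K \<union> L)" using K(1) L(1) by (rule compactin_Un)
    fix x assume "x \<in> topspace X - (K \<union> L)"
    then show "\<bar>f x + g x\<bar> < e" using K(2)[of x] L(2)[of x] by auto
  qed
qed

lemma C0_cmult: assumes "f \<in> C0 X" shows "(\<lambda>x. c * f x) \<in> C0 X"
  using assms by (intro C0_dominated[OF assms, where B="\<bar>c\<bar>"])
    (auto simp: C0_def abs_mult intro!: continuous_map_real_mult_left)

lemma C0_zero: "(\<lambda>x. 0) \<in> C0 X"
  by (rule C0I) (auto intro!: exI[of _ "{}"])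

lemma C0_diff: assumes "f \<in> C0 X" "g \<in> C0 X" shows "(\<lambda>x. f x - g x) \<in> C0 X"
  using C0_add[OF assms(1) C0_cmult[OF assms(2), of "-1"]] by simp

lemma C0_sum: assumes "\<And>i. i \<in> I \<Longrightarrow> f i \<in> C0 X" shows "(\<lambda>x. \<Sum>i\<in>I. f i x) \<in> C0 X"
  using assms by (induction I rule: infinite_finite_induct) (auto intro: C0_add C0_zero)

text \<open>Closedness under uniform convergence. It serves for limits that are not finite
  combinations: a weighted series of bump functions and a time integral of the semigroup.\<close>

lemma C0_approx:
  assumes g: "\<And>e. 0 < e \<Longrightarrow> \<exists>h\<in>C0 X. \<forall>x\<in>topspace X. \<bar>h x - g x\<bar> < e"
    and z: "\<And>x. x \<notin> topspace X \<Longrightarrow> g x = 0"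
  shows "g \<in> C0 X"
proof (rule C0I)
  have "\<exists>h\<in>C0 X. \<forall>x\<in>topspace X. \<bar>h x - g x\<bar> < 1 / Suc k" for k by (rule g) simp
  then obtain h where h: "\<And>k. h k \<in> C0 X" "\<And>k x. x \<in> topspace X \<Longrightarrow> \<bar>h k x - g x\<bar> < 1 / Suc k" by metis
  have "continuous_map X (Met_TC.mtopology) g"
  proof (rule Met_TC.continuous_map_uniform_limit[where f = h and F = sequentially])
    show "\<forall>\<^sub>F \<xi> in sequentially. continuous_map X Met_TC.mtopology (h \<xi>)"
      using h(1) by (auto simp: C0_def)
    fix e :: real assume e: "0 < e"
    have "\<forall>\<^sub>F k in sequentially. 1 / Suc k < e"
      using LIMSEQ_inverse_real_of_nat[THEN order_tendstoD(2), OF e] by (simp add: inverse_eq_divide)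
    then show "\<forall>\<^sub>F k in sequentially. \<forall>x\<in>topspace X. g x \<in> UNIV \<and> dist (h k x) (g x) < e"
    proof eventually_elim
      case (elim k)
      then show ?case using h(2)[of _ k] by (auto simp: dist_real_def intro: less_trans)
    qed
  qed auto
  then show "continuous_map X euclideanreal g" by simp
  fix e :: real assume e: "0 < e"
  obtain h where h: "h \<in> C0 X" "\<And>x. x \<in> topspace X \<Longrightarrow> \<bar>h x - g x\<bar> < e/2" using g[of "e/2"] e by auto
  from e have "0 < e/2" by simp
  then obtain K where K: "compactin X K" "\<And>x. x \<in> topspace X - K \<Longrightarrow> \<bar>h x\<bar> < e/2"
    using h(1) unfolding C0_def by blast
  show "\<exists>K. compactin X K \<and> (\<forall>x\<in>topspace X - K. \<bar>g x\<bar> < e)"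
  proof (intro exI[of _ K] conjI ballI)
    fix x assume "x \<in> topspace X - K"
    then show "\<bar>g x\<bar> < e" using K(2)[of x] h(2)[of x] by (auto simp: abs_real_def split: if_splits)
  qed (rule K(1))
qed (use z in auto)

text \<open>The function is the distance to the complement, truncated at 1. Being positive exactly
  on \<open>U\<close>, its multiples cut off at 1 increase to the indicator of \<open>U\<close>,
  which is how open sets are reached from continuous functions below. If the complement is empty the
  infimum has no meaning, hence the case split.\<close>

lemma openin_indicator_continuous:
  assumes X: "metrizable_space X" and U: "openin X U"
  obtains c where "continuous_map X euclideanreal c" "\<And>x. 0 \<le> c x" "\<And>x. c x \<le> (1::real)"
    "\<And>x. x \<in> topspace X \<Longrightarrow> 0 < c x \<longleftrightarrow> x \<in> U" "\<And>x. x \<notin> topspace X \<Longrightarrow> c x = 0"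
proof -
  obtain M d where Md: "Metric_space M d" and XM: "X = Metric_space.mtopology M d"
    using X unfolding metrizable_space_def by blast
  interpret Metric_space M d by fact
  have top: "topspace X = M" using XM by simp
  show ?thesis
  proof (cases "M - U = {}")
    case True
    have "continuous_map X euclideanreal (\<lambda>x. if x \<in> topspace X then 1 else 0)"
      by (rule continuous_map_eq[where f = "\<lambda>x. 1"]) auto
    then show ?thesis
      using True top by (intro that[of "\<lambda>x. if x \<in> topspace X then 1 else 0"]) auto
  next
    case False
    define D where "D x = (INF y\<in>M - U. d x y)" for x
    have bdd: "bdd_below (d x ` (M - U))" for x by (rule bdd_belowI[of _ 0]) auto
    have D0: "0 \<le> D x" for x unfolding D_def by (rule cINF_greatest[OF False]) auto
    have Dle: "D x \<le> d x x' + D x'" if "x \<in> M" "x' \<in> M" for x x'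
    proof -
      have "D x - d x x' \<le> D x'"
        unfolding D_def[of x']
      proof (rule cINF_greatest[OF False])
        fix y assume y: "y \<in> M - U"
        have "D x \<le> d x y" unfolding D_def by (rule cINF_lower[OF bdd y])
        also have "\<dots> \<le> d x x' + d x' y" using that y by (intro triangle) auto
        finally show "D x - d x x' \<le> d x' y" by simp
      qed
      then show ?thesis by simp
    qed
    have Dabs: "\<bar>D x - D x'\<bar> \<le> d x x'" if "x \<in> M" "x' \<in> M" for x x'
      using Dle[OF that] Dle[OF that(2,1)] commute[of x x'] by linarith
    have Dpos: "0 < D x \<longleftrightarrow> x \<in> U" if x: "x \<in> M" for x
    proof
      assume "x \<in> U"
      then obtain r where r: "0 < r" "mball x r \<subseteq> U" using U unfolding XM openin_mtopology by auto
      have "r \<le> D x" unfolding D_def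
      proof (rule cINF_greatest[OF False])
        fix y assume "y \<in> M - U" then show "r \<le> d x y" using r(2) x by (force simp: mball_def)
      qed
      then show "0 < D x" using r by simp
    next
      assume "0 < D x"
      show "x \<in> U"
      proof (rule ccontr)
        assume "x \<notin> U"
        then have "D x \<le> d x x" unfolding D_def using x by (intro cINF_lower[OF bdd]) auto
        then show False using x \<open>0 < D x\<close> by simp
      qed
    qed
    define c where "c x = (if x \<in> M then min 1 (D x) else 0)" for x
    have cont: "continuous_map X euclideanreal c"
      unfolding XM mtopology_is_euclidean[symmetric]
    proof (subst metric_continuous_map)
      show "Metric_space (UNIV::real set) dist" by (rule Met_TC.Metric_space_axioms)
      have "\<exists>\<delta>>0. \<forall>x. x \<in> M \<and> d a x < \<delta> \<longrightarrow> dist (c a) (c x) < \<epsilon>"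
        if "a \<in> M" "0 < \<epsilon>" for a \<epsilon>
      proof (intro exI[of _ \<epsilon>] conjI allI impI that(2))
        fix x assume "x \<in> M \<and> d a x < \<epsilon>"
        then show "dist (c a) (c x) < \<epsilon>" using Dabs[of a x] that(1) by (auto simp: c_def dist_real_def min_def)
      qed
      then show "c ` M \<subseteq> UNIV \<and> (\<forall>a\<in>M. \<forall>\<epsilon>>0. \<exists>\<delta>>0. \<forall>x. x \<in> M \<and> d a x < \<delta> \<longrightarrow> dist (c a) (c x) < \<epsilon>)"
        by auto
    qed
    show ?thesis
    proof (rule that[OF cont])
      show "0 < c x \<longleftrightarrow> x \<in> U" if "x \<in> topspace X" for x
        using Dpos[of x] that top by (simp add: c_def)
    qed (use D0 top in \<open>auto simp: c_def\<close>)
  qed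
qed

text \<open>
  Stands in for local compactness and second countability: it passes to products, and it suffices
  for \<open>C0 X\<close> to determine finite measures.
\<close>

definition C0_positive :: "'a topology \<Rightarrow> bool" where
  "C0_positive X \<longleftrightarrow> metrizable_space X \<and>
     (\<exists>c\<in>C0 X. \<forall>x\<in>topspace X. 0 < c x \<and> c x \<le> 1)"

text \<open>Countably many basic open sets lie in compact sets and cover the space. A bump function
  positive exactly on such a set vanishes off a compact set, so it is in \<open>C0 X\<close>. The
  series with weights \<open>(1/2)^Suc k\<close> converges uniformly, is positive everywhere, and is
  at most 1 because the weights sum to 1.\<close>

lemma C0_positive_locally_compact_Polish:
  assumes "locally_compact_Polish X" shows "C0_positive X"
proof -
  have met: "metrizable_space X" and sc: "second_countable X" and lc: "locally_compact_space X"
    using assms completely_metrizable_imp_metrizable_space by (auto simp: locally_compact_Polish_def)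
  obtain \<B> where \<B>0: "countable \<B>" "\<forall>V\<in>\<B>. openin X V"
    "\<forall>U x. openin X U \<and> x \<in> U \<longrightarrow> (\<exists>V\<in>\<B>. x \<in> V \<and> V \<subseteq> U)"
    using sc unfolding second_countable_def by blast
  then have \<B>: "countable \<B>" "\<And>V. V \<in> \<B> \<Longrightarrow> openin X V"
    "\<And>U x. openin X U \<Longrightarrow> x \<in> U \<Longrightarrow> \<exists>V\<in>\<B>. x \<in> V \<and> V \<subseteq> U" by auto
  \<comment> \<open>The empty set is added so that the family can be enumerated even if the space is
    empty.\<close>
  define \<C> where "\<C> = insert {} {V \<in> \<B>. \<exists>K. compactin X K \<and> V \<subseteq> K}"
  have "countable \<C>" "\<C> \<noteq> {}" using \<B>(1) by (auto simp: \<C>_def)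
  then obtain V :: "nat \<Rightarrow> 'a set" where V: "\<C> = range V" using range_from_nat_into by metis
  have Vo: "openin X (V k)" for k
  proof -
    have "V k \<in> \<C>" using V by auto
    then show ?thesis unfolding \<C>_def using \<B>(2) by auto
  qed
  have "\<exists>K. compactin X K \<and> V k \<subseteq> K" for k
  proof -
    have "V k \<in> \<C>" using V by auto
    then show ?thesis unfolding \<C>_def by (auto intro: exI[of _ "{}"])
  qed
  then obtain K where K: "\<And>k. compactin X (K k)" "\<And>k. V k \<subseteq> K k" by metis
  have cover: "\<exists>k. x \<in> V k" if x: "x \<in> topspace X" for x
  proof -
    obtain U L where "openin X U" "compactin X L" "x \<in> U" "U \<subseteq> L" using lc x unfolding locally_compact_space_def by blast
    moreover then obtain W where "W \<in> \<B>" "x \<in> W" "W \<subseteq> U" using \<B>(3) by blast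
    ultimately have "W \<in> \<C>" "x \<in> W" unfolding \<C>_def by blast+
    then show ?thesis using V by auto
  qed
  have "\<exists>c. continuous_map X euclideanreal c \<and> (\<forall>x. 0 \<le> c x) \<and> (\<forall>x. c x \<le> (1::real)) \<and>
    (\<forall>x \<in> topspace X. 0 < c x \<longleftrightarrow> x \<in> V k) \<and> (\<forall>x. x \<notin> topspace X \<longrightarrow> c x = 0)" for k
    using openin_indicator_continuous[OF met Vo[of k]] by metis
  then obtain c where cc: "\<And>k. continuous_map X euclideanreal (c k)" and c0: "\<And>k x. 0 \<le> c k x"
    and c1: "\<And>k x. c k x \<le> (1::real)" and cV: "\<And>k x. x \<in> topspace X \<Longrightarrow> 0 < c k x \<longleftrightarrow> x \<in> V k"
    and cz: "\<And>k x. x \<notin> topspace X \<Longrightarrow> c k x = 0" by metis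
  have cC0: "c k \<in> C0 X" for k
  proof (rule C0I[OF cc _ cz])
    fix e :: real assume "0 < e"
    have "c k x = 0" if "x \<in> topspace X - K k" for x
      using that cV[of x k] K(2)[of k] c0[of k x] by auto
    then show "\<exists>K. compactin X K \<and> (\<forall>x\<in>topspace X - K. \<bar>c k x\<bar> < e)"
      using K(1)[of k] \<open>0 < e\<close> by (intro exI[of _ "K k"]) auto
  qed
  have hs: "(\<lambda>k. (1/2::real)^Suc k) sums 1" by (rule power_half_series)
  have sm: "summable (\<lambda>k. (1/2)^Suc k * c k x)" for x
    by (rule summable_comparison_test'[OF sums_summable[OF hs], of 0])
       (use c0 c1 in \<open>auto simp: mult_left_le\<close>)
  define s where "s x = (\<Sum>k. (1/2)^Suc k * c k x)" for x
  have sC0: "s \<in> C0 X"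
  proof (rule C0_approx)
    show "\<And>x. x \<notin> topspace X \<Longrightarrow> s x = 0" by (simp add: s_def cz)
    fix e :: real assume "0 < e"
    then obtain N where N: "(1/2::real)^N < e" using real_arch_pow_inv[of e "1/2"] by auto
    show "\<exists>h\<in>C0 X. \<forall>x\<in>topspace X. \<bar>h x - s x\<bar> < e"
    proof (intro bexI ballI)
      show "(\<lambda>x. \<Sum>k<N. (1/2)^Suc k * c k x) \<in> C0 X" by (intro C0_sum C0_cmult cC0)
      fix x
      have "s x - (\<Sum>k<N. (1/2)^Suc k * c k x) = (\<Sum>k. (1/2)^Suc (k + N) * c (k + N) x)"
        unfolding s_def using suminf_split_initial_segment[OF sm[of x], of N] by simp
      moreover have "0 \<le> (\<Sum>k. (1/2)^Suc (k + N) * c (k + N) x)"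
        using c0 by (intro suminf_nonneg summable_ignore_initial_segment[OF sm]) auto
      moreover have "(\<Sum>k. (1/2)^Suc (k + N) * c (k + N) x) \<le> (\<Sum>k. (1/2)^N * (1/2)^Suc k)"
        by (intro suminf_le summable_ignore_initial_segment[OF sm] summable_mult sums_summable[OF hs])
          (use c0 c1 in \<open>auto simp: power_add field_simps\<close>)
      moreover have "(\<Sum>k. (1/2)^N * (1/2)^Suc k) = (1/2::real)^N"
        using sums_unique[OF sums_mult[OF hs, of "(1/2)^N"]] by simp
      ultimately show "\<bar>(\<Sum>k<N. (1/2)^Suc k * c k x) - s x\<bar> < e" using N by linarith
    qed
  qed
  have "0 < s x \<and> s x \<le> 1" if x: "x \<in> topspace X" for x
  proof
    obtain k where k: "x \<in> V k" using cover[OF x] by blast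
    show "0 < s x" unfolding s_def
      by (rule suminf_pos2[OF sm, of _ k]) (use c0 cV[OF x] k in auto)
    have "s x \<le> (\<Sum>k. (1/2)^Suc k)" unfolding s_def
      by (intro suminf_le sm sums_summable[OF hs]) (use c0 c1 in \<open>auto simp: mult_left_le\<close>)
    then show "s x \<le> 1" using sums_unique[OF hs] by simp
  qed
  then show ?thesis unfolding C0_positive_def using met sC0 by blast
qed

text \<open>The witness is the product of the factors' witnesses. Off a box of compact sets some
  factor is below \<open>e\<close> while the others are at most 1; this is where the upper bound in
  \<open>C0_positive\<close> is needed.\<close>

lemma C0_positive_product:
  assumes "\<And>i. i \<in> {1..n} \<Longrightarrow> C0_positive (E i)"
  shows "C0_positive (prod_space n E)"
proof -
  have met: "metrizable_space (prod_space n E)"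
    unfolding metrizable_space_product_topology using assms
    by (auto simp: C0_positive_def intro!: countable_subset[OF _ countable_finite[of "{1..n}"]])
  obtain c where c: "\<And>i. i \<in> {1..n} \<Longrightarrow> c i \<in> C0 (E i)"
    "\<And>i x. i \<in> {1..n} \<Longrightarrow> x \<in> topspace (E i) \<Longrightarrow> 0 < c i x \<and> c i x \<le> 1"
    using assms unfolding C0_positive_def by metis
  define s where "s x = (if x \<in> topspace (prod_space n E) then \<Prod>i\<in>{1..n}. c i (x i) else 0)" for x
  have xi: "x i \<in> topspace (E i)" if "x \<in> topspace (prod_space n E)" "i \<in> {1..n}" for x i
    using that by (auto simp: PiE_iff)
  have "s \<in> C0 (prod_space n E)"
  proof (rule C0I)
    have "continuous_map (prod_space n E) euclideanreal (\<lambda>x. \<Prod>i\<in>{1..n}. c i (x i))"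
    proof (rule continuous_map_prod)
      fix i assume i: "i \<in> {1..n}"
      have "continuous_map (prod_space n E) euclideanreal (c i \<circ> (\<lambda>x. x i))"
        by (rule continuous_map_compose[OF continuous_map_product_projection[OF i]])
           (use c(1)[OF i] in \<open>auto simp: C0_def\<close>)
      then show "continuous_map (prod_space n E) euclideanreal (\<lambda>x. c i (x i))" by (simp add: o_def)
    qed auto
    then show "continuous_map (prod_space n E) euclideanreal s"
      by (rule continuous_map_eq) (auto simp: s_def)
    fix e :: real assume e: "0 < e"
    have "\<forall>i\<in>{1..n}. \<exists>K. compactin (E i) K \<and> (\<forall>x\<in>topspace (E i) - K. \<bar>c i x\<bar> < e)"
      using c(1) e unfolding C0_def by blast
    then obtain K where K: "\<And>i. i \<in> {1..n} \<Longrightarrow> compactin (E i) (K i)"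
      "\<And>i x. i \<in> {1..n} \<Longrightarrow> x \<in> topspace (E i) - K i \<Longrightarrow> \<bar>c i x\<bar> < e" by metis
    show "\<exists>K. compactin (prod_space n E) K \<and> (\<forall>x\<in>topspace (prod_space n E) - K. \<bar>s x\<bar> < e)"
    proof (intro exI[of _ "\<Pi>\<^sub>E i\<in>{1..n}. K i"] conjI ballI)
      show "compactin (prod_space n E) (\<Pi>\<^sub>E i\<in>{1..n}. K i)" using K(1) by (simp add: compactin_PiE)
      fix x assume x: "x \<in> topspace (prod_space n E) - (\<Pi>\<^sub>E i\<in>{1..n}. K i)"
      then obtain i where i: "i \<in> {1..n}" "x i \<notin> K i" by (auto simp: PiE_iff)
      have "s x = c i (x i) * (\<Prod>j\<in>{1..n} - {i}. c j (x j))"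
        using x i(1) prod.remove[OF _ i(1), of "\<lambda>i. c i (x i)"] by (simp add: s_def)
      moreover have "(\<Prod>j\<in>{1..n} - {i}. c j (x j)) \<le> 1" "0 \<le> (\<Prod>j\<in>{1..n} - {i}. c j (x j))"
        using c(2)[OF _ xi[of x]] x by (auto intro!: prod_le_1 prod_nonneg intro: less_imp_le simp del: topspace_product_topology)
      moreover have "\<bar>c i (x i)\<bar> < e" using K(2)[OF i(1)] xi[of x i] x i by auto
      ultimately show "\<bar>s x\<bar> < e"
        using mult_left_le[of "\<Prod>j\<in>{1..n} - {i}. c j (x j)" "\<bar>c i (x i)\<bar>"] by (simp add: abs_mult)
    qed
  qed (simp add: s_def)
  moreover have "0 < s x \<and> s x \<le> 1" if x: "x \<in> topspace (prod_space n E)" for x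
    using x c(2)[OF _ xi[OF x]] by (auto simp: s_def simp del: topspace_product_topology intro!: prod_pos prod_le_1 intro: less_imp_le)
  ultimately show ?thesis using met unfolding C0_positive_def by blast
qed

lemma Int_stable_openin: "Int_stable {U. openin X U}"
  by (auto simp: Int_stable_def)

text \<open>With \<open>c\<close> positive exactly on \<open>U\<close> and \<open>b\<close> the
  positive function in \<open>C0 X\<close>, the functions \<open>min 1 (k c b)\<close> are dominated
  by \<open>k b\<close>, hence in \<open>C0 X\<close>, and converge to the indicator of
  \<open>U\<close>. Dominated convergence gives agreement on open sets, an intersection-stable
  generator.\<close>

lemma measure_eqI_C0:
  assumes X: "C0_positive X"
    and \<mu>: "finite_measure \<mu>" "sets \<mu> = sets (borel_of X)"
    and \<nu>: "finite_measure \<nu>" "sets \<nu> = sets (borel_of X)"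
    and eq: "\<And>f. f \<in> C0 X \<Longrightarrow> (\<integral>x. f x \<partial>\<mu>) = (\<integral>x. f x \<partial>\<nu>)"
  shows "\<mu> = \<nu>"
proof -
  interpret \<mu>: finite_measure \<mu> by fact
  interpret \<nu>: finite_measure \<nu> by fact
  obtain b where b: "b \<in> C0 X" "\<And>x. x \<in> topspace X \<Longrightarrow> 0 < b x \<and> b x \<le> 1" and met: "metrizable_space X"
    using X unfolding C0_positive_def by blast
  have sp: "space \<mu> = topspace X" "space \<nu> = topspace X"
    using \<mu>(2) \<nu>(2) by (auto dest: sets_eq_imp_space_eq)
  have "measure \<mu> U = measure \<nu> U" if U: "openin X U" for U
  proof -
    obtain c where c: "continuous_map X euclideanreal c" "\<And>x. 0 \<le> c x" "\<And>x. c x \<le> (1::real)"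
    "\<And>x. x \<in> topspace X \<Longrightarrow> 0 < c x \<longleftrightarrow> x \<in> U" "\<And>x. x \<notin> topspace X \<Longrightarrow> c x = 0"
      using openin_indicator_continuous[OF met U] by metis
    define h where "h k x = min 1 (real k * (c x * b x))" for k x
    have bc: "continuous_map X euclideanreal b" and bz: "\<And>x. x \<notin> topspace X \<Longrightarrow> b x = 0" using b(1) by (auto simp: C0_def)
    have cb0: "0 \<le> c x * b x" for x using b(2)[of x] c(2)[of x] c(5)[of x] by (cases "x \<in> topspace X") auto
    have hC: "h k \<in> C0 X" for k
    proof (rule C0_dominated[OF b(1), where B = "real k"])
      show "continuous_map X euclideanreal (h k)" unfolding h_def
        by (intro continuous_map_real_min continuous_map_real_mult bc c) auto
      show "\<And>x. x \<notin> topspace X \<Longrightarrow> h k x = 0" using c(5) by (simp add: h_def)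
      fix x assume x: "x \<in> topspace X"
      have "c x * b x \<le> b x" using c(2,3)[of x] b(2)[OF x] by (simp add: mult_left_le_one_le)
      then have "real k * (c x * b x) \<le> real k * b x" by (intro mult_left_mono) auto
      then show "\<bar>h k x\<bar> \<le> real k * \<bar>b x\<bar>" using cb0[of x] b(2)[OF x] by (auto simp: h_def min_def)
    qed
    have h01: "0 \<le> h k x" "h k x \<le> 1" for k x using cb0[of x] by (auto simp: h_def)
    have lim: "(\<lambda>k. h k x) \<longlonglongrightarrow> indicator U x" if x: "x \<in> topspace X" for x
    proof (cases "x \<in> U")
      case True
      then have pos: "0 < c x * b x" using c(4)[OF x] b(2)[OF x] by simp
      obtain k0 :: nat where k0: "1 < real k0 * (c x * b x)" using reals_Archimedean3[OF pos] by blast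
      have "\<forall>\<^sub>F k in sequentially. h k x = indicator U x"
        using eventually_ge_at_top[of k0]
      proof eventually_elim
        case (elim k)
        have "real k0 * (c x * b x) \<le> real k * (c x * b x)" using pos elim by (intro mult_right_mono) auto
        then show ?case using k0 True by (simp add: h_def)
      qed
      then show ?thesis by (rule tendsto_eventually)
    next
      case False
      then have "c x = 0" using c(4)[OF x] c(2)[of x] by force
      then show ?thesis using False by (simp add: h_def)
    qed
    have L: "(\<lambda>k. \<integral>x. h k x \<partial>m) \<longlonglongrightarrow> (\<integral>x. indicator U x \<partial>m)"
      if m: "finite_measure m" "sets m = sets (borel_of X)" "space m = topspace X" for m
    proof (rule integral_dominated_convergence[where w = "\<lambda>_. 1"])
      interpret finite_measure m by fact
      show "integrable m (\<lambda>_. 1::real)" by simp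
      show "(indicator U :: _ \<Rightarrow> real) \<in> borel_measurable m" using U m(2) by (simp add: openin_borel_of)
      show "\<And>k. h k \<in> borel_measurable m" using C0_measurable[OF hC] measurable_cong_sets[OF m(2) refl] by blast
      show "AE x in m. (\<lambda>k. h k x) \<longlonglongrightarrow> indicator U x" using lim m(3) by (auto intro!: AE_I2)
      show "\<And>k. AE x in m. norm (h k x) \<le> 1" using h01 by (auto intro!: AE_I2)
    qed
    have "(\<integral>x. indicator U x \<partial>\<mu>) = (\<integral>x. indicator U x \<partial>\<nu> :: real)"
      using LIMSEQ_unique[OF L[OF \<mu> sp(1)]] L[OF \<nu> sp(2)] eq[OF hC] by simp
    moreover have "U \<inter> topspace X = U" using openin_subset[OF U] by auto
    ultimately show ?thesis using sp by simp
  qed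
  then have em: "emeasure \<mu> U = emeasure \<nu> U" if "openin X U" for U
    using that by (simp add: \<mu>.emeasure_eq_measure \<nu>.emeasure_eq_measure)
  show ?thesis
    by (rule measure_eqI_generator_eq[where E = "{U. openin X U}" and \<Omega> = "topspace X" and A = "\<lambda>_. topspace X"])
       (use em \<mu>(2) \<nu>(2) in \<open>auto simp: Int_stable_openin sets_borel_of \<mu>.emeasure_eq_measure dest: openin_subset\<close>)
qed

lemma integrable_bounded_borel_of:
  fixes f :: "'a \<Rightarrow> real"
  assumes "finite_measure \<mu>" "sets \<mu> = sets (borel_of X)" "f \<in> borel_measurable (borel_of X)" "\<And>x. \<bar>f x\<bar> \<le> B"
  shows "integrable \<mu> f"
proof -
  interpret finite_measure \<mu> by fact
  have "f \<in> borel_measurable \<mu>" using assms(2,3) measurable_cong_sets by blast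
  then show ?thesis by (rule integrable_const_bound[where B=B, rotated]) (use assms(4) in auto)
qed

text \<open>Approximability is stable under sums, multiples and limits in the mean. Open sets are
  approximated by truncated multiples of a bump function, all Borel sets follow by Dynkin induction,
  and integrable functions by induction over simple functions.\<close>

lemma Cb_dense_L1:
  assumes X: "metrizable_space X" and \<mu>: "finite_measure \<mu>" "sets \<mu> = sets (borel_of X)"
    and f: "integrable \<mu> f"
  shows "\<forall>e>0. \<exists>g\<in>Cb X. (\<integral>x. \<bar>f x - g x\<bar> \<partial>\<mu>) < e"
proof -
  interpret finite_measure \<mu> by fact
  have sp: "space \<mu> = topspace X" using \<mu>(2) by (auto dest: sets_eq_imp_space_eq)
  have mb: "g \<in> borel_measurable \<mu>" if "g \<in> Cb X" for g
    using Cb_measurable[OF that] \<mu>(2) measurable_cong_sets by blast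
  have ig: "integrable \<mu> g" if "g \<in> Cb X" for g
    using integrable_bounded_borel_of[OF \<mu> Cb_measurable[OF that]] Cb_bounded[OF that] by metis
  have add: "(\<lambda>x. g x + h x) \<in> Cb X" if "g \<in> Cb X" "h \<in> Cb X" for g h
    using that by (auto simp: Cb_def intro!: continuous_map_add bounded_plus_comp)
  have cm: "(\<lambda>x. a * g x) \<in> Cb X" if "g \<in> Cb X" for g a
    using that bounded_scaling[of "range g" a] by (auto simp: Cb_def image_image intro!: continuous_map_real_mult_left)
  let ?P = "\<lambda>f. \<forall>e>0. \<exists>g\<in>Cb X. (\<integral>x. \<bar>f x - g x\<bar> \<partial>\<mu>) < e"
  have Padd: "?P (\<lambda>x. f1 x + f2 x)" if f1: "integrable \<mu> f1" "?P f1" and f2: "integrable \<mu> f2" "?P f2" for f1 f2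
  proof (intro allI impI)
    fix e :: real assume "0 < e"
    then have e2: "0 < e/2" by simp
    obtain g1 where g1: "g1 \<in> Cb X" "(\<integral>x. \<bar>f1 x - g1 x\<bar> \<partial>\<mu>) < e/2" using f1(2) e2 by blast
    obtain g2 where g2: "g2 \<in> Cb X" "(\<integral>x. \<bar>f2 x - g2 x\<bar> \<partial>\<mu>) < e/2" using f2(2) e2 by blast
    have "(\<integral>x. \<bar>(f1 x + f2 x) - (g1 x + g2 x)\<bar> \<partial>\<mu>) \<le> (\<integral>x. \<bar>f1 x - g1 x\<bar> + \<bar>f2 x - g2 x\<bar> \<partial>\<mu>)"
      by (intro integral_mono Bochner_Integration.integrable_diff Bochner_Integration.integrable_add integrable_abs f1(1) f2(1) ig[OF g1(1)] ig[OF g2(1)]) auto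
    also have "\<dots> = (\<integral>x. \<bar>f1 x - g1 x\<bar> \<partial>\<mu>) + (\<integral>x. \<bar>f2 x - g2 x\<bar> \<partial>\<mu>)"
      by (intro Bochner_Integration.integral_add integrable_abs Bochner_Integration.integrable_diff f1(1) f2(1) ig[OF g1(1)] ig[OF g2(1)])
    also have "\<dots> < e" using g1(2) g2(2) by simp
    finally show "\<exists>g\<in>Cb X. (\<integral>x. \<bar>(f1 x + f2 x) - g x\<bar> \<partial>\<mu>) < e"
      by (intro bexI[OF _ add[OF g1(1) g2(1)]])
  qed
  have Pcm: "?P (\<lambda>x. a * f1 x)" if f1: "?P f1" for f1 a
  proof (intro allI impI)
    fix e :: real assume e: "0 < e"
    have ea: "0 < e/(\<bar>a\<bar>+1)" using e by simp
    obtain g1 where g1: "g1 \<in> Cb X" "(\<integral>x. \<bar>f1 x - g1 x\<bar> \<partial>\<mu>) < e/(\<bar>a\<bar>+1)" using f1 ea by blast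
    have "(\<integral>x. \<bar>a * f1 x - a * g1 x\<bar> \<partial>\<mu>) = \<bar>a\<bar> * (\<integral>x. \<bar>f1 x - g1 x\<bar> \<partial>\<mu>)"
      by (simp add: abs_mult flip: right_diff_distrib)
    also have "\<dots> \<le> (\<bar>a\<bar>+1) * (\<integral>x. \<bar>f1 x - g1 x\<bar> \<partial>\<mu>)" by (intro mult_right_mono) auto
    also have "\<dots> < e" using g1(2) by (simp add: field_simps add_nonneg_pos)
    finally show "\<exists>g\<in>Cb X. (\<integral>x. \<bar>a * f1 x - g x\<bar> \<partial>\<mu>) < e" by (intro bexI[OF _ cm[OF g1(1)]])
  qed
  have Plim: "?P F" if F: "integrable \<mu> F" and s: "\<And>i. integrable \<mu> (s i)" "\<And>i. ?P (s i)"
      and lim: "(\<lambda>i. \<integral>x. \<bar>F x - s i x\<bar> \<partial>\<mu>) \<longlonglongrightarrow> 0" for F s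
  proof (intro allI impI)
    fix e :: real assume e: "0 < e"
    then obtain i where i: "(\<integral>x. \<bar>F x - s i x\<bar> \<partial>\<mu>) < e/2"
      using order_tendstoD(2)[OF lim, of "e/2"] by (auto simp: eventually_sequentially)
    from e have e2: "0 < e/2" by simp
    obtain g where g: "g \<in> Cb X" "(\<integral>x. \<bar>s i x - g x\<bar> \<partial>\<mu>) < e/2" using s(2)[of i] e2 by blast
    have "(\<integral>x. \<bar>F x - g x\<bar> \<partial>\<mu>) \<le> (\<integral>x. \<bar>F x - s i x\<bar> + \<bar>s i x - g x\<bar> \<partial>\<mu>)"
      by (intro integral_mono Bochner_Integration.integrable_diff Bochner_Integration.integrable_add integrable_abs F s(1) ig[OF g(1)]) auto
    also have "\<dots> = (\<integral>x. \<bar>F x - s i x\<bar> \<partial>\<mu>) + (\<integral>x. \<bar>s i x - g x\<bar> \<partial>\<mu>)"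
      by (intro Bochner_Integration.integral_add integrable_abs Bochner_Integration.integrable_diff F s(1) ig[OF g(1)])
    also have "\<dots> < e" using i g(2) by simp
    finally show "\<exists>g\<in>Cb X. (\<integral>x. \<bar>F x - g x\<bar> \<partial>\<mu>) < e" by (intro bexI[OF _ g(1)])
  qed
  have one: "indicator (topspace X) \<in> Cb X"
  proof -
    have "continuous_map X euclideanreal (indicator (topspace X))"
      by (rule continuous_map_eq[where f = "\<lambda>x. 1"]) auto
    moreover have "bounded (range (indicator (topspace X) :: 'a \<Rightarrow> real))"
      by (rule boundedI[of _ 1]) (auto simp: indicator_def)
    ultimately show ?thesis by (auto simp: Cb_def)
  qed
  have PCb: "?P g" if "g \<in> Cb X" for g
  proof (intro allI impI)
    fix e :: real assume "0 < e"
    then show "\<exists>g'\<in>Cb X. (\<integral>x. \<bar>g x - g' x\<bar> \<partial>\<mu>) < e" by (intro bexI[OF _ that]) simp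
  qed
  have Pind: "?P (indicator A)" if "A \<in> sets \<mu>" for A
  proof -
    have "{U. openin X U} \<subseteq> Pow (topspace X)" "A \<in> sigma_sets (topspace X) {U. openin X U}"
      using that \<mu>(2) sets_borel_of by (blast dest: openin_subset)+
    with Int_stable_openin show ?thesis
    proof (induction A rule: sigma_sets_induct_disjoint)
      case (basic U)
      then have U: "openin X U" by simp
      obtain c where c: "continuous_map X euclideanreal c" "\<And>x. 0 \<le> c x" "\<And>x. c x \<le> (1::real)"
        "\<And>x. x \<in> topspace X \<Longrightarrow> 0 < c x \<longleftrightarrow> x \<in> U" "\<And>x. x \<notin> topspace X \<Longrightarrow> c x = 0"
        using openin_indicator_continuous[OF X U] by metis
      define h where "h k x = min 1 (real k * c x)" for k x
      have hC: "h k \<in> Cb X" for k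
      proof -
        have "continuous_map X euclideanreal (h k)" unfolding h_def
          by (intro continuous_map_real_min continuous_map_real_mult c) auto
        moreover have "bounded (range (h k))" by (rule boundedI[of _ 1]) (use c(2) in \<open>auto simp: h_def\<close>)
        ultimately show ?thesis using c(5) by (auto simp: Cb_def h_def)
      qed
      have Um: "U \<in> sets \<mu>" using openin_borel_of[OF U] \<mu>(2) by simp
      have iU: "integrable \<mu> (indicator U :: _ \<Rightarrow> real)"
        by (rule integrable_real_indicator[OF Um]) (simp add: less_top[symmetric])
      show ?case
      proof (rule Plim[OF iU ig[OF hC] PCb[OF hC]])
        have "(\<lambda>i. \<integral>x. \<bar>indicator U x - h i x\<bar> \<partial>\<mu>) \<longlonglongrightarrow> (\<integral>x. 0 \<partial>\<mu>)"
        proof (rule integral_dominated_convergence[where w = "\<lambda>_. 1"])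
          show "AE x in \<mu>. (\<lambda>k. \<bar>indicator U x - h k x\<bar>) \<longlonglongrightarrow> 0"
          proof (rule AE_I2)
            fix x assume "x \<in> space \<mu>"
            then have x: "x \<in> topspace X" using sp by simp
            have "\<forall>\<^sub>F k in sequentially. h k x = indicator U x"
            proof (cases "x \<in> U")
              case True
              then have pos: "0 < c x" using c(4)[OF x] by simp
              obtain k0 :: nat where k0: "1 < real k0 * c x" using reals_Archimedean3[OF pos] by blast
              show ?thesis
                using eventually_ge_at_top[of k0]
              proof eventually_elim
                case (elim k)
                have "real k0 * c x \<le> real k * c x" using pos elim by (intro mult_right_mono) auto
                then show ?case using k0 True by (simp add: h_def)
              qed
            next
              case False
              then have "c x = 0" using c(4)[OF x] c(2)[of x] by force
              then show ?thesis using False by (simp add: h_def)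
            qed
            then show "(\<lambda>k. \<bar>indicator U x - h k x\<bar>) \<longlonglongrightarrow> 0"
              by (intro tendsto_eventually) (auto elim: eventually_mono)
          qed
          show "AE x in \<mu>. norm \<bar>indicator U x - h k x\<bar> \<le> 1" for k
            using c(2) by (intro AE_I2) (auto simp: h_def indicator_def min_def)
          show "(\<lambda>x. \<bar>indicator U x - h k x\<bar>) \<in> borel_measurable \<mu>" for k
            using mb[OF hC, of k] Um by measurable
        qed auto
        then show "(\<lambda>i. \<integral>x. \<bar>indicator U x - h i x\<bar> \<partial>\<mu>) \<longlonglongrightarrow> 0" by simp
      qed
    next
      case empty
      have "(\<lambda>_. 0) \<in> Cb X" by (auto simp: Cb_def)
      then show ?case by (auto intro!: bexI[of _ "\<lambda>_. 0"])
    next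
      case (compl A)
      have Am: "A \<in> sets \<mu>" using compl(1) \<mu>(2) sets_borel_of by blast
      have "?P (\<lambda>x. indicator (topspace X) x + (-1) * indicator A x)"
        by (intro Padd Pcm compl(2) PCb one) (use Am ig[OF one] in \<open>auto intro!: integrable_real_indicator simp: less_top[symmetric]\<close>)
      moreover have "(\<integral>x. \<bar>(indicator (topspace X) x + (-1) * indicator A x) - g x\<bar> \<partial>\<mu>)
          = (\<integral>x. \<bar>indicator (topspace X - A) x - g x\<bar> \<partial>\<mu>)" for g :: "'a \<Rightarrow> real"
        using sp by (intro Bochner_Integration.integral_cong) (auto simp: indicator_def)
      ultimately show ?case by simp
    next
      case (union A)
      have Am: "A i \<in> sets \<mu>" for i using union(2) \<mu>(2) sets_borel_of by blast
      have fin: "?P (\<lambda>x. \<Sum>i<(k::nat). indicator (A i) x)" for k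
      proof (induction k)
        case 0
        have "(\<lambda>_. 0) \<in> Cb X" by (auto simp: Cb_def)
        then show ?case by (auto intro!: bexI[of _ "\<lambda>_. 0"])
      next
        case (Suc k)
        show ?case unfolding sum.lessThan_Suc
          by (intro Padd Suc union(3)) (use Am in \<open>auto intro!: integrable_real_indicator simp: less_top[symmetric]\<close>)
      qed
      show ?case
      proof (rule Plim[where s = "\<lambda>k x. \<Sum>i<k. indicator (A i) x"])
        show "integrable \<mu> (indicator (\<Union> (range A)) :: _ \<Rightarrow> real)"
          using Am by (auto intro!: integrable_real_indicator simp: less_top[symmetric])
        show "integrable \<mu> (\<lambda>x. \<Sum>i<k. indicator (A i) x :: real)" for k
          using Am by (auto intro!: integrable_real_indicator simp: less_top[symmetric])
        show "?P (\<lambda>x. \<Sum>i<k. indicator (A i) x)" for k by (rule fin)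
        have le: "\<bar>indicator (\<Union> (range A)) x - (\<Sum>i<k. indicator (A i) x :: real)\<bar> \<le> 1" for x k
        proof -
          have "(\<Sum>i<k. indicator (A i) x :: real) = indicator (\<Union>i<k. A i) x"
            using union(1) by (subst indicator_UN_disjoint) (auto intro: disjoint_family_on_mono)
          then show ?thesis by (auto simp: indicator_def)
        qed
        have lim: "(\<lambda>k. \<Sum>i<k. indicator (A i) x :: real) \<longlonglongrightarrow> indicator (\<Union> (range A)) x" for x
        proof -
          have "(\<Sum>i<k. indicator (A i) x :: real) = indicator (\<Union>i<k. A i) x" for k
            using union(1) by (subst indicator_UN_disjoint) (auto intro: disjoint_family_on_mono)
          then show ?thesis using LIMSEQ_indicator_UN[of A x] by simp
        qed
        have "(\<lambda>k. \<integral>x. \<bar>indicator (\<Union> (range A)) x - (\<Sum>i<k. indicator (A i) x :: real)\<bar> \<partial>\<mu>) \<longlonglongrightarrow> (\<integral>x. 0 \<partial>\<mu>)"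
        proof (rule integral_dominated_convergence[where w = "\<lambda>_. 1"])
          show "AE x in \<mu>. (\<lambda>k. \<bar>indicator (\<Union> (range A)) x - (\<Sum>i<k. indicator (A i) x :: real)\<bar>) \<longlonglongrightarrow> 0"
          proof (intro AE_I2 tendsto_rabs_zero)
            show "(\<lambda>k. indicator (\<Union> (range A)) x - (\<Sum>i<k. indicator (A i) x :: real)) \<longlonglongrightarrow> 0" for x
              using tendsto_diff[OF tendsto_const[of "indicator (\<Union> (range A)) x :: real"] lim[of x]] by simp
          qed
          show "(\<lambda>x. \<bar>indicator (\<Union> (range A)) x - (\<Sum>i<k. indicator (A i) x :: real)\<bar>) \<in> borel_measurable \<mu>" for k
            using Am by measurable
        qed (use le in auto)
        then show "(\<lambda>k. \<integral>x. \<bar>indicator (\<Union> (range A)) x - (\<Sum>i<k. indicator (A i) x :: real)\<bar> \<partial>\<mu>) \<longlonglongrightarrow> 0" by simp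
      qed
    qed
  qed
  from f show ?thesis
  proof (induction rule: integrable_induct)
    case (base A c)
    have "?P (\<lambda>x. c * indicator A x)" by (rule Pcm[OF Pind[OF base(1)]])
    then show ?case by (simp add: mult.commute)
  next
    case (add f g)
    then show ?case by (intro Padd) auto
  next
    case (lim f s)
    show ?case
    proof (rule Plim[OF lim(4) lim(1)])
      show "?P (s i)" for i by (rule lim(5))
      have [measurable]: "f \<in> borel_measurable \<mu>" "\<And>i. s i \<in> borel_measurable \<mu>" using lim(1,4) by auto
      have "(\<lambda>i. \<integral>x. \<bar>f x - s i x\<bar> \<partial>\<mu>) \<longlonglongrightarrow> (\<integral>x. 0 \<partial>\<mu>)"
      \<comment> \<open>The simple approximants are bounded by twice \<open>\<bar>f\<bar>\<close>,
        so the difference is bounded by three times it.\<close>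
      proof (rule integral_dominated_convergence[where w = "\<lambda>x. 3 * \<bar>f x\<bar>"])
        show "AE x in \<mu>. (\<lambda>i. \<bar>f x - s i x\<bar>) \<longlonglongrightarrow> 0"
        proof (intro AE_I2 tendsto_rabs_zero)
          fix x assume "x \<in> space \<mu>"
          then show "(\<lambda>i. f x - s i x) \<longlonglongrightarrow> 0"
            using tendsto_diff[OF tendsto_const[of "f x"] lim(2)[of x]] by simp
        qed
        show "AE x in \<mu>. norm \<bar>f x - s i x\<bar> \<le> 3 * \<bar>f x\<bar>" for i
        proof (rule AE_I2)
          fix x assume "x \<in> space \<mu>"
          then show "norm \<bar>f x - s i x\<bar> \<le> 3 * \<bar>f x\<bar>" using lim(3)[of x i] by auto
        qed
        show "integrable \<mu> (\<lambda>x. 3 * \<bar>f x\<bar>)" using lim(4) by auto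
      qed auto
      then show "(\<lambda>i. \<integral>x. \<bar>f x - s i x\<bar> \<partial>\<mu>) \<longlonglongrightarrow> 0" by simp
    qed
  qed
qed

section \<open>Feller semigroups\<close>

lemma eventually_at_right_0:
  "eventually Q (at_right (0::real)) \<longleftrightarrow> (\<exists>d>0. \<forall>t. 0 < t \<and> t < d \<longrightarrow> Q t)"
  unfolding eventually_at_right_field by auto

lemma BbI:
  assumes "f \<in> borel_measurable (borel_of X)" "\<And>x. \<bar>f x\<bar> \<le> B" "\<And>x. x \<notin> topspace X \<Longrightarrow> f x = 0"
  shows "f \<in> Bb X"
  using assms by (auto simp: Bb_def intro!: boundedI[of _ B])

lemma Bb_bounded: assumes "f \<in> Bb X" obtains B where "0 < B" "\<And>x. \<bar>f x\<bar> \<le> B"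
proof -
  from assms obtain B where "\<forall>y\<in>range f. norm y \<le> B" unfolding Bb_def bounded_iff by auto
  then have "\<bar>f x\<bar> \<le> \<bar>B\<bar> + 1" for x
    using abs_ge_self[of B] by (auto intro: order_trans)
  then show ?thesis using that[of "\<bar>B\<bar> + 1"] by auto
qed

lemma C0_subset_Bb: "C0 X \<subseteq> Bb X"
proof
  fix f assume f: "f \<in> C0 X"
  obtain B where "0 < B" "\<And>x. \<bar>f x\<bar> \<le> B" using C0_bounded[OF f] by metis
  then show "f \<in> Bb X" using f C0_measurable[OF f] by (intro BbI) (auto simp: C0_def)
qed

lemma C0_imp_Bb: "f \<in> C0 X \<Longrightarrow> f \<in> Bb X" using C0_subset_Bb by auto

lemma Cb_imp_Bb: "f \<in> Cb X \<Longrightarrow> f \<in> Bb X"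
  using Cb_measurable[of f X] by (auto simp: Cb_def Bb_def)

lemma Bb_add: "f \<in> Bb X \<Longrightarrow> g \<in> Bb X \<Longrightarrow> (\<lambda>x. f x + g x) \<in> Bb X"
  by (auto simp: Bb_def intro!: bounded_plus_comp)

lemma Bb_cmult: "f \<in> Bb X \<Longrightarrow> (\<lambda>x. a * f x) \<in> Bb X"
  using bounded_scaling[of "range f" a] by (auto simp: Bb_def image_image)

lemma Bb_diff: "f \<in> Bb X \<Longrightarrow> g \<in> Bb X \<Longrightarrow> (\<lambda>x. f x - g x) \<in> Bb X"
  using Bb_add[of f X "\<lambda>x. -1 * g x"] Bb_cmult[of g X "-1"] by simp

lemma telescope_bound:
  fixes a :: "nat \<Rightarrow> real"
  assumes "\<And>k. k < N \<Longrightarrow> \<bar>a (Suc k) - a k\<bar> \<le> b"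
  shows "\<bar>a N - a 0\<bar> \<le> real N * b"
  using assms
proof (induction N)
  case (Suc N)
  have "\<bar>a N - a 0\<bar> \<le> real N * b" using Suc by simp
  moreover have "\<bar>a (Suc N) - a N\<bar> \<le> b" using Suc by simp
  ultimately show ?case by (simp add: algebra_simps)
qed simp

lemma fine_grid:
  assumes "0 < t" "0 < d" obtains N :: nat where "0 < N" "t / real N < d"
proof -
  obtain N :: nat where N: "t / d < real N" using reals_Archimedean2 by blast
  have "0 < real N" using N assms by (smt (verit) divide_pos_pos)
  then show ?thesis using that[of N] N assms by (simp add: field_simps)
qed

section \<open>Markov kernels acting on bounded measurable functions\<close>

locale markov_kernel =
  fixes X :: "'a topology" and p :: "real \<Rightarrow> 'a \<Rightarrow> 'a measure"
  assumes kernel: "transition_kernel X p"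
begin

abbreviation "P \<equiv> semigroup_of X p"

lemma kernel_measurable: "0 \<le> t \<Longrightarrow> p t \<in> borel_of X \<rightarrow>\<^sub>M prob_algebra (borel_of X)"
  using kernel by (auto simp: transition_kernel_def)

lemma kernel_subprob [measurable]: "0 \<le> t \<Longrightarrow> p t \<in> borel_of X \<rightarrow>\<^sub>M subprob_algebra (borel_of X)"
  using kernel_measurable by (rule measurable_prob_algebraD)

lemma kernel_prob: "0 \<le> t \<Longrightarrow> x \<in> topspace X \<Longrightarrow> prob_space (p t x)"
  and kernel_sets: "0 \<le> t \<Longrightarrow> x \<in> topspace X \<Longrightarrow> sets (p t x) = sets (borel_of X)"
  using measurable_space[OF kernel_measurable, of t x] by (auto simp: space_prob_algebra)

lemma kernel_space: "0 \<le> t \<Longrightarrow> x \<in> topspace X \<Longrightarrow> space (p t x) = topspace X"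
  using sets_eq_imp_space_eq[OF kernel_sets] by simp

lemma kernel_integrable:
  assumes "0 \<le> t" "x \<in> topspace X" "f \<in> Bb X" shows "integrable (p t x) f"
proof -
  obtain B where "\<And>x. \<bar>f x\<bar> \<le> B" using Bb_bounded[OF assms(3)] by metis
  moreover have "f \<in> borel_measurable (borel_of X)" using assms(3) by (simp add: Bb_def)
  ultimately show ?thesis
    using integrable_bounded_borel_of[OF prob_space.finite_measure[OF kernel_prob[OF assms(1,2)]] kernel_sets[OF assms(1,2)]] by metis
qed

lemma kernel_integral_measurable:
  fixes f :: "'a \<Rightarrow> real"
  assumes "0 \<le> t" "f \<in> borel_measurable (borel_of X)"
  shows "(\<lambda>x. \<integral>y. f y \<partial>p t x) \<in> borel_measurable (borel_of X)"
  by (rule measurable_compose[OF kernel_subprob[OF assms(1)] integral_measurable_subprob_algebra[OF assms(2)]])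

lemma P_eq: "x \<in> topspace X \<Longrightarrow> P t f x = (\<integral>y. f y \<partial>p t x)"
  and P_out: "x \<notin> topspace X \<Longrightarrow> P t f x = 0"
  by (auto simp: semigroup_of_def)

lemma P_measurable:
  assumes "0 \<le> t" "f \<in> borel_measurable (borel_of X)" shows "P t f \<in> borel_measurable (borel_of X)"
proof -
  have "P t f \<in> borel_measurable (borel_of X) \<longleftrightarrow> (\<lambda>x. \<integral>y. f y \<partial>p t x) \<in> borel_measurable (borel_of X)"
    by (rule measurable_cong) (simp add: P_eq)
  then show ?thesis using kernel_integral_measurable[OF assms] by simp
qed

lemma P_bound:
  assumes t: "0 \<le> t" and f: "f \<in> Bb X" and B: "0 \<le> B" "\<And>y. y \<in> topspace X \<Longrightarrow> \<bar>f y\<bar> \<le> B"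
  shows "\<bar>P t f x\<bar> \<le> B"
proof (cases "x \<in> topspace X")
  case True
  interpret px: prob_space "p t x" by (rule kernel_prob[OF t True])
  have "\<bar>\<integral>y. f y \<partial>p t x\<bar> \<le> (\<integral>y. \<bar>f y\<bar> \<partial>p t x)" by (rule integral_abs_bound)
  also have "\<dots> \<le> (\<integral>y. B \<partial>p t x)"
    using kernel_integrable[OF t True f] B(2) kernel_space[OF t True] by (intro integral_mono) auto
  also have "\<dots> = B" by (simp add: px.prob_space)
  finally show ?thesis by (simp add: P_eq True)
qed (use B in \<open>simp add: P_out\<close>)

lemma P_Bb: assumes "0 \<le> t" "f \<in> Bb X" shows "P t f \<in> Bb X"
proof -
  obtain B where B: "0 < B" "\<And>x. \<bar>f x\<bar> \<le> B" using Bb_bounded[OF assms(2)] by metis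
  have "f \<in> borel_measurable (borel_of X)" using assms(2) by (simp add: Bb_def)
  then show ?thesis
    using B by (intro BbI[of _ _ B] P_measurable P_bound assms P_out) auto
qed

lemma P_add:
  assumes "0 \<le> t" "f \<in> Bb X" "g \<in> Bb X" shows "P t (\<lambda>x. f x + g x) = (\<lambda>x. P t f x + P t g x)"
proof
  show "P t (\<lambda>x. f x + g x) x = P t f x + P t g x" for x
    using kernel_integrable assms by (cases "x \<in> topspace X") (auto simp: P_eq P_out)
qed

lemma P_cmult: "P t (\<lambda>x. a * f x) = (\<lambda>x. a * P t f x)"
  by (auto simp: semigroup_of_def)

lemma P_diff:
  assumes "0 \<le> t" "f \<in> Bb X" "g \<in> Bb X" shows "P t (\<lambda>x. f x - g x) = (\<lambda>x. P t f x - P t g x)"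
  using P_add[OF assms(1,2) Bb_cmult[OF assms(3), of "-1"]] P_cmult[of t "-1" g] by (simp add: fun_eq_iff)

lemma P_approx:
  assumes "0 \<le> t" "f \<in> Bb X" "g \<in> Bb X" "0 \<le> e" "\<And>y. y \<in> topspace X \<Longrightarrow> \<bar>f y - g y\<bar> \<le> e"
  shows "\<bar>P t f x - P t g x\<bar> \<le> e"
  using P_bound[OF assms(1) Bb_diff[OF assms(2,3)] assms(4,5), of x] P_diff[OF assms(1-3)] by simp

lemma P_P:
  assumes s: "0 \<le> s" and t: "0 \<le> t" and f: "f \<in> Bb X" shows "P s (P t f) = P (s + t) f"
proof
  fix x
  show "P s (P t f) x = P (s + t) f x"
  proof (cases "x \<in> topspace X")
    case x: True
    interpret px: prob_space "p s x" by (rule kernel_prob[OF s x])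
    obtain B where B: "0 < B" "\<And>x. \<bar>f x\<bar> \<le> B" using Bb_bounded[OF f] by metis
    have fm: "f \<in> borel_measurable (borel_of X)" using f by (simp add: Bb_def)
    have pm: "p t \<in> p s x \<rightarrow>\<^sub>M subprob_algebra (borel_of X)"
      using kernel_subprob[OF t] measurable_cong_sets[OF kernel_sets[OF s x] refl] by blast
    have "p (s + t) x = p s x \<bind> p t" using kernel s t x by (auto simp: transition_kernel_def)
    then have "P (s + t) f x = (\<integral>y. f y \<partial>(p s x \<bind> p t))" by (simp add: P_eq x)
    also have "\<dots> = (\<integral>y. (\<integral>z. f z \<partial>p t y) \<partial>p s x)"
    proof (rule integral_bind[OF fm _ pm px.finite_measure_axioms, where B = B and B' = 1])
      show "AE y in p s x. emeasure (p t y) (space (p t y)) \<le> ennreal 1"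
        using prob_space.emeasure_space_1[OF kernel_prob[OF t]] kernel_space[OF s x] by (intro AE_I2) auto
    qed (use B in auto)
    also have "\<dots> = (\<integral>y. P t f y \<partial>p s x)"
      by (rule Bochner_Integration.integral_cong) (auto simp: P_eq kernel_space[OF s x])
    finally show ?thesis by (simp add: P_eq x)
  qed (simp add: P_out)
qed

lemma P_0: assumes "f \<in> Bb X" shows "P 0 f = f"
proof
  fix x
  show "P 0 f x = f x"
  proof (cases "x \<in> topspace X")
    case True
    then have "p 0 x = return (borel_of X) x" using kernel by (auto simp: transition_kernel_def)
    then show ?thesis using True assms by (simp add: P_eq Bb_def integral_return)
  qed (use assms in \<open>simp add: P_out Bb_def\<close>)
qed

lemma P_grid:
  assumes h: "0 \<le> h" and f: "f \<in> Bb X" and b: "\<And>x. \<bar>P h f x - f x\<bar> \<le> b"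
  shows "\<bar>P (real k * h) f x - f x\<bar> \<le> real k * b"
proof (induction k)
  case 0
  then show ?case using P_0[OF f] by simp
next
  case (Suc k)
  have b0: "0 \<le> b" using b[of undefined] by linarith
  have k: "0 \<le> real k * h" using h by simp
  have "P (real (Suc k) * h) f = P (real k * h) (P h f)"
    unfolding P_P[OF k h f] by (simp add: algebra_simps)
  moreover have "\<bar>P (real k * h) (P h f) x - P (real k * h) f x\<bar> \<le> b"
    by (rule P_approx[OF k P_Bb[OF h f] f b0 b])
  ultimately show ?case using Suc by (simp add: algebra_simps)
qed

end

section \<open>Strongly continuous semigroups and their generators\<close>

locale feller_kernel = markov_kernel X p
  for X :: "'a topology" and p :: "real \<Rightarrow> 'a \<Rightarrow> 'a measure" +
  assumes pos: "C0_positive X"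
    and P_C0: "\<And>t f. 0 \<le> t \<Longrightarrow> f \<in> C0 X \<Longrightarrow> semigroup_of X p t f \<in> C0 X"
    and P_cont: "\<And>f. f \<in> C0 X \<Longrightarrow> uniform_limit UNIV (\<lambda>t. semigroup_of X p t f) f (at_right 0)"
begin

abbreviation "G \<equiv> generator X p"

lemma P_contD:
  assumes "f \<in> C0 X" "0 < e"
  obtains d where "0 < d" "\<And>t x. 0 \<le> t \<Longrightarrow> t < d \<Longrightarrow> \<bar>P t f x - f x\<bar> \<le> e"
proof -
  have "\<forall>\<^sub>F t in at_right 0. \<forall>x. dist (P t f x) (f x) < e"
    using uniform_limitD[OF P_cont[OF assms(1)] assms(2)] by simp
  then obtain d where d: "0 < d" "\<And>t x. 0 < t \<Longrightarrow> t < d \<Longrightarrow> dist (P t f x) (f x) < e"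
    unfolding eventually_at_right_0 by blast
  show ?thesis
  proof (rule that[OF d(1)])
    fix t :: real and x assume t: "0 \<le> t" "t < d"
    show "\<bar>P t f x - f x\<bar> \<le> e"
    proof (cases "t = 0")
      case True
      then show ?thesis using P_0[OF C0_imp_Bb[OF assms(1)]] assms(2) by simp
    next
      case False
      then show ?thesis using d(2)[of t x] t by (simp add: dist_real_def)
    qed
  qed
qed

text \<open>\<open>P (a + b) f - P a f\<close> is \<open>P a\<close> applied to
  \<open>P b f - f\<close>, and \<open>P a\<close> is a contraction; so the modulus of continuity at
  time 0 serves at every time.\<close>

lemma P_cont_shift:
  assumes f: "f \<in> Bb X" and d: "\<And>t x. 0 \<le> t \<Longrightarrow> t < d \<Longrightarrow> \<bar>P t f x - f x\<bar> \<le> e"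
    and s: "0 \<le> s" "0 \<le> t" "\<bar>t - s\<bar> < d" and e: "0 \<le> e"
  shows "\<bar>P t f x - P s f x\<bar> \<le> e"
proof -
  have *: "\<bar>P (a + b) f x - P a f x\<bar> \<le> e" if "0 \<le> a" "0 \<le> b" "b < d" for a b
    using P_approx[OF that(1) P_Bb[OF that(2) f] f e d[OF that(2,3)]] P_P[OF that(1,2) f] by simp
  show ?thesis using *[of s "t - s"] *[of t "s - t"] s by (cases "s \<le> t") auto
qed

lemma generator_C0: "(f, g) \<in> G \<Longrightarrow> f \<in> C0 X" "(f, g) \<in> G \<Longrightarrow> g \<in> C0 X"
  by (auto simp: generator_def)

lemma generatorD:
  assumes "(f, g) \<in> G" "0 < e"
  obtains d where "0 < d" "\<And>t x. 0 < t \<Longrightarrow> t < d \<Longrightarrow> \<bar>P t f x - f x - t * g x\<bar> \<le> t * e"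
proof -
  have "\<forall>\<^sub>F t in at_right 0. \<forall>x. dist ((P t f x - f x) / t) (g x) < e"
    using assms by (auto simp: generator_def dest!: uniform_limitD)
  then obtain d where d: "0 < d" "\<And>t x. 0 < t \<Longrightarrow> t < d \<Longrightarrow> dist ((P t f x - f x) / t) (g x) < e"
    unfolding eventually_at_right_0 by blast
  show ?thesis
  proof (rule that[OF d(1)])
    fix t :: real and x assume t: "0 < t" "t < d"
    have "\<bar>P t f x - f x - t * g x\<bar> = t * \<bar>(P t f x - f x) / t - g x\<bar>"
    proof -
      have "P t f x - f x - t * g x = t * ((P t f x - f x) / t - g x)" using t by (simp add: field_simps)
      then show ?thesis using t by (simp add: abs_mult)
    qed
    also have "\<dots> \<le> t * e" using d(2)[OF t, of x] t by (intro mult_left_mono) (auto simp: dist_real_def)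
    finally show "\<bar>P t f x - f x - t * g x\<bar> \<le> t * e" .
  qed
qed

lemma generatorI:
  assumes "f \<in> C0 X" "g \<in> C0 X"
    and "\<And>e. 0 < e \<Longrightarrow> \<exists>d>0. \<forall>t x. 0 < t \<longrightarrow> t < d \<longrightarrow> \<bar>P t f x - f x - t * g x\<bar> \<le> t * e"
  shows "(f, g) \<in> G"
proof -
  have "uniform_limit UNIV (\<lambda>t x. (P t f x - f x) / t) g (at_right 0)"
  proof (rule uniform_limitI)
    fix e :: real assume "0 < e"
    then have "0 < e/2" by simp
    then obtain d where d: "0 < d" "\<And>t x. 0 < t \<Longrightarrow> t < d \<Longrightarrow> \<bar>P t f x - f x - t * g x\<bar> \<le> t * (e/2)"
      using assms(3) by blast
    have "dist ((P t f x - f x) / t) (g x) < e" if t: "0 < t" "t < d" for t x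
    proof -
      have "t * \<bar>(P t f x - f x) / t - g x\<bar> = \<bar>P t f x - f x - t * g x\<bar>"
      proof -
        have "P t f x - f x - t * g x = t * ((P t f x - f x) / t - g x)" using t by (simp add: field_simps)
        then show ?thesis using t by (simp add: abs_mult)
      qed
      also have "\<dots> \<le> t * (e/2)" using d(2)[OF t] .
      also have "\<dots> < t * e" using t \<open>0 < e\<close> by simp
      finally show ?thesis using t by (simp add: dist_real_def)
    qed
    then show "\<forall>\<^sub>F t in at_right 0. \<forall>x\<in>UNIV. dist ((P t f x - f x) / t) (g x) < e"
      unfolding eventually_at_right_0 using d(1) by blast
  qed
  then show ?thesis using assms(1,2) by (auto simp: generator_def)
qed

lemma P_commute:
  assumes "0 \<le> s" "0 \<le> t" "f \<in> Bb X" shows "P s (P t f) = P t (P s f)"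
  using assms by (simp add: P_P add.commute)

text \<open>The first-order remainder at \<open>P s f\<close> is \<open>P s\<close> applied to the
  remainder at \<open>f\<close>. Hence one step size works along the whole orbit, which is what
  makes the telescoping arguments below uniform.\<close>

lemma generator_remainder:
  assumes fg: "(f, g) \<in> G" and d: "\<And>x. \<bar>P t f x - f x - t * g x\<bar> \<le> e"
    and s: "0 \<le> s" and t: "0 \<le> t"
  shows "\<bar>P t (P s f) x - P s f x - t * P s g x\<bar> \<le> e"
proof -
  have f: "f \<in> Bb X" and g: "g \<in> Bb X" using generator_C0[OF fg] C0_imp_Bb by auto
  have Ptf: "P t f \<in> Bb X" using P_Bb[OF t f] .
  have e: "0 \<le> e" using d[of undefined] by linarith
  have "P s (\<lambda>x. P t f x - f x - t * g x) = (\<lambda>x. P t (P s f) x - P s f x - t * P s g x)"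
    by (simp add: P_diff[OF s Bb_diff[OF Ptf f] Bb_cmult[OF g]] P_diff[OF s Ptf f] P_cmult P_commute[OF s t f])
  moreover have "\<bar>P s (\<lambda>x. P t f x - f x - t * g x) x\<bar> \<le> e"
    by (rule P_bound[OF s Bb_diff[OF Bb_diff[OF Ptf f] Bb_cmult[OF g]] e d])
  ultimately show ?thesis by simp
qed

lemma generator_invariant:
  assumes fg: "(f, g) \<in> G" and s: "0 \<le> s" shows "(P s f, P s g) \<in> G"
proof (rule generatorI)
  fix e :: real assume e: "0 < e"
  obtain d where "0 < d" "\<And>t x. 0 < t \<Longrightarrow> t < d \<Longrightarrow> \<bar>P t f x - f x - t * g x\<bar> \<le> t * e"
    using generatorD[OF fg e] by metis
  then show "\<exists>d>0. \<forall>t x. 0 < t \<longrightarrow> t < d \<longrightarrow> \<bar>P t (P s f) x - P s f x - t * P s g x\<bar> \<le> t * e"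
    using generator_remainder[OF fg _ s] by (intro exI[of _ d]) auto
qed (use generator_C0[OF fg] P_C0[OF s] in auto)

lemma P_continuous_on:
  assumes f: "f \<in> C0 X" shows "continuous_on {0..} (\<lambda>s. P s f x)"
proof (subst continuous_on_iff, intro ballI allI impI)
  fix s e :: real assume s: "s \<in> {0..}" and e: "0 < e"
  then have "0 < e/2" by simp
  then obtain d where d: "0 < d" "\<And>t x. 0 \<le> t \<Longrightarrow> t < d \<Longrightarrow> \<bar>P t f x - f x\<bar> \<le> e/2" using P_contD[OF f] by metis
  show "\<exists>d>0. \<forall>t\<in>{0..}. dist t s < d \<longrightarrow> dist (P t f x) (P s f x) < e"
  proof (intro exI[of _ d] conjI ballI impI d(1))
    fix t assume "t \<in> {0..}" "dist t s < d"
    then have "\<bar>P t f x - P s f x\<bar> \<le> e/2"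
      using s e d(2) by (intro P_cont_shift[OF C0_imp_Bb[OF f], where d = d]) (auto simp: dist_real_def)
    then show "dist (P t f x) (P s f x) < e" using e by (simp add: dist_real_def)
  qed
qed

lemma P_integrable_on:
  assumes "f \<in> C0 X" "0 \<le> a" shows "(\<lambda>s. P s f x) integrable_on {a..b}"
  by (rule integrable_continuous_interval, rule continuous_on_subset[OF P_continuous_on[OF assms(1)]]) (use assms(2) in auto)

lemma P_integral_approx:
  assumes f: "f \<in> C0 X" and ab: "0 \<le> a" "a \<le> b"
    and e: "\<And>s. a \<le> s \<Longrightarrow> s \<le> b \<Longrightarrow> \<bar>P s f x - c\<bar> \<le> e"
  shows "\<bar>integral {a..b} (\<lambda>s. P s f x) - (b - a) * c\<bar> \<le> (b - a) * e"
proof -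
  have "integral {a..b} (\<lambda>s. P s f x - c) = integral {a..b} (\<lambda>s. P s f x) - (b - a) * c"
    using ab by (subst Henstock_Kurzweil_Integration.integral_diff[OF P_integrable_on[OF f ab(1)]]) auto
  moreover have "norm (integral {a..b} (\<lambda>s. P s f x - c)) \<le> e * (b - a)"
    by (rule integral_bound)
       (use ab e in \<open>auto intro!: continuous_on_diff continuous_on_subset[OF P_continuous_on[OF f]]\<close>)
  ultimately show ?thesis by (simp add: mult.commute)
qed

text \<open>The error does not depend on \<open>x\<close> or on the starting time. Riemann sums are
  finite combinations of the functions \<open>P s f\<close>, so membership in \<open>C0 X\<close>
  and commutation with \<open>P t\<close> can be checked on them and passed to the integral.\<close>

lemma P_riemann:
  assumes f: "f \<in> C0 X" and a: "0 \<le> a" and h: "0 \<le> h" and e: "0 \<le> e"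
    and d: "\<And>t x. 0 \<le> t \<Longrightarrow> t < d \<Longrightarrow> \<bar>P t f x - f x\<bar> \<le> e" "h < d"
  shows "\<bar>integral {a..a + real m * h} (\<lambda>s. P s f x) - (\<Sum>j<m. h * P (a + real j * h) f x)\<bar> \<le> real m * (h * e)"
proof (induction m)
  case (Suc m)
  have mh: "0 \<le> real m * h" using h by simp
  have "integral {a..a + real m * h} (\<lambda>s. P s f x) + integral {a + real m * h..a + real (Suc m) * h} (\<lambda>s. P s f x)
    = integral {a..a + real (Suc m) * h} (\<lambda>s. P s f x)"
    by (rule Henstock_Kurzweil_Integration.integral_combine) (use mh h P_integrable_on[OF f a] in \<open>auto simp: algebra_simps\<close>)
  moreover have "\<bar>integral {a + real m * h..a + real (Suc m) * h} (\<lambda>s. P s f x)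
    - ((a + real (Suc m) * h) - (a + real m * h)) * P (a + real m * h) f x\<bar> \<le> ((a + real (Suc m) * h) - (a + real m * h)) * e"
  proof (rule P_integral_approx[OF f])
    fix s assume "a + real m * h \<le> s" "s \<le> a + real (Suc m) * h"
    then show "\<bar>P s f x - P (a + real m * h) f x\<bar> \<le> e"
      using a h mh e d order_trans[of 0 "a + real m * h" s]
      by (intro P_cont_shift[OF C0_imp_Bb[OF f], where d = d]) (auto simp: algebra_simps)
  qed (use a h mh in \<open>auto simp: algebra_simps\<close>)
  moreover have "(a + real (Suc m) * h) - (a + real m * h) = h" by (simp add: algebra_simps)
  ultimately show ?case using Suc by (simp add: algebra_simps)
qed simp

text \<open>The classical smoothing: \<open>u\<close> is the average of \<open>P s f\<close> over
  \<open>s\<close> in \<open>[0, h]\<close>. It is uniformly close to \<open>f\<close> for small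
  \<open>h\<close>, and its generator is the difference quotient
  \<open>(P h f - f) / h\<close>.\<close>

lemma generator_dense:
  assumes f: "f \<in> C0 X" and e: "0 < e"
  obtains u v where "(u, v) \<in> G" "\<And>x. \<bar>u x - f x\<bar> \<le> e"
proof -
  obtain d0 where d0: "0 < d0" "\<And>t x. 0 \<le> t \<Longrightarrow> t < d0 \<Longrightarrow> \<bar>P t f x - f x\<bar> \<le> e" using P_contD[OF f e] by metis
  define h where "h = d0 / 2"
  have h: "0 < h" "h < d0" using d0 by (auto simp: h_def)
  have fb: "f \<in> Bb X" using C0_imp_Bb[OF f] .
  define I where "I a x = integral {a..a + h} (\<lambda>s. P s f x)" for a x
  define R where "R a m x = (\<Sum>j<m. h / real m * P (a + real j * (h / real m)) f x)" for a and m :: nat and x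
  \<comment> \<open>Uniformity in \<open>a\<close> allows the same \<open>m\<close> for
    \<open>I 0\<close> and for its translate \<open>I t\<close>.\<close>
  have RI: "\<exists>m>0. \<forall>x a. 0 \<le> a \<longrightarrow> \<bar>I a x - R a m x\<bar> \<le> h * c" if c: "0 < c" for c
  proof -
    obtain d where d: "0 < d" "\<And>t x. 0 \<le> t \<Longrightarrow> t < d \<Longrightarrow> \<bar>P t f x - f x\<bar> \<le> c" using P_contD[OF f c] by metis
    obtain m :: nat where m: "h / d < real m" using reals_Archimedean2 by blast
    have m0: "0 < real m" using m d(1) h by (smt (verit) divide_nonneg_pos)
    have "h / real m < d" using m m0 d(1) by (simp add: field_simps)
    then have "\<bar>I a x - R a m x\<bar> \<le> h * c" if "0 \<le> a" for a x
      using P_riemann[OF f that, of "h / real m" c d m x] d(2) c h m0 unfolding I_def R_def by simp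
    then show ?thesis using m0 by auto
  qed
  have R0: "R 0 m \<in> C0 X" for m unfolding R_def
    by (intro C0_sum C0_cmult P_C0 f) (use h in auto)
  have I0: "I 0 \<in> C0 X"
  proof (rule C0_approx)
    fix c :: real assume "0 < c"
    then have "0 < c / (2 * h)" using h by simp
    from RI[OF this] obtain m where m: "\<And>x. \<bar>I 0 x - R 0 m x\<bar> \<le> h * (c / (2*h))" by auto
    have "\<bar>R 0 m x - I 0 x\<bar> < c" for x using m[of x] h \<open>0 < c\<close> by (simp add: abs_minus_commute)
    then show "\<exists>g\<in>C0 X. \<forall>x\<in>topspace X. \<bar>g x - I 0 x\<bar> < c" using R0 by blast
  next
    fix x assume "x \<notin> topspace X"
    then show "I 0 x = 0" by (simp add: I_def P_out)
  qed
  \<comment> \<open>On Riemann sums, applying \<open>P t\<close> merely translates the starting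
    time; approximation then gives the same for the integral.\<close>
  have PR: "P t (R 0 m) x = R t m x" if t: "0 \<le> t" for t m x
  proof -
    have "P t (\<lambda>x. \<Sum>j<k. h / real m * P (0 + real j * (h / real m)) f x) x
        = (\<Sum>j<k. h / real m * P (t + real j * (h / real m)) f x)" for k
    proof (induction k)
      case 0
      then show ?case using P_cmult[of t 0 f] by simp
    next
      case (Suc k)
      have kh: "0 \<le> 0 + real k * (h / real m)" using h by simp
      have "(\<lambda>x. \<Sum>j<k. h / real m * P (0 + real j * (h / real m)) f x) \<in> C0 X"
        by (intro C0_sum C0_cmult P_C0 f) (use h in auto)
      note * = P_add[OF t C0_imp_Bb[OF this] Bb_cmult[OF P_Bb[OF kh fb], of "h / real m"]]
      have "P t (\<lambda>x. \<Sum>j<Suc k. h / real m * P (0 + real j * (h / real m)) f x) x =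
        P t (\<lambda>x. \<Sum>j<k. h / real m * P (0 + real j * (h / real m)) f x) x + h / real m * P t (P (0 + real k * (h / real m)) f) x"
        unfolding sum.lessThan_Suc * P_cmult ..
      then show ?case using Suc P_P[OF t kh fb] by simp
    qed
    from this[of m] show ?thesis by (simp add: R_def[abs_def])
  qed
  have PI: "P t (I 0) x = I t x" if t: "0 \<le> t" for t x
  proof -
    have "\<bar>P t (I 0) x - I t x\<bar> \<le> 0 + c" if c: "0 < c" for c
    proof -
      have "0 < c / (2 * h)" using h c by simp
      from RI[OF this] obtain m where m: "\<And>x a. 0 \<le> a \<Longrightarrow> \<bar>I a x - R a m x\<bar> \<le> h * (c / (2*h))" by auto
      have m': "\<bar>I a x - R a m x\<bar> \<le> c/2" if "0 \<le> a" for a x using m[OF that, of x] h by simp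
      have "\<bar>P t (I 0) x - P t (R 0 m) x\<bar> \<le> c/2"
        using m'[of 0] c by (intro P_approx[OF t C0_imp_Bb[OF I0] C0_imp_Bb[OF R0]]) auto
      then show ?thesis using m'[OF t, of x] PR[OF t, of m x] by linarith
    qed
    then have "\<bar>P t (I 0) x - I t x\<bar> \<le> 0" by (rule field_le_epsilon)
    then show ?thesis by simp
  qed
  define u where "u x = 1 / h * I 0 x" for x
  define v where "v x = 1 / h * (P h f x - f x)" for x
  have "(u, v) \<in> G"
  proof (rule generatorI)
    show "u \<in> C0 X" unfolding u_def by (rule C0_cmult[OF I0])
    show "v \<in> C0 X" unfolding v_def using h by (intro C0_cmult C0_diff P_C0 f) auto
    fix c :: real assume c: "0 < c"
    \<comment> \<open>Two boundary integrals contribute \<open>t * c'\<close> each, and the result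
      is divided by \<open>h\<close>.\<close>
    define c' where "c' = c * h / 2"
    have c': "0 < c'" using c h by (simp add: c'_def)
    obtain d where d: "0 < d" "\<And>t x. 0 \<le> t \<Longrightarrow> t < d \<Longrightarrow> \<bar>P t f x - f x\<bar> \<le> c'" using P_contD[OF f c'] by metis
    show "\<exists>d>0. \<forall>t x. 0 < t \<longrightarrow> t < d \<longrightarrow> \<bar>P t u x - u x - t * v x\<bar> \<le> t * c"
    proof (intro exI[of _ d] conjI allI impI d(1))
      fix t x assume t: "0 < t" "t < d"
      define A where "A = integral {0..t} (\<lambda>s. P s f x)"
      define B where "B = integral {h..h + t} (\<lambda>s. P s f x)"
      have "A + I t x = integral {0..h + t} (\<lambda>s. P s f x)" "I 0 x + B = integral {0..h + t} (\<lambda>s. P s f x)"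
        unfolding A_def B_def I_def
        using Henstock_Kurzweil_Integration.integral_combine[of 0 t "t + h" "\<lambda>s. P s f x"]
          Henstock_Kurzweil_Integration.integral_combine[of 0 h "t + h" "\<lambda>s. P s f x"] P_integrable_on[OF f] t h
        by (auto simp: add.commute)
      \<comment> \<open>The windows \<open>[0, h]\<close> and \<open>[t, h + t]\<close> differ only
        by their ends, so the increment of the average is an integral near \<open>h\<close> minus
        one near 0.\<close>
      then have IAB: "I t x - I 0 x = B - A" by simp
      have "\<bar>A - (t - 0) * f x\<bar> \<le> (t - 0) * c'" unfolding A_def
        by (rule P_integral_approx[OF f]) (use t d in auto)
      moreover have "\<bar>B - ((h + t) - h) * P h f x\<bar> \<le> ((h + t) - h) * c'" unfolding B_def
      proof (rule P_integral_approx[OF f])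
        fix s assume "h \<le> s" "s \<le> h + t"
        then show "\<bar>P s f x - P h f x\<bar> \<le> c'"
          using t h c' d by (intro P_cont_shift[OF fb, where d = d]) auto
      qed (use t h in auto)
      ultimately have "\<bar>(B - A) - t * (P h f x - f x)\<bar> \<le> t * (2 * c')"
        by (simp add: algebra_simps)
      moreover have "P t u x - u x - t * v x = 1 / h * ((I t x - I 0 x) - t * (P h f x - f x))"
        unfolding u_def v_def P_cmult using PI[of t x] t by (simp add: algebra_simps)
      then have "P t u x - u x - t * v x = 1 / h * ((B - A) - t * (P h f x - f x))" unfolding IAB .
      ultimately have "\<bar>P t u x - u x - t * v x\<bar> \<le> 1 / h * (t * (2 * c'))"
        using h by (simp add: abs_mult mult_left_mono divide_right_mono)
      then show "\<bar>P t u x - u x - t * v x\<bar> \<le> t * c" using h by (simp add: c'_def)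
    qed
  qed
  moreover have "\<bar>u x - f x\<bar> \<le> e" for x
  proof -
    have "\<bar>I 0 x - (h - 0) * f x\<bar> \<le> (h - 0) * e" unfolding I_def using P_integral_approx[OF f, of 0 h x "f x" e] h d0 by auto
    moreover have "I 0 x - h * f x = h * (u x - f x)" using h by (simp add: u_def right_diff_distrib)
    ultimately have "h * \<bar>u x - f x\<bar> \<le> h * e" using h by (simp add: abs_mult)
    then show ?thesis using h by simp
  qed
  ultimately show ?thesis by (rule that)
qed

text \<open>For \<open>(u, v)\<close> in the generator, \<open>P s v\<close> is again the image of a
  domain element, so its integral vanishes and each grid step changes the integral of
  \<open>P s u\<close> only by the uniform remainder. Refining the grid gives invariance on the
  domain, and density extends it.\<close>

lemma invariant_integral:
  assumes \<mu>: "prob_on X \<mu>" and inv: "\<And>f g. (f, g) \<in> G \<Longrightarrow> (\<integral>x. g x \<partial>\<mu>) = 0"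
    and t: "0 < t" and f: "f \<in> C0 X"
  shows "(\<integral>x. P t f x \<partial>\<mu>) = (\<integral>x. f x \<partial>\<mu>)"
proof -
  interpret \<mu>: prob_space \<mu> using \<mu> by (simp add: prob_on_def)
  have \<mu>s: "sets \<mu> = sets (borel_of X)" using \<mu> by (simp add: prob_on_def)
  have int: "integrable \<mu> g" if g: "g \<in> Bb X" for g
  proof -
    obtain B where B: "\<And>x. \<bar>g x\<bar> \<le> B" using Bb_bounded[OF g] by metis
    have "g \<in> borel_measurable (borel_of X)" using g by (simp add: Bb_def)
    then show ?thesis by (rule integrable_bounded_borel_of[OF \<mu>.finite_measure_axioms \<mu>s _ B])
  qed
  have diff: "\<bar>(\<integral>x. g x \<partial>\<mu>) - (\<integral>x. h x \<partial>\<mu>)\<bar> \<le> e"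
    if gh: "g \<in> Bb X" "h \<in> Bb X" and e: "\<And>x. \<bar>g x - h x\<bar> \<le> e" for g h e
  proof -
    have "\<bar>(\<integral>x. g x \<partial>\<mu>) - (\<integral>x. h x \<partial>\<mu>)\<bar> = \<bar>\<integral>x. g x - h x \<partial>\<mu>\<bar>"
      by (simp add: Bochner_Integration.integral_diff[OF int[OF gh(1)] int[OF gh(2)]])
    also have "\<dots> \<le> (\<integral>x. \<bar>g x - h x\<bar> \<partial>\<mu>)" by (rule integral_abs_bound)
    also have "\<dots> \<le> (\<integral>x. e \<partial>\<mu>)" by (intro integral_mono) (use int gh e in auto)
    finally show ?thesis by (simp add: \<mu>.prob_space)
  qed
  have gen: "\<bar>(\<integral>x. P t u x \<partial>\<mu>) - (\<integral>x. u x \<partial>\<mu>)\<bar> \<le> t * e"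
    if uv: "(u, v) \<in> G" and e: "0 < e" for u v e
  proof -
    have u: "u \<in> Bb X" and v: "v \<in> Bb X" using generator_C0[OF uv] C0_imp_Bb by auto
    obtain d where d: "0 < d" "\<And>h x. 0 < h \<Longrightarrow> h < d \<Longrightarrow> \<bar>P h u x - u x - h * v x\<bar> \<le> h * e"
      using generatorD[OF uv e] by metis
    obtain N :: nat where N: "0 < N" "t / real N < d" using fine_grid[OF t d(1)] by metis
    define h where "h = t / real N"
    have h: "0 < h" "h < d" using t N by (auto simp: h_def)
    have "\<bar>(\<integral>x. P (real (Suc k) * h) u x \<partial>\<mu>) - (\<integral>x. P (real k * h) u x \<partial>\<mu>)\<bar> \<le> h * e" for k
    proof -
      have kh: "0 \<le> real k * h" and h0: "0 \<le> h" using h by auto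
      have "P (real (Suc k) * h) u = P h (P (real k * h) u)"
        unfolding P_P[OF h0 kh u] by (simp add: algebra_simps)
      then have "\<bar>P (real (Suc k) * h) u x - (P (real k * h) u x + h * P (real k * h) v x)\<bar> \<le> h * e" for x
        using generator_remainder[OF uv d(2)[OF h] kh, of x] h by simp
      then have "\<bar>(\<integral>x. P (real (Suc k) * h) u x \<partial>\<mu>) - (\<integral>x. P (real k * h) u x + h * P (real k * h) v x \<partial>\<mu>)\<bar> \<le> h * e"
        using h by (intro diff P_Bb Bb_add Bb_cmult u v) auto
      moreover have "(\<integral>x. P (real k * h) v x \<partial>\<mu>) = 0"
        by (rule inv[OF generator_invariant[OF uv kh]])
      ultimately show ?thesis
        by (simp add: int P_Bb[OF kh u] P_Bb[OF kh v] del: of_nat_Suc)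
    qed
    then have "\<bar>(\<integral>x. P (real N * h) u x \<partial>\<mu>) - (\<integral>x. P (real 0 * h) u x \<partial>\<mu>)\<bar> \<le> real N * (h * e)"
      by (intro telescope_bound)
    then show ?thesis using N P_0[OF u] by (simp add: h_def)
  qed
  have "\<bar>(\<integral>x. P t f x \<partial>\<mu>) - (\<integral>x. f x \<partial>\<mu>)\<bar> \<le> 0 + e" if e: "0 < e" for e
  proof -
    \<comment> \<open>Two uniform approximations cost \<open>e'\<close> each and the telescoped
      remainder costs \<open>t * e'\<close>.\<close>
    define e' where "e' = e / (2 + t)"
    have e': "0 < e'" using e t by (simp add: e'_def)
    obtain u v where uv: "(u, v) \<in> G" "\<And>x. \<bar>u x - f x\<bar> \<le> e'" using generator_dense[OF f e'] by metis
    have u: "u \<in> Bb X" and fb: "f \<in> Bb X" using generator_C0[OF uv(1)] f C0_imp_Bb by auto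
    have "\<bar>(\<integral>x. u x \<partial>\<mu>) - (\<integral>x. f x \<partial>\<mu>)\<bar> \<le> e'" by (rule diff[OF u fb uv(2)])
    moreover have "\<bar>(\<integral>x. P t u x \<partial>\<mu>) - (\<integral>x. P t f x \<partial>\<mu>)\<bar> \<le> e'"
      by (rule diff) (use t u fb uv(2) e' in \<open>auto intro!: P_Bb P_approx\<close>)
    moreover note gen[OF uv(1) e']
    ultimately have "\<bar>(\<integral>x. P t f x \<partial>\<mu>) - (\<integral>x. f x \<partial>\<mu>)\<bar> \<le> (2 + t) * e'" by (simp add: algebra_simps)
    then show ?thesis using t by (simp add: e'_def)
  qed
  then have "\<bar>(\<integral>x. P t f x \<partial>\<mu>) - (\<integral>x. f x \<partial>\<mu>)\<bar> \<le> 0" by (rule field_le_epsilon)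
  then show ?thesis by simp
qed

lemma invariant_measure:
  assumes \<mu>: "prob_on X \<mu>" and inv: "\<And>f g. (f, g) \<in> G \<Longrightarrow> (\<integral>x. g x \<partial>\<mu>) = 0" and t: "0 \<le> t"
  shows "\<mu> \<bind> p t = \<mu>"
proof -
  interpret \<mu>: prob_space \<mu> using \<mu> by (simp add: prob_on_def)
  have \<mu>s: "sets \<mu> = sets (borel_of X)" using \<mu> by (simp add: prob_on_def)
  have sp: "space \<mu> = topspace X" using sets_eq_imp_space_eq[OF \<mu>s] by simp
  have pm: "p t \<in> \<mu> \<rightarrow>\<^sub>M subprob_algebra (borel_of X)"
    using kernel_subprob[OF t] measurable_cong_sets[OF \<mu>s refl] by blast
  have one: "emeasure (p t y) (space (p t y)) = 1" if "y \<in> topspace X" for y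
    using prob_space.emeasure_space_1[OF kernel_prob[OF t that]] .
  show ?thesis
  proof (rule measure_eqI_C0[OF pos _ _ \<mu>.finite_measure_axioms \<mu>s])
    have "prob_space (\<mu> \<bind> p t)"
      by (rule \<mu>.prob_space_bind[OF _ pm]) (use kernel_prob[OF t] sp in \<open>auto intro!: AE_I2\<close>)
    then show "finite_measure (\<mu> \<bind> p t)" by (rule prob_space.finite_measure)
    show "sets (\<mu> \<bind> p t) = sets (borel_of X)"
      using kernel_sets[OF t] sp \<mu>.not_empty by (intro sets_bind) auto
    fix f assume f: "f \<in> C0 X"
    obtain B where B: "0 < B" "\<And>x. \<bar>f x\<bar> \<le> B" using C0_bounded[OF f] by metis
    have "(\<integral>x. f x \<partial>(\<mu> \<bind> p t)) = (\<integral>x. (\<integral>y. f y \<partial>p t x) \<partial>\<mu>)"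
      by (rule integral_bind[OF C0_measurable[OF f] _ pm \<mu>.finite_measure_axioms, where B = B and B' = 1])
         (use B one sp in \<open>auto intro!: AE_I2\<close>)
    also have "\<dots> = (\<integral>x. P t f x \<partial>\<mu>)"
      by (rule Bochner_Integration.integral_cong) (auto simp: P_eq sp)
    also have "\<dots> = (\<integral>x. f x \<partial>\<mu>)"
    proof (cases "t = 0")
      case True
      then show ?thesis using P_0[OF C0_imp_Bb[OF f]] by simp
    next
      case False
      show ?thesis by (rule invariant_integral[OF \<mu> inv]) (use t f False in auto)
    qed
    finally show "(\<integral>x. f x \<partial>(\<mu> \<bind> p t)) = (\<integral>x. f x \<partial>\<mu>)" .
  qed
qed

text \<open>Dynkin's formula for functions composed with \<open>r\<close> makes the image of
  \<open>q\<close> under \<open>r\<close> agree with \<open>p\<close>. The terms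
  \<open>Q (k h) L (P ((N - k) h) f)\<close>, with \<open>L\<close> the composition with
  \<open>r\<close>, interpolate between the two semigroups; neighbours have the same first-order
  expansion. It is used with \<open>r\<close> a coordinate projection and with \<open>r\<close> the
  identity.\<close>

lemma intertwining:
  fixes W :: "'b topology"
  assumes q: "markov_kernel W q" and r: "r \<in> borel_of W \<rightarrow>\<^sub>M borel_of X"
    and dynkin: "\<And>f g t x. (f, g) \<in> G \<Longrightarrow> 0 \<le> t \<Longrightarrow> x \<in> topspace W \<Longrightarrow>
      (\<integral>y. f (r y) \<partial>q t x) - f (r x) = (LINT s:{0..t}|lborel. (\<integral>y. g (r y) \<partial>q s x))"
    and t: "0 \<le> t" and x: "x \<in> topspace W"
  shows "distr (q t x) (borel_of X) r = p t (r x)"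
proof -
  interpret Q: markov_kernel W q by fact
  have rX: "r y \<in> topspace X" if "y \<in> topspace W" for y using measurable_space[OF r] that by simp
  define L where "L f y = (if y \<in> topspace W then f (r y) else (0::real))" for f y
  have L_Bb: "L f \<in> Bb W" if f: "f \<in> Bb X" for f
  proof -
    obtain B where B: "0 < B" "\<And>x. \<bar>f x\<bar> \<le> B" using Bb_bounded[OF f] by metis
    have "f \<in> borel_measurable (borel_of X)" using f by (simp add: Bb_def)
    then have "(\<lambda>y. f (r y)) \<in> borel_measurable (borel_of W)" using r by measurable
    then have "L f \<in> borel_measurable (borel_of W)"
      by (subst measurable_cong[where g = "\<lambda>y. f (r y)"]) (auto simp: L_def)
    then show ?thesis by (rule BbI[where B = B]) (use B in \<open>auto simp: L_def\<close>)
  qed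
  have QL: "Q.P s (L f) y = (\<integral>z. f (r z) \<partial>q s y)" if "0 \<le> s" "y \<in> topspace W" for s f y
    using that Q.kernel_space[OF that] by (auto simp: Q.P_eq L_def intro!: Bochner_Integration.integral_cong)
  have dyn: "Q.P s (L f) y - L f y = (LINT u:{0..s}|lborel. Q.P u (L g) y)"
    if "(f, g) \<in> G" "0 \<le> s" "y \<in> topspace W" for f g s y
  proof -
    have "(LINT u:{0..s}|lborel. Q.P u (L g) y) = (LINT u:{0..s}|lborel. (\<integral>z. g (r z) \<partial>q u y))"
      by (rule set_lebesgue_integral_cong) (auto simp: QL that)
    then show ?thesis using dynkin[OF that] QL[OF that(2,3)] that(3) by (simp add: L_def)
  qed
  have lint: "\<bar>(LINT u:{0..s}|lborel. F u) - s * c\<bar> \<le> s * e"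
    if s: "0 \<le> s" and F: "set_integrable lborel {0..s} F" "\<And>u. 0 \<le> u \<Longrightarrow> u \<le> s \<Longrightarrow> \<bar>F u - c\<bar> \<le> e" for s c e and F :: "real \<Rightarrow> real"
  proof -
    have ic: "set_integrable lborel {0..s} (\<lambda>u. c)" for c :: real
      by (rule borel_integrable_atLeastAtMost') simp
    have cc: "(LINT u:{0..s}|lborel. c) = s * c" for c :: real using s by (simp add: set_lebesgue_integral_def)
    have "(LINT u:{0..s}|lborel. c - e) \<le> (LINT u:{0..s}|lborel. F u)"
      by (rule set_integral_mono[OF ic F(1)]) (use F(2) in \<open>fastforce simp: abs_le_iff\<close>)
    moreover have "(LINT u:{0..s}|lborel. F u) \<le> (LINT u:{0..s}|lborel. c + e)"
      by (rule set_integral_mono[OF F(1) ic]) (use F(2) in \<open>fastforce simp: abs_le_iff\<close>)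
    ultimately show ?thesis unfolding cc by (auto simp: abs_le_iff algebra_simps)
  qed
  \<comment> \<open>Strong continuity of \<open>Q\<close> on the functions \<open>L f\<close> is not
    assumed; it has to be extracted from Dynkin's formula, beginning with a Lipschitz bound for
    \<open>f\<close> in the domain.\<close>
  have lip: "\<bar>Q.P s (L f) y - L f y\<bar> \<le> s * C"
    if fg: "(f, g) \<in> G" and C: "0 \<le> C" "\<And>y. \<bar>g y\<bar> \<le> C" and s: "0 \<le> s" for f g C s y
  proof (cases "y \<in> topspace W")
    case y: True
    have g: "L g \<in> Bb W" using L_Bb C0_imp_Bb generator_C0(2)[OF fg] by blast
    show ?thesis
    proof (cases "set_integrable lborel {0..s} (\<lambda>u. Q.P u (L g) y)")
      case True
      have "\<bar>Q.P u (L g) y - 0\<bar> \<le> C" if "0 \<le> u" for u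
        using Q.P_bound[OF that g C(1), of y] C(2) C(1) by (simp add: L_def)
      then show ?thesis using lint[OF s True, of 0 C] dyn[OF fg s y] by simp
    next
      \<comment> \<open>Integrability in time is not known yet. Without it the integral is 0 by
        convention, and the bound is trivial; this avoids a circular argument.\<close>
      case False
      then show ?thesis using dyn[OF fg s y] C(1) s
        by (simp add: set_lebesgue_integral_def set_integrable_def not_integrable_integral_eq)
    qed
  qed (use C s in \<open>simp add: Q.P_out L_def\<close>)
  have near: "\<bar>Q.P s (L f) y - Q.P s (L g) y\<bar> \<le> e" if "f \<in> Bb X" "g \<in> Bb X" "0 \<le> s" "\<And>z. \<bar>f z - g z\<bar> \<le> e" for f g s e y
  proof -
    have "0 \<le> e" using that(4)[of undefined] by linarith
    then show ?thesis by (intro Q.P_approx L_Bb that(1-3)) (auto simp: L_def that(4))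
  qed
  \<comment> \<open>Uniform approximation by domain elements carries continuity from Lipschitz
    orbits to all of \<open>C0 X\<close>, and with it integrability in time.\<close>
  have cont: "continuous_on {0..} (\<lambda>s. Q.P s (L v) y)" if v: "v \<in> C0 X" for v and y :: 'b
  proof (subst continuous_on_iff, intro ballI allI impI)
    fix s e :: real assume s: "s \<in> {0..}" and e: "0 < e"
    then have "0 < e/4" by simp
    then obtain w w' where w: "(w, w') \<in> G" "\<And>x. \<bar>w x - v x\<bar> \<le> e/4" using generator_dense[OF v] by metis
    obtain C where C: "0 < C" "\<And>x. \<bar>w' x\<bar> \<le> C" using C0_bounded[OF generator_C0(2)[OF w(1)]] by metis
    have wb: "w \<in> Bb X" and vb: "v \<in> Bb X" using generator_C0(1)[OF w(1)] v C0_imp_Bb by auto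
    have st: "\<bar>Q.P (a + b) (L w) y - Q.P a (L w) y\<bar> \<le> b * C" if "0 \<le> a" "0 \<le> b" for a b
      using Q.P_approx[OF that(1) Q.P_Bb[OF that(2) L_Bb[OF wb]] L_Bb[OF wb], of "b * C" y]
        lip[OF w(1) _ C(2) that(2)] Q.P_P[OF that L_Bb[OF wb]] C(1) that by simp
    show "\<exists>d>0. \<forall>u\<in>{0..}. dist u s < d \<longrightarrow> dist (Q.P u (L v) y) (Q.P s (L v) y) < e"
    proof (intro exI[of _ "e / (4 * C)"] conjI ballI impI)
      fix u assume u: "u \<in> {0..}" "dist u s < e / (4 * C)"
      then have "\<bar>u - s\<bar> * C < e / 4" using C(1) by (simp add: dist_real_def field_simps)
      moreover have "\<bar>Q.P u (L w) y - Q.P s (L w) y\<bar> \<le> \<bar>u - s\<bar> * C"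
        using st[of s "u - s"] st[of u "s - u"] u(1) s by (cases "s \<le> u") auto
      moreover have "\<bar>Q.P u (L w) y - Q.P u (L v) y\<bar> \<le> e/4" "\<bar>Q.P s (L w) y - Q.P s (L v) y\<bar> \<le> e/4"
        using near[OF wb vb _ w(2)] u(1) s by auto
      ultimately show "dist (Q.P u (L v) y) (Q.P s (L v) y) < e" unfolding dist_real_def by linarith
    qed (use e C in auto)
  qed
  have sint: "set_integrable lborel {0..s} (\<lambda>u. Q.P u (L v) y)" if "v \<in> C0 X" for v s y
    by (rule borel_integrable_atLeastAtMost') (rule continuous_on_subset[OF cont[OF that]], auto)
  \<comment> \<open>The image \<open>g\<close> need not have a Lipschitz orbit, so it is
    approximated by \<open>w\<close> in the domain, whose image is bounded by \<open>C\<close>. The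
    Lipschitz constant \<open>C\<close> serves every \<open>P \<rho> w\<close> at once.\<close>
  have step: "\<bar>Q.P t (L f) x - L (P t f) x\<bar> \<le> t * (2 * e)" if fg: "(f, g) \<in> G" and e: "0 < e" and t0: "0 < t" for f g e
  proof -
    have f: "f \<in> Bb X" and g: "g \<in> Bb X" and gC: "g \<in> C0 X" using generator_C0[OF fg] C0_imp_Bb by auto
    have "0 < e/3" using e by simp
    then obtain w w' where w: "(w, w') \<in> G" "\<And>x. \<bar>w x - g x\<bar> \<le> e/3" using generator_dense[OF gC] by metis
    obtain C where C: "0 < C" "\<And>x. \<bar>w' x\<bar> \<le> C" using C0_bounded[OF generator_C0(2)[OF w(1)]] by metis
    have wb: "w \<in> Bb X" using generator_C0(1)[OF w(1)] C0_imp_Bb by auto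
    have wb': "w' \<in> Bb X" using generator_C0(2)[OF w(1)] C0_imp_Bb by auto
    obtain d where d: "0 < d" "\<And>h x. 0 < h \<Longrightarrow> h < d \<Longrightarrow> \<bar>P h f x - f x - h * g x\<bar> \<le> h * e"
      using generatorD[OF fg e] by metis
    have "0 < min d (e / (3 * C))" using d(1) e C(1) by simp
    from fine_grid[OF t0 this] obtain N :: nat where N: "0 < N" "t / real N < min d (e / (3 * C))" by metis
    define h where "h = t / real N"
    have h: "0 < h" "h < d" "h * C < e / 3" using N t0 C(1) by (auto simp: h_def field_simps)
    \<comment> \<open>Both terms expand to the same value plus \<open>h\<close> times the same
      derivative \<open>L (P \<rho> g)\<close>; each expansion has an error of at most
      \<open>h * e\<close>.\<close>
    have one: "\<bar>Q.P h (L (P \<rho> f)) y - L (P (h + \<rho>) f) y\<bar> \<le> h * (2 * e)" if \<rho>: "0 \<le> \<rho>" for \<rho> y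
    proof (cases "y \<in> topspace W")
      case y: True
      have gen\<rho>: "(P \<rho> f, P \<rho> g) \<in> G" by (rule generator_invariant[OF fg \<rho>])
      have P\<rho>: "P \<rho> g \<in> Bb X" "P \<rho> w \<in> Bb X" "P \<rho> g \<in> C0 X" using P_Bb[OF \<rho>] g wb P_C0[OF \<rho> gC] by auto
      have wg: "\<bar>P \<rho> w z - P \<rho> g z\<bar> \<le> e/3" for z by (rule P_approx[OF \<rho> wb g _ w(2)]) (use e in simp)
      have w'C: "\<bar>P \<rho> w' z\<bar> \<le> C" for z by (rule P_bound[OF \<rho> wb' _ C(2)]) (use C in simp)
      have "\<bar>Q.P u (L (P \<rho> g)) y - L (P \<rho> g) y\<bar> \<le> e" if u: "0 \<le> u" "u \<le> h" for u
      proof -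
        have "\<bar>Q.P u (L (P \<rho> w)) y - L (P \<rho> w) y\<bar> \<le> u * C"
          by (rule lip[OF generator_invariant[OF w(1) \<rho>] _ w'C u(1)]) (use C in simp)
        also have "u * C \<le> h * C" using u C by (intro mult_right_mono) auto
        finally have "\<bar>Q.P u (L (P \<rho> w)) y - L (P \<rho> w) y\<bar> \<le> e/3" using h by simp
        moreover have "\<bar>Q.P u (L (P \<rho> w)) y - Q.P u (L (P \<rho> g)) y\<bar> \<le> e/3"
          by (rule near[OF P\<rho>(2,1) u(1) wg])
        moreover have "\<bar>L (P \<rho> w) y - L (P \<rho> g) y\<bar> \<le> e/3" using wg y by (simp add: L_def)
        ultimately show ?thesis by linarith
      qed
      then have "\<bar>(LINT u:{0..h}|lborel. Q.P u (L (P \<rho> g)) y) - h * L (P \<rho> g) y\<bar> \<le> h * e"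
        using h(1) by (intro lint sint P\<rho>(3)) auto
      then have "\<bar>Q.P h (L (P \<rho> f)) y - L (P \<rho> f) y - h * L (P \<rho> g) y\<bar> \<le> h * e"
        using dyn[OF gen\<rho> less_imp_le[OF h(1)] y] by simp
      moreover have "\<bar>P h (P \<rho> f) (r y) - P \<rho> f (r y) - h * P \<rho> g (r y)\<bar> \<le> h * e"
        using h by (intro generator_remainder[OF fg d(2)[OF h(1,2)] \<rho>]) auto
      ultimately show ?thesis using y P_P[OF less_imp_le[OF h(1)] \<rho> f] by (simp add: L_def)
    qed (use h e in \<open>simp add: L_def Q.P_out\<close>)
    \<comment> \<open>At \<open>k = 0\<close> only \<open>P\<close> has acted, at
      \<open>k = N\<close> only \<open>Q\<close>.\<close>
    define a where "a k = Q.P (real k * h) (L (P (real (N - k) * h) f)) x" for k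
    have "\<bar>a (Suc k) - a k\<bar> \<le> h * (2 * e)" if k: "k < N" for k
    proof -
      define \<rho> where "\<rho> = real (N - Suc k) * h"
      have \<rho>: "0 \<le> \<rho>" using h by (simp add: \<rho>_def)
      have "h + \<rho> = real (N - k) * h" using k by (simp add: \<rho>_def Suc_diff_Suc of_nat_diff algebra_simps)
      then have ak: "a k = Q.P (real k * h) (L (P (h + \<rho>) f)) x" by (simp add: a_def)
      have kh: "0 \<le> real k * h" and h0: "0 \<le> h" and h\<rho>: "0 \<le> h + \<rho>" using h \<rho> by auto
      have Lb: "L (P \<rho> f) \<in> Bb W" by (rule L_Bb[OF P_Bb[OF \<rho> f]])
      have "a (Suc k) = Q.P (real k * h + h) (L (P \<rho> f)) x" by (simp add: a_def \<rho>_def algebra_simps)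
      also have "\<dots> = Q.P (real k * h) (Q.P h (L (P \<rho> f))) x" using Q.P_P[OF kh h0 Lb] by simp
      finally show ?thesis unfolding ak using h e
        by (simp del: mult_le_cancel_left) (intro Q.P_approx kh Q.P_Bb h0 Lb L_Bb P_Bb h\<rho> f one \<rho>, auto)
    qed
    then have "\<bar>a N - a 0\<bar> \<le> real N * (h * (2 * e))" by (rule telescope_bound)
    moreover have "real N * h = t" using N by (simp add: h_def)
    moreover have "a N = Q.P t (L f) x" using \<open>real N * h = t\<close> P_0[OF f] by (simp add: a_def)
    moreover have "a 0 = L (P t f) x" using \<open>real N * h = t\<close> Q.P_0[OF L_Bb[OF P_Bb[OF t f]]] by (simp add: a_def)
    ultimately show ?thesis by (metis mult.assoc)
  qed
  have main: "(\<integral>y. f (r y) \<partial>q t x) = P t f (r x)" if f: "f \<in> C0 X" for f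
  proof (cases "t = 0")
    case True
    then show ?thesis using Q.P_0[OF L_Bb[OF C0_imp_Bb[OF f]]] P_0[OF C0_imp_Bb[OF f]] QL[of 0 x f] x
      by (simp add: L_def)
  next
    case False
    have "\<bar>Q.P t (L f) x - L (P t f) x\<bar> \<le> 0 + e" if e: "0 < e" for e
    proof -
      define e' where "e' = e / (2 + 2 * t)"
      have e': "0 < e'" using e t by (simp add: e'_def)
      obtain u v where uv: "(u, v) \<in> G" "\<And>x. \<bar>u x - f x\<bar> \<le> e'" using generator_dense[OF f e'] by metis
      have u: "u \<in> Bb X" and fb: "f \<in> Bb X" using generator_C0[OF uv(1)] f C0_imp_Bb by auto
      have "\<bar>Q.P t (L u) x - Q.P t (L f) x\<bar> \<le> e'" by (rule near[OF u fb t uv(2)])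
      moreover have "\<bar>L (P t u) x - L (P t f) x\<bar> \<le> e'"
        using P_approx[OF t u fb _ uv(2)] e' x by (simp add: L_def)
      moreover have "\<bar>Q.P t (L u) x - L (P t u) x\<bar> \<le> t * (2 * e')" using step[OF uv(1) e'] t False by simp
      ultimately have "\<bar>Q.P t (L f) x - L (P t f) x\<bar> \<le> (2 + 2 * t) * e'" by (simp add: algebra_simps)
      then show ?thesis using t by (simp add: e'_def)
    qed
    then have "\<bar>Q.P t (L f) x - L (P t f) x\<bar> \<le> 0" by (rule field_le_epsilon)
    then show ?thesis using QL[OF t x] x by (simp add: L_def)
  qed
  have rq: "r \<in> q t x \<rightarrow>\<^sub>M borel_of X" using r measurable_cong_sets[OF Q.kernel_sets[OF t x] refl] by blast
  show ?thesis
  proof (rule measure_eqI_C0[OF pos])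
    show "finite_measure (distr (q t x) (borel_of X) r)"
      using prob_space.finite_measure[OF prob_space.prob_space_distr[OF Q.kernel_prob[OF t x] rq]] .
    show "finite_measure (p t (r x))" by (rule prob_space.finite_measure[OF kernel_prob[OF t rX[OF x]]])
    show "sets (p t (r x)) = sets (borel_of X)" by (rule kernel_sets[OF t rX[OF x]])
    fix f assume f: "f \<in> C0 X"
    show "(\<integral>y. f y \<partial>distr (q t x) (borel_of X) r) = (\<integral>y. f y \<partial>p t (r x))"
      using main[OF f] by (simp add: integral_distr[OF rq C0_measurable[OF f]] P_eq[OF rX[OF x]])
  qed simp
qed

end

section \<open>Stationary Markov processes\<close>

text \<open>A bounded continuous approximant is multiplied by the cutoff \<open>min 1 (k b)\<close>,
  which tends to 1 pointwise. Approximants in \<open>C0 X\<close> are wanted because strong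
  continuity of the semigroup holds there.\<close>

lemma C0_dense_L1:
  assumes X: "C0_positive X" and \<mu>: "finite_measure \<mu>" "sets \<mu> = sets (borel_of X)"
    and f: "integrable \<mu> f" and e: "0 < e"
  obtains g where "g \<in> C0 X" "(\<integral>x. \<bar>f x - g x\<bar> \<partial>\<mu>) < e"
proof -
  have sp: "space \<mu> = topspace X" using \<mu>(2) by (auto dest: sets_eq_imp_space_eq)
  have met: "metrizable_space X" using X by (simp add: C0_positive_def)
  obtain b where b: "b \<in> C0 X" "\<And>x. x \<in> topspace X \<Longrightarrow> 0 < b x \<and> b x \<le> 1"
    using X unfolding C0_positive_def by blast
  have "0 < e/2" using e by simp
  then obtain g where g: "g \<in> Cb X" "(\<integral>x. \<bar>f x - g x\<bar> \<partial>\<mu>) < e/2" using Cb_dense_L1[OF met \<mu> f] by blast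
  obtain B where B: "0 < B" "\<And>x. \<bar>g x\<bar> \<le> B" using Cb_bounded[OF g(1)] by metis
  define h where "h k x = g x * min 1 (real k * b x)" for k x
  have bz: "b x = 0" if "x \<notin> topspace X" for x using b(1) that by (simp add: C0_def)
  have b0: "0 \<le> b x" for x using b(2)[of x] bz[of x] by (cases "x \<in> topspace X") auto
  have hC: "h k \<in> C0 X" for k
  proof (rule C0_dominated[OF b(1), where B = "B * real k"])
    show "continuous_map X euclideanreal (h k)" unfolding h_def using g(1) b(1)
      by (intro continuous_map_real_min continuous_map_real_mult) (auto simp: Cb_def C0_def)
    show "\<And>x. x \<notin> topspace X \<Longrightarrow> h k x = 0" using bz by (simp add: h_def)
    fix x assume x: "x \<in> topspace X"
    have "\<bar>g x\<bar> * \<bar>min 1 (real k * b x)\<bar> \<le> B * (real k * b x)"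
      using B b0[of x] by (intro mult_mono) auto
    then show "\<bar>h k x\<bar> \<le> B * real k * \<bar>b x\<bar>" using b0[of x] by (simp add: h_def abs_mult mult.assoc)
  qed
  have hint: "integrable \<mu> (h k)" for k
    using C0_bounded[OF hC[of k]] integrable_bounded_borel_of[OF \<mu> C0_measurable[OF hC[of k]]] by metis
  have gint: "integrable \<mu> g" using integrable_bounded_borel_of[OF \<mu> Cb_measurable[OF g(1)] B(2)] .
  have hg: "\<bar>g x - h k x\<bar> \<le> B" for k x
  proof -
    have "g x - h k x = g x * (1 - min 1 (real k * b x))" by (simp add: h_def algebra_simps)
    moreover have "\<bar>g x\<bar> * \<bar>1 - min 1 (real k * b x)\<bar> \<le> B * 1"
      using B b0[of x] by (intro mult_mono) (auto simp: min_def)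
    ultimately show ?thesis by (simp add: abs_mult)
  qed
  have "(\<lambda>k. \<integral>x. \<bar>g x - h k x\<bar> \<partial>\<mu>) \<longlonglongrightarrow> (\<integral>x. 0 \<partial>\<mu>)"
  proof (rule integral_dominated_convergence[where w = "\<lambda>_. B"])
    show "AE x in \<mu>. (\<lambda>k. \<bar>g x - h k x\<bar>) \<longlonglongrightarrow> 0"
    proof (rule AE_I2)
      fix x assume "x \<in> space \<mu>"
      then have pos: "0 < b x" using b(2) sp by auto
      obtain k0 :: nat where k0: "1 < real k0 * b x" using reals_Archimedean3[OF pos] by blast
      have "\<forall>\<^sub>F k in sequentially. \<bar>g x - h k x\<bar> = 0"
        using eventually_ge_at_top[of k0]
      proof eventually_elim
        case (elim k)
        have "real k0 * b x \<le> real k * b x" using pos elim by (intro mult_right_mono) auto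
        then show ?case using k0 by (simp add: h_def)
      qed
      then show "(\<lambda>k. \<bar>g x - h k x\<bar>) \<longlonglongrightarrow> 0" by (rule tendsto_eventually)
    qed
    show "integrable \<mu> (\<lambda>_. B)" using \<mu>(1) by (simp add: finite_measure.integrable_const)
    show "(\<lambda>x. \<bar>g x - h k x\<bar>) \<in> borel_measurable \<mu>" for k
      using gint hint[of k] by (auto intro: borel_measurable_integrable)
  qed (use hg in auto)
  then obtain k where k: "(\<integral>x. \<bar>g x - h k x\<bar> \<partial>\<mu>) < e/2"
    using order_tendstoD(2)[of _ 0 sequentially "e/2"] e by (auto simp: eventually_sequentially)
  have "(\<integral>x. \<bar>f x - h k x\<bar> \<partial>\<mu>) \<le> (\<integral>x. \<bar>f x - g x\<bar> + \<bar>g x - h k x\<bar> \<partial>\<mu>)"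
    by (intro integral_mono Bochner_Integration.integrable_add integrable_abs Bochner_Integration.integrable_diff f gint hint) auto
  also have "\<dots> = (\<integral>x. \<bar>f x - g x\<bar> \<partial>\<mu>) + (\<integral>x. \<bar>g x - h k x\<bar> \<partial>\<mu>)"
    by (intro Bochner_Integration.integral_add integrable_abs Bochner_Integration.integrable_diff f gint hint)
  also have "\<dots> < e" using g(2) k by simp
  finally show ?thesis using that[OF hC] by blast
qed

section \<open>Kernels with an invariant law, on integrable functions\<close>

locale invariant_kernel = markov_kernel X p
  for X :: "'a topology" and p :: "real \<Rightarrow> 'a \<Rightarrow> 'a measure" +
  fixes \<mu> :: "'a measure"
  assumes prob_\<mu>: "prob_space \<mu>" and sets_\<mu>: "sets \<mu> = sets (borel_of X)"
    and stationary: "\<And>t. 0 \<le> t \<Longrightarrow> \<mu> \<bind> p t = \<mu>"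
begin

sublocale \<mu>: prob_space \<mu> by (rule prob_\<mu>)

lemma space_\<mu>: "space \<mu> = topspace X" using sets_eq_imp_space_eq[OF sets_\<mu>] by simp

lemma measurable_\<mu>: "borel_measurable \<mu> = borel_measurable (borel_of X)"
  by (rule measurable_cong_sets[OF sets_\<mu> refl])

lemma integrable_imp_borel: "integrable \<mu> g \<Longrightarrow> g \<in> borel_measurable (borel_of X)"
  using borel_measurable_integrable[of \<mu> g] unfolding measurable_\<mu> .

lemma kernel_nn_measurable:
  assumes "0 \<le> t" "g \<in> borel_measurable (borel_of X)"
  shows "(\<lambda>x. \<integral>\<^sup>+y. g y \<partial>p t x) \<in> borel_measurable (borel_of X)"
  by (rule measurable_compose[OF kernel_subprob[OF assms(1)] nn_integral_measurable_subprob_algebra[OF assms(2)]])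

text \<open>Invariance says that integrating \<open>\<bar>g\<bar>\<close> first against
  \<open>p t x\<close> and then against \<open>\<mu>\<close> gives its
  \<open>\<mu>\<close>-integral. So the inner integral is finite almost everywhere, but in general
  not everywhere.\<close>

lemma kernel_L1:
  fixes g :: "'a \<Rightarrow> real"
  assumes t: "0 \<le> t" and g: "integrable \<mu> g"
  shows "AE x in \<mu>. integrable (p t x) g" "integrable \<mu> (\<lambda>x. \<integral>y. g y \<partial>p t x)"
proof -
  have gm: "g \<in> borel_measurable (borel_of X)" by (rule integrable_imp_borel[OF g])
  have gm': "(\<lambda>x. ennreal \<bar>g x\<bar>) \<in> borel_measurable (borel_of X)" using gm by measurable
  have pm: "p t \<in> \<mu> \<rightarrow>\<^sub>M subprob_algebra (borel_of X)"
    using kernel_subprob[OF t] measurable_cong_sets[OF sets_\<mu> refl] by blast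
  have km: "(\<lambda>x. \<integral>\<^sup>+y. ennreal \<bar>g y\<bar> \<partial>p t x) \<in> borel_measurable \<mu>" unfolding measurable_\<mu> by (rule kernel_nn_measurable[OF t gm'])
  have "(\<integral>\<^sup>+x. \<integral>\<^sup>+y. ennreal \<bar>g y\<bar> \<partial>p t x \<partial>\<mu>) = (\<integral>\<^sup>+y. ennreal \<bar>g y\<bar> \<partial>\<mu>)"
    using nn_integral_bind[OF gm' pm] stationary[OF t] by simp
  also have "\<dots> < \<infinity>" using g by (simp add: integrable_iff_bounded)
  finally have fin: "(\<integral>\<^sup>+x. \<integral>\<^sup>+y. ennreal \<bar>g y\<bar> \<partial>p t x \<partial>\<mu>) < \<infinity>" .
  have gp: "g \<in> borel_measurable (p t x)" if "x \<in> topspace X" for x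
    using gm measurable_cong_sets[OF kernel_sets[OF t that] refl] by blast
  have "AE x in \<mu>. (\<integral>\<^sup>+y. ennreal \<bar>g y\<bar> \<partial>p t x) \<noteq> \<infinity>" by (rule nn_integral_PInf_AE[OF km]) (use fin in auto)
  then show "AE x in \<mu>. integrable (p t x) g"
  proof (rule AE_mp, intro AE_I2 impI)
    fix x assume "x \<in> space \<mu>" "(\<integral>\<^sup>+y. ennreal \<bar>g y\<bar> \<partial>p t x) \<noteq> \<infinity>"
    then show "integrable (p t x) g" using gp[of x] space_\<mu> by (simp add: integrable_iff_bounded less_top)
  qed
  show "integrable \<mu> (\<lambda>x. \<integral>y. g y \<partial>p t x)"
  proof (rule integrableI_bounded)
    show "(\<lambda>x. \<integral>y. g y \<partial>p t x) \<in> borel_measurable \<mu>" unfolding measurable_\<mu> by (rule kernel_integral_measurable[OF t gm])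
    have "(\<integral>\<^sup>+x. ennreal (norm (\<integral>y. g y \<partial>p t x)) \<partial>\<mu>) \<le> (\<integral>\<^sup>+x. \<integral>\<^sup>+y. ennreal \<bar>g y\<bar> \<partial>p t x \<partial>\<mu>)"
    proof (rule nn_integral_mono)
      fix x assume "x \<in> space \<mu>"
      \<comment> \<open>At exceptional points the inner integral is 0 by convention, so the bound
        holds at every \<open>x\<close>.\<close>
      show "ennreal (norm (\<integral>y. g y \<partial>p t x)) \<le> (\<integral>\<^sup>+y. ennreal \<bar>g y\<bar> \<partial>p t x)"
        using integral_norm_bound_ennreal[of "p t x" g] by (cases "integrable (p t x) g") (auto simp: not_integrable_integral_eq)
    qed
    then show "(\<integral>\<^sup>+x. ennreal (norm (\<integral>y. g y \<partial>p t x)) \<partial>\<mu>) < \<infinity>" using fin by (rule le_less_trans)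
  qed
qed

end

section \<open>The Markov property as an identity between weighted expectations\<close>

locale stationary_process = feller_kernel X p
  for X :: "'a topology" and p :: "real \<Rightarrow> 'a \<Rightarrow> 'a measure" +
  fixes \<mu> :: "'a measure" and M :: "'w measure" and Y :: "real \<Rightarrow> 'w \<Rightarrow> 'a"
  assumes process: "markov_process X p \<mu> M Y"
    and invariant: "\<And>t. 0 \<le> t \<Longrightarrow> \<mu> \<bind> p t = \<mu>"
begin

sublocale prob_space M using process by (simp add: markov_process_def)

lemma Y_measurable [measurable]: "0 \<le> t \<Longrightarrow> Y t \<in> M \<rightarrow>\<^sub>M borel_of X"
  using process by (simp add: markov_process_def)

lemma distr_Y_0: "distr M (borel_of X) (Y 0) = \<mu>"
  using process by (simp add: markov_process_def)

sublocale invariant_kernel X p \<mu>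
proof (rule invariant_kernel.intro[OF markov_kernel_axioms], rule invariant_kernel_axioms.intro)
  show "prob_space \<mu>" using prob_space_distr[OF Y_measurable[of 0]] distr_Y_0 by simp
  show "sets \<mu> = sets (borel_of X)" using distr_Y_0 by auto
qed (rule invariant)

lemma Y_topspace: "0 \<le> t \<Longrightarrow> \<omega> \<in> space M \<Longrightarrow> Y t \<omega> \<in> topspace X"
  using measurable_space[OF Y_measurable] by simp

abbreviation "NF \<equiv> natural_filtration M X Y"

lemma space_NF: "space (NF s) = space M"
  unfolding natural_filtration_def by (simp add: space_measure_of_conv)

lemma NF_generators: "{Y u -` A \<inter> space M | u A. 0 \<le> u \<and> u \<le> s \<and> A \<in> sets (borel_of X)} \<subseteq> Pow (space M)"
  by auto

lemma Y_NF_measurable: assumes "0 \<le> u" "u \<le> s" shows "Y u \<in> NF s \<rightarrow>\<^sub>M borel_of X"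
proof (rule measurableI)
  show "\<omega> \<in> space (NF s) \<Longrightarrow> Y u \<omega> \<in> space (borel_of X)" for \<omega> using Y_topspace assms space_NF by simp
  show "Y u -` A \<inter> space (NF s) \<in> sets (NF s)" if "A \<in> sets (borel_of X)" for A
    unfolding space_NF unfolding natural_filtration_def sets_measure_of[OF NF_generators]
    using assms that by auto
qed

lemma NF_subalgebra: "subalgebra M (NF s)"
proof -
  have "sets (NF s) \<subseteq> sets M"
    unfolding natural_filtration_def sets_measure_of[OF NF_generators]
    by (rule sets.sigma_sets_subset) (auto intro!: measurable_sets Y_measurable)
  then show ?thesis by (simp add: subalgebra_def space_NF)
qed

lemma NF_measurable: "Z \<in> borel_measurable (NF s) \<Longrightarrow> Z \<in> borel_measurable M"
  by (rule measurable_from_subalg[OF NF_subalgebra])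

text \<open>The process is given by conditional probabilities of sets. Pairing with a bounded weight
  known at time \<open>s\<close> and passing through the monotone class of nonnegative functions
  removes conditional expectations from everything that follows.\<close>

lemma markov_nn:
  assumes s: "0 \<le> s" and t: "0 \<le> t" and Z: "Z \<in> borel_measurable (NF s)" "\<And>\<omega>. 0 \<le> Z \<omega>" "\<And>\<omega>. Z \<omega> \<le> B"
    and g: "g \<in> borel_measurable (borel_of X)"
  shows "(\<integral>\<^sup>+\<omega>. ennreal (Z \<omega>) * g (Y (s + t) \<omega>) \<partial>M) = (\<integral>\<^sup>+\<omega>. ennreal (Z \<omega>) * (\<integral>\<^sup>+y. g y \<partial>p t (Y s \<omega>)) \<partial>M)"
proof -
  have ZM [measurable]: "Z \<in> borel_measurable M" by (rule NF_measurable[OF Z(1)])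
  have st: "0 \<le> s + t" using s t by simp
  note [measurable] = Y_measurable[OF st] Y_measurable[OF s]
  have Bi: "\<bar>Z \<omega>\<bar> \<le> B" for \<omega> using Z by simp
  show ?thesis
    using g
  proof (induction g rule: borel_measurable_induct)
    case (cong f g)
    have "(\<integral>\<^sup>+\<omega>. ennreal (Z \<omega>) * g (Y (s + t) \<omega>) \<partial>M) = (\<integral>\<^sup>+\<omega>. ennreal (Z \<omega>) * f (Y (s + t) \<omega>) \<partial>M)"
      using cong(3) Y_topspace[OF st] by (intro nn_integral_cong) auto
    moreover have "(\<integral>\<^sup>+y. g y \<partial>p t (Y s \<omega>)) = (\<integral>\<^sup>+y. f y \<partial>p t (Y s \<omega>))" if "\<omega> \<in> space M" for \<omega>
      using cong(3) kernel_space[OF t Y_topspace[OF s that]] by (intro nn_integral_cong) auto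
    then have "(\<integral>\<^sup>+\<omega>. ennreal (Z \<omega>) * (\<integral>\<^sup>+y. g y \<partial>p t (Y s \<omega>)) \<partial>M) = (\<integral>\<^sup>+\<omega>. ennreal (Z \<omega>) * (\<integral>\<^sup>+y. f y \<partial>p t (Y s \<omega>)) \<partial>M)"
      by (intro nn_integral_cong) auto
    ultimately show ?case using cong(4) by simp
  next
    case (set A)
    interpret F: finite_measure_subalgebra M "NF s"
      by unfold_locales (rule NF_subalgebra)
    have Am [measurable]: "A \<in> sets (borel_of X)" using set by simp
    let ?f = "\<lambda>\<omega>. indicator A (Y (s + t) \<omega>) :: real"
    have fm [measurable]: "?f \<in> borel_measurable M" by measurable
    have mm [measurable]: "(\<lambda>x. measure (p t x) A) \<in> borel_measurable (borel_of X)"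
      by (rule measurable_compose[OF kernel_subprob[OF t] measurable_measure_subprob_algebra[OF Am]])
    have i1: "integrable M (\<lambda>\<omega>. Z \<omega> * ?f \<omega>)"
      by (rule integrable_const_bound[where B = B]) (use Bi Z in \<open>auto simp: indicator_def intro: order_trans[OF Z(2) Z(3)]\<close>)
    have m1: "measure (p t (Y s \<omega>)) A \<le> 1" if "\<omega> \<in> space M" for \<omega>
      using prob_space.prob_le_1[OF kernel_prob[OF t Y_topspace[OF s that]]] .
    have i2: "integrable M (\<lambda>\<omega>. Z \<omega> * measure (p t (Y s \<omega>)) A)"
    proof (rule integrable_const_bound[where B = B])
      show "AE \<omega> in M. norm (Z \<omega> * measure (p t (Y s \<omega>)) A) \<le> B"
      proof (rule AE_I2)
        fix \<omega> assume "\<omega> \<in> space M"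
        then have "Z \<omega> * measure (p t (Y s \<omega>)) A \<le> Z \<omega> * 1" using m1 Z(2) by (intro mult_left_mono) auto
        then show "norm (Z \<omega> * measure (p t (Y s \<omega>)) A) \<le> B" using Z(2,3)[of \<omega>] by (simp add: abs_mult)
      qed
    qed measurable
    have "AE \<omega> in M. real_cond_exp M (NF s) ?f \<omega> = measure (p t (Y s \<omega>)) A"
      using process s t Am by (simp add: markov_process_def)
    then have "(\<integral>\<omega>. Z \<omega> * real_cond_exp M (NF s) ?f \<omega> \<partial>M) = (\<integral>\<omega>. Z \<omega> * measure (p t (Y s \<omega>)) A \<partial>M)"
      by (intro integral_cong_AE) auto
    then have eq: "(\<integral>\<omega>. Z \<omega> * ?f \<omega> \<partial>M) = (\<integral>\<omega>. Z \<omega> * measure (p t (Y s \<omega>)) A \<partial>M)"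
      using F.real_cond_exp_intg(2)[OF i1 Z(1) fm] by simp
    have "(\<integral>\<^sup>+\<omega>. ennreal (Z \<omega>) * indicator A (Y (s + t) \<omega>) \<partial>M) = (\<integral>\<^sup>+\<omega>. ennreal (Z \<omega> * ?f \<omega>) \<partial>M)"
      by (intro nn_integral_cong) (auto simp: indicator_def)
    also have "\<dots> = ennreal (\<integral>\<omega>. Z \<omega> * ?f \<omega> \<partial>M)"
      by (rule nn_integral_eq_integral[OF i1]) (use Z in auto)
    also have "\<dots> = (\<integral>\<^sup>+\<omega>. ennreal (Z \<omega> * measure (p t (Y s \<omega>)) A) \<partial>M)"
      unfolding eq by (rule nn_integral_eq_integral[OF i2, symmetric]) (use Z in auto)
    also have "\<dots> = (\<integral>\<^sup>+\<omega>. ennreal (Z \<omega>) * (\<integral>\<^sup>+y. indicator A y \<partial>p t (Y s \<omega>)) \<partial>M)"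
    proof (rule nn_integral_cong)
      fix \<omega> assume \<omega>: "\<omega> \<in> space M"
      interpret pt: prob_space "p t (Y s \<omega>)" by (rule kernel_prob[OF t Y_topspace[OF s \<omega>]])
      have "A \<in> sets (p t (Y s \<omega>))" using Am kernel_sets[OF t Y_topspace[OF s \<omega>]] by simp
      then show "ennreal (Z \<omega> * measure (p t (Y s \<omega>)) A) = ennreal (Z \<omega>) * (\<integral>\<^sup>+y. indicator A y \<partial>p t (Y s \<omega>))"
        using Z(2) by (simp add: pt.emeasure_eq_measure ennreal_mult)
    qed
    finally show ?case .
  next
    case (mult u c)
    note [measurable] = mult(2)
    have km [measurable]: "(\<lambda>x. \<integral>\<^sup>+y. u y \<partial>p t x) \<in> borel_measurable (borel_of X)" by (rule kernel_nn_measurable[OF t mult(2)])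
    have "(\<integral>\<^sup>+y. c * u y \<partial>p t (Y s \<omega>)) = c * (\<integral>\<^sup>+y. u y \<partial>p t (Y s \<omega>))" if "\<omega> \<in> space M" for \<omega>
      by (rule nn_integral_cmult) (use mult(2) measurable_cong_sets[OF kernel_sets[OF t Y_topspace[OF s that]] refl] in blast)
    then have "(\<integral>\<^sup>+\<omega>. ennreal (Z \<omega>) * (\<integral>\<^sup>+y. c * u y \<partial>p t (Y s \<omega>)) \<partial>M) = (\<integral>\<^sup>+\<omega>. c * (ennreal (Z \<omega>) * (\<integral>\<^sup>+y. u y \<partial>p t (Y s \<omega>))) \<partial>M)"
      by (intro nn_integral_cong) (simp add: ac_simps)
    also have "\<dots> = c * (\<integral>\<^sup>+\<omega>. ennreal (Z \<omega>) * (\<integral>\<^sup>+y. u y \<partial>p t (Y s \<omega>)) \<partial>M)"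
      by (rule nn_integral_cmult) measurable
    also have "\<dots> = c * (\<integral>\<^sup>+\<omega>. ennreal (Z \<omega>) * u (Y (s + t) \<omega>) \<partial>M)" using mult by simp
    also have "\<dots> = (\<integral>\<^sup>+\<omega>. c * (ennreal (Z \<omega>) * u (Y (s + t) \<omega>)) \<partial>M)"
      by (rule nn_integral_cmult[symmetric]) measurable
    finally show ?case by (simp add: ac_simps)
  next
    case (add u v)
    note [measurable] = add(1,3)
    have km [measurable]: "(\<lambda>x. \<integral>\<^sup>+y. u y \<partial>p t x) \<in> borel_measurable (borel_of X)" by (rule kernel_nn_measurable[OF t add(1)])
    have km' [measurable]: "(\<lambda>x. \<integral>\<^sup>+y. v y \<partial>p t x) \<in> borel_measurable (borel_of X)" by (rule kernel_nn_measurable[OF t add(3)])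
    have "(\<integral>\<^sup>+y. v y + u y \<partial>p t (Y s \<omega>)) = (\<integral>\<^sup>+y. v y \<partial>p t (Y s \<omega>)) + (\<integral>\<^sup>+y. u y \<partial>p t (Y s \<omega>))" if "\<omega> \<in> space M" for \<omega>
      by (rule nn_integral_add) (use add(1,3) measurable_cong_sets[OF kernel_sets[OF t Y_topspace[OF s that]] refl] in blast)+
    then have "(\<integral>\<^sup>+\<omega>. ennreal (Z \<omega>) * (\<integral>\<^sup>+y. v y + u y \<partial>p t (Y s \<omega>)) \<partial>M) =
      (\<integral>\<^sup>+\<omega>. ennreal (Z \<omega>) * (\<integral>\<^sup>+y. v y \<partial>p t (Y s \<omega>)) + ennreal (Z \<omega>) * (\<integral>\<^sup>+y. u y \<partial>p t (Y s \<omega>)) \<partial>M)"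
      by (intro nn_integral_cong) (simp add: distrib_left)
    also have "\<dots> = (\<integral>\<^sup>+\<omega>. ennreal (Z \<omega>) * (\<integral>\<^sup>+y. v y \<partial>p t (Y s \<omega>)) \<partial>M) + (\<integral>\<^sup>+\<omega>. ennreal (Z \<omega>) * (\<integral>\<^sup>+y. u y \<partial>p t (Y s \<omega>)) \<partial>M)"
      by (rule nn_integral_add) measurable
    also have "\<dots> = (\<integral>\<^sup>+\<omega>. ennreal (Z \<omega>) * v (Y (s + t) \<omega>) \<partial>M) + (\<integral>\<^sup>+\<omega>. ennreal (Z \<omega>) * u (Y (s + t) \<omega>) \<partial>M)"
      using add by simp
    also have "\<dots> = (\<integral>\<^sup>+\<omega>. ennreal (Z \<omega>) * v (Y (s + t) \<omega>) + ennreal (Z \<omega>) * u (Y (s + t) \<omega>) \<partial>M)"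
      by (rule nn_integral_add[symmetric]) measurable
    finally show ?case by (simp add: distrib_left)
  next
    case (seq U)
    note [measurable] = seq(1)
    have km [measurable]: "\<And>i. (\<lambda>x. \<integral>\<^sup>+y. U i y \<partial>p t x) \<in> borel_measurable (borel_of X)" by (rule kernel_nn_measurable[OF t seq(1)])
    have inc: "incseq (\<lambda>i. ennreal (Z \<omega>) * U i (Y (s + t) \<omega>))" for \<omega>
      using seq(3) by (auto simp: incseq_def le_fun_def intro!: mult_left_mono)
    have inc2: "incseq (\<lambda>i. ennreal (Z \<omega>) * (\<integral>\<^sup>+y. U i y \<partial>p t (Y s \<omega>)))" for \<omega>
      using seq(3) by (auto simp: incseq_def le_fun_def intro!: mult_left_mono nn_integral_mono)
    have "(\<integral>\<^sup>+\<omega>. ennreal (Z \<omega>) * (SUP i. U i) (Y (s + t) \<omega>) \<partial>M) = (\<integral>\<^sup>+\<omega>. (SUP i. ennreal (Z \<omega>) * U i (Y (s + t) \<omega>)) \<partial>M)"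
      by (simp add: SUP_mult_left_ennreal image_image)
    also have "\<dots> = (SUP i. \<integral>\<^sup>+\<omega>. ennreal (Z \<omega>) * U i (Y (s + t) \<omega>) \<partial>M)"
      by (rule nn_integral_monotone_convergence_SUP) (use inc in \<open>auto simp: incseq_def le_fun_def\<close>)
    also have "\<dots> = (SUP i. \<integral>\<^sup>+\<omega>. ennreal (Z \<omega>) * (\<integral>\<^sup>+y. U i y \<partial>p t (Y s \<omega>)) \<partial>M)" using seq by simp
    also have "\<dots> = (\<integral>\<^sup>+\<omega>. (SUP i. ennreal (Z \<omega>) * (\<integral>\<^sup>+y. U i y \<partial>p t (Y s \<omega>))) \<partial>M)"
      by (rule nn_integral_monotone_convergence_SUP[symmetric]) (use inc2 in \<open>auto simp: incseq_def le_fun_def\<close>)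
    also have "\<dots> = (\<integral>\<^sup>+\<omega>. ennreal (Z \<omega>) * (\<integral>\<^sup>+y. (SUP i. U i) y \<partial>p t (Y s \<omega>)) \<partial>M)"
    proof (rule nn_integral_cong)
      fix \<omega> assume \<omega>: "\<omega> \<in> space M"
      have Um: "U i \<in> borel_measurable (p t (Y s \<omega>))" for i
        using seq(1)[of i] measurable_cong_sets[OF kernel_sets[OF t Y_topspace[OF s \<omega>]] refl] by blast
      have "(\<integral>\<^sup>+y. (SUP i. U i y) \<partial>p t (Y s \<omega>)) = (SUP i. \<integral>\<^sup>+y. U i y \<partial>p t (Y s \<omega>))"
        by (rule nn_integral_monotone_convergence_SUP)
           (use seq(3) Um in auto)
      then show "(SUP i. ennreal (Z \<omega>) * (\<integral>\<^sup>+y. U i y \<partial>p t (Y s \<omega>))) = ennreal (Z \<omega>) * (\<integral>\<^sup>+y. (SUP i. U i) y \<partial>p t (Y s \<omega>))"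
        by (simp add: SUP_mult_left_ennreal image_image)
    qed
    finally show ?case .
  qed
qed

lemma distr_Y: assumes t: "0 \<le> t" shows "distr M (borel_of X) (Y t) = \<mu>"
proof (rule measure_eqI)
  show "sets (distr M (borel_of X) (Y t)) = sets \<mu>" by (simp add: sets_\<mu>)
  fix A assume "A \<in> sets (distr M (borel_of X) (Y t))"
  then have A: "A \<in> sets (borel_of X)" by simp
  have pm: "p t \<in> \<mu> \<rightarrow>\<^sub>M subprob_algebra (borel_of X)"
    using kernel_subprob[OF t] measurable_cong_sets[OF sets_\<mu> refl] by blast
  have Yt: "Y t \<in> M \<rightarrow>\<^sub>M borel_of X" and Y0: "Y 0 \<in> M \<rightarrow>\<^sub>M borel_of X" using Y_measurable t by auto
  have im: "(indicator A :: _ \<Rightarrow> ennreal) \<in> borel_measurable (borel_of X)" using A by simp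
  have "emeasure (distr M (borel_of X) (Y t)) A = (\<integral>\<^sup>+x. indicator A x \<partial>distr M (borel_of X) (Y t))"
    using A by simp
  also have "\<dots> = (\<integral>\<^sup>+\<omega>. indicator A (Y t \<omega>) \<partial>M)" by (rule nn_integral_distr[OF Yt]) (use im in simp)
  also have "\<dots> = (\<integral>\<^sup>+\<omega>. (\<integral>\<^sup>+y. indicator A y \<partial>p t (Y 0 \<omega>)) \<partial>M)"
    using markov_nn[OF order_refl t, of "\<lambda>_. 1" 1, OF _ _ _ im] by simp
  also have "\<dots> = (\<integral>\<^sup>+x. (\<integral>\<^sup>+y. indicator A y \<partial>p t x) \<partial>\<mu>)"
    unfolding distr_Y_0[symmetric]
    by (rule nn_integral_distr[OF Y0, symmetric]) (use kernel_nn_measurable[OF t im] in simp)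
  also have "\<dots> = (\<integral>\<^sup>+y. indicator A y \<partial>(\<mu> \<bind> p t))" by (rule nn_integral_bind[OF im pm, symmetric])
  also have "\<dots> = emeasure \<mu> A" using A sets_\<mu> stationary[OF t] by simp
  finally show "emeasure (distr M (borel_of X) (Y t)) A = emeasure \<mu> A" .
qed

lemma integrable_Y:
  fixes g :: "'a \<Rightarrow> 'b::{banach, second_countable_topology}"
  assumes "0 \<le> t" "integrable \<mu> g" shows "integrable M (\<lambda>\<omega>. g (Y t \<omega>))"
  using integrable_distr[OF Y_measurable[OF assms(1)], of g] distr_Y[OF assms(1)] assms(2) by simp

lemma integral_Y:
  fixes g :: "'a \<Rightarrow> 'b::{banach, second_countable_topology}"
  assumes "0 \<le> t" "g \<in> borel_measurable (borel_of X)" shows "(\<integral>\<omega>. g (Y t \<omega>) \<partial>M) = (\<integral>x. g x \<partial>\<mu>)"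
  using integral_distr[OF Y_measurable[OF assms(1)] assms(2)] distr_Y[OF assms(1)] by simp

lemma AE_Y: assumes "0 \<le> t" "AE x in \<mu>. Q x" shows "AE \<omega> in M. Q (Y t \<omega>)"
proof -
  have "AE x in distr M (borel_of X) (Y t). Q x" unfolding distr_Y[OF assms(1)] by (rule assms(2))
  then show ?thesis by (rule AE_distrD[OF Y_measurable[OF assms(1)]])
qed

lemma integrable_bounded_mult:
  fixes g Z :: "'w \<Rightarrow> real"
  assumes "integrable M g" "Z \<in> borel_measurable M" "\<And>\<omega>. \<bar>Z \<omega>\<bar> \<le> B"
  shows "integrable M (\<lambda>\<omega>. Z \<omega> * g \<omega>)"
proof (rule Bochner_Integration.integrable_bound[of M "\<lambda>\<omega>. B * g \<omega>"])
  show "AE \<omega> in M. norm (Z \<omega> * g \<omega>) \<le> norm (B * g \<omega>)"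
    using assms(3) by (intro AE_I2) (auto simp: abs_mult intro!: mult_right_mono order_trans[OF assms(3) abs_ge_self])
qed (use assms in auto)

lemma markov_integral_nonneg:
  fixes g :: "'a \<Rightarrow> real" and Z :: "'w \<Rightarrow> real"
  assumes s: "0 \<le> s" and t: "0 \<le> t" and Z: "Z \<in> borel_measurable (NF s)" "\<And>\<omega>. 0 \<le> Z \<omega>" "\<And>\<omega>. Z \<omega> \<le> B"
    and g: "integrable \<mu> g" "\<And>x. 0 \<le> g x"
  shows "(\<integral>\<omega>. Z \<omega> * g (Y (s + t) \<omega>) \<partial>M) = (\<integral>\<omega>. Z \<omega> * (\<integral>y. g y \<partial>p t (Y s \<omega>)) \<partial>M)"
proof -
  have ZM [measurable]: "Z \<in> borel_measurable M" by (rule NF_measurable[OF Z(1)])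
  have st: "0 \<le> s + t" using s t by simp
  have gm [measurable]: "g \<in> borel_measurable (borel_of X)" by (rule integrable_imp_borel[OF g(1)])
  note [measurable] = Y_measurable[OF st] Y_measurable[OF s] kernel_integral_measurable[OF t gm]
  have "(\<integral>\<omega>. Z \<omega> * g (Y (s + t) \<omega>) \<partial>M) = enn2real (\<integral>\<^sup>+\<omega>. ennreal (Z \<omega>) * ennreal (g (Y (s + t) \<omega>)) \<partial>M)"
    by (subst integral_eq_nn_integral) (use Z g in \<open>auto simp: ennreal_mult\<close>)
  also have "(\<integral>\<^sup>+\<omega>. ennreal (Z \<omega>) * ennreal (g (Y (s + t) \<omega>)) \<partial>M) = (\<integral>\<^sup>+\<omega>. ennreal (Z \<omega>) * (\<integral>\<^sup>+y. ennreal (g y) \<partial>p t (Y s \<omega>)) \<partial>M)"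
    by (rule markov_nn[OF s t Z]) measurable
  also have "\<dots> = (\<integral>\<^sup>+\<omega>. ennreal (Z \<omega> * (\<integral>y. g y \<partial>p t (Y s \<omega>))) \<partial>M)"
  proof (rule nn_integral_cong_AE)
    show "AE \<omega> in M. ennreal (Z \<omega>) * (\<integral>\<^sup>+y. ennreal (g y) \<partial>p t (Y s \<omega>)) = ennreal (Z \<omega> * (\<integral>y. g y \<partial>p t (Y s \<omega>)))"
      using AE_Y[OF s kernel_L1(1)[OF t g(1)]]
    proof eventually_elim
      case (elim \<omega>)
      then have "(\<integral>\<^sup>+y. ennreal (g y) \<partial>p t (Y s \<omega>)) = ennreal (\<integral>y. g y \<partial>p t (Y s \<omega>))"
        by (rule nn_integral_eq_integral) (use g in auto)
      then show ?case using Z(2) g(2) by (simp add: ennreal_mult)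
    qed
  qed
  also have "enn2real \<dots> = (\<integral>\<omega>. Z \<omega> * (\<integral>y. g y \<partial>p t (Y s \<omega>)) \<partial>M)"
    by (rule integral_eq_nn_integral[symmetric]) (use Z g in auto)
  finally show ?thesis .
qed

text \<open>Weight and function are split into positive and negative parts. Recombining the kernel
  integrals of the parts of \<open>g\<close> is legitimate only almost surely, by
  \<open>kernel_L1\<close>.\<close>

lemma markov_integral:
  fixes g :: "'a \<Rightarrow> real" and Z :: "'w \<Rightarrow> real"
  assumes s: "0 \<le> s" and t: "0 \<le> t" and Z: "Z \<in> borel_measurable (NF s)" "\<And>\<omega>. \<bar>Z \<omega>\<bar> \<le> B"
    and g: "integrable \<mu> g"
  shows "(\<integral>\<omega>. Z \<omega> * g (Y (s + t) \<omega>) \<partial>M) = (\<integral>\<omega>. Z \<omega> * (\<integral>y. g y \<partial>p t (Y s \<omega>)) \<partial>M)"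
proof -
  have ZM: "Z \<in> borel_measurable M" by (rule NF_measurable[OF Z(1)])
  have st: "0 \<le> s + t" using s t by simp
  have *: "(\<integral>\<omega>. Z \<omega> * h (Y (s + t) \<omega>) \<partial>M) = (\<integral>\<omega>. Z \<omega> * (\<integral>y. h y \<partial>p t (Y s \<omega>)) \<partial>M)"
    if h: "integrable \<mu> h" "\<And>x. 0 \<le> h x" for h
  proof -
    define Zp where "Zp \<omega> = max 0 (Z \<omega>)" for \<omega>
    define Zm where "Zm \<omega> = max 0 (- Z \<omega>)" for \<omega>
    have Zpm: "Zp \<in> borel_measurable (NF s)" "Zm \<in> borel_measurable (NF s)" unfolding Zp_def Zm_def using Z(1) by measurable
    have B: "0 \<le> Zp \<omega>" "Zp \<omega> \<le> B" "0 \<le> Zm \<omega>" "Zm \<omega> \<le> B" "\<bar>Zp \<omega>\<bar> \<le> B" "\<bar>Zm \<omega>\<bar> \<le> B" for \<omega>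
      using Z(2)[of \<omega>] by (auto simp: Zp_def Zm_def)
    have Zd: "Z \<omega> = Zp \<omega> - Zm \<omega>" for \<omega> by (auto simp: Zp_def Zm_def)
    note i1 = integrable_bounded_mult[OF integrable_Y[OF st h(1)] NF_measurable[OF Zpm(1)] B(5)]
      integrable_bounded_mult[OF integrable_Y[OF st h(1)] NF_measurable[OF Zpm(2)] B(6)]
    note i2 = integrable_bounded_mult[OF integrable_Y[OF s kernel_L1(2)[OF t h(1)]] NF_measurable[OF Zpm(1)] B(5)]
      integrable_bounded_mult[OF integrable_Y[OF s kernel_L1(2)[OF t h(1)]] NF_measurable[OF Zpm(2)] B(6)]
    show ?thesis
      unfolding Zd left_diff_distrib
      using markov_integral_nonneg[OF s t Zpm(1) B(1,2) h] markov_integral_nonneg[OF s t Zpm(2) B(3,4) h]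
      by (simp add: Bochner_Integration.integral_diff[OF i1] Bochner_Integration.integral_diff[OF i2])
  qed
  define gp where "gp x = max 0 (g x)" for x
  define gm where "gm x = max 0 (- g x)" for x
  have gi: "integrable \<mu> gp" "integrable \<mu> gm" unfolding gp_def gm_def using g by auto
  have g0: "0 \<le> gp x" "0 \<le> gm x" for x by (auto simp: gp_def gm_def)
  have gd: "g x = gp x - gm x" for x by (auto simp: gp_def gm_def)
  note j1 = integrable_bounded_mult[OF integrable_Y[OF st gi(1)] ZM Z(2)] integrable_bounded_mult[OF integrable_Y[OF st gi(2)] ZM Z(2)]
  note j2 = integrable_bounded_mult[OF integrable_Y[OF s kernel_L1(2)[OF t gi(1)]] ZM Z(2)]
    integrable_bounded_mult[OF integrable_Y[OF s kernel_L1(2)[OF t gi(2)]] ZM Z(2)]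
  have "(\<integral>\<omega>. Z \<omega> * g (Y (s + t) \<omega>) \<partial>M) = (\<integral>\<omega>. Z \<omega> * gp (Y (s + t) \<omega>) \<partial>M) - (\<integral>\<omega>. Z \<omega> * gm (Y (s + t) \<omega>) \<partial>M)"
    unfolding gd right_diff_distrib by (rule Bochner_Integration.integral_diff[OF j1])
  also have "\<dots> = (\<integral>\<omega>. Z \<omega> * (\<integral>y. gp y \<partial>p t (Y s \<omega>)) - Z \<omega> * (\<integral>y. gm y \<partial>p t (Y s \<omega>)) \<partial>M)"
    unfolding *[OF gi(1) g0(1)] *[OF gi(2) g0(2)] by (rule Bochner_Integration.integral_diff[OF j2, symmetric])
  also have "\<dots> = (\<integral>\<omega>. Z \<omega> * (\<integral>y. g y \<partial>p t (Y s \<omega>)) \<partial>M)"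
  proof (rule integral_cong_AE)
    have [measurable]: "(\<lambda>\<omega>. \<integral>y. h y \<partial>p t (Y s \<omega>)) \<in> borel_measurable M" if "integrable \<mu> h" for h :: "'a \<Rightarrow> real"
      using integrable_Y[OF s kernel_L1(2)[OF t that]] by auto
    show "(\<lambda>\<omega>. Z \<omega> * (\<integral>y. gp y \<partial>p t (Y s \<omega>)) - Z \<omega> * (\<integral>y. gm y \<partial>p t (Y s \<omega>))) \<in> borel_measurable M"
      "(\<lambda>\<omega>. Z \<omega> * (\<integral>y. g y \<partial>p t (Y s \<omega>))) \<in> borel_measurable M" using ZM g gi by measurable
    show "AE \<omega> in M. Z \<omega> * (\<integral>y. gp y \<partial>p t (Y s \<omega>)) - Z \<omega> * (\<integral>y. gm y \<partial>p t (Y s \<omega>)) = Z \<omega> * (\<integral>y. g y \<partial>p t (Y s \<omega>))"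
      using AE_Y[OF s kernel_L1(1)[OF t gi(1)]] AE_Y[OF s kernel_L1(1)[OF t gi(2)]]
      by eventually_elim (simp add: gd[abs_def] right_diff_distrib)
  qed
  finally show ?thesis .
qed

text \<open>The present value \<open>g (Y s)\<close> is an admissible weight. The result depends on
  the lag \<open>t\<close> alone, which is all the stationarity used for increments and block
  moments.\<close>

lemma two_time:
  assumes s: "0 \<le> s" and t: "0 \<le> t" and g: "g \<in> Bb X"
  shows "(\<integral>\<omega>. g (Y s \<omega>) * g (Y (s + t) \<omega>) \<partial>M) = (\<integral>x. g x * P t g x \<partial>\<mu>)"
proof -
  obtain B where B: "\<And>x. \<bar>g x\<bar> \<le> B" using Bb_bounded[OF g] by metis
  have gm: "g \<in> borel_measurable (borel_of X)" using g by (simp add: Bb_def)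
  have gi: "integrable \<mu> g" by (rule integrable_bounded_borel_of[OF \<mu>.finite_measure_axioms sets_\<mu> gm B])
  have "(\<integral>\<omega>. g (Y s \<omega>) * g (Y (s + t) \<omega>) \<partial>M) = (\<integral>\<omega>. g (Y s \<omega>) * (\<integral>y. g y \<partial>p t (Y s \<omega>)) \<partial>M)"
    by (rule markov_integral[OF s t _ B gi]) (rule measurable_compose[OF Y_NF_measurable[OF s order_refl] gm])
  also have "\<dots> = (\<integral>\<omega>. g (Y s \<omega>) * P t g (Y s \<omega>) \<partial>M)"
    using Y_topspace[OF s] by (intro Bochner_Integration.integral_cong) (auto simp: P_eq)
  also have "\<dots> = (\<integral>x. g x * P t g x \<partial>\<mu>)"
    by (rule integral_Y[OF s]) (use gm P_measurable[OF t gm] in measurable)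
  finally show ?thesis .
qed

section \<open>Joint measurability and time integrals along paths\<close>

lemma right_approx:
  fixes t :: real
  shows "filterlim (\<lambda>k. (real_of_int \<lfloor>t * real (Suc k)\<rfloor> + 1) / real (Suc k)) (at_right t) sequentially"
proof -
  let ?u = "\<lambda>k. (real_of_int \<lfloor>t * real (Suc k)\<rfloor> + 1) / real (Suc k)"
  \<comment> \<open>The successor of the floor puts the grid point strictly to the right of
    \<open>t\<close>, as a right limit requires.\<close>
  have lo: "t < ?u k" and hi: "?u k \<le> t + 1 / real (Suc k)" for k
  proof -
    have "t * real (Suc k) < of_int \<lfloor>t * real (Suc k)\<rfloor> + 1" by linarith
    then show "t < ?u k" by (subst pos_less_divide_eq) auto
    have "of_int \<lfloor>t * real (Suc k)\<rfloor> + 1 \<le> t * real (Suc k) + 1" by linarith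
    then have "?u k \<le> (t * real (Suc k) + 1) / real (Suc k)" by (intro divide_right_mono) auto
    also have "\<dots> = t + 1 / real (Suc k)" by (simp add: add_divide_distrib del: of_nat_Suc)
    finally show "?u k \<le> t + 1 / real (Suc k)" .
  qed
  have "(\<lambda>k. t + 1 / real (Suc k)) \<longlonglongrightarrow> t + 0"
    by (intro tendsto_add tendsto_const) (use LIMSEQ_inverse_real_of_nat in \<open>simp add: inverse_eq_divide\<close>)
  then have "(\<lambda>k. t + 1 / real (Suc k)) \<longlonglongrightarrow> t" by simp
  then have "?u \<longlonglongrightarrow> t"
    using lo hi by (intro tendsto_sandwich[OF _ _ tendsto_const, of t ?u sequentially "\<lambda>k. t + 1 / real (Suc k)"] always_eventually allI) (auto intro: less_imp_le simp del: of_nat_Suc)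
  then show ?thesis
    using lo by (intro filterlim_at_withinI) (auto intro!: always_eventually less_imp_neq[THEN not_sym] simp del: of_nat_Suc)
qed

text \<open>Right continuity makes the process a limit of processes that take countably many time
  values. The limit is taken after composing with a real continuous function, and every open set is
  the positivity set of one. The \<open>max 0\<close> makes the map total, as nothing is known at
  negative times.\<close>

lemma Y_jointly_measurable:
  "(\<lambda>z. Y (max 0 (snd z)) (fst z)) \<in> M \<Otimes>\<^sub>M lborel \<rightarrow>\<^sub>M borel_of X"
proof -
  let ?N = "M \<Otimes>\<^sub>M (lborel :: real measure)"
  \<comment> \<open>The truncation gives every integer index an admissible time; for the indices
    that actually occur it changes nothing.\<close>
  define \<tau> where "\<tau> k i = max 0 ((real_of_int i + 1) / real (Suc k))" for k :: nat and i :: int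
  have \<tau>0: "0 \<le> \<tau> k i" for k i by (simp add: \<tau>_def)
  have cm: "(\<lambda>z. c (Y (max 0 (snd z)) (fst z))) \<in> borel_measurable ?N"
    if c: "continuous_map X euclideanreal c" for c :: "'a \<Rightarrow> real"
  proof (rule borel_measurable_LIMSEQ_real)
    have c': "c \<in> borel_measurable (borel_of X)" by (rule continuous_map_borel_measurable[OF c])
    fix k
    have "(\<lambda>z. c (Y (\<tau> k i) (fst z))) \<in> borel_measurable ?N" for i
      by (rule measurable_compose[OF measurable_compose[OF measurable_fst Y_measurable[OF \<tau>0]] c'])
    moreover have "(\<lambda>z. \<lfloor>max 0 (snd z) * real (Suc k)\<rfloor>) \<in> ?N \<rightarrow>\<^sub>M count_space UNIV"
      by measurable
    ultimately show "(\<lambda>z. c (Y (\<tau> k \<lfloor>max 0 (snd z) * real (Suc k)\<rfloor>) (fst z))) \<in> borel_measurable ?N"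
      by (rule measurable_compose_countable[where f = "\<lambda>i z. c (Y (\<tau> k i) (fst z))"])
  next
    fix z assume "z \<in> space ?N"
    then have \<omega>: "fst z \<in> space M" by (auto simp: space_pair_measure)
    define t where "t = max 0 (snd z)"
    have t: "0 \<le> t" by (simp add: t_def)
    have "limitin X (\<lambda>s. Y s (fst z)) (Y t (fst z)) (at_right t)"
      using process \<omega> t by (auto simp: markov_process_def cadlag_def)
    then have "((\<lambda>s. c (Y s (fst z))) \<longlongrightarrow> c (Y t (fst z))) (at_right t)"
      using continuous_map_limit[OF c] by (fastforce simp: o_def)
    from filterlim_compose[OF this right_approx]
    have "(\<lambda>k. c (Y ((real_of_int \<lfloor>t * real (Suc k)\<rfloor> + 1) / real (Suc k)) (fst z))) \<longlonglongrightarrow> c (Y t (fst z))" .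
    moreover have "\<tau> k \<lfloor>t * real (Suc k)\<rfloor> = (real_of_int \<lfloor>t * real (Suc k)\<rfloor> + 1) / real (Suc k)" for k
    proof -
      have "0 \<le> \<lfloor>t * real (Suc k)\<rfloor>" using t by simp
      then have "0 \<le> real_of_int \<lfloor>t * real (Suc k)\<rfloor>" by (simp only: of_int_0_le_iff)
      then show ?thesis unfolding \<tau>_def by (intro max_absorb2 divide_nonneg_nonneg) auto
    qed
    ultimately show "(\<lambda>k. c (Y (\<tau> k \<lfloor>max 0 (snd z) * real (Suc k)\<rfloor>) (fst z))) \<longlonglongrightarrow> c (Y (max 0 (snd z)) (fst z))"
      by (simp add: t_def)
  qed
  have sp: "Y (max 0 (snd z)) (fst z) \<in> topspace X" if "z \<in> space ?N" for z
    using that Y_topspace by (auto simp: space_pair_measure)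
  show ?thesis
    unfolding borel_of_def
  proof (rule measurable_measure_of)
    show "{U. openin X U} \<subseteq> Pow (topspace X)" by (auto dest: openin_subset)
    show "(\<lambda>z. Y (max 0 (snd z)) (fst z)) \<in> space ?N \<rightarrow> topspace X" using sp by auto
    fix U assume "U \<in> {U. openin X U}"
    then have U: "openin X U" by simp
    have met: "metrizable_space X" using pos by (simp add: C0_positive_def)
    obtain c where c: "continuous_map X euclideanreal c" "\<And>x. x \<in> topspace X \<Longrightarrow> (0::real) < c x \<longleftrightarrow> x \<in> U"
      using openin_indicator_continuous[OF met U] by metis
    have "(\<lambda>z. Y (max 0 (snd z)) (fst z)) -` U \<inter> space ?N = {z \<in> space ?N. 0 < c (Y (max 0 (snd z)) (fst z))}"
      using c(2) sp by auto
    also have "\<dots> \<in> sets ?N" using cm[OF c(1)] by measurable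
    finally show "(\<lambda>z. Y (max 0 (snd z)) (fst z)) -` U \<inter> space ?N \<in> sets ?N" .
  qed
qed

text \<open>Tonelli applied to the integrand cut off to the interval: a bound on the mean at each
  time bounds the mean of the time integral, and makes almost every path integrable.\<close>

lemma time_integral_L1:
  fixes H :: "'w \<Rightarrow> real \<Rightarrow> real"
  assumes H: "case_prod H \<in> borel_measurable (M \<Otimes>\<^sub>M lborel)"
    and ab: "a \<le> b" and c: "0 \<le> c"
    and Hi: "\<And>t. a < t \<Longrightarrow> t \<le> b \<Longrightarrow> integrable M (\<lambda>\<omega>. H \<omega> t)"
    and Hc: "\<And>t. a < t \<Longrightarrow> t \<le> b \<Longrightarrow> (\<integral>\<omega>. \<bar>H \<omega> t\<bar> \<partial>M) \<le> c"
  shows "AE \<omega> in M. set_integrable lborel {a<..b} (H \<omega>)"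
    and "integrable M (\<lambda>\<omega>. LINT t:{a<..b}|lborel. H \<omega> t)"
    and "(\<integral>\<omega>. \<bar>LINT t:{a<..b}|lborel. H \<omega> t\<bar> \<partial>M) \<le> (b - a) * c"
proof -
  interpret pair_sigma_finite M "lborel :: real measure" ..
  note [measurable] = H
  define J where "J z = indicator {a<..b} (snd z) * H (fst z) (snd z)" for z
  have J [measurable]: "J \<in> borel_measurable (M \<Otimes>\<^sub>M lborel)"
    using H unfolding J_def[abs_def] case_prod_beta' by measurable
  have "(\<integral>\<^sup>+z. ennreal \<bar>J z\<bar> \<partial>(M \<Otimes>\<^sub>M lborel)) = (\<integral>\<^sup>+t. (\<integral>\<^sup>+\<omega>. ennreal \<bar>J (\<omega>, t)\<bar> \<partial>M) \<partial>lborel)"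
    by (rule nn_integral_snd[symmetric]) measurable
  also have "\<dots> \<le> (\<integral>\<^sup>+t. ennreal c * indicator {a<..b} t \<partial>lborel)"
  proof (rule nn_integral_mono)
    fix t :: real
    show "(\<integral>\<^sup>+\<omega>. ennreal \<bar>J (\<omega>, t)\<bar> \<partial>M) \<le> ennreal c * indicator {a<..b} t"
    proof (cases "t \<in> {a<..b}")
      case True
      then have "(\<integral>\<^sup>+\<omega>. ennreal \<bar>J (\<omega>, t)\<bar> \<partial>M) = (\<integral>\<^sup>+\<omega>. ennreal \<bar>H \<omega> t\<bar> \<partial>M)" by (simp add: J_def)
      also have "\<dots> = ennreal (\<integral>\<omega>. \<bar>H \<omega> t\<bar> \<partial>M)" using Hi[of t] True by (intro nn_integral_eq_integral) auto
      finally show ?thesis using Hc[of t] True by (simp add: ennreal_leI)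
    qed (simp add: J_def)
  qed
  also have "\<dots> = ennreal c * ennreal (b - a)" using ab by (simp add: nn_integral_cmult_indicator)
  also have "\<dots> = ennreal ((b - a) * c)" using ab c by (simp add: ennreal_mult mult.commute)
  finally have bound: "(\<integral>\<^sup>+z. ennreal \<bar>J z\<bar> \<partial>(M \<Otimes>\<^sub>M lborel)) \<le> ennreal ((b - a) * c)" .
  then have Ji: "integrable (M \<Otimes>\<^sub>M lborel) J"
    by (intro integrableI_bounded) (auto intro: le_less_trans[OF _ ennreal_less_top])
  have Jset: "(\<integral>t. J (\<omega>, t) \<partial>lborel) = (LINT t:{a<..b}|lborel. H \<omega> t)" for \<omega>
    by (simp add: J_def set_lebesgue_integral_def)
  show "AE \<omega> in M. set_integrable lborel {a<..b} (H \<omega>)"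
    using AE_integrable_fst'[OF Ji] by (simp add: J_def set_integrable_def)
  show int: "integrable M (\<lambda>\<omega>. LINT t:{a<..b}|lborel. H \<omega> t)"
    using integrable_fst'[OF Ji] unfolding Jset .
  have "ennreal (\<integral>\<omega>. \<bar>LINT t:{a<..b}|lborel. H \<omega> t\<bar> \<partial>M) = (\<integral>\<^sup>+\<omega>. ennreal \<bar>LINT t:{a<..b}|lborel. H \<omega> t\<bar> \<partial>M)"
    by (rule nn_integral_eq_integral[symmetric]) (use int in auto)
  also have "\<dots> \<le> (\<integral>\<^sup>+\<omega>. (\<integral>\<^sup>+t. ennreal \<bar>J (\<omega>, t)\<bar> \<partial>lborel) \<partial>M)"
  proof (rule nn_integral_mono)
    fix \<omega>
    show "ennreal \<bar>LINT t:{a<..b}|lborel. H \<omega> t\<bar> \<le> (\<integral>\<^sup>+t. ennreal \<bar>J (\<omega>, t)\<bar> \<partial>lborel)"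
      unfolding Jset[symmetric] using integral_norm_bound_ennreal[of lborel "\<lambda>t. J (\<omega>, t)"]
      by (cases "integrable lborel (\<lambda>t. J (\<omega>, t))") (auto simp: not_integrable_integral_eq)
  qed
  also have "\<dots> = (\<integral>\<^sup>+z. ennreal \<bar>J z\<bar> \<partial>(M \<Otimes>\<^sub>M lborel))"
    by (rule lborel.nn_integral_fst) measurable
  also note bound
  finally show "(\<integral>\<omega>. \<bar>LINT t:{a<..b}|lborel. H \<omega> t\<bar> \<partial>M) \<le> (b - a) * c"
    using ab c by (subst (asm) ennreal_le_iff) auto
qed

text \<open>Grid cells are taken half-open so that they concatenate disjointly, while time averages
  are stated over closed intervals. The identity needs no integrability: the integrands differ at
  one point, so they are integrable together, and otherwise both integrals are 0.\<close>

lemma set_integral_left_endpoint: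
  fixes g :: "real \<Rightarrow> real"
  shows "(LINT t:{a..b}|lborel. g t) = (LINT t:{a<..b}|lborel. g t)"
    "set_integrable lborel {a..b} g \<longleftrightarrow> set_integrable lborel {a<..b} g"
proof -
  have ae: "AE t in lborel. indicator {a..b} t *\<^sub>R g t = indicator {a<..b} t *\<^sub>R g t"
    using AE_lborel_singleton[of a] by eventually_elim (auto simp: indicator_def)
  have eq: "(\<lambda>t. indicator {a..b} t *\<^sub>R g t) = (\<lambda>t. if t \<in> {a} then (if a \<le> b then g a else 0) else indicator {a<..b} t *\<^sub>R g t)"
    by (auto simp: fun_eq_iff indicator_def)
  have eq': "(\<lambda>t. indicator {a<..b} t *\<^sub>R g t) = (\<lambda>t. if t \<in> {a} then 0 else indicator {a..b} t *\<^sub>R g t)"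
    by (auto simp: fun_eq_iff indicator_def)
  have m: "(\<lambda>t. indicator {a..b} t *\<^sub>R g t) \<in> borel_measurable lborel \<longleftrightarrow> (\<lambda>t. indicator {a<..b} t *\<^sub>R g t) \<in> borel_measurable lborel"
  proof
    assume "(\<lambda>t. indicator {a..b} t *\<^sub>R g t) \<in> borel_measurable lborel"
    then show "(\<lambda>t. indicator {a<..b} t *\<^sub>R g t) \<in> borel_measurable lborel" unfolding eq' by measurable
  next
    assume "(\<lambda>t. indicator {a<..b} t *\<^sub>R g t) \<in> borel_measurable lborel"
    then show "(\<lambda>t. indicator {a..b} t *\<^sub>R g t) \<in> borel_measurable lborel" unfolding eq by measurable
  qed
  show i: "set_integrable lborel {a..b} g \<longleftrightarrow> set_integrable lborel {a<..b} g"
    unfolding set_integrable_def using m integrable_cong_AE[OF _ _ ae] borel_measurable_integrable by blast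
  show "(LINT t:{a..b}|lborel. g t) = (LINT t:{a<..b}|lborel. g t)"
  proof (cases "set_integrable lborel {a..b} g")
    case True
    then have "(\<lambda>t. indicator {a..b} t *\<^sub>R g t) \<in> borel_measurable lborel" by (auto simp: set_integrable_def)
    then show ?thesis unfolding set_lebesgue_integral_def using m by (intro integral_cong_AE[OF _ _ ae]) auto
  next
    case False
    then show ?thesis using i unfolding set_lebesgue_integral_def set_integrable_def by (simp add: not_integrable_integral_eq)
  qed
qed

text \<open>The additive functional up to time \<open>T\<close>, half-open so that it splits along a
  grid.\<close>

definition occ :: "real \<Rightarrow> ('a \<Rightarrow> real) \<Rightarrow> 'w \<Rightarrow> real" where
  "occ T g \<omega> = (LINT t:{0<..T}|lborel. g (Y t \<omega>))"

lemma jointly_measurable: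
  assumes "g \<in> borel_measurable (borel_of X)"
  shows "case_prod (\<lambda>\<omega> t. g (Y (max 0 t) \<omega>)) \<in> borel_measurable (M \<Otimes>\<^sub>M lborel)"
  using measurable_compose[OF Y_jointly_measurable assms] by (simp add: case_prod_beta')

lemma set_integral_max0:
  assumes "0 \<le> a"
  shows "(LINT t:{a<..b}|lborel. g (Y (max 0 t) \<omega>)) = (LINT t:{a<..b}|lborel. g (Y t \<omega>) :: real)"
    "set_integrable lborel {a<..b} (\<lambda>t. g (Y (max 0 t) \<omega>)) \<longleftrightarrow> set_integrable lborel {a<..b} (\<lambda>t. g (Y t \<omega>) :: real)"
proof -
  have *: "indicator {a<..b} t *\<^sub>R g (Y (max 0 t) \<omega>) = indicator {a<..b} t *\<^sub>R g (Y t \<omega>)" for t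
    using assms by (auto simp: indicator_def max_def)
  show "(LINT t:{a<..b}|lborel. g (Y (max 0 t) \<omega>)) = (LINT t:{a<..b}|lborel. g (Y t \<omega>) :: real)"
    "set_integrable lborel {a<..b} (\<lambda>t. g (Y (max 0 t) \<omega>)) \<longleftrightarrow> set_integrable lborel {a<..b} (\<lambda>t. g (Y t \<omega>) :: real)"
    unfolding set_lebesgue_integral_def set_integrable_def * by (rule refl)+
qed

lemma path_integral_L1:
  assumes g: "integrable \<mu> g" and ab: "0 \<le> a" "a \<le> b"
  shows "AE \<omega> in M. set_integrable lborel {a<..b} (\<lambda>t. g (Y t \<omega>) :: real)"
    and "integrable M (\<lambda>\<omega>. LINT t:{a<..b}|lborel. g (Y t \<omega>))"
proof -
  have gm: "g \<in> borel_measurable (borel_of X)" by (rule integrable_imp_borel[OF g])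
  have i: "integrable M (\<lambda>\<omega>. g (Y (max 0 t) \<omega>))" if "a < t" for t
    using ab that by (intro integrable_Y g) auto
  have le: "(\<integral>\<omega>. \<bar>g (Y (max 0 t) \<omega>)\<bar> \<partial>M) \<le> (\<integral>x. \<bar>g x\<bar> \<partial>\<mu>)" for t
    using integral_Y[of "max 0 t" "\<lambda>x. \<bar>g x\<bar>"] gm by simp
  have "0 \<le> (\<integral>x. \<bar>g x\<bar> \<partial>\<mu>)" by simp
  note * = time_integral_L1[OF jointly_measurable[OF gm] ab(2) this i le]
  show "AE \<omega> in M. set_integrable lborel {a<..b} (\<lambda>t. g (Y t \<omega>) :: real)"
    using *(1) unfolding set_integral_max0[OF ab(1)] by simp
  show "integrable M (\<lambda>\<omega>. LINT t:{a<..b}|lborel. g (Y t \<omega>))"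
    using *(2) unfolding set_integral_max0[OF ab(1)] by simp
qed

text \<open>For \<open>h\<close> in \<open>C0 X\<close> the mean square of the increment equals
  \<open>2 \<integral> h (h - P u h)\<close>, which strong continuity makes small uniformly in the
  starting time. Density in the mean and stationarity carry this over to an integrable
  \<open>g\<close>.\<close>

lemma modulus:
  fixes g :: "'a \<Rightarrow> real"
  assumes g: "integrable \<mu> g" and e: "0 < e"
  obtains d where "0 < d" "\<And>s u. 0 \<le> s \<Longrightarrow> 0 \<le> u \<Longrightarrow> u < d \<Longrightarrow> (\<integral>\<omega>. \<bar>g (Y (s + u) \<omega>) - g (Y s \<omega>)\<bar> \<partial>M) \<le> e"
proof -
  have gm: "g \<in> borel_measurable (borel_of X)" by (rule integrable_imp_borel[OF g])
  have e3: "0 < e/3" using e by simp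
  obtain h where h: "h \<in> C0 X" "(\<integral>x. \<bar>g x - h x\<bar> \<partial>\<mu>) < e/3"
    using C0_dense_L1[OF pos \<mu>.finite_measure_axioms sets_\<mu> g e3] by metis
  obtain B where B: "0 < B" "\<And>x. \<bar>h x\<bar> \<le> B" using C0_bounded[OF h(1)] by metis
  have hm: "h \<in> borel_measurable (borel_of X)" by (rule C0_measurable[OF h(1)])
  have hb: "h \<in> Bb X" by (rule C0_imp_Bb[OF h(1)])
  have hi: "integrable \<mu> h" by (rule integrable_bounded_borel_of[OF \<mu>.finite_measure_axioms sets_\<mu> hm B(2)])
  \<comment> \<open>Chosen so that \<open>2 * B * c\<close> is the square of \<open>e / 3\<close>;
    the other two thirds pay for replacing \<open>g\<close> by \<open>h\<close> at both
    times.\<close>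
  define c where "c = (e/3)^2 / (2 * B)"
  have c: "0 < c" using e B by (simp add: c_def)
  obtain d where d: "0 < d" "\<And>t x. 0 \<le> t \<Longrightarrow> t < d \<Longrightarrow> \<bar>P t h x - h x\<bar> \<le> c" using P_contD[OF h(1) c] by metis
  show ?thesis
  proof (rule that[OF d(1)])
    fix s u :: real assume s: "0 \<le> s" and u: "0 \<le> u" "u < d"
    then have su: "0 \<le> s + u" by simp
    note i = integrable_Y[OF su g] integrable_Y[OF s g] integrable_Y[OF su hi] integrable_Y[OF s hi]
    have gh: "(\<integral>\<omega>. \<bar>g (Y t \<omega>) - h (Y t \<omega>)\<bar> \<partial>M) < e/3" if "0 \<le> t" for t
      using integral_Y[OF that, of "\<lambda>x. \<bar>g x - h x\<bar>"] gm hm h(2) by simp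
    have bi: "integrable M (\<lambda>\<omega>. h (Y a \<omega>) * h (Y b \<omega>))" if "0 \<le> a" "0 \<le> b" for a b
      by (rule integrable_bounded_mult[OF integrable_Y[OF that(2) hi] _ B(2)])
         (use measurable_compose[OF Y_measurable[OF that(1)] hm] in simp)
    have Pu: "P u h \<in> Bb X" by (rule P_Bb[OF u(1) hb])
    have mi: "integrable \<mu> (\<lambda>x. h x * v x)" if v: "v \<in> Bb X" for v
    proof -
      obtain D where D: "\<And>x. \<bar>v x\<bar> \<le> D" using Bb_bounded[OF v] by metis
      have "\<bar>h x * v x\<bar> \<le> B * D" for x
        unfolding abs_mult using B D by (intro mult_mono) auto
      moreover have "(\<lambda>x. h x * v x) \<in> borel_measurable (borel_of X)" using hm v by (auto simp: Bb_def)
      ultimately show ?thesis by (intro integrable_bounded_borel_of[OF \<mu>.finite_measure_axioms sets_\<mu>])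
    qed
    have sq: "(\<integral>\<omega>. h (Y t \<omega>) * h (Y t \<omega>) \<partial>M) = (\<integral>x. h x * h x \<partial>\<mu>)" if "0 \<le> t" for t
      using integral_Y[OF that, of "\<lambda>x. h x * h x"] hm by simp
    have "(\<integral>\<omega>. (h (Y (s + u) \<omega>) - h (Y s \<omega>))\<^sup>2 \<partial>M)
        = (\<integral>\<omega>. (h (Y (s+u) \<omega>) * h (Y (s+u) \<omega>) + h (Y s \<omega>) * h (Y s \<omega>)) - 2 * (h (Y s \<omega>) * h (Y (s+u) \<omega>)) \<partial>M)"
      by (intro Bochner_Integration.integral_cong) (auto simp: power2_eq_square algebra_simps)
    also have "\<dots> = ((\<integral>x. h x * h x \<partial>\<mu>) + (\<integral>x. h x * h x \<partial>\<mu>)) - 2 * (\<integral>x. h x * P u h x \<partial>\<mu>)"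
      using bi[OF su su] bi[OF s s] bi[OF s su] sq[OF su] sq[OF s] two_time[OF s u(1) hb] by simp
    also have "\<dots> = 2 * (\<integral>x. h x * (h x - P u h x) \<partial>\<mu>)"
      by (simp add: right_diff_distrib Bochner_Integration.integral_diff[OF mi[OF hb] mi[OF Pu]])
    also have "(\<integral>x. h x * (h x - P u h x) \<partial>\<mu>) \<le> (\<integral>x. B * c \<partial>\<mu>)"
    proof (rule integral_mono)
      show "integrable \<mu> (\<lambda>x. h x * (h x - P u h x))" by (rule mi[OF Bb_diff[OF hb Pu]])
      show "h x * (h x - P u h x) \<le> B * c" for x
      proof -
        have "\<bar>h x\<bar> * \<bar>h x - P u h x\<bar> \<le> B * c" using B d(2)[OF u, of x] by (intro mult_mono) (auto simp: abs_minus_commute)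
        then show ?thesis by (metis abs_ge_self abs_mult order_trans)
      qed
    qed simp
    also have "2 * (\<integral>x. B * c \<partial>\<mu>) = (e/3)^2" using B by (simp add: c_def \<mu>.prob_space)
    finally have sq2: "(\<integral>\<omega>. (h (Y (s + u) \<omega>) - h (Y s \<omega>))\<^sup>2 \<partial>M) \<le> (e/3)^2" by simp
    have isq: "integrable M (\<lambda>\<omega>. (h (Y (s + u) \<omega>) - h (Y s \<omega>))\<^sup>2)"
      using bi[OF su su] bi[OF s s] bi[OF s su] by (simp add: power2_eq_square algebra_simps)
    have "(\<integral>\<omega>. \<bar>h (Y (s + u) \<omega>) - h (Y s \<omega>)\<bar> \<partial>M)\<^sup>2 \<le> (\<integral>\<omega>. \<bar>h (Y (s + u) \<omega>) - h (Y s \<omega>)\<bar>\<^sup>2 \<partial>M)"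
      using variance_positive[of "\<lambda>\<omega>. \<bar>h (Y (s + u) \<omega>) - h (Y s \<omega>)\<bar>"] variance_eq[of "\<lambda>\<omega>. \<bar>h (Y (s + u) \<omega>) - h (Y s \<omega>)\<bar>"] i(3,4) isq by simp
    then have "(\<integral>\<omega>. \<bar>h (Y (s + u) \<omega>) - h (Y s \<omega>)\<bar> \<partial>M)\<^sup>2 \<le> (e/3)^2" using sq2 by simp
    then have h3: "(\<integral>\<omega>. \<bar>h (Y (s + u) \<omega>) - h (Y s \<omega>)\<bar> \<partial>M) \<le> e/3"
      by (rule power2_le_imp_le) (use e in simp)
    have "(\<integral>\<omega>. \<bar>g (Y (s + u) \<omega>) - g (Y s \<omega>)\<bar> \<partial>M) \<le>
       (\<integral>\<omega>. (\<bar>g (Y (s + u) \<omega>) - h (Y (s + u) \<omega>)\<bar> + \<bar>g (Y s \<omega>) - h (Y s \<omega>)\<bar>) + \<bar>h (Y (s + u) \<omega>) - h (Y s \<omega>)\<bar> \<partial>M)"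
      by (intro integral_mono Bochner_Integration.integrable_add integrable_abs Bochner_Integration.integrable_diff i) auto
    also have "\<dots> = ((\<integral>\<omega>. \<bar>g (Y (s + u) \<omega>) - h (Y (s + u) \<omega>)\<bar> \<partial>M) + (\<integral>\<omega>. \<bar>g (Y s \<omega>) - h (Y s \<omega>)\<bar> \<partial>M)) + (\<integral>\<omega>. \<bar>h (Y (s + u) \<omega>) - h (Y s \<omega>)\<bar> \<partial>M)"
      using i by simp
    also have "\<dots> \<le> e" using gh[OF s] gh[OF su] h3 by linarith
    finally show "(\<integral>\<omega>. \<bar>g (Y (s + u) \<omega>) - g (Y s \<omega>)\<bar> \<partial>M) \<le> e" .
  qed
qed

text \<open>A measurable \<open>g\<close> along a path need not be Riemann integrable, so
  convergence holds only in the mean: on each cell the integrand is compared with its value at the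
  right endpoint by \<open>modulus\<close>. The error per unit of time is independent of the number
  of cells.\<close>

lemma occ_riemann:
  assumes g: "integrable \<mu> g" and e: "0 < e"
  obtains d where "0 < d" "\<And>h m. 0 < h \<Longrightarrow> h < d \<Longrightarrow>
    (\<integral>\<omega>. \<bar>(\<Sum>k<m. h * g (Y (real (Suc k) * h) \<omega>)) - occ (real m * h) g \<omega>\<bar> \<partial>M) \<le> real m * (h * e)"
proof -
  have gm: "g \<in> borel_measurable (borel_of X)" by (rule integrable_imp_borel[OF g])
  obtain d where d: "0 < d" "\<And>s u. 0 \<le> s \<Longrightarrow> 0 \<le> u \<Longrightarrow> u < d \<Longrightarrow> (\<integral>\<omega>. \<bar>g (Y (s + u) \<omega>) - g (Y s \<omega>)\<bar> \<partial>M) \<le> e"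
    using modulus[OF g e] by metis
  show ?thesis
  proof (rule that[OF d(1)])
    fix h :: real and m :: nat assume h: "0 < h" "h < d"
    define r where "r k = real k * h" for k :: nat
    have r0: "0 \<le> r k" and rS: "r (Suc k) = r k + h" for k using h by (auto simp: r_def algebra_simps)
    define D where "D k \<omega> = (LINT t:{r k<..r (Suc k)}|lborel. g (Y (r (Suc k)) \<omega>) - g (Y (max 0 t) \<omega>))" for k \<omega>
    have Dm: "case_prod (\<lambda>\<omega> t. g (Y (r (Suc k)) \<omega>) - g (Y (max 0 t) \<omega>)) \<in> borel_measurable (M \<Otimes>\<^sub>M lborel)" for k
    proof -
      have "(\<lambda>z. g (Y (r (Suc k)) (fst z))) \<in> borel_measurable (M \<Otimes>\<^sub>M lborel)"
        by (rule measurable_compose[OF measurable_compose[OF measurable_fst Y_measurable[OF r0]] gm])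
      then show ?thesis using jointly_measurable[OF gm] unfolding case_prod_beta' by measurable
    qed
    have Di: "integrable M (\<lambda>\<omega>. g (Y (r (Suc k)) \<omega>) - g (Y (max 0 t) \<omega>))" for k t
      by (intro Bochner_Integration.integrable_diff integrable_Y g r0) auto
    have De: "(\<integral>\<omega>. \<bar>g (Y (r (Suc k)) \<omega>) - g (Y (max 0 t) \<omega>)\<bar> \<partial>M) \<le> e" if "r k < t" "t \<le> r (Suc k)" for k t
      using d(2)[of t "r (Suc k) - t"] that r0[of k] h rS[of k] by simp
    have rle: "r k \<le> r (Suc k)" for k using h rS by simp
    have D2: "integrable M (\<lambda>\<omega>. D k \<omega>)" and D3: "(\<integral>\<omega>. \<bar>D k \<omega>\<bar> \<partial>M) \<le> (r (Suc k) - r k) * e" for k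
      unfolding D_def
      using time_integral_L1(2)[OF Dm rle less_imp_le[OF e] Di De, of k]
        time_integral_L1(3)[OF Dm rle less_imp_le[OF e] Di De, of k] by auto
    have sum: "occ (r m) g \<omega> = (\<Sum>k<m. LINT t:{r k<..r (Suc k)}|lborel. g (Y t \<omega>))"
      if "set_integrable lborel {0<..r m} (\<lambda>t. g (Y t \<omega>))" for \<omega> m
      using that
    proof (induction m)
      case 0
      then show ?case by (simp add: occ_def r_def set_lebesgue_integral_def)
    next
      case (Suc m)
      have split: "{0<..r (Suc m)} = {0<..r m} \<union> {r m<..r (Suc m)}" using r0[of m] rle[of m] by auto
      have i: "set_integrable lborel {0<..r m} (\<lambda>t. g (Y t \<omega>))" "set_integrable lborel {r m<..r (Suc m)} (\<lambda>t. g (Y t \<omega>))"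
        by (rule set_integrable_subset[OF Suc.prems]; use split in auto)+
      show ?case
        using Suc.IH[OF i(1)] set_integral_Un[OF _ i] by (simp add: occ_def split)
    qed
    \<comment> \<open>Splitting the integral over the cells needs an integrable path, hence only
      almost surely.\<close>
    have ae: "AE \<omega> in M. (\<Sum>k<m. h * g (Y (r (Suc k)) \<omega>)) - occ (r m) g \<omega> = (\<Sum>k<m. D k \<omega>)"
      using path_integral_L1(1)[OF g order_refl r0[of m]]
    proof eventually_elim
      case (elim \<omega>)
      have "D k \<omega> = h * g (Y (r (Suc k)) \<omega>) - (LINT t:{r k<..r (Suc k)}|lborel. g (Y t \<omega>))" if "k < m" for k
      proof -
        have "r (Suc k) \<le> r m" using that h by (simp add: r_def)
        then have "{r k<..r (Suc k)} \<subseteq> {0<..r m}" using r0[of k] by auto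
        then have "set_integrable lborel {r k<..r (Suc k)} (\<lambda>t. g (Y t \<omega>))"
          by (intro set_integrable_subset[OF elim]) auto
        then have i: "set_integrable lborel {r k<..r (Suc k)} (\<lambda>t. g (Y (max 0 t) \<omega>))"
          using set_integral_max0(2)[OF r0] by blast
        have c: "set_integrable lborel {r k<..r (Suc k)} (\<lambda>t. g (Y (r (Suc k)) \<omega>))"
          unfolding set_integrable_def using rle[of k] by (intro integrable_scaleR_left integrable_real_indicator) auto
        have "(LINT t:{r k<..r (Suc k)}|lborel. g (Y (r (Suc k)) \<omega>)) = h * g (Y (r (Suc k)) \<omega>)"
          using h by (simp add: set_lebesgue_integral_def rS)
        then show ?thesis unfolding D_def set_integral_diff(2)[OF c i] set_integral_max0(1)[OF r0] by simp
      qed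
      then have "(\<Sum>k<m. D k \<omega>) = (\<Sum>k<m. h * g (Y (r (Suc k)) \<omega>) - (LINT t:{r k<..r (Suc k)}|lborel. g (Y t \<omega>)))"
        by (intro sum.cong) auto
      then show ?case unfolding sum_subtractf using sum[OF elim] by simp
    qed
    have im: "integrable M (\<lambda>\<omega>. (\<Sum>k<m. h * g (Y (r (Suc k)) \<omega>)) - occ (r m) g \<omega>)"
      unfolding occ_def
      by (intro Bochner_Integration.integrable_diff Bochner_Integration.integrable_sum integrable_mult_right integrable_Y g r0 path_integral_L1(2)) auto
    have "(\<integral>\<omega>. \<bar>(\<Sum>k<m. h * g (Y (r (Suc k)) \<omega>)) - occ (r m) g \<omega>\<bar> \<partial>M) = (\<integral>\<omega>. \<bar>\<Sum>k<m. D k \<omega>\<bar> \<partial>M)"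
    proof (rule integral_cong_AE)
      show "(\<lambda>\<omega>. \<bar>(\<Sum>k<m. h * g (Y (r (Suc k)) \<omega>)) - occ (r m) g \<omega>\<bar>) \<in> borel_measurable M" using im by auto
      show "(\<lambda>\<omega>. \<bar>\<Sum>k<m. D k \<omega>\<bar>) \<in> borel_measurable M" using D2 by auto
    qed (use ae in auto)
    also have "\<dots> \<le> (\<integral>\<omega>. (\<Sum>k<m. \<bar>D k \<omega>\<bar>) \<partial>M)"
      using D2 by (intro integral_mono) auto
    also have "\<dots> = (\<Sum>k<m. \<integral>\<omega>. \<bar>D k \<omega>\<bar> \<partial>M)" using D2 by (intro Bochner_Integration.integral_sum) auto
    also have "\<dots> \<le> (\<Sum>k<m. h * e)" by (intro sum_mono order_trans[OF D3]) (simp add: rS)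
    finally show "(\<integral>\<omega>. \<bar>(\<Sum>k<m. h * g (Y (real (Suc k) * h) \<omega>)) - occ (real m * h) g \<omega>\<bar> \<partial>M) \<le> real m * (h * e)"
      by (simp add: r_def)
  qed
qed

end

context stationary_process
begin

lemma occ_bound:
  assumes T: "0 \<le> T" and B: "0 \<le> B" "\<And>x. \<bar>g x\<bar> \<le> B"
  shows "\<bar>occ T g \<omega>\<bar> \<le> T * B"
proof (cases "set_integrable lborel {0<..T} (\<lambda>t. g (Y t \<omega>))")
  case True
  have c: "set_integrable lborel {0<..T} (\<lambda>t. b)" for b :: real
    unfolding set_integrable_def using T by (intro integrable_scaleR_left integrable_real_indicator) auto
  have cc: "(LINT t:{0<..T}|lborel. b) = T * b" for b :: real using T by (simp add: set_lebesgue_integral_def)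
  have "- B \<le> g x" "g x \<le> B" for x using B(2)[of x] by auto
  then have "(LINT t:{0<..T}|lborel. - B) \<le> occ T g \<omega>" "occ T g \<omega> \<le> (LINT t:{0<..T}|lborel. B)"
    unfolding occ_def by (intro set_integral_mono c True; simp)+
  then show ?thesis unfolding cc by (simp add: abs_le_iff)
next
  case False
  then show ?thesis
    using T B(1) by (simp add: occ_def set_lebesgue_integral_def set_integrable_def not_integrable_integral_eq)
qed

lemma occ_integrable:
  assumes "integrable \<mu> g" shows "integrable M (occ T g)"
proof (cases "0 \<le> T")
  case True
  then show ?thesis using path_integral_L1(2)[OF assms order_refl True] by (simp add: occ_def[abs_def])
next
  case False
  then show ?thesis by (simp add: occ_def[abs_def] set_lebesgue_integral_def)
qed

section \<open>Transfer of the law to path space\<close>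

definition paths :: "(real \<Rightarrow> 'a) set" where
  "paths = {y. (\<forall>t\<ge>0. y t \<in> topspace X) \<and> cadlag X y}"

text \<open>The hypothesis \<open>ergodic\<close> speaks of the coordinate process on functions of
  time. The space is confined to regular paths because \<open>markov_process\<close> demands
  regularity of every path, not of almost every one.\<close>

definition path_space :: "(real \<Rightarrow> 'a) measure" where
  "path_space = sigma paths {(\<lambda>y. y t) -` A \<inter> paths | t A. 0 \<le> t \<and> A \<in> sets (borel_of X)}"

definition path_map :: "'w \<Rightarrow> real \<Rightarrow> 'a" where "path_map \<omega> = (\<lambda>t. Y t \<omega>)"

lemma path_generators: "{(\<lambda>y. y t) -` A \<inter> paths | t A. 0 \<le> t \<and> A \<in> sets (borel_of X)} \<subseteq> Pow paths"
  by auto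

lemma space_path_space: "space path_space = paths"
  unfolding path_space_def by (simp add: space_measure_of_conv)

lemma path_map_paths: "\<omega> \<in> space M \<Longrightarrow> path_map \<omega> \<in> paths"
  using process Y_topspace by (auto simp: paths_def path_map_def markov_process_def)

lemma path_map_measurable: "path_map \<in> M \<rightarrow>\<^sub>M path_space"
  unfolding path_space_def
proof (rule measurable_measure_of[OF path_generators])
  show "path_map \<in> space M \<rightarrow> paths" using path_map_paths by auto
  fix S assume "S \<in> {(\<lambda>y. y t) -` A \<inter> paths | t A. 0 \<le> t \<and> A \<in> sets (borel_of X)}"
  then obtain t A where S: "S = (\<lambda>y. y t) -` A \<inter> paths" "0 \<le> t" "A \<in> sets (borel_of X)" by auto
  have "path_map -` S \<inter> space M = Y t -` A \<inter> space M"
    using path_map_paths unfolding S(1) by (auto simp: path_map_def)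
  then show "path_map -` S \<inter> space M \<in> sets M" using measurable_sets[OF Y_measurable[OF S(2)] S(3)] by simp
qed

lemma coordinate_measurable: "0 \<le> t \<Longrightarrow> (\<lambda>y. y t) \<in> path_space \<rightarrow>\<^sub>M borel_of X"
proof (rule measurableI)
  assume t: "0 \<le> t"
  show "y \<in> space path_space \<Longrightarrow> y t \<in> space (borel_of X)" for y using t by (simp add: space_path_space paths_def)
  show "(\<lambda>y. y t) -` A \<inter> space path_space \<in> sets path_space" if "A \<in> sets (borel_of X)" for A
    unfolding space_path_space unfolding path_space_def sets_measure_of[OF path_generators] using t that by auto
qed

text \<open>The path map pulls the coordinate filtration back into the filtration of
  \<open>Y\<close>, so the indicator of an event of the path past is an admissible weight in
  \<open>markov_integral\<close>. Equality of integrals over all such events characterises the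
  conditional expectation.\<close>

lemma path_process:
  "markov_process X p \<mu> (distr M path_space path_map) (\<lambda>t y. y t)"
proof -
  let ?R = "distr M path_space path_map"
  interpret R: prob_space ?R by (rule prob_space_distr[OF path_map_measurable])
  have spR: "space ?R = paths" by (simp add: space_path_space)
  have cR: "(\<lambda>y. y t) \<in> ?R \<rightarrow>\<^sub>M borel_of X" if "0 \<le> t" for t
    using coordinate_measurable[OF that] by simp
  have "AE y in ?R. real_cond_exp ?R (natural_filtration ?R X (\<lambda>t y. y t) s) (\<lambda>y. indicator A (y (s + t))) y = measure (p t (y s)) A"
    if s: "0 \<le> s" and t: "0 \<le> t" and A: "A \<in> sets (borel_of X)" for s t A
  proof -
    let ?F = "natural_filtration ?R X (\<lambda>t y. y t) s"
    have gens: "{(\<lambda>y. y u) -` A \<inter> space ?R | u A. 0 \<le> u \<and> u \<le> s \<and> A \<in> sets (borel_of X)} \<subseteq> Pow (space ?R)" by auto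
    have spF: "space ?F = paths" unfolding natural_filtration_def by (simp add: space_measure_of_conv space_path_space)
    have "sets ?F \<subseteq> sets ?R"
      unfolding natural_filtration_def sets_measure_of[OF gens]
      by (rule sets.sigma_sets_subset) (auto intro!: measurable_sets coordinate_measurable)
    then have sub: "subalgebra ?R ?F" using spF spR by (simp add: subalgebra_def)
    interpret F: finite_measure_subalgebra ?R ?F by unfold_locales (rule sub)
    have pmF: "path_map \<in> NF s \<rightarrow>\<^sub>M ?F"
      unfolding natural_filtration_def[of ?R]
    proof (rule measurable_measure_of[OF gens])
      show "path_map \<in> space (NF s) \<rightarrow> space ?R" using path_map_paths by (auto simp: space_NF space_path_space)
      fix S assume "S \<in> {(\<lambda>y. y u) -` A \<inter> space ?R | u A. 0 \<le> u \<and> u \<le> s \<and> A \<in> sets (borel_of X)}"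
      then obtain u A where S: "S = (\<lambda>y. y u) -` A \<inter> paths" "0 \<le> u" "u \<le> s" "A \<in> sets (borel_of X)" using spR by auto
      have "path_map -` S \<inter> space (NF s) = Y u -` A \<inter> space (NF s)"
        using path_map_paths unfolding S(1) by (auto simp: path_map_def space_NF)
      then show "path_map -` S \<inter> space (NF s) \<in> sets (NF s)" using measurable_sets[OF Y_NF_measurable[OF S(2,3)] S(4)] by simp
    qed
    have ysF: "(\<lambda>y. y s) \<in> ?F \<rightarrow>\<^sub>M borel_of X"
    proof (rule measurableI)
      show "y \<in> space ?F \<Longrightarrow> y s \<in> space (borel_of X)" for y using s by (simp add: spF paths_def)
      show "(\<lambda>y. y s) -` A \<inter> space ?F \<in> sets ?F" if "A \<in> sets (borel_of X)" for A
        unfolding spF unfolding natural_filtration_def sets_measure_of[OF gens] spR using s that by auto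
    qed
    have mm: "(\<lambda>x. measure (p t x) A) \<in> borel_measurable (borel_of X)"
      by (rule measurable_compose[OF kernel_subprob[OF t] measurable_measure_subprob_algebra[OF A]])
    have st: "0 \<le> s + t" using s t by simp
    have m1: "measure (p t x) A \<le> 1" if "x \<in> topspace X" for x
      using prob_space.prob_le_1[OF kernel_prob[OF t that]] .
    have iA: "(indicator A :: 'a \<Rightarrow> real) \<in> borel_measurable (borel_of X)" using A by simp
    have fm: "(\<lambda>y. indicator A (y (s + t)) :: real) \<in> borel_measurable path_space"
      by (rule measurable_compose[OF coordinate_measurable[OF st] iA])
    have gm: "(\<lambda>y. measure (p t (y s)) A) \<in> borel_measurable path_space"
      by (rule measurable_compose[OF coordinate_measurable[OF s] mm])
    show ?thesis
    proof (rule F.real_cond_exp_charact)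
      show "integrable ?R (\<lambda>y. indicator A (y (s + t)) :: real)"
        by (rule R.integrable_const_bound[where B = 1]) (use fm in auto)
      show "integrable ?R (\<lambda>y. measure (p t (y s)) A)"
        by (rule R.integrable_const_bound[where B = 1])
           (use gm m1 s in \<open>auto intro!: AE_I2 simp: space_path_space paths_def\<close>)
      show "(\<lambda>y. measure (p t (y s)) A) \<in> borel_measurable ?F" by (rule measurable_compose[OF ysF mm])
      fix S assume S: "S \<in> sets ?F"
      then have SR: "S \<in> sets path_space" using sub by (auto simp: subalgebra_def)
      have iS: "(indicator S :: _ \<Rightarrow> real) \<in> borel_measurable path_space" using SR by simp
      have Z: "(\<lambda>\<omega>. indicator S (path_map \<omega>) :: real) \<in> borel_measurable (NF s)"
        by (rule measurable_compose[OF pmF]) (use S in simp)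
      have iA\<mu>: "integrable \<mu> (indicator A :: _ \<Rightarrow> real)" using A sets_\<mu> by (auto intro!: integrable_real_indicator simp: less_top[symmetric])
      have "(\<integral>y\<in>S. indicator A (y (s + t)) \<partial>?R) = (\<integral>y. indicator S y * indicator A (y (s + t)) \<partial>?R :: real)"
        by (simp add: set_lebesgue_integral_def)
      also have "\<dots> = (\<integral>\<omega>. indicator S (path_map \<omega>) * indicator A (Y (s + t) \<omega>) \<partial>M :: real)"
        by (subst integral_distr[OF path_map_measurable]) (use iS fm in \<open>auto simp: path_map_def\<close>)
      also have "\<dots> = (\<integral>\<omega>. indicator S (path_map \<omega>) * (\<integral>y. indicator A y \<partial>p t (Y s \<omega>)) \<partial>M)"
        by (rule markov_integral[OF s t Z _ iA\<mu>, where B = 1]) (simp add: indicator_def)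
      also have "\<dots> = (\<integral>\<omega>. indicator S (path_map \<omega>) * measure (p t (path_map \<omega> s)) A \<partial>M)"
      proof (rule Bochner_Integration.integral_cong[OF refl])
        fix \<omega> assume "\<omega> \<in> space M"
        then have "A \<subseteq> space (p t (Y s \<omega>))" using sets.sets_into_space[OF A] kernel_space[OF t Y_topspace[OF s]] by simp
        then have "A \<inter> space (p t (Y s \<omega>)) = A" by auto
        then show "indicator S (path_map \<omega>) * (\<integral>y. indicator A y \<partial>p t (Y s \<omega>)) = indicator S (path_map \<omega>) * measure (p t (path_map \<omega> s)) A"
          by (simp add: path_map_def)
      qed
      also have "\<dots> = (\<integral>y. indicator S y * measure (p t (y s)) A \<partial>?R)"
        by (subst integral_distr[OF path_map_measurable]) (use iS gm in auto)
      finally show "(\<integral>y\<in>S. indicator A (y (s + t)) \<partial>?R) = (\<integral>y\<in>S. measure (p t (y s)) A \<partial>?R)"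
        by (simp add: set_lebesgue_integral_def)
    qed
  qed
  moreover have "distr ?R (borel_of X) (\<lambda>y. y 0) = \<mu>"
  proof -
    have "distr ?R (borel_of X) (\<lambda>y. y 0) = distr M (borel_of X) ((\<lambda>y. y 0) \<circ> path_map)"
      by (rule distr_distr[OF coordinate_measurable[OF order_refl] path_map_measurable])
    also have "(\<lambda>y. y 0) \<circ> path_map = Y 0" by (auto simp: path_map_def)
    finally show ?thesis using distr_Y_0 by simp
  qed
  ultimately show ?thesis
    unfolding markov_process_def using R.prob_space_axioms cR by (auto simp: space_path_space paths_def)
qed

text \<open>Almost sure convergence becomes mean-square convergence because the averages are
  bounded. The mean-square form is the one that bounds block sums later.\<close>

lemma time_average_L2:
  assumes g: "g \<in> Cb X"
    and path: "\<And>R :: (real \<Rightarrow> 'a) measure. markov_process X p \<mu> R (\<lambda>t y. y t) \<Longrightarrow>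
      AE y in R. ((\<lambda>T. 1 / T * (LINT t:{0..T}|lborel. g (y t))) \<longlongrightarrow> c) at_top"
  shows "((\<lambda>T. \<integral>\<omega>. (1 / T * occ T g \<omega> - c)\<^sup>2 \<partial>M) \<longlongrightarrow> 0) at_top"
proof -
  obtain B where B: "0 < B" "\<And>x. \<bar>g x\<bar> \<le> B" using Cb_bounded[OF g] by metis
  have gi: "integrable \<mu> g" by (rule integrable_bounded_borel_of[OF \<mu>.finite_measure_axioms sets_\<mu> Cb_measurable[OF g] B(2)])
  have [measurable]: "occ T g \<in> borel_measurable M" for T using occ_integrable[OF gi] by auto
  have "AE \<omega> in M. ((\<lambda>T. 1 / T * (LINT t:{0..T}|lborel. g (path_map \<omega> t))) \<longlongrightarrow> c) at_top"
    by (rule AE_distrD[OF path_map_measurable path[OF path_process]])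
  then have lim: "AE \<omega> in M. ((\<lambda>T. 1 / T * occ T g \<omega>) \<longlongrightarrow> c) at_top"
    by (simp add: path_map_def occ_def set_integral_left_endpoint(1))
  have "((\<lambda>T. \<integral>\<omega>. (1 / T * occ T g \<omega> - c)\<^sup>2 \<partial>M) \<longlongrightarrow> (\<integral>\<omega>. 0 \<partial>M)) at_top"
  proof (rule integral_dominated_convergence_at_top[where w = "\<lambda>_. (B + \<bar>c\<bar>)\<^sup>2"])
    show "AE \<omega> in M. ((\<lambda>T. (1 / T * occ T g \<omega> - c)\<^sup>2) \<longlongrightarrow> 0) at_top"
      using lim
    proof eventually_elim
      case (elim \<omega>)
      have "((\<lambda>T. (1 / T * occ T g \<omega> - c)\<^sup>2) \<longlongrightarrow> (c - c)\<^sup>2) at_top" by (intro tendsto_intros elim)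
      then show ?case by simp
    qed
    show "\<forall>\<^sub>F T in at_top. AE \<omega> in M. norm ((1 / T * occ T g \<omega> - c)\<^sup>2) \<le> (B + \<bar>c\<bar>)\<^sup>2"
      using eventually_gt_at_top[of 0]
    proof eventually_elim
      case (elim T)
      have "norm ((1 / T * occ T g \<omega> - c)\<^sup>2) \<le> (B + \<bar>c\<bar>)\<^sup>2" for \<omega>
      proof -
        have "\<bar>1 / T * occ T g \<omega>\<bar> \<le> B"
          using occ_bound[of T B g \<omega>] B elim by (simp add: abs_mult field_simps)
        then have "\<bar>1 / T * occ T g \<omega> - c\<bar> \<le> \<bar>B + \<bar>c\<bar>\<bar>" by linarith
        then have "\<bar>1 / T * occ T g \<omega> - c\<bar>\<^sup>2 \<le> \<bar>B + \<bar>c\<bar>\<bar>\<^sup>2" by (rule power_mono) simp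
        then show ?thesis by simp
      qed
      then show ?case by simp
    qed
  qed simp_all
  then show ?thesis by simp
qed

end

section \<open>A central limit theorem for additive functionals\<close>

lemma (in prob_space) integral_abs_square_le:
  fixes g :: "'a \<Rightarrow> real"
  assumes g: "g \<in> borel_measurable M" and g2: "integrable M (\<lambda>x. (g x)\<^sup>2)"
  shows "integrable M g" "(\<integral>x. \<bar>g x\<bar> \<partial>M)\<^sup>2 \<le> (\<integral>x. (g x)\<^sup>2 \<partial>M)"
proof -
  show gi: "integrable M g"
  proof (rule Bochner_Integration.integrable_bound[of M "\<lambda>x. 1 + (g x)\<^sup>2"])
    have "\<bar>g x\<bar> \<le> 1 + (g x)\<^sup>2" for x
    proof -
      have "0 \<le> (\<bar>g x\<bar> - 1)\<^sup>2" by simp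
      moreover have "(\<bar>g x\<bar> - 1)\<^sup>2 = (g x)\<^sup>2 + 1 - 2 * \<bar>g x\<bar>" by (simp add: power2_diff)
      ultimately show ?thesis using abs_ge_zero[of "g x"] by linarith
    qed
    then show "AE x in M. norm (g x) \<le> norm (1 + (g x)\<^sup>2)" by (intro AE_I2) (simp add: abs_of_nonneg)
  qed (use g g2 in auto)
  show "(\<integral>x. \<bar>g x\<bar> \<partial>M)\<^sup>2 \<le> (\<integral>x. (g x)\<^sup>2 \<partial>M)"
    \<comment> \<open>The inequality is nonnegativity of the variance of
      \<open>\<bar>g\<bar>\<close>.\<close>
    using variance_positive[of "\<lambda>x. \<bar>g x\<bar>"] variance_eq[of "\<lambda>x. \<bar>g x\<bar>"] gi g2 by simp
qed

lemma L2_mult_integrable: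
  assumes "f \<in> L2 \<mu>" "g \<in> L2 \<mu>" shows "integrable \<mu> (\<lambda>x. f x * g x)"
proof (rule Bochner_Integration.integrable_bound[of \<mu> "\<lambda>x. (f x)\<^sup>2 + (g x)\<^sup>2"])
  have "\<bar>f x * g x\<bar> \<le> (f x)\<^sup>2 + (g x)\<^sup>2" for x
  proof -
    have "0 \<le> (\<bar>f x\<bar> - \<bar>g x\<bar>)\<^sup>2" by simp
    moreover have "(\<bar>f x\<bar> - \<bar>g x\<bar>)\<^sup>2 = (f x)\<^sup>2 + (g x)\<^sup>2 - 2 * \<bar>f x * g x\<bar>" by (simp add: power2_diff abs_mult)
    ultimately show ?thesis using abs_ge_zero[of "f x * g x"] by linarith
  qed
  then show "AE x in \<mu>. norm (f x * g x) \<le> norm ((f x)\<^sup>2 + (g x)\<^sup>2)" by (intro AE_I2) simp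
qed (use assms in \<open>auto simp: L2_def\<close>)

text \<open>The constant depends on the real part only. In the applications the real part is
  deterministic and small, whereas the imaginary part contains the unbounded
  \<open>F\<close>.\<close>

lemma norm_exp_minus_1: "cmod (exp w - 1) \<le> exp \<bar>Re w\<bar> * cmod w"
  using Taylor_exp[of w 0] by simp

lemma norm_exp_minus_1_minus: "cmod (exp w - 1 - w) \<le> exp \<bar>Re w\<bar> * (cmod w)\<^sup>2"
  using Taylor_exp[of w 1] by (simp add: algebra_simps power2_eq_square)

lemma (in prob_space) bounded_factor:
  fixes Z :: "'a \<Rightarrow> complex" and g :: "'a \<Rightarrow> complex"
  assumes Z: "Z \<in> borel_measurable M" "\<And>\<omega>. cmod (Z \<omega>) \<le> B" and g: "integrable M g"
  shows "integrable M (\<lambda>\<omega>. Z \<omega> * g \<omega>)" "cmod (\<integral>\<omega>. Z \<omega> * g \<omega> \<partial>M) \<le> B * (\<integral>\<omega>. cmod (g \<omega>) \<partial>M)"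
proof -
  have B: "0 \<le> B" using order_trans[OF norm_ge_zero Z(2)] .
  show i: "integrable M (\<lambda>\<omega>. Z \<omega> * g \<omega>)"
  proof (rule Bochner_Integration.integrable_bound[of M "\<lambda>\<omega>. B * cmod (g \<omega>)"])
    show "AE \<omega> in M. norm (Z \<omega> * g \<omega>) \<le> norm (B * cmod (g \<omega>))"
      using B Z(2) by (intro AE_I2) (simp add: norm_mult mult_right_mono)
  qed (use Z g in auto)
  have "cmod (\<integral>\<omega>. Z \<omega> * g \<omega> \<partial>M) \<le> (\<integral>\<omega>. cmod (Z \<omega> * g \<omega>) \<partial>M)" by (rule integral_norm_bound)
  also have "\<dots> \<le> (\<integral>\<omega>. B * cmod (g \<omega>) \<partial>M)"
    by (intro integral_mono integrable_norm i integrable_mult_right g) (simp add: norm_mult mult_right_mono Z(2))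
  finally show "cmod (\<integral>\<omega>. Z \<omega> * g \<omega> \<partial>M) \<le> B * (\<integral>\<omega>. cmod (g \<omega>) \<partial>M)" by simp
qed

section \<open>Additive functionals of solutions of a Poisson equation\<close>

locale additive_functional = stationary_process X p \<mu> M Y
  for X :: "'a topology" and p \<mu> and M :: "'w measure" and Y +
  fixes F \<Phi> :: "'a \<Rightarrow> real"
  assumes poisson: "(\<Phi>, \<lambda>x. - F x) \<in> L2_generator X p \<mu>"
    and ergodic_L2: "\<And>g. g \<in> Cb X \<Longrightarrow> ((\<lambda>T. \<integral>\<omega>. (1 / T * occ T g \<omega> - (\<integral>x. g x \<partial>\<mu>))\<^sup>2 \<partial>M) \<longlongrightarrow> 0) at_top"
begin

text \<open>Half the limit variance. Its sign is settled only by \<open>s2_nonneg\<close>, after the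
  limit of the characteristic functions, so the bounds until then involve
  \<open>\<bar>l\<bar>\<close>.\<close>

definition "s2 = (\<integral>x. F x * \<Phi> x \<partial>\<mu>)"

lemma \<Phi>_L2: "\<Phi> \<in> L2 \<mu>" using poisson by (simp add: L2_generator_def)

lemma F_L2: "F \<in> L2 \<mu>"
proof -
  have "(\<lambda>x. - F x) \<in> L2 \<mu>" using poisson by (simp add: L2_generator_def)
  then have "(\<lambda>x. - F x) \<in> borel_measurable \<mu>" "integrable \<mu> (\<lambda>x. (F x)\<^sup>2)" by (auto simp: L2_def)
  then have "(\<lambda>x. - (- F x)) \<in> borel_measurable \<mu>" by measurable
  then show ?thesis using \<open>integrable \<mu> (\<lambda>x. (F x)\<^sup>2)\<close> by (simp add: L2_def)
qed

lemma F_integrable: "integrable \<mu> F" and \<Phi>_integrable: "integrable \<mu> \<Phi>"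
  using F_L2 \<Phi>_L2 by (auto intro: \<mu>.integral_abs_square_le(1) simp: L2_def)

lemma F\<Phi>_integrable: "integrable \<mu> (\<lambda>x. F x * \<Phi> x)"
  by (rule L2_mult_integrable[OF F_L2 \<Phi>_L2])

lemma P_integrable: assumes "0 \<le> t" "integrable \<mu> g" shows "integrable \<mu> (P t g)"
proof -
  have "integrable \<mu> (P t g) \<longleftrightarrow> integrable \<mu> (\<lambda>x. \<integral>y. g y \<partial>p t x)"
    by (rule Bochner_Integration.integrable_cong) (auto simp: space_\<mu> P_eq)
  then show ?thesis using kernel_L1(2)[OF assms] by simp
qed

text \<open>The mean-square generator statement is weakened to the mean, which suffices because this
  error is always multiplied by the bounded factor \<open>Uv\<close>.\<close>

lemma generator_L1:
  assumes e: "0 < e"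
  obtains d where "0 < d" "\<And>h. 0 < h \<Longrightarrow> h < d \<Longrightarrow> (\<integral>x. \<bar>P h \<Phi> x - \<Phi> x + h * F x\<bar> \<partial>\<mu>) \<le> h * e"
proof -
  have "((\<lambda>t. \<integral>\<^sup>+ x. ennreal (((P t \<Phi> x - \<Phi> x) / t - (- F x))\<^sup>2) \<partial>\<mu>) \<longlongrightarrow> 0) (at_right 0)"
    using poisson by (simp add: L2_generator_def)
  moreover have "0 < ennreal (e\<^sup>2)" using e by simp
  ultimately have "\<forall>\<^sub>F t in at_right 0. (\<integral>\<^sup>+ x. ennreal (((P t \<Phi> x - \<Phi> x) / t - (- F x))\<^sup>2) \<partial>\<mu>) < ennreal (e\<^sup>2)"
    by (rule order_tendstoD(2))
  then obtain d where d: "0 < d" "\<And>t. 0 < t \<Longrightarrow> t < d \<Longrightarrow> (\<integral>\<^sup>+ x. ennreal (((P t \<Phi> x - \<Phi> x) / t - (- F x))\<^sup>2) \<partial>\<mu>) < ennreal (e\<^sup>2)"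
    unfolding eventually_at_right_0 by blast
  show ?thesis
  proof (rule that[OF d(1)])
    fix h assume h: "0 < h" "h < d"
    define Q where "Q x = (P h \<Phi> x - \<Phi> x) / h + F x" for x
    have Qi: "integrable \<mu> Q" unfolding Q_def
      using P_integrable[OF less_imp_le[OF h(1)] \<Phi>_integrable] \<Phi>_integrable F_integrable by auto
    have nn: "(\<integral>\<^sup>+ x. ennreal ((Q x)\<^sup>2) \<partial>\<mu>) < ennreal (e\<^sup>2)" using d(2)[OF h] by (simp add: Q_def)
    have Q2: "integrable \<mu> (\<lambda>x. (Q x)\<^sup>2)"
      by (rule integrableI_bounded) (use Qi nn in \<open>auto intro: less_trans[OF _ ennreal_less_top]\<close>)
    have "ennreal (\<integral>x. (Q x)\<^sup>2 \<partial>\<mu>) = (\<integral>\<^sup>+ x. ennreal ((Q x)\<^sup>2) \<partial>\<mu>)"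
      by (rule nn_integral_eq_integral[symmetric, OF Q2]) simp
    then have "ennreal (\<integral>x. (Q x)\<^sup>2 \<partial>\<mu>) < ennreal (e\<^sup>2)" using nn by (rule ord_eq_less_trans)
    then have "(\<integral>x. (Q x)\<^sup>2 \<partial>\<mu>) < e\<^sup>2" by (subst (asm) ennreal_less_iff) auto
    then have "(\<integral>x. \<bar>Q x\<bar> \<partial>\<mu>)\<^sup>2 \<le> e\<^sup>2" using \<mu>.integral_abs_square_le(2)[of Q] Qi Q2 by auto
    then have "(\<integral>x. \<bar>Q x\<bar> \<partial>\<mu>) \<le> e" by (rule power2_le_imp_le) (use e in simp)
    moreover have "P h \<Phi> x - \<Phi> x + h * F x = h * Q x" for x using h by (simp add: Q_def field_simps)
    then have "(\<integral>x. \<bar>P h \<Phi> x - \<Phi> x + h * F x\<bar> \<partial>\<mu>) = h * (\<integral>x. \<bar>Q x\<bar> \<partial>\<mu>)"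
      using h by (simp add: abs_mult)
    ultimately show "(\<integral>x. \<bar>P h \<Phi> x - \<Phi> x + h * F x\<bar> \<partial>\<mu>) \<le> h * e" using h by simp
  qed
qed

lemma complex_markov:
  fixes Z :: "'w \<Rightarrow> complex"
  assumes s: "0 \<le> s" and t: "0 \<le> t" and Z: "Z \<in> borel_measurable (NF s)" "\<And>\<omega>. cmod (Z \<omega>) \<le> B"
    and g: "integrable \<mu> g"
  shows "(\<integral>\<omega>. Z \<omega> * complex_of_real (g (Y (s + t) \<omega>)) \<partial>M) = (\<integral>\<omega>. Z \<omega> * complex_of_real (P t g (Y s \<omega>)) \<partial>M)"
proof -
  have st: "0 \<le> s + t" using s t by simp
  have ZM: "Z \<in> borel_measurable M" by (rule measurable_from_subalg[OF NF_subalgebra Z(1)])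
  have i1: "integrable M (\<lambda>\<omega>. Z \<omega> * complex_of_real (g (Y (s + t) \<omega>)))"
    using integrable_Y[OF st g] by (intro bounded_factor(1)[OF ZM Z(2)]) auto
  have i2: "integrable M (\<lambda>\<omega>. Z \<omega> * complex_of_real (P t g (Y s \<omega>)))"
    using integrable_Y[OF s P_integrable[OF t g]] by (intro bounded_factor(1)[OF ZM Z(2)]) auto
  have B: "\<bar>Re (Z \<omega>)\<bar> \<le> B" "\<bar>Im (Z \<omega>)\<bar> \<le> B" for \<omega>
    using abs_Re_le_cmod[of "Z \<omega>"] abs_Im_le_cmod[of "Z \<omega>"] Z(2)[of \<omega>] by linarith+
  have R: "(\<lambda>\<omega>. Re (Z \<omega>)) \<in> borel_measurable (NF s)" "(\<lambda>\<omega>. Im (Z \<omega>)) \<in> borel_measurable (NF s)" using Z(1) by measurable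
  have PP: "(\<integral>\<omega>. f \<omega> * (\<integral>y. g y \<partial>p t (Y s \<omega>)) \<partial>M) = (\<integral>\<omega>. f \<omega> * P t g (Y s \<omega>) \<partial>M)" for f :: "'w \<Rightarrow> real"
    using Y_topspace[OF s] by (intro Bochner_Integration.integral_cong) (auto simp: P_eq)
  show ?thesis
    by (rule complex_eqI)
       (simp_all add: integral_Re[OF i1, symmetric] integral_Re[OF i2, symmetric] integral_Im[OF i1, symmetric]
         integral_Im[OF i2, symmetric] markov_integral[OF s t R(1) B(1) g] markov_integral[OF s t R(2) B(2) g] PP)
qed

text \<open>
  \<open>yv\<close> is the state on the grid of mesh \<open>h\<close>, taken at right endpoints (step \<open>k\<close> uses time
  \<open>(k + 1) h\<close>), \<open>Sv\<close> the Riemann sum of \<open>F\<close>, and \<open>Uv\<close> the discretised exponential; \<open>zv\<close> is the rate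
  of \<open>log Uv\<close>, and \<open>Rv\<close> the second-order remainder of one backward step.
\<close>

definition yv :: "real \<Rightarrow> nat \<Rightarrow> 'w \<Rightarrow> 'a" where "yv h k = Y (real (Suc k) * h)"

definition Sv :: "real \<Rightarrow> nat \<Rightarrow> 'w \<Rightarrow> real" where "Sv h k \<omega> = (\<Sum>j<k. h * F (yv h j \<omega>))"

definition Uv :: "real \<Rightarrow> real \<Rightarrow> real \<Rightarrow> nat \<Rightarrow> 'w \<Rightarrow> complex" where
  "Uv a l h k \<omega> = exp (Complex (l * h * real k) (a * Sv h k \<omega>))"

definition zv :: "real \<Rightarrow> real \<Rightarrow> 'a \<Rightarrow> complex" where "zv a l x = Complex l (a * F x)"

definition Rv :: "real \<Rightarrow> real \<Rightarrow> real \<Rightarrow> 'a \<Rightarrow> complex" where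
  "Rv a l h x = 1 - exp (- (of_real h * zv a l x)) - of_real h * zv a l x"

lemma yv_integrable: "0 \<le> h \<Longrightarrow> integrable \<mu> g \<Longrightarrow> integrable M (\<lambda>\<omega>. g (yv h k \<omega>))"
  for g :: "'a \<Rightarrow> 'b::{banach, second_countable_topology}"
  unfolding yv_def by (rule integrable_Y) auto

lemma yv_integral: "0 \<le> h \<Longrightarrow> g \<in> borel_measurable (borel_of X) \<Longrightarrow> (\<integral>\<omega>. g (yv h k \<omega>) \<partial>M) = (\<integral>x. g x \<partial>\<mu>)"
  for g :: "'a \<Rightarrow> 'b::{banach, second_countable_topology}"
  unfolding yv_def by (rule integral_Y) auto

lemma Uv_Suc: "Uv a l h (Suc k) \<omega> = Uv a l h k \<omega> * exp (of_real h * zv a l (yv h k \<omega>))"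
  unfolding Uv_def mult_exp_exp by (rule arg_cong[where f = exp]) (simp add: complex_eq_iff Sv_def zv_def algebra_simps)

lemma Uv_0: "Uv a l h 0 \<omega> = 1" by (simp add: Uv_def Sv_def complex_eq_iff flip: zero_complex.code)

lemma cmod_Uv: "cmod (Uv a l h k \<omega>) = exp (l * h * real k)" by (simp add: Uv_def)

lemma cmod_Uv_le:
  assumes "0 \<le> h" "k \<le> m" shows "cmod (Uv a l h k \<omega>) \<le> exp (\<bar>l\<bar> * (h * real m))"
proof -
  have "l * h * real k \<le> \<bar>l\<bar> * h * real k" using assms by (intro mult_right_mono) auto
  also have "\<dots> \<le> \<bar>l\<bar> * h * real m" using assms by (intro mult_left_mono) auto
  finally show ?thesis by (simp add: cmod_Uv mult.assoc)
qed

text \<open>After \<open>Suc k\<close> steps the sum uses states up to time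
  \<open>Suc k * h\<close>, which is the time of \<open>yv h k\<close>. So \<open>Uv (Suc k)\<close>
  is known exactly when the Markov step from \<open>yv h k\<close> to \<open>yv h (Suc k)\<close>
  begins.\<close>

lemma Sv_NF_measurable:
  assumes h: "0 \<le> h" shows "Sv h (Suc k) \<in> borel_measurable (NF (real (Suc k) * h))"
  unfolding Sv_def[abs_def]
proof (intro borel_measurable_sum borel_measurable_times borel_measurable_const)
  fix j assume "j \<in> {..<Suc k}"
  then have "real (Suc j) \<le> real (Suc k)" by simp
  then have "real (Suc j) * h \<le> real (Suc k) * h" using h by (rule mult_right_mono)
  then show "(\<lambda>\<omega>. F (yv h j \<omega>)) \<in> borel_measurable (NF (real (Suc k) * h))"
    unfolding yv_def using h
    by (intro measurable_compose[OF Y_NF_measurable integrable_imp_borel[OF F_integrable]]) auto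
qed

lemma Uv_NF_measurable:
  assumes h: "0 \<le> h" shows "Uv a l h (Suc k) \<in> borel_measurable (NF (real (Suc k) * h))"
proof -
  note [measurable] = Sv_NF_measurable[OF h, of k]
  show ?thesis unfolding Uv_def[abs_def] Complex_eq by measurable
qed

lemma Uv_measurable:
  assumes h: "0 \<le> h" shows "Uv a l h k \<in> borel_measurable M"
proof (cases k)
  case 0
  have "Uv a l h 0 = (\<lambda>_. 1)" using Uv_0 by auto
  then show ?thesis using 0 by simp
next
  case (Suc n)
  then show ?thesis using measurable_from_subalg[OF NF_subalgebra Uv_NF_measurable[OF h]] by simp
qed

lemma zv_integrable: "integrable \<mu> (zv a l)"
proof -
  have "integrable \<mu> (\<lambda>x. complex_of_real l + \<i> * complex_of_real (a * F x))"
    using F_integrable by (intro Bochner_Integration.integrable_add integrable_mult_right) auto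
  then show ?thesis by (simp add: zv_def[abs_def] Complex_eq)
qed

lemma zv_bound: "(\<integral>x. cmod (zv a l x) \<partial>\<mu>) \<le> \<bar>a\<bar> * (\<integral>x. \<bar>F x\<bar> \<partial>\<mu>) + \<bar>l\<bar>"
proof -
  have "(\<integral>x. cmod (zv a l x) \<partial>\<mu>) \<le> (\<integral>x. \<bar>a\<bar> * \<bar>F x\<bar> + \<bar>l\<bar> \<partial>\<mu>)"
  proof (intro integral_mono integrable_norm zv_integrable)
    show "integrable \<mu> (\<lambda>x. \<bar>a\<bar> * \<bar>F x\<bar> + \<bar>l\<bar>)" using F_integrable by simp
    show "cmod (zv a l x) \<le> \<bar>a\<bar> * \<bar>F x\<bar> + \<bar>l\<bar>" for x
      using cmod_le[of "zv a l x"] by (simp add: zv_def abs_mult)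
  qed
  also have "\<dots> = \<bar>a\<bar> * (\<integral>x. \<bar>F x\<bar> \<partial>\<mu>) + \<bar>l\<bar>" using F_integrable by (simp add: \<mu>.prob_space)
  finally show ?thesis .
qed

text \<open>Abel summation of the increments of \<open>\<Phi>\<close> along the grid turns the first-order term into a
  second-order one.\<close>

lemma discrete_identity:
  fixes U W R \<Phi>' D :: "nat \<Rightarrow> complex"
  assumes U: "\<And>k. U (Suc k) - U k = U (Suc k) * (W k + R k)" "U 0 = 1"
    and W: "\<And>k. W k = c + \<i> * \<alpha> * H k"
  shows "(\<Sum>k<m. U (Suc k) * (c + R k) + \<i> * \<alpha> * (U (Suc k) * (\<Phi>' k - \<Phi>' (Suc k) + D k)))
     = \<i> * \<alpha> * (\<Phi>' 0 - U m * \<Phi>' m)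
       + (\<Sum>k<m. U (Suc k) * (R k * (1 + \<i> * \<alpha> * \<Phi>' k)) + \<i> * \<alpha> * (U (Suc k) * D k)
           + U (Suc k) * (c - \<alpha>\<^sup>2 * (H k * \<Phi>' k)) + \<i> * \<alpha> * c * (U (Suc k) * \<Phi>' k))"
proof (induction m)
  case 0
  then show ?case using U(2) by simp
next
  case (Suc m)
  have i2: "\<i> * (\<i> * z) = - z" for z by (simp add: mult.assoc[symmetric])
  have Um: "U m = U (Suc m) - U (Suc m) * (c + \<i> * \<alpha> * H m + R m)" using U(1)[of m] W[of m] by (simp add: algebra_simps)
  show ?case unfolding sum.lessThan_Suc Suc.IH Um by (simp add: algebra_simps i2 power2_eq_square)
qed

text \<open>Both bounds are needed. The linear one stays integrable after multiplication by
  \<open>\<Phi>\<close> and serves as dominating function; the quadratic one, which need not be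
  integrable, gives pointwise decay after division by \<open>h\<close>.\<close>

lemma Rv_bounds:
  assumes h: "0 \<le> h" and L: "\<bar>l\<bar> * h \<le> L"
  shows "cmod (Rv a l h x) \<le> (1 + exp L) * (h * cmod (zv a l x))"
    and "cmod (Rv a l h x) \<le> exp L * (h * cmod (zv a l x))\<^sup>2"
proof -
  let ?w = "- (of_real h * zv a l x)"
  have re: "\<bar>Re ?w\<bar> \<le> L" using h L by (simp add: zv_def abs_mult mult.commute)
  have nw: "cmod ?w = h * cmod (zv a l x)" using h by (simp add: norm_mult)
  have "cmod (exp ?w - 1) \<le> exp L * cmod ?w"
    using norm_exp_minus_1[of ?w] re by (meson exp_le_cancel_iff mult_right_mono norm_ge_zero order_trans)
  moreover have R: "Rv a l h x = - (exp ?w - 1 - ?w)" by (simp add: Rv_def)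
  have "cmod (Rv a l h x) \<le> cmod (exp ?w - 1) + cmod ?w"
    using norm_triangle_ineq4[of "exp ?w - 1" ?w] unfolding R norm_minus_cancel[of "exp ?w - 1 - ?w"] .
  ultimately show "cmod (Rv a l h x) \<le> (1 + exp L) * (h * cmod (zv a l x))"
    unfolding nw by (simp add: algebra_simps)
  show "cmod (Rv a l h x) \<le> exp L * (h * cmod (zv a l x))\<^sup>2"
    unfolding R norm_minus_cancel[of "exp ?w - 1 - ?w"] nw[symmetric]
    using norm_exp_minus_1_minus[of ?w] re by (meson exp_le_cancel_iff mult_right_mono zero_le_power2 order_trans)
qed

lemma zv_measurable: "zv a l \<in> borel_measurable (borel_of X)"
  by (rule integrable_imp_borel[OF zv_integrable])

lemma Rv_measurable: "Rv a l h \<in> borel_measurable (borel_of X)"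
  unfolding Rv_def[abs_def] using zv_measurable by measurable

text \<open>The worst term is \<open>F \<Phi>\<close>, integrable as a product of two
  square-integrable functions.\<close>

lemma zv\<Phi>_integrable: "integrable \<mu> (\<lambda>x. cmod (zv a l x) * (1 + \<bar>a\<bar> * \<bar>\<Phi> x\<bar>))"
proof (rule Bochner_Integration.integrable_bound[of \<mu> "\<lambda>x. \<bar>a\<bar> * \<bar>F x\<bar> + \<bar>l\<bar> + \<bar>a\<bar> * (\<bar>a\<bar> * \<bar>F x * \<Phi> x\<bar> + \<bar>l\<bar> * \<bar>\<Phi> x\<bar>)"])
  show "integrable \<mu> (\<lambda>x. \<bar>a\<bar> * \<bar>F x\<bar> + \<bar>l\<bar> + \<bar>a\<bar> * (\<bar>a\<bar> * \<bar>F x * \<Phi> x\<bar> + \<bar>l\<bar> * \<bar>\<Phi> x\<bar>))"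
    using F_integrable F\<Phi>_integrable \<Phi>_integrable by auto
  show "(\<lambda>x. cmod (zv a l x) * (1 + \<bar>a\<bar> * \<bar>\<Phi> x\<bar>)) \<in> borel_measurable \<mu>"
    using zv_integrable[of a l] \<Phi>_integrable by auto
  have "cmod (zv a l x) * (1 + \<bar>a\<bar> * \<bar>\<Phi> x\<bar>) \<le> \<bar>a\<bar> * \<bar>F x\<bar> + \<bar>l\<bar> + \<bar>a\<bar> * (\<bar>a\<bar> * \<bar>F x * \<Phi> x\<bar> + \<bar>l\<bar> * \<bar>\<Phi> x\<bar>)" for x
  proof -
    have "cmod (zv a l x) \<le> \<bar>a\<bar> * \<bar>F x\<bar> + \<bar>l\<bar>" using cmod_le[of "zv a l x"] by (simp add: zv_def abs_mult)
    then have "cmod (zv a l x) * (1 + \<bar>a\<bar> * \<bar>\<Phi> x\<bar>) \<le> (\<bar>a\<bar> * \<bar>F x\<bar> + \<bar>l\<bar>) * (1 + \<bar>a\<bar> * \<bar>\<Phi> x\<bar>)"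
      by (intro mult_right_mono) auto
    then show ?thesis by (simp add: algebra_simps abs_mult)
  qed
  then show "AE x in \<mu>. norm (cmod (zv a l x) * (1 + \<bar>a\<bar> * \<bar>\<Phi> x\<bar>)) \<le> norm (\<bar>a\<bar> * \<bar>F x\<bar> + \<bar>l\<bar> + \<bar>a\<bar> * (\<bar>a\<bar> * \<bar>F x * \<Phi> x\<bar> + \<bar>l\<bar> * \<bar>\<Phi> x\<bar>))"
    by (intro AE_I2) (simp add: abs_of_nonneg)
qed

lemma Rv\<Phi>_integrable:
  assumes h: "0 \<le> h" shows "integrable \<mu> (\<lambda>x. cmod (Rv a l h x) * (1 + \<bar>a\<bar> * \<bar>\<Phi> x\<bar>))"
proof (rule Bochner_Integration.integrable_bound[OF integrable_mult_right[OF zv\<Phi>_integrable[of a l], of "(1 + exp (\<bar>l\<bar> * h)) * h"]])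
  show "(\<lambda>x. cmod (Rv a l h x) * (1 + \<bar>a\<bar> * \<bar>\<Phi> x\<bar>)) \<in> borel_measurable \<mu>"
    using Rv_measurable[of a l h] \<Phi>_integrable unfolding measurable_\<mu>[symmetric] by auto
  show "AE x in \<mu>. norm (cmod (Rv a l h x) * (1 + \<bar>a\<bar> * \<bar>\<Phi> x\<bar>)) \<le> norm ((1 + exp (\<bar>l\<bar> * h)) * h * (cmod (zv a l x) * (1 + \<bar>a\<bar> * \<bar>\<Phi> x\<bar>)))"
  proof (rule AE_I2)
    fix x
    have "cmod (Rv a l h x) * (1 + \<bar>a\<bar> * \<bar>\<Phi> x\<bar>) \<le> (1 + exp (\<bar>l\<bar> * h)) * (h * cmod (zv a l x)) * (1 + \<bar>a\<bar> * \<bar>\<Phi> x\<bar>)"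
      using Rv_bounds(1)[OF h order_refl, where l = l and a = a and x = x] by (intro mult_right_mono) auto
    then show "norm (cmod (Rv a l h x) * (1 + \<bar>a\<bar> * \<bar>\<Phi> x\<bar>)) \<le> norm ((1 + exp (\<bar>l\<bar> * h)) * h * (cmod (zv a l x) * (1 + \<bar>a\<bar> * \<bar>\<Phi> x\<bar>)))"
      using h by (simp add: abs_mult mult.assoc abs_of_nonneg add_nonneg_nonneg)
  qed
qed

lemma Uv_integrable: "0 \<le> h \<Longrightarrow> integrable M (Uv a l h k)"
  by (rule integrable_const_bound[where B = "exp (l * h * real k)"]) (auto simp: cmod_Uv intro: Uv_measurable)

lemma Uv_factor:
  assumes h: "0 \<le> h" and k: "k \<le> m" and g: "integrable \<mu> g"
  shows "integrable M (\<lambda>\<omega>. Uv a l h k \<omega> * g (yv h j \<omega>))"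
    "cmod (\<integral>\<omega>. Uv a l h k \<omega> * g (yv h j \<omega>) \<partial>M) \<le> exp (\<bar>l\<bar> * (h * real m)) * (\<integral>x. cmod (g x) \<partial>\<mu>)"
proof -
  note * = bounded_factor[OF Uv_measurable[OF h] cmod_Uv_le[OF h k] yv_integrable[OF h g]]
  show "integrable M (\<lambda>\<omega>. Uv a l h k \<omega> * g (yv h j \<omega>))" by (rule *(1))
  have gm: "g \<in> borel_measurable (borel_of X)" by (rule integrable_imp_borel[OF g])
  then have "(\<lambda>x. cmod (g x)) \<in> borel_measurable (borel_of X)" by measurable
  then show "cmod (\<integral>\<omega>. Uv a l h k \<omega> * g (yv h j \<omega>) \<partial>M) \<le> exp (\<bar>l\<bar> * (h * real m)) * (\<integral>x. cmod (g x) \<partial>\<mu>)"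
    using *(2)[of a l j] yv_integral[OF h, of "\<lambda>x. cmod (g x)" j] by simp
qed

lemma Uv_markov:
  assumes h: "0 \<le> h" and g: "integrable \<mu> g"
  shows "(\<integral>\<omega>. Uv a l h (Suc k) \<omega> * complex_of_real (g (yv h (Suc k) \<omega>)) \<partial>M) = (\<integral>\<omega>. Uv a l h (Suc k) \<omega> * complex_of_real (P h g (yv h k \<omega>)) \<partial>M)"
proof -
  have "0 \<le> real (Suc k) * h" using h by simp
  from complex_markov[OF this h Uv_NF_measurable[OF h] cmod_Uv_le[OF h order_refl] g]
  show ?thesis by (simp add: yv_def algebra_simps)
qed

text \<open>The terms on the right are, in order: the boundary terms of the summation by parts; the
  second-order remainder, occurring alone and multiplied by \<open>\<Phi>\<close>; the error in
  replacing \<open>-h F\<close> by \<open>P h \<Phi> - \<Phi>\<close>; the fluctuation of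
  \<open>F \<Phi>\<close> about its mean; and the product of the deterministic drift with
  \<open>\<Phi>\<close>. Only the fourth needs ergodicity.\<close>

lemma Uv_expectation:
  fixes a l h :: real and m :: nat
  assumes h: "0 < h" and l: "l = a\<^sup>2 * s2"
  defines "B \<equiv> exp (\<bar>l\<bar> * (h * real m))"
  shows "cmod ((\<integral>\<omega>. Uv a l h m \<omega> \<partial>M) - 1) \<le>
    \<bar>a\<bar> * ((1 + B) * (\<integral>x. \<bar>\<Phi> x\<bar> \<partial>\<mu>))
    + B * (real m * (\<integral>x. cmod (Rv a l h x) * (1 + \<bar>a\<bar> * \<bar>\<Phi> x\<bar>) \<partial>\<mu>))
    + \<bar>a\<bar> * (B * (real m * (\<integral>x. \<bar>P h \<Phi> x - \<Phi> x + h * F x\<bar> \<partial>\<mu>)))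
    + a\<^sup>2 * cmod (\<integral>\<omega>. (\<Sum>k<m. of_real h * (Uv a l h (Suc k) \<omega> * of_real (F (yv h k \<omega>) * \<Phi> (yv h k \<omega>) - s2))) \<partial>M)
    + \<bar>a\<bar> * \<bar>l\<bar> * (h * real m) * (B * (\<integral>x. \<bar>\<Phi> x\<bar> \<partial>\<mu>))"
proof -
  have h0: "0 \<le> h" using h by simp
  define D where "D x = P h \<Phi> x - \<Phi> x + h * F x" for x
  have Di: "integrable \<mu> D" unfolding D_def using P_integrable[OF h0 \<Phi>_integrable] \<Phi>_integrable F_integrable by auto
  have Gi: "integrable \<mu> (\<lambda>x. F x * \<Phi> x - s2)" using F\<Phi>_integrable by auto
  have ci: "integrable \<mu> (\<lambda>x. complex_of_real (g x))" if "integrable \<mu> g" for g using that by auto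
  define RP where "RP x = Rv a l h x * (1 + \<i> * of_real a * of_real (\<Phi> x))" for x
  have RPn: "cmod (RP x) \<le> cmod (Rv a l h x) * (1 + \<bar>a\<bar> * \<bar>\<Phi> x\<bar>)" for x
  proof -
    have "cmod (1 + \<i> * of_real a * of_real (\<Phi> x)) \<le> 1 + \<bar>a\<bar> * \<bar>\<Phi> x\<bar>"
      by (rule order_trans[OF norm_triangle_ineq]) (simp add: norm_mult)
    then show ?thesis unfolding RP_def norm_mult by (intro mult_left_mono) auto
  qed
  have RPi: "integrable \<mu> RP"
  proof (rule Bochner_Integration.integrable_bound[OF Rv\<Phi>_integrable[OF h0]])
    show "RP \<in> borel_measurable \<mu>" unfolding RP_def[abs_def]
      using Rv_measurable[of a l h] \<Phi>_integrable unfolding measurable_\<mu>[symmetric] by measurable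
    show "AE x in \<mu>. norm (RP x) \<le> norm (cmod (Rv a l h x) * (1 + \<bar>a\<bar> * \<bar>\<Phi> x\<bar>))"
      using RPn by (intro AE_I2) (auto intro: order_trans)
  qed
  have Rvi: "integrable \<mu> (Rv a l h)"
  proof (rule Bochner_Integration.integrable_bound[OF Rv\<Phi>_integrable[OF h0]])
    show "Rv a l h \<in> borel_measurable \<mu>" using Rv_measurable[of a l h] unfolding measurable_\<mu> .
    have "cmod (Rv a l h x) * 1 \<le> cmod (Rv a l h x) * (1 + \<bar>a\<bar> * \<bar>\<Phi> x\<bar>)" for x by (intro mult_left_mono) auto
    then show "AE x in \<mu>. norm (Rv a l h x) \<le> norm (cmod (Rv a l h x) * (1 + \<bar>a\<bar> * \<bar>\<Phi> x\<bar>))"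
      by (intro AE_I2) (auto intro: order_trans)
  qed
  let ?U = "\<lambda>k \<omega>. Uv a l h k \<omega>" and ?y = "\<lambda>k \<omega>. yv h k \<omega>"
  have UF: "integrable M (\<lambda>\<omega>. ?U k \<omega> * complex_of_real (g (?y j \<omega>)))" if "integrable \<mu> g" for g k j
    by (rule Uv_factor(1)[OF h0 order_refl ci[OF that]])
  have UFb: "cmod (\<integral>\<omega>. ?U k \<omega> * complex_of_real (g (?y j \<omega>)) \<partial>M) \<le> B * (\<integral>x. \<bar>g x\<bar> \<partial>\<mu>)" if "integrable \<mu> g" "k \<le> m" for g k j
    using Uv_factor(2)[OF h0 that(2) ci[OF that(1)]] by (simp add: B_def)
  have UR: "integrable M (\<lambda>\<omega>. ?U k \<omega> * Rv a l h (?y j \<omega>))" for k j by (rule Uv_factor(1)[OF h0 order_refl Rvi])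
  have URP: "integrable M (\<lambda>\<omega>. ?U k \<omega> * RP (?y j \<omega>))" for k j by (rule Uv_factor(1)[OF h0 order_refl RPi])
  define c where "c = complex_of_real (l * h)"
  define A1 where "A1 \<omega> = \<i> * of_real a * (of_real (\<Phi> (?y 0 \<omega>)) - ?U m \<omega> * of_real (\<Phi> (?y m \<omega>)))" for \<omega>
  define A2 where "A2 \<omega> = (\<Sum>k<m. ?U (Suc k) \<omega> * RP (?y k \<omega>))" for \<omega>
  define A3 where "A3 \<omega> = (\<Sum>k<m. \<i> * of_real a * (?U (Suc k) \<omega> * of_real (D (?y k \<omega>))))" for \<omega>
  define A4 where "A4 \<omega> = (\<Sum>k<m. of_real h * (?U (Suc k) \<omega> * of_real (F (?y k \<omega>) * \<Phi> (?y k \<omega>) - s2)))" for \<omega>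
  define A5 where "A5 \<omega> = (\<Sum>k<m. \<i> * of_real a * c * (?U (Suc k) \<omega> * of_real (\<Phi> (?y k \<omega>))))" for \<omega>
  \<comment> \<open>The increment is expressed through the later value \<open>?U (Suc k)\<close>,
    which already contains the factor of the state \<open>?y k\<close>. This explains the
    exponential of the negative argument in \<open>Rv\<close>.\<close>
  have step: "?U (Suc k) \<omega> - ?U k \<omega> = ?U (Suc k) \<omega> * (of_real h * zv a l (?y k \<omega>) + Rv a l h (?y k \<omega>))" for k \<omega>
  proof -
    have "?U (Suc k) \<omega> * exp (- (of_real h * zv a l (?y k \<omega>))) = ?U k \<omega>"
      unfolding Uv_Suc by (simp add: exp_minus)
    then show ?thesis by (simp add: Rv_def algebra_simps)
  qed
  have W: "of_real h * zv a l (?y k \<omega>) = c + \<i> * of_real a * of_real (h * F (?y k \<omega>))" for k \<omega>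
    by (simp add: zv_def c_def complex_eq_iff)
  let ?Q = "\<lambda>\<omega>. \<Sum>k<m. ?U (Suc k) \<omega> * (c + Rv a l h (?y k \<omega>)) + \<i> * of_real a * (?U (Suc k) \<omega> * (of_real (\<Phi> (?y k \<omega>)) - of_real (\<Phi> (?y (Suc k) \<omega>)) + of_real (D (?y k \<omega>))))"
  have id: "?Q \<omega> = A1 \<omega> + A2 \<omega> + A3 \<omega> - of_real (a\<^sup>2) * A4 \<omega> + A5 \<omega>" for \<omega>
  proof -
    have "?Q \<omega> = A1 \<omega> + (\<Sum>k<m. ?U (Suc k) \<omega> * (Rv a l h (?y k \<omega>) * (1 + \<i> * of_real a * of_real (\<Phi> (?y k \<omega>))))
      + \<i> * of_real a * (?U (Suc k) \<omega> * of_real (D (?y k \<omega>)))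
      + ?U (Suc k) \<omega> * (c - (of_real a)\<^sup>2 * (of_real (h * F (?y k \<omega>)) * of_real (\<Phi> (?y k \<omega>))))
      + \<i> * of_real a * c * (?U (Suc k) \<omega> * of_real (\<Phi> (?y k \<omega>))))"
      unfolding A1_def by (rule discrete_identity[OF step Uv_0 W])
    \<comment> \<open>Here \<open>l = a\<^sup>2 * s2\<close> enters: the drift \<open>c\<close>
      turns \<open>F \<Phi>\<close> into its centred version.\<close>
    also have "\<dots> = A1 \<omega> + (\<Sum>k<m. ?U (Suc k) \<omega> * RP (?y k \<omega>)
      + \<i> * of_real a * (?U (Suc k) \<omega> * of_real (D (?y k \<omega>)))
      + - of_real (a\<^sup>2) * (of_real h * (?U (Suc k) \<omega> * of_real (F (?y k \<omega>) * \<Phi> (?y k \<omega>) - s2)))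
      + \<i> * of_real a * c * (?U (Suc k) \<omega> * of_real (\<Phi> (?y k \<omega>))))"
      by (intro arg_cong2[where f = "(+)"] sum.cong refl) (simp_all add: RP_def c_def l algebra_simps)
    also have "\<dots> = A1 \<omega> + A2 \<omega> + A3 \<omega> - of_real (a\<^sup>2) * A4 \<omega> + A5 \<omega>"
      by (simp add: sum.distrib A2_def A3_def A4_def A5_def sum_distrib_left sum_negf sum_subtractf)
    finally show ?thesis .
  qed
  have "(\<integral>\<omega>. ?U m \<omega> \<partial>M) - 1 = (\<integral>\<omega>. ?U m \<omega> - 1 \<partial>M)"
    by (simp add: Bochner_Integration.integral_diff[OF Uv_integrable[OF h0]] prob_space)
  also have "\<dots> = (\<integral>\<omega>. (\<Sum>k<m. ?U (Suc k) \<omega> * (c + Rv a l h (?y k \<omega>)) + \<i> * of_real a * (?U (Suc k) \<omega> * of_real (h * F (?y k \<omega>)))) \<partial>M)"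
  proof (rule Bochner_Integration.integral_cong[OF refl])
    fix \<omega>
    have "?U m \<omega> - 1 = (\<Sum>k<m. ?U (Suc k) \<omega> - ?U k \<omega>)" using sum_lessThan_telescope[of "\<lambda>k. ?U k \<omega>" m] Uv_0 by simp
    also have "\<dots> = (\<Sum>k<m. ?U (Suc k) \<omega> * (c + Rv a l h (?y k \<omega>)) + \<i> * of_real a * (?U (Suc k) \<omega> * of_real (h * F (?y k \<omega>))))"
      unfolding step W by (intro sum.cong refl) (simp add: algebra_simps)
    finally show "?U m \<omega> - 1 = (\<Sum>k<m. ?U (Suc k) \<omega> * (c + Rv a l h (?y k \<omega>)) + \<i> * of_real a * (?U (Suc k) \<omega> * of_real (h * F (?y k \<omega>))))" .
  qed
  also have "\<dots> = (\<Sum>k<m. (\<integral>\<omega>. ?U (Suc k) \<omega> * (c + Rv a l h (?y k \<omega>)) \<partial>M) + \<i> * of_real a * (\<integral>\<omega>. ?U (Suc k) \<omega> * of_real (h * F (?y k \<omega>)) \<partial>M))"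
    using UR Uv_integrable[OF h0] UF[OF integrable_mult_right[OF F_integrable]]
    by (subst Bochner_Integration.integral_sum) (auto simp: distrib_left)
  \<comment> \<open>The identity \<open>h F = \<Phi> - P h \<Phi> + D\<close> is inserted, and under
    the expectation the Markov property turns \<open>P h \<Phi>\<close> at the present state into
    \<open>\<Phi>\<close> at the next one. The two sums agree only in expectation.\<close>
  also have "\<dots> = (\<Sum>k<m. (\<integral>\<omega>. ?U (Suc k) \<omega> * (c + Rv a l h (?y k \<omega>)) \<partial>M) + \<i> * of_real a *
     (\<integral>\<omega>. ?U (Suc k) \<omega> * (of_real (\<Phi> (?y k \<omega>)) - of_real (\<Phi> (?y (Suc k) \<omega>)) + of_real (D (?y k \<omega>))) \<partial>M))"
  proof (intro sum.cong refl arg_cong2[where f = "(+)"] arg_cong2[where f = "(*)"])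
    fix k
    have "(\<integral>\<omega>. ?U (Suc k) \<omega> * of_real (h * F (?y k \<omega>)) \<partial>M) =
      (\<integral>\<omega>. (?U (Suc k) \<omega> * of_real (\<Phi> (?y k \<omega>)) - ?U (Suc k) \<omega> * of_real (P h \<Phi> (?y k \<omega>))) + ?U (Suc k) \<omega> * of_real (D (?y k \<omega>)) \<partial>M)"
      by (intro Bochner_Integration.integral_cong refl) (simp add: D_def algebra_simps)
    also have "\<dots> = ((\<integral>\<omega>. ?U (Suc k) \<omega> * of_real (\<Phi> (?y k \<omega>)) \<partial>M) - (\<integral>\<omega>. ?U (Suc k) \<omega> * of_real (P h \<Phi> (?y k \<omega>)) \<partial>M)) + (\<integral>\<omega>. ?U (Suc k) \<omega> * of_real (D (?y k \<omega>)) \<partial>M)"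
      using UF[OF \<Phi>_integrable] UF[OF P_integrable[OF h0 \<Phi>_integrable]] UF[OF Di] by simp
    also have "\<dots> = ((\<integral>\<omega>. ?U (Suc k) \<omega> * of_real (\<Phi> (?y k \<omega>)) \<partial>M) - (\<integral>\<omega>. ?U (Suc k) \<omega> * of_real (\<Phi> (?y (Suc k) \<omega>)) \<partial>M)) + (\<integral>\<omega>. ?U (Suc k) \<omega> * of_real (D (?y k \<omega>)) \<partial>M)"
      unfolding Uv_markov[OF h0 \<Phi>_integrable] ..
    also have "\<dots> = (\<integral>\<omega>. ?U (Suc k) \<omega> * (of_real (\<Phi> (?y k \<omega>)) - of_real (\<Phi> (?y (Suc k) \<omega>)) + of_real (D (?y k \<omega>))) \<partial>M)"
      unfolding distrib_left right_diff_distrib using UF[OF \<Phi>_integrable] UF[OF Di] by simp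
    finally show "(\<integral>\<omega>. ?U (Suc k) \<omega> * of_real (h * F (?y k \<omega>)) \<partial>M) = (\<integral>\<omega>. ?U (Suc k) \<omega> * (of_real (\<Phi> (?y k \<omega>)) - of_real (\<Phi> (?y (Suc k) \<omega>)) + of_real (D (?y k \<omega>))) \<partial>M)" .
  qed
  also have "\<dots> = (\<integral>\<omega>. ?Q \<omega> \<partial>M)"
    using UR Uv_integrable[OF h0] UF[OF \<Phi>_integrable] UF[OF Di]
    by (subst Bochner_Integration.integral_sum) (auto simp: distrib_left right_diff_distrib)
  also have "\<dots> = (\<integral>\<omega>. A1 \<omega> + A2 \<omega> + A3 \<omega> - of_real (a\<^sup>2) * A4 \<omega> + A5 \<omega> \<partial>M)" unfolding id ..
  finally have main: "(\<integral>\<omega>. ?U m \<omega> \<partial>M) - 1 = (\<integral>\<omega>. A1 \<omega> + A2 \<omega> + A3 \<omega> - of_real (a\<^sup>2) * A4 \<omega> + A5 \<omega> \<partial>M)" .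
  have y\<Phi>: "integrable M (\<lambda>\<omega>. complex_of_real (\<Phi> (?y k \<omega>)))" for k using yv_integrable[OF h0 ci[OF \<Phi>_integrable]] .
  have iA: "integrable M A1" "integrable M A2" "integrable M A3" "integrable M A4" "integrable M A5"
    unfolding A1_def[abs_def] A2_def[abs_def] A3_def[abs_def] A4_def[abs_def] A5_def[abs_def]
    by (intro integrable_mult_right Bochner_Integration.integrable_diff Bochner_Integration.integrable_sum y\<Phi> UF[OF \<Phi>_integrable] URP UF[OF Di] UF[OF Gi])+
  have "(\<integral>\<omega>. ?U m \<omega> \<partial>M) - 1 = (\<integral>\<omega>. A1 \<omega> \<partial>M) + (\<integral>\<omega>. A2 \<omega> \<partial>M) + (\<integral>\<omega>. A3 \<omega> \<partial>M) - of_real (a\<^sup>2) * (\<integral>\<omega>. A4 \<omega> \<partial>M) + (\<integral>\<omega>. A5 \<omega> \<partial>M)"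
    unfolding main using iA by simp
  then have "cmod ((\<integral>\<omega>. ?U m \<omega> \<partial>M) - 1) \<le> cmod (\<integral>\<omega>. A1 \<omega> \<partial>M) + cmod (\<integral>\<omega>. A2 \<omega> \<partial>M) + cmod (\<integral>\<omega>. A3 \<omega> \<partial>M) + cmod (of_real (a\<^sup>2) * (\<integral>\<omega>. A4 \<omega> \<partial>M)) + cmod (\<integral>\<omega>. A5 \<omega> \<partial>M)"
    by (simp only:) (intro order_trans[OF norm_triangle_ineq] order_trans[OF norm_triangle_ineq4] add_mono order_refl)
  moreover have "cmod (\<integral>\<omega>. A1 \<omega> \<partial>M) \<le> \<bar>a\<bar> * ((1 + B) * (\<integral>x. \<bar>\<Phi> x\<bar> \<partial>\<mu>))"
  proof -
    have "(\<integral>\<omega>. A1 \<omega> \<partial>M) = \<i> * of_real a * ((\<integral>\<omega>. of_real (\<Phi> (?y 0 \<omega>)) \<partial>M) - (\<integral>\<omega>. ?U m \<omega> * of_real (\<Phi> (?y m \<omega>)) \<partial>M))"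
      unfolding A1_def using y\<Phi> UF[OF \<Phi>_integrable] by simp
    moreover have "cmod ((\<integral>\<omega>. of_real (\<Phi> (?y 0 \<omega>)) \<partial>M) - (\<integral>\<omega>. ?U m \<omega> * of_real (\<Phi> (?y m \<omega>)) \<partial>M)) \<le> (\<integral>x. \<bar>\<Phi> x\<bar> \<partial>\<mu>) + B * (\<integral>x. \<bar>\<Phi> x\<bar> \<partial>\<mu>)"
    proof (rule order_trans[OF norm_triangle_ineq4 add_mono])
      show "cmod (\<integral>\<omega>. of_real (\<Phi> (?y 0 \<omega>)) \<partial>M) \<le> (\<integral>x. \<bar>\<Phi> x\<bar> \<partial>\<mu>)"
        using integral_norm_bound[of M "\<lambda>\<omega>. \<Phi> (?y 0 \<omega>)"] yv_integral[OF h0, of "\<lambda>x. \<bar>\<Phi> x\<bar>" 0] integrable_imp_borel[OF \<Phi>_integrable] by simp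
    qed (rule UFb[OF \<Phi>_integrable order_refl])
    ultimately show ?thesis by (simp add: norm_mult distrib_right mult_left_mono)
  qed
  moreover have "cmod (\<integral>\<omega>. A2 \<omega> \<partial>M) \<le> B * (real m * (\<integral>x. cmod (Rv a l h x) * (1 + \<bar>a\<bar> * \<bar>\<Phi> x\<bar>) \<partial>\<mu>))"
  proof -
    have "(\<integral>x. cmod (RP x) \<partial>\<mu>) \<le> (\<integral>x. cmod (Rv a l h x) * (1 + \<bar>a\<bar> * \<bar>\<Phi> x\<bar>) \<partial>\<mu>)"
      by (intro integral_mono integrable_norm RPi Rv\<Phi>_integrable[OF h0] RPn)
    then have "cmod (\<integral>\<omega>. ?U (Suc k) \<omega> * RP (?y k \<omega>) \<partial>M) \<le> B * (\<integral>x. cmod (Rv a l h x) * (1 + \<bar>a\<bar> * \<bar>\<Phi> x\<bar>) \<partial>\<mu>)" if "k < m" for k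
      using Uv_factor(2)[OF h0 Suc_leI[OF that] RPi, of a l k] unfolding B_def[symmetric]
      by (elim order_trans) (simp add: B_def)
    then have "cmod (\<Sum>k<m. \<integral>\<omega>. ?U (Suc k) \<omega> * RP (?y k \<omega>) \<partial>M) \<le> (\<Sum>k<m. B * (\<integral>x. cmod (Rv a l h x) * (1 + \<bar>a\<bar> * \<bar>\<Phi> x\<bar>) \<partial>\<mu>))"
      by (intro sum_norm_le) auto
    moreover have "(\<integral>\<omega>. A2 \<omega> \<partial>M) = (\<Sum>k<m. \<integral>\<omega>. ?U (Suc k) \<omega> * RP (?y k \<omega>) \<partial>M)"
      unfolding A2_def using URP by (intro Bochner_Integration.integral_sum) auto
    ultimately show ?thesis by (simp add: ac_simps)
  qed
  moreover have "cmod (\<integral>\<omega>. A3 \<omega> \<partial>M) \<le> \<bar>a\<bar> * (B * (real m * (\<integral>x. \<bar>D x\<bar> \<partial>\<mu>)))"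
  proof -
    have "(\<integral>\<omega>. A3 \<omega> \<partial>M) = (\<Sum>k<m. \<i> * of_real a * (\<integral>\<omega>. ?U (Suc k) \<omega> * of_real (D (?y k \<omega>)) \<partial>M))"
      unfolding A3_def using UF[OF Di] by (subst Bochner_Integration.integral_sum) auto
    moreover have "cmod (\<Sum>k<m. \<i> * of_real a * (\<integral>\<omega>. ?U (Suc k) \<omega> * of_real (D (?y k \<omega>)) \<partial>M)) \<le> (\<Sum>k<m. \<bar>a\<bar> * (B * (\<integral>x. \<bar>D x\<bar> \<partial>\<mu>)))"
      using UFb[OF Di] by (intro sum_norm_le) (auto simp: norm_mult intro!: mult_left_mono)
    ultimately show ?thesis by (simp add: ac_simps)
  qed
  moreover have "cmod (\<integral>\<omega>. A5 \<omega> \<partial>M) \<le> \<bar>a\<bar> * \<bar>l\<bar> * (h * real m) * (B * (\<integral>x. \<bar>\<Phi> x\<bar> \<partial>\<mu>))"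
  proof -
    have "(\<integral>\<omega>. A5 \<omega> \<partial>M) = (\<Sum>k<m. \<i> * of_real a * c * (\<integral>\<omega>. ?U (Suc k) \<omega> * of_real (\<Phi> (?y k \<omega>)) \<partial>M))"
      unfolding A5_def using UF[OF \<Phi>_integrable] by (subst Bochner_Integration.integral_sum) auto
    moreover have "cmod (\<Sum>k<m. \<i> * of_real a * c * (\<integral>\<omega>. ?U (Suc k) \<omega> * of_real (\<Phi> (?y k \<omega>)) \<partial>M)) \<le> (\<Sum>k<m. \<bar>a\<bar> * (\<bar>l\<bar> * h) * (B * (\<integral>x. \<bar>\<Phi> x\<bar> \<partial>\<mu>)))"
      using UFb[OF \<Phi>_integrable] h by (intro sum_norm_le) (auto simp: norm_mult c_def abs_mult intro!: mult_left_mono)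
    ultimately show ?thesis by (simp add: ac_simps)
  qed
  moreover have "cmod (of_real (a\<^sup>2) * (\<integral>\<omega>. A4 \<omega> \<partial>M)) = a\<^sup>2 * cmod (\<integral>\<omega>. A4 \<omega> \<partial>M)" by (simp add: norm_mult norm_power)
  ultimately show ?thesis unfolding A4_def D_def by linarith
qed

section \<open>Averaging over blocks\<close>

lemma bounded_integrable:
  assumes "\<gamma> \<in> Bb X" shows "integrable \<mu> \<gamma>"
proof -
  obtain C where "\<And>x. \<bar>\<gamma> x\<bar> \<le> C" using Bb_bounded[OF assms] by metis
  then show ?thesis
    using assms by (intro integrable_bounded_borel_of[OF \<mu>.finite_measure_axioms sets_\<mu>]) (auto simp: Bb_def)
qed

lemma bounded_product_integrable:
  assumes \<gamma>: "\<gamma> \<in> Bb X" and h: "0 \<le> h"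
  shows "integrable M (\<lambda>\<omega>. \<gamma> (yv h i \<omega>) * \<gamma> (yv h j \<omega>))"
proof -
  obtain C where C: "\<And>x. \<bar>\<gamma> x\<bar> \<le> C" using Bb_bounded[OF \<gamma>] by metis
  note * = yv_integrable[OF h bounded_integrable[OF \<gamma>]]
  show ?thesis by (rule integrable_bounded_mult[OF * borel_measurable_integrable[OF *] C])
qed

text \<open>By \<open>two_time\<close> a correlation depends only on the difference of the
  indices.\<close>

lemma correlation_shift:
  assumes \<gamma>: "\<gamma> \<in> Bb X" and h: "0 \<le> h"
  shows "(\<integral>\<omega>. \<gamma> (yv h (k + i) \<omega>) * \<gamma> (yv h (k + j) \<omega>) \<partial>M) = (\<integral>\<omega>. \<gamma> (yv h i \<omega>) * \<gamma> (yv h j \<omega>) \<partial>M)"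
proof -
  have *: "(\<integral>\<omega>. \<gamma> (yv h i \<omega>) * \<gamma> (yv h (i + d) \<omega>) \<partial>M) = (\<integral>x. \<gamma> x * P (real d * h) \<gamma> x \<partial>\<mu>)" for i d
  proof -
    have "0 \<le> real (Suc i) * h" "0 \<le> real d * h" using h by auto
    from two_time[OF this \<gamma>] show ?thesis by (simp add: yv_def algebra_simps)
  qed
  have le: "(\<integral>\<omega>. \<gamma> (yv h (k + i) \<omega>) * \<gamma> (yv h (k + j) \<omega>) \<partial>M) = (\<integral>\<omega>. \<gamma> (yv h i \<omega>) * \<gamma> (yv h j \<omega>) \<partial>M)"
    if "i \<le> j" for i j
    using *[of "k + i" "j - i"] *[of i "j - i"] that by simp
  show ?thesis using le[of i j] le[of j i] by (cases "i \<le> j") (auto simp: mult.commute)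
qed

text \<open>Expanding the square leaves two-time correlations only, so all blocks have the same
  second moment without an appeal to shift invariance of the whole path law.\<close>

lemma block_second_moment:
  assumes \<gamma>: "\<gamma> \<in> Bb X" and h: "0 \<le> h"
  shows "integrable M (\<lambda>\<omega>. (\<Sum>i<r. h * \<gamma> (yv h (k + i) \<omega>))\<^sup>2)"
    and "(\<integral>\<omega>. (\<Sum>i<r. h * \<gamma> (yv h (k + i) \<omega>))\<^sup>2 \<partial>M) = (\<integral>\<omega>. (\<Sum>i<r. h * \<gamma> (yv h i \<omega>))\<^sup>2 \<partial>M)"
proof -
  have eq: "(\<Sum>i<r. h * \<gamma> (yv h (k + i) \<omega>))\<^sup>2 = (\<Sum>i<r. \<Sum>j<r. h * h * (\<gamma> (yv h (k + i) \<omega>) * \<gamma> (yv h (k + j) \<omega>)))" for k \<omega>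
    unfolding power2_eq_square sum_product by (intro sum.cong refl) (simp add: ac_simps)
  have i: "integrable M (\<lambda>\<omega>. h * h * (\<gamma> (yv h (k + i) \<omega>) * \<gamma> (yv h (k + j) \<omega>)))" for k i j
    by (intro integrable_mult_right bounded_product_integrable[OF \<gamma> h])
  have I: "(\<integral>\<omega>. (\<Sum>i<r. h * \<gamma> (yv h (k + i) \<omega>))\<^sup>2 \<partial>M) = (\<Sum>i<r. \<Sum>j<r. h * h * (\<integral>\<omega>. \<gamma> (yv h i \<omega>) * \<gamma> (yv h j \<omega>) \<partial>M))" for k
    unfolding eq using i[of k] by (simp add: Bochner_Integration.integral_sum Bochner_Integration.integrable_sum correlation_shift[OF \<gamma> h])
  show "integrable M (\<lambda>\<omega>. (\<Sum>i<r. h * \<gamma> (yv h (k + i) \<omega>))\<^sup>2)"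
    unfolding eq by (intro Bochner_Integration.integrable_sum i)
  show "(\<integral>\<omega>. (\<Sum>i<r. h * \<gamma> (yv h (k + i) \<omega>))\<^sup>2 \<partial>M) = (\<integral>\<omega>. (\<Sum>i<r. h * \<gamma> (yv h i \<omega>))\<^sup>2 \<partial>M)"
    using I[of k] I[of 0] by simp
qed

text \<open>Each step changes \<open>Uv\<close> by its value times an exponential increment. One
  exponential factor bounds the value, the other comes from the Taylor bound, hence the square. The
  mean of \<open>zv\<close> is of order \<open>\<bar>a\<bar>\<close>, so \<open>Uv\<close> is nearly
  constant on a block of fixed duration.\<close>

lemma Uv_increment:
  assumes h: "0 \<le> h" and m: "k + i \<le> m"
  shows "(\<integral>\<omega>. cmod (Uv a l h (k + i) \<omega> - Uv a l h k \<omega>) \<partial>M)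
    \<le> real i * ((exp (\<bar>l\<bar> * (h * real m)))\<^sup>2 * (h * (\<integral>x. cmod (zv a l x) \<partial>\<mu>)))"
  using m
proof (induction i)
  case (Suc i)
  let ?B = "exp (\<bar>l\<bar> * (h * real m))" and ?U = "Uv a l h"
  note iU = Uv_integrable[OF h]
  have zi: "integrable M (\<lambda>\<omega>. cmod (zv a l (yv h (k + i) \<omega>)))"
    by (rule integrable_norm[OF yv_integrable[OF h zv_integrable]])
  have one: "cmod (?U (Suc (k + i)) \<omega> - ?U (k + i) \<omega>) \<le> ?B\<^sup>2 * (h * cmod (zv a l (yv h (k + i) \<omega>)))" for \<omega>
  proof -
    let ?w = "of_real h * zv a l (yv h (k + i) \<omega>)"
    have "?U (Suc (k + i)) \<omega> - ?U (k + i) \<omega> = ?U (k + i) \<omega> * (exp ?w - 1)" by (simp add: Uv_Suc algebra_simps)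
    moreover have "cmod (?U (k + i) \<omega>) \<le> ?B" by (rule cmod_Uv_le[OF h]) (use Suc.prems in simp)
    moreover have "cmod (exp ?w - 1) \<le> ?B * cmod ?w"
    proof -
      have "1 \<le> real m" using Suc.prems by simp
      then have "h * 1 \<le> h * real m" using h by (intro mult_left_mono) auto
      then have "\<bar>l\<bar> * h \<le> \<bar>l\<bar> * (h * real m)" by (intro mult_left_mono) auto
      moreover have "\<bar>Re ?w\<bar> = \<bar>l\<bar> * h" using h by (simp add: zv_def abs_mult)
      ultimately have "exp \<bar>Re ?w\<bar> * cmod ?w \<le> ?B * cmod ?w" by (intro mult_right_mono) auto
      then show ?thesis using norm_exp_minus_1[of ?w] by linarith
    qed
    ultimately have "cmod (?U (Suc (k + i)) \<omega> - ?U (k + i) \<omega>) \<le> ?B * (?B * cmod ?w)"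
      by (simp only: norm_mult) (intro mult_mono, auto)
    then show ?thesis using h by (simp add: norm_mult power2_eq_square mult.assoc)
  qed
  have "(\<integral>\<omega>. cmod (?U (k + Suc i) \<omega> - ?U k \<omega>) \<partial>M) \<le> (\<integral>\<omega>. cmod (?U (k + i) \<omega> - ?U k \<omega>) + ?B\<^sup>2 * (h * cmod (zv a l (yv h (k + i) \<omega>))) \<partial>M)"
  proof (intro integral_mono Bochner_Integration.integrable_add integrable_norm Bochner_Integration.integrable_diff iU integrable_mult_right zi yv_integrable[OF h zv_integrable])
    fix \<omega>
    have "cmod (?U (k + Suc i) \<omega> - ?U k \<omega>) \<le> cmod (?U (k + i) \<omega> - ?U k \<omega>) + cmod (?U (Suc (k + i)) \<omega> - ?U (k + i) \<omega>)"
      using norm_triangle_ineq[of "?U (k + i) \<omega> - ?U k \<omega>" "?U (Suc (k + i)) \<omega> - ?U (k + i) \<omega>"] by simp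
    then show "cmod (?U (k + Suc i) \<omega> - ?U k \<omega>) \<le> cmod (?U (k + i) \<omega> - ?U k \<omega>) + ?B\<^sup>2 * (h * cmod (zv a l (yv h (k + i) \<omega>)))"
      using one[of \<omega>] by linarith
  qed
  also have "\<dots> = (\<integral>\<omega>. cmod (?U (k + i) \<omega> - ?U k \<omega>) \<partial>M) + ?B\<^sup>2 * (h * (\<integral>\<omega>. cmod (zv a l (yv h (k + i) \<omega>)) \<partial>M))"
    using iU zi by simp
  also have "(\<integral>\<omega>. cmod (zv a l (yv h (k + i) \<omega>)) \<partial>M) = (\<integral>x. cmod (zv a l x) \<partial>\<mu>)"
    by (rule yv_integral[OF h]) (use zv_measurable in measurable)
  finally show ?case using Suc by (simp add: algebra_simps)
qed simp

lemma block_estimate: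
  fixes a l h :: real and N r :: nat
  assumes h: "0 \<le> h" and \<gamma>: "\<gamma> \<in> Bb X" "\<And>x. \<bar>\<gamma> x\<bar> \<le> C"
  defines "B \<equiv> exp (\<bar>l\<bar> * (h * real (N * r)))" and "V \<equiv> (\<integral>\<omega>. (\<Sum>i<r. h * \<gamma> (yv h i \<omega>))\<^sup>2 \<partial>M)"
  shows "cmod (\<integral>\<omega>. (\<Sum>k<N * r. of_real h * (Uv a l h (Suc k) \<omega> * of_real (\<gamma> (yv h k \<omega>)))) \<partial>M)
    \<le> real N * (B * sqrt V + C * B\<^sup>2 * (\<integral>x. cmod (zv a l x) \<partial>\<mu>) * (real r * h)\<^sup>2)"
proof -
  let ?U = "Uv a l h" and ?\<zeta> = "\<integral>x. cmod (zv a l x) \<partial>\<mu>"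
  have C0: "0 \<le> C" using order_trans[OF abs_ge_zero \<gamma>(2)] .
  have z0: "0 \<le> ?\<zeta>" by simp
  have ci: "integrable \<mu> (\<lambda>x. complex_of_real (\<gamma> x))" using bounded_integrable[OF \<gamma>(1)] by auto
  note UF = Uv_factor(1)[OF h order_refl ci]
  have yi: "integrable M (\<lambda>\<omega>. \<gamma> (yv h k \<omega>))" for k by (rule yv_integrable[OF h bounded_integrable[OF \<gamma>(1)]])
  have block: "cmod (\<Sum>i<r. of_real h * (\<integral>\<omega>. ?U (Suc (i + j * r)) \<omega> * of_real (\<gamma> (yv h (i + j * r) \<omega>)) \<partial>M))
      \<le> B * sqrt V + C * B\<^sup>2 * ?\<zeta> * (real r * h)\<^sup>2" if j: "j < N" for j
  proof -
    define q where "q = j * r"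
    have qr: "q + r \<le> N * r"
    proof -
      have "Suc j * r \<le> N * r" using j by (intro mult_right_mono) auto
      then show ?thesis by (simp add: q_def)
    qed
    define S where "S \<omega> = (\<Sum>i<r. h * \<gamma> (yv h (q + i) \<omega>))" for \<omega>
    have Si: "integrable M S" unfolding S_def[abs_def] by (intro Bochner_Integration.integrable_sum integrable_mult_right yi)
    have Sm: "(\<integral>\<omega>. \<bar>S \<omega>\<bar> \<partial>M) \<le> sqrt V"
      using integral_abs_square_le(2)[OF borel_measurable_integrable[OF Si]] block_second_moment[OF \<gamma>(1) h, where r = r and k = q]
      by (intro real_le_rsqrt) (simp add: S_def[abs_def] V_def)
    have "cmod (\<integral>\<omega>. ?U q \<omega> * of_real (S \<omega>) \<partial>M) \<le> B * (\<integral>\<omega>. cmod (of_real (S \<omega>)) \<partial>M)"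
      unfolding B_def by (rule bounded_factor(2)[OF Uv_measurable[OF h] cmod_Uv_le[OF h]]) (use qr Si in auto)
    also have "\<dots> \<le> B * sqrt V" using Sm by (simp add: B_def)
    finally have b1: "cmod (\<integral>\<omega>. ?U q \<omega> * of_real (S \<omega>) \<partial>M) \<le> B * sqrt V" .
    have b2: "cmod (\<integral>\<omega>. (?U (Suc (q + i)) \<omega> - ?U q \<omega>) * of_real (\<gamma> (yv h (q + i) \<omega>)) \<partial>M) \<le> C * (real r * (B\<^sup>2 * (h * ?\<zeta>)))" if i: "i < r" for i
    proof -
      have dU: "integrable M (\<lambda>\<omega>. ?U (Suc (q + i)) \<omega> - ?U q \<omega>)" by (intro Bochner_Integration.integrable_diff Uv_integrable[OF h])
      have gm: "(\<lambda>\<omega>. complex_of_real (\<gamma> (yv h (q + i) \<omega>))) \<in> borel_measurable M" using borel_measurable_integrable[OF yi[of "q + i"]] by measurable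
      have "cmod (\<integral>\<omega>. of_real (\<gamma> (yv h (q + i) \<omega>)) * (?U (Suc (q + i)) \<omega> - ?U q \<omega>) \<partial>M) \<le> C * (\<integral>\<omega>. cmod (?U (Suc (q + i)) \<omega> - ?U q \<omega>) \<partial>M)"
        by (rule bounded_factor(2)[OF gm _ dU]) (simp add: \<gamma>(2))
      also have "\<dots> \<le> C * (real (Suc i) * (B\<^sup>2 * (h * ?\<zeta>)))"
        using Uv_increment[OF h, of q "Suc i" "N * r" a l] i qr C0 unfolding B_def by (intro mult_left_mono) auto
      also have "\<dots> \<le> C * (real r * (B\<^sup>2 * (h * ?\<zeta>)))"
        using i C0 h z0 by (intro mult_left_mono mult_right_mono) auto
      finally show ?thesis by (simp only: mult.commute)
    qed
    have bi: "integrable M (\<lambda>\<omega>. (?U (Suc (q + i)) \<omega> - ?U q \<omega>) * of_real (\<gamma> (yv h (q + i) \<omega>)))" for i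
      unfolding left_diff_distrib by (intro Bochner_Integration.integrable_diff UF)
    have US: "integrable M (\<lambda>\<omega>. ?U q \<omega> * of_real (S \<omega>))"
      using Si by (intro bounded_factor(1)[OF Uv_measurable[OF h] cmod_Uv_le[OF h order_refl]]) auto
    have "(\<Sum>i<r. of_real h * (\<integral>\<omega>. ?U (Suc (i + j * r)) \<omega> * of_real (\<gamma> (yv h (i + j * r) \<omega>)) \<partial>M))
      = (\<Sum>i<r. of_real h * (\<integral>\<omega>. ?U q \<omega> * of_real (\<gamma> (yv h (q + i) \<omega>)) \<partial>M) + of_real h * (\<integral>\<omega>. (?U (Suc (q + i)) \<omega> - ?U q \<omega>) * of_real (\<gamma> (yv h (q + i) \<omega>)) \<partial>M))"
    proof (intro sum.cong refl)
      fix i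
      have "(\<integral>\<omega>. ?U (Suc (q + i)) \<omega> * of_real (\<gamma> (yv h (q + i) \<omega>)) \<partial>M) =
        (\<integral>\<omega>. ?U q \<omega> * of_real (\<gamma> (yv h (q + i) \<omega>)) + (?U (Suc (q + i)) \<omega> - ?U q \<omega>) * of_real (\<gamma> (yv h (q + i) \<omega>)) \<partial>M)"
        by (intro Bochner_Integration.integral_cong refl) (simp add: algebra_simps)
      also have "\<dots> = (\<integral>\<omega>. ?U q \<omega> * of_real (\<gamma> (yv h (q + i) \<omega>)) \<partial>M) + (\<integral>\<omega>. (?U (Suc (q + i)) \<omega> - ?U q \<omega>) * of_real (\<gamma> (yv h (q + i) \<omega>)) \<partial>M)"
        by (rule Bochner_Integration.integral_add[OF UF bi])
      finally show "of_real h * (\<integral>\<omega>. ?U (Suc (i + j * r)) \<omega> * of_real (\<gamma> (yv h (i + j * r) \<omega>)) \<partial>M) =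
        of_real h * (\<integral>\<omega>. ?U q \<omega> * of_real (\<gamma> (yv h (q + i) \<omega>)) \<partial>M) + of_real h * (\<integral>\<omega>. (?U (Suc (q + i)) \<omega> - ?U q \<omega>) * of_real (\<gamma> (yv h (q + i) \<omega>)) \<partial>M)"
        by (simp add: q_def add.commute distrib_left)
    qed
    also have "\<dots> = (\<integral>\<omega>. ?U q \<omega> * of_real (S \<omega>) \<partial>M) + (\<Sum>i<r. of_real h * (\<integral>\<omega>. (?U (Suc (q + i)) \<omega> - ?U q \<omega>) * of_real (\<gamma> (yv h (q + i) \<omega>)) \<partial>M))"
    proof -
      have "(\<integral>\<omega>. ?U q \<omega> * of_real (S \<omega>) \<partial>M) = (\<integral>\<omega>. (\<Sum>i<r. of_real h * (?U q \<omega> * of_real (\<gamma> (yv h (q + i) \<omega>)))) \<partial>M)"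
        by (intro Bochner_Integration.integral_cong refl) (simp add: S_def sum_distrib_left ac_simps)
      also have "\<dots> = (\<Sum>i<r. of_real h * (\<integral>\<omega>. ?U q \<omega> * of_real (\<gamma> (yv h (q + i) \<omega>)) \<partial>M))"
        using UF by (subst Bochner_Integration.integral_sum) auto
      finally show ?thesis by (simp add: sum.distrib)
    qed
    finally have "cmod (\<Sum>i<r. of_real h * (\<integral>\<omega>. ?U (Suc (i + j * r)) \<omega> * of_real (\<gamma> (yv h (i + j * r) \<omega>)) \<partial>M))
      \<le> cmod (\<integral>\<omega>. ?U q \<omega> * of_real (S \<omega>) \<partial>M) + cmod (\<Sum>i<r. of_real h * (\<integral>\<omega>. (?U (Suc (q + i)) \<omega> - ?U q \<omega>) * of_real (\<gamma> (yv h (q + i) \<omega>)) \<partial>M))"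
      by (simp only: norm_triangle_ineq)
    also have "cmod (\<Sum>i<r. of_real h * (\<integral>\<omega>. (?U (Suc (q + i)) \<omega> - ?U q \<omega>) * of_real (\<gamma> (yv h (q + i) \<omega>)) \<partial>M)) \<le> (\<Sum>i<r. h * (C * (real r * (B\<^sup>2 * (h * ?\<zeta>)))))"
      using b2 h by (intro sum_norm_le) (auto simp: norm_mult intro!: mult_left_mono)
    finally show ?thesis using b1 by (simp add: power2_eq_square algebra_simps)
  qed
  have "(\<integral>\<omega>. (\<Sum>k<N * r. of_real h * (?U (Suc k) \<omega> * of_real (\<gamma> (yv h k \<omega>)))) \<partial>M) = (\<Sum>k<N * r. of_real h * (\<integral>\<omega>. ?U (Suc k) \<omega> * of_real (\<gamma> (yv h k \<omega>)) \<partial>M))"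
    using UF by (subst Bochner_Integration.integral_sum) auto
  \<comment> \<open>The index \<open>k\<close> is written as \<open>i + j * r\<close>, block
    \<open>j\<close> and position \<open>i\<close>.\<close>
  also have "\<dots> = (\<Sum>j<N. \<Sum>i<r. of_real h * (\<integral>\<omega>. ?U (Suc (i + j * r)) \<omega> * of_real (\<gamma> (yv h (i + j * r) \<omega>)) \<partial>M))"
    by (rule sum_mult_product)
  finally have eq: "(\<integral>\<omega>. (\<Sum>k<N * r. of_real h * (?U (Suc k) \<omega> * of_real (\<gamma> (yv h k \<omega>)))) \<partial>M)
    = (\<Sum>j<N. \<Sum>i<r. of_real h * (\<integral>\<omega>. ?U (Suc (i + j * r)) \<omega> * of_real (\<gamma> (yv h (i + j * r) \<omega>)) \<partial>M))" .
  have "cmod (\<Sum>j<N. \<Sum>i<r. of_real h * (\<integral>\<omega>. ?U (Suc (i + j * r)) \<omega> * of_real (\<gamma> (yv h (i + j * r) \<omega>)) \<partial>M))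
    \<le> (\<Sum>j<N. B * sqrt V + C * B\<^sup>2 * ?\<zeta> * (real r * h)\<^sup>2)"
    by (rule sum_norm_le) (rule block, simp)
  then show ?thesis unfolding eq sum_constant card_lessThan .
qed

end

section \<open>Vanishing mesh at a fixed time\<close>

lemma cmod_exp_Complex_diff: "cmod (exp (Complex p x) - exp (Complex p y)) \<le> exp p * \<bar>x - y\<bar>"
proof -
  have "exp (Complex p x) = exp (Complex p y) * exp (Complex 0 (x - y))"
    unfolding mult_exp_exp by (rule arg_cong[where f = exp]) (simp add: complex_eq_iff)
  then have "exp (Complex p x) - exp (Complex p y) = exp (Complex p y) * (exp (Complex 0 (x - y)) - 1)"
    by (simp add: algebra_simps)
  moreover have "cmod (exp (Complex 0 (x - y)) - 1) \<le> \<bar>x - y\<bar>"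
    using norm_exp_minus_1[of "Complex 0 (x - y)"] by (simp add: cmod_def)
  ultimately show ?thesis by (simp add: norm_mult)
qed

lemma tendsto_of_le_epsilon:
  fixes f :: "nat \<Rightarrow> 'a::real_normed_vector"
  assumes "\<And>e. 0 < e \<Longrightarrow> \<forall>\<^sub>F r in sequentially. norm (f r - L) \<le> c * e"
  shows "f \<longlonglongrightarrow> L"
proof (rule tendstoI)
  fix e :: real assume e: "0 < e"
  have "0 < e / (\<bar>c\<bar> + 1)" using e by simp
  from assms[OF this] show "\<forall>\<^sub>F r in sequentially. dist (f r) L < e"
  proof eventually_elim
    case (elim r)
    have "c * (e / (\<bar>c\<bar> + 1)) < (\<bar>c\<bar> + 1) * (e / (\<bar>c\<bar> + 1))" using e by (intro mult_strict_right_mono) auto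
    also have "\<dots> = e" by simp
    finally show ?case using elim by (simp add: dist_norm)
  qed
qed

context additive_functional
begin

lemma occ_riemann_ex:
  assumes "integrable \<mu> g" "0 < e"
  shows "\<exists>d>0. \<forall>h m. 0 < h \<longrightarrow> h < d \<longrightarrow>
    (\<integral>\<omega>. \<bar>(\<Sum>k<m. h * g (Y (real (Suc k) * h) \<omega>)) - occ (real m * h) g \<omega>\<bar> \<partial>M) \<le> real m * (h * e)"
proof (rule occ_riemann[OF assms])
  fix d assume "0 < d" and d: "\<And>h m. 0 < h \<Longrightarrow> h < d \<Longrightarrow>
    (\<integral>\<omega>. \<bar>(\<Sum>k<m. h * g (Y (real (Suc k) * h) \<omega>)) - occ (real m * h) g \<omega>\<bar> \<partial>M) \<le> real m * (h * e)"
  show ?thesis by (intro exI[of _ d] conjI \<open>0 < d\<close> allI impI d)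
qed

text \<open>At fixed modulus the exponential is Lipschitz in its phase, so the mean convergence of
  the Riemann sums in \<open>occ_riemann\<close> suffices.\<close>

lemma Uv_limit:
  assumes hr: "\<And>r. 0 < h r" "h \<longlonglongrightarrow> 0" "\<And>r. h r * real (m r) = T"
  shows "(\<lambda>r. \<integral>\<omega>. Uv a l (h r) (m r) \<omega> \<partial>M) \<longlonglongrightarrow> (\<integral>\<omega>. exp (Complex (l * T) (a * occ T F \<omega>)) \<partial>M)"
proof (rule tendsto_of_le_epsilon)
  fix e :: real assume e: "0 < e"
  obtain d where d: "0 < d" "\<And>h m. 0 < h \<Longrightarrow> h < d \<Longrightarrow>
    (\<integral>\<omega>. \<bar>(\<Sum>k<m. h * F (Y (real (Suc k) * h) \<omega>)) - occ (real m * h) F \<omega>\<bar> \<partial>M) \<le> real m * (h * e)"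
    using occ_riemann_ex[OF F_integrable e] by blast
  have oi: "integrable M (occ T F)" by (rule occ_integrable[OF F_integrable])
  have ei: "integrable M (\<lambda>\<omega>. exp (Complex (l * T) (a * occ T F \<omega>)))"
  proof (rule integrable_const_bound[where B = "exp (l * T)"])
    have [measurable]: "occ T F \<in> borel_measurable M" using oi by auto
    show "(\<lambda>\<omega>. exp (Complex (l * T) (a * occ T F \<omega>))) \<in> borel_measurable M" unfolding Complex_eq by measurable
  qed simp
  show "\<forall>\<^sub>F r in sequentially. cmod ((\<integral>\<omega>. Uv a l (h r) (m r) \<omega> \<partial>M) - (\<integral>\<omega>. exp (Complex (l * T) (a * occ T F \<omega>)) \<partial>M)) \<le> (exp (l * T) * \<bar>a\<bar> * T) * e"
    using order_tendstoD(2)[OF hr(2) d(1)]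
  proof eventually_elim
    case (elim r)
    have h0: "0 \<le> h r" using hr(1) less_imp_le by blast
    have mh: "real (m r) * h r = T" using hr(3)[of r] by (simp add: mult.commute)
    have Si: "integrable M (\<lambda>\<omega>. Sv (h r) (m r) \<omega>)"
      unfolding Sv_def by (intro Bochner_Integration.integrable_sum integrable_mult_right yv_integrable[OF h0 F_integrable])
    have "(\<integral>\<omega>. Uv a l (h r) (m r) \<omega> \<partial>M) - (\<integral>\<omega>. exp (Complex (l * T) (a * occ T F \<omega>)) \<partial>M) =
      (\<integral>\<omega>. Uv a l (h r) (m r) \<omega> - exp (Complex (l * T) (a * occ T F \<omega>)) \<partial>M)"
      by (rule Bochner_Integration.integral_diff[OF Uv_integrable[OF h0] ei, symmetric])
    then have "cmod ((\<integral>\<omega>. Uv a l (h r) (m r) \<omega> \<partial>M) - (\<integral>\<omega>. exp (Complex (l * T) (a * occ T F \<omega>)) \<partial>M))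
      \<le> (\<integral>\<omega>. cmod (Uv a l (h r) (m r) \<omega> - exp (Complex (l * T) (a * occ T F \<omega>))) \<partial>M)"
      by (simp only: integral_norm_bound)
    also have "\<dots> \<le> (\<integral>\<omega>. exp (l * T) * \<bar>a\<bar> * \<bar>Sv (h r) (m r) \<omega> - occ T F \<omega>\<bar> \<partial>M)"
    proof (intro integral_mono integrable_norm Bochner_Integration.integrable_diff Uv_integrable[OF h0] ei integrable_mult_right integrable_abs Si oi)
      fix \<omega>
      have "Uv a l (h r) (m r) \<omega> = exp (Complex (l * T) (a * Sv (h r) (m r) \<omega>))"
        using hr(3)[of r] by (simp add: Uv_def mult.assoc)
      then have "cmod (Uv a l (h r) (m r) \<omega> - exp (Complex (l * T) (a * occ T F \<omega>))) \<le> exp (l * T) * \<bar>a * Sv (h r) (m r) \<omega> - a * occ T F \<omega>\<bar>"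
        using cmod_exp_Complex_diff by simp
      then show "cmod (Uv a l (h r) (m r) \<omega> - exp (Complex (l * T) (a * occ T F \<omega>))) \<le> exp (l * T) * \<bar>a\<bar> * \<bar>Sv (h r) (m r) \<omega> - occ T F \<omega>\<bar>"
        by (simp add: abs_mult flip: right_diff_distrib)
    qed
    also have "\<dots> = exp (l * T) * \<bar>a\<bar> * (\<integral>\<omega>. \<bar>Sv (h r) (m r) \<omega> - occ T F \<omega>\<bar> \<partial>M)" by simp
    also have "\<dots> \<le> exp (l * T) * \<bar>a\<bar> * (T * e)"
      using d(2)[OF hr(1) elim, of "m r"] unfolding Sv_def yv_def mh
      by (intro mult_left_mono) (simp_all add: mult.assoc[symmetric] mh)
    finally show ?case by (simp add: mult.assoc)
  qed
qed

text \<open>As \<open>m = T / h\<close>, the integral of the remainder must be of smaller order than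
  \<open>h\<close>. After division by \<open>h\<close> the linear bound dominates and the quadratic
  one forces pointwise convergence to 0.\<close>

lemma remainder_limit:
  assumes hr: "\<And>r. 0 < h r" "h \<longlonglongrightarrow> 0" "\<And>r. h r * real (m r) = T"
  shows "(\<lambda>r. real (m r) * (\<integral>x. cmod (Rv a l (h r) x) * (1 + \<bar>a\<bar> * \<bar>\<Phi> x\<bar>) \<partial>\<mu>)) \<longlonglongrightarrow> 0"
proof -
  \<comment> \<open>A common bound for the meshes gives one constant \<open>L\<close> for the whole
    sequence, hence a dominating function independent of \<open>r\<close>.\<close>
  obtain H where H: "\<And>r. norm (h r) \<le> H"
    using convergent_imp_Bseq[OF convergentI[OF hr(2)]] by (auto simp: Bseq_def)
  define L where "L = \<bar>l\<bar> * H"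
  have L: "\<bar>l\<bar> * h r \<le> L" for r unfolding L_def using H[of r] by (intro mult_left_mono) auto
  have h0: "0 \<le> h r" for r using hr(1) less_imp_le by blast
  let ?f = "\<lambda>r x. inverse (h r) * (cmod (Rv a l (h r) x) * (1 + \<bar>a\<bar> * \<bar>\<Phi> x\<bar>))"
  have "(\<lambda>r. \<integral>x. ?f r x \<partial>\<mu>) \<longlonglongrightarrow> (\<integral>x. 0 \<partial>\<mu>)"
  proof (rule integral_dominated_convergence[where w = "\<lambda>x. (1 + exp L) * (cmod (zv a l x) * (1 + \<bar>a\<bar> * \<bar>\<Phi> x\<bar>))"])
    show "integrable \<mu> (\<lambda>x. (1 + exp L) * (cmod (zv a l x) * (1 + \<bar>a\<bar> * \<bar>\<Phi> x\<bar>)))"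
      by (rule integrable_mult_right[OF zv\<Phi>_integrable])
    show "?f r \<in> borel_measurable \<mu>" for r
      by (rule borel_measurable_integrable[OF integrable_mult_right[OF Rv\<Phi>_integrable[OF h0]]])
    show "AE x in \<mu>. norm (?f r x) \<le> (1 + exp L) * (cmod (zv a l x) * (1 + \<bar>a\<bar> * \<bar>\<Phi> x\<bar>))" for r
    proof (rule AE_I2)
      fix x
      have "cmod (Rv a l (h r) x) * (1 + \<bar>a\<bar> * \<bar>\<Phi> x\<bar>) \<le> (1 + exp L) * (h r * cmod (zv a l x)) * (1 + \<bar>a\<bar> * \<bar>\<Phi> x\<bar>)"
        using Rv_bounds(1)[OF h0 L] by (intro mult_right_mono) auto
      then have "inverse (h r) * (cmod (Rv a l (h r) x) * (1 + \<bar>a\<bar> * \<bar>\<Phi> x\<bar>)) \<le> inverse (h r) * ((1 + exp L) * (h r * cmod (zv a l x)) * (1 + \<bar>a\<bar> * \<bar>\<Phi> x\<bar>))"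
        using h0[of r] by (intro mult_left_mono) auto
      also have "\<dots> = (1 + exp L) * (cmod (zv a l x) * (1 + \<bar>a\<bar> * \<bar>\<Phi> x\<bar>))"
        using hr(1)[of r] by (simp add: field_simps)
      finally show "norm (?f r x) \<le> (1 + exp L) * (cmod (zv a l x) * (1 + \<bar>a\<bar> * \<bar>\<Phi> x\<bar>))"
        using h0[of r] by (simp add: abs_mult abs_of_nonneg add_nonneg_nonneg)
    qed
    show "AE x in \<mu>. (\<lambda>r. ?f r x) \<longlonglongrightarrow> 0"
    proof (rule AE_I2)
      fix x
      have up: "?f r x \<le> h r * (exp L * (cmod (zv a l x))\<^sup>2 * (1 + \<bar>a\<bar> * \<bar>\<Phi> x\<bar>))" for r
      proof -
        have "cmod (Rv a l (h r) x) * (1 + \<bar>a\<bar> * \<bar>\<Phi> x\<bar>) \<le> exp L * (h r * cmod (zv a l x))\<^sup>2 * (1 + \<bar>a\<bar> * \<bar>\<Phi> x\<bar>)"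
          using Rv_bounds(2)[OF h0 L] by (intro mult_right_mono) auto
        then have "?f r x \<le> inverse (h r) * (exp L * (h r * cmod (zv a l x))\<^sup>2 * (1 + \<bar>a\<bar> * \<bar>\<Phi> x\<bar>))"
          using h0[of r] by (intro mult_left_mono) auto
        also have "\<dots> = h r * (exp L * (cmod (zv a l x))\<^sup>2 * (1 + \<bar>a\<bar> * \<bar>\<Phi> x\<bar>))"
          using hr(1)[of r] by (simp add: field_simps power2_eq_square)
        finally show ?thesis .
      qed
      have lo: "0 \<le> ?f r x" for r using h0[of r] by (simp add: add_nonneg_nonneg)
      have "(\<lambda>r. h r * (exp L * (cmod (zv a l x))\<^sup>2 * (1 + \<bar>a\<bar> * \<bar>\<Phi> x\<bar>))) \<longlonglongrightarrow> 0 * (exp L * (cmod (zv a l x))\<^sup>2 * (1 + \<bar>a\<bar> * \<bar>\<Phi> x\<bar>))"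
        by (intro tendsto_intros hr(2))
      then have lim: "(\<lambda>r. h r * (exp L * (cmod (zv a l x))\<^sup>2 * (1 + \<bar>a\<bar> * \<bar>\<Phi> x\<bar>))) \<longlonglongrightarrow> 0" by simp
      show "(\<lambda>r. ?f r x) \<longlonglongrightarrow> 0"
        by (rule tendsto_sandwich[OF always_eventually always_eventually tendsto_const lim]) (use lo up in blast)+
    qed
  qed simp
  then have "(\<lambda>r. T * (\<integral>x. ?f r x \<partial>\<mu>)) \<longlonglongrightarrow> T * 0" by (intro tendsto_intros) simp
  moreover have "T * (\<integral>x. ?f r x \<partial>\<mu>) = real (m r) * (\<integral>x. cmod (Rv a l (h r) x) * (1 + \<bar>a\<bar> * \<bar>\<Phi> x\<bar>) \<partial>\<mu>)" for r
  proof -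
    have "(\<integral>x. ?f r x \<partial>\<mu>) = inverse (h r) * (\<integral>x. cmod (Rv a l (h r) x) * (1 + \<bar>a\<bar> * \<bar>\<Phi> x\<bar>) \<partial>\<mu>)" by simp
    then show ?thesis using hr(1)[of r] by (simp only: hr(3)[of r, symmetric]) simp
  qed
  ultimately show ?thesis by (simp only: mult_zero_right)
qed

lemma generator_limit:
  assumes hr: "\<And>r. 0 < h r" "h \<longlonglongrightarrow> 0" "\<And>r. h r * real (m r) = T"
  shows "(\<lambda>r. real (m r) * (\<integral>x. \<bar>P (h r) \<Phi> x - \<Phi> x + h r * F x\<bar> \<partial>\<mu>)) \<longlonglongrightarrow> 0"
proof (rule tendsto_of_le_epsilon)
  fix e :: real assume e: "0 < e"
  obtain d where d: "0 < d" "\<And>h. 0 < h \<Longrightarrow> h < d \<Longrightarrow> (\<integral>x. \<bar>P h \<Phi> x - \<Phi> x + h * F x\<bar> \<partial>\<mu>) \<le> h * e"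
    using generator_L1[OF e] by metis
  show "\<forall>\<^sub>F r in sequentially. norm (real (m r) * (\<integral>x. \<bar>P (h r) \<Phi> x - \<Phi> x + h r * F x\<bar> \<partial>\<mu>) - 0) \<le> T * e"
    using order_tendstoD(2)[OF hr(2) d(1)]
  proof eventually_elim
    case (elim r)
    have "real (m r) * (\<integral>x. \<bar>P (h r) \<Phi> x - \<Phi> x + h r * F x\<bar> \<partial>\<mu>) \<le> real (m r) * (h r * e)"
      using d(2)[OF hr(1) elim] by (intro mult_left_mono) auto
    also have "\<dots> = T * e" using hr(3)[of r] by (simp add: mult.commute mult.left_commute)
    finally show ?case by (simp add: abs_mult)
  qed
qed

text \<open>Convergence in the mean passes to second moments since the Riemann sums and the integral
  are both bounded by \<open>b * C\<close>.\<close>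

lemma block_limit:
  assumes hr: "\<And>r. 0 < h r" "h \<longlonglongrightarrow> 0" "\<And>r. h r * real (n r) = b"
    and \<gamma>: "\<gamma> \<in> Bb X" "0 \<le> C" "\<And>x. \<bar>\<gamma> x\<bar> \<le> C"
  shows "(\<lambda>r. \<integral>\<omega>. (\<Sum>i<n r. h r * \<gamma> (yv (h r) i \<omega>))\<^sup>2 \<partial>M) \<longlonglongrightarrow> (\<integral>\<omega>. (occ b \<gamma> \<omega>)\<^sup>2 \<partial>M)"
proof (rule tendsto_of_le_epsilon)
  fix e :: real assume e: "0 < e"
  have gi: "integrable \<mu> \<gamma>" by (rule bounded_integrable[OF \<gamma>(1)])
  obtain d where d: "0 < d" "\<And>h m. 0 < h \<Longrightarrow> h < d \<Longrightarrow>
    (\<integral>\<omega>. \<bar>(\<Sum>k<m. h * \<gamma> (Y (real (Suc k) * h) \<omega>)) - occ (real m * h) \<gamma> \<omega>\<bar> \<partial>M) \<le> real m * (h * e)"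
    using occ_riemann_ex[OF gi e] by blast
  have b0: "0 \<le> b" using hr(1,3)[of 0] by (metis less_imp_le mult_nonneg_nonneg of_nat_0_le_iff)
  have oi: "integrable M (occ b \<gamma>)" by (rule occ_integrable[OF gi])
  have ob: "\<bar>occ b \<gamma> \<omega>\<bar> \<le> b * C" for \<omega> by (rule occ_bound[OF b0 \<gamma>(2,3)])
  have o2: "integrable M (\<lambda>\<omega>. (occ b \<gamma> \<omega>)\<^sup>2)"
    unfolding power2_eq_square by (rule integrable_bounded_mult[OF oi borel_measurable_integrable[OF oi] ob])
  show "\<forall>\<^sub>F r in sequentially. norm ((\<integral>\<omega>. (\<Sum>i<n r. h r * \<gamma> (yv (h r) i \<omega>))\<^sup>2 \<partial>M) - (\<integral>\<omega>. (occ b \<gamma> \<omega>)\<^sup>2 \<partial>M)) \<le> (2 * (b * C) * b) * e"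
    using order_tendstoD(2)[OF hr(2) d(1)]
  proof eventually_elim
    case (elim r)
    have h0: "0 \<le> h r" using hr(1) less_imp_le by blast
    have nh: "real (n r) * h r = b" using hr(3)[of r] by (simp add: mult.commute)
    define S where "S \<omega> = (\<Sum>i<n r. h r * \<gamma> (yv (h r) i \<omega>))" for \<omega>
    have Si: "integrable M S" unfolding S_def[abs_def] by (intro Bochner_Integration.integrable_sum integrable_mult_right yv_integrable[OF h0 gi])
    have S2: "integrable M (\<lambda>\<omega>. (S \<omega>)\<^sup>2)"
      using block_second_moment(1)[OF \<gamma>(1) h0, where r = "n r" and k = 0] by (simp add: S_def)
    have Sb: "\<bar>S \<omega>\<bar> \<le> b * C" for \<omega>
    proof -
      have "\<bar>S \<omega>\<bar> \<le> (\<Sum>i<n r. h r * C)" unfolding S_def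
        by (rule order_trans[OF sum_abs sum_mono]) (use h0 \<gamma>(3) in \<open>simp add: abs_mult mult_left_mono\<close>)
      also have "\<dots> = b * C" by (simp add: nh mult.assoc[symmetric])
      finally show ?thesis .
    qed
    have "\<bar>(\<integral>\<omega>. (S \<omega>)\<^sup>2 \<partial>M) - (\<integral>\<omega>. (occ b \<gamma> \<omega>)\<^sup>2 \<partial>M)\<bar> = \<bar>\<integral>\<omega>. (S \<omega>)\<^sup>2 - (occ b \<gamma> \<omega>)\<^sup>2 \<partial>M\<bar>"
      by (simp add: Bochner_Integration.integral_diff[OF S2 o2])
    also have "\<dots> \<le> (\<integral>\<omega>. \<bar>(S \<omega>)\<^sup>2 - (occ b \<gamma> \<omega>)\<^sup>2\<bar> \<partial>M)" by (rule integral_abs_bound)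
    also have "\<dots> \<le> (\<integral>\<omega>. 2 * (b * C) * \<bar>S \<omega> - occ b \<gamma> \<omega>\<bar> \<partial>M)"
    proof (intro integral_mono integrable_abs Bochner_Integration.integrable_diff S2 o2 integrable_mult_right Si oi)
      fix \<omega>
      have "(S \<omega>)\<^sup>2 - (occ b \<gamma> \<omega>)\<^sup>2 = (S \<omega> + occ b \<gamma> \<omega>) * (S \<omega> - occ b \<gamma> \<omega>)" by (simp add: power2_eq_square algebra_simps)
      moreover have "\<bar>S \<omega> + occ b \<gamma> \<omega>\<bar> \<le> 2 * (b * C)" using Sb[of \<omega>] ob[of \<omega>] by linarith
      ultimately show "\<bar>(S \<omega>)\<^sup>2 - (occ b \<gamma> \<omega>)\<^sup>2\<bar> \<le> 2 * (b * C) * \<bar>S \<omega> - occ b \<gamma> \<omega>\<bar>"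
        by (simp only: abs_mult) (intro mult_right_mono, auto)
    qed
    also have "\<dots> = 2 * (b * C) * (\<integral>\<omega>. \<bar>S \<omega> - occ b \<gamma> \<omega>\<bar> \<partial>M)" by simp
    also have "\<dots> \<le> 2 * (b * C) * (b * e)"
    proof (intro mult_left_mono)
      have "(\<integral>\<omega>. \<bar>S \<omega> - occ b \<gamma> \<omega>\<bar> \<partial>M) \<le> real (n r) * (h r * e)"
        using d(2)[OF hr(1) elim, of "n r"] by (simp only: S_def yv_def nh)
      also have "\<dots> = b * e" by (simp add: nh mult.assoc[symmetric])
      finally show "(\<integral>\<omega>. \<bar>S \<omega> - occ b \<gamma> \<omega>\<bar> \<partial>M) \<le> b * e" .
    qed (use b0 \<gamma>(2) in simp)
    finally show ?case by (simp add: S_def[abs_def] mult.assoc)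
  qed
qed

text \<open>\<open>T\<close> and the block length \<open>b\<close> stay fixed while the mesh tends
  to 0. The remainder and the generator error vanish, and block sums become time integrals; the
  bound that is left depends on time integrals of the process alone.\<close>

lemma fixed_time_bound:
  fixes a l T :: real and N :: nat
  assumes T: "0 < T" and N: "0 < N" and l: "l = a\<^sup>2 * s2"
    and \<gamma>: "\<gamma> \<in> Bb X" "0 \<le> C" "\<And>x. \<bar>\<gamma> x\<bar> \<le> C" and \<epsilon>: "(\<integral>x. \<bar>F x * \<Phi> x - s2 - \<gamma> x\<bar> \<partial>\<mu>) \<le> \<epsilon>"
  defines "B \<equiv> exp (\<bar>l\<bar> * T)" and "b \<equiv> T / real N"
  shows "cmod ((\<integral>\<omega>. exp (Complex (l * T) (a * occ T F \<omega>)) \<partial>M) - 1) \<le>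
    \<bar>a\<bar> * ((1 + B) * (\<integral>x. \<bar>\<Phi> x\<bar> \<partial>\<mu>))
    + a\<^sup>2 * (T * (B * \<epsilon>) + real N * (B * sqrt (\<integral>\<omega>. (occ b \<gamma> \<omega>)\<^sup>2 \<partial>M) + C * B\<^sup>2 * (\<integral>x. cmod (zv a l x) \<partial>\<mu>) * b\<^sup>2))
    + \<bar>a\<bar> * \<bar>l\<bar> * T * (B * (\<integral>x. \<bar>\<Phi> x\<bar> \<partial>\<mu>))"
proof -
  \<comment> \<open>Each of the \<open>N\<close> blocks is cut into \<open>Suc r\<close> cells, so
    both the block length and the horizon are exact multiples of the mesh.\<close>
  define h where "h r = b / real (Suc r)" for r
  define n where "n r = Suc r" for r :: nat
  define m where "m r = N * n r" for r
  have b0: "0 < b" using T N by (simp add: b_def)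
  have h0: "0 < h r" for r using b0 by (simp add: h_def)
  have hn: "h r * real (n r) = b" for r by (simp add: h_def n_def)
  have hm: "h r * real (m r) = T" for r
  proof -
    have "h r * real (m r) = real N * (h r * real (n r))" by (simp add: m_def)
    then show ?thesis using N by (simp add: hn b_def)
  qed
  have "(\<lambda>r. b * inverse (real (Suc r))) \<longlonglongrightarrow> b * 0" by (intro tendsto_intros LIMSEQ_inverse_real_of_nat)
  then have hl: "h \<longlonglongrightarrow> 0" by (simp add: h_def[abs_def] divide_inverse)
  define K where "K = (\<integral>x. \<bar>\<Phi> x\<bar> \<partial>\<mu>)"
  define \<zeta> where "\<zeta> = (\<integral>x. cmod (zv a l x) \<partial>\<mu>)"
  define V where "V r = (\<integral>\<omega>. (\<Sum>i<n r. h r * \<gamma> (yv (h r) i \<omega>))\<^sup>2 \<partial>M)" for r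
  define R1 where "R1 r = real (m r) * (\<integral>x. cmod (Rv a l (h r) x) * (1 + \<bar>a\<bar> * \<bar>\<Phi> x\<bar>) \<partial>\<mu>)" for r
  define R2 where "R2 r = real (m r) * (\<integral>x. \<bar>P (h r) \<Phi> x - \<Phi> x + h r * F x\<bar> \<partial>\<mu>)" for r
  have \<gamma>i: "integrable \<mu> \<gamma>" by (rule bounded_integrable[OF \<gamma>(1)])
  have B0: "0 \<le> B" by (simp add: B_def)
  have A4: "cmod (\<integral>\<omega>. (\<Sum>k<m r. of_real (h r) * (Uv a l (h r) (Suc k) \<omega> * of_real (F (yv (h r) k \<omega>) * \<Phi> (yv (h r) k \<omega>) - s2))) \<partial>M)
      \<le> T * (B * \<epsilon>) + real N * (B * sqrt (V r) + C * B\<^sup>2 * \<zeta> * b\<^sup>2)" for r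
  proof -
    let ?U = "Uv a l (h r)" and ?y = "yv (h r)"
    \<comment> \<open>The part of \<open>F \<Phi> - s2\<close> not captured by the bounded
      \<open>\<gamma>\<close>; it is small in the mean and is paired with the bounded
      \<open>?U\<close> directly, without blocks.\<close>
    define \<eta> where "\<eta> x = F x * \<Phi> x - s2 - \<gamma> x" for x
    have hr0: "0 \<le> h r" using h0 less_imp_le by blast
    have \<eta>i: "integrable \<mu> \<eta>" unfolding \<eta>_def using F\<Phi>_integrable \<gamma>i by auto
    have c\<eta>: "integrable \<mu> (\<lambda>x. complex_of_real (\<eta> x))" and c\<gamma>: "integrable \<mu> (\<lambda>x. complex_of_real (\<gamma> x))" using \<eta>i \<gamma>i by auto
    note U\<eta> = Uv_factor(1)[OF hr0 order_refl c\<eta>] and U\<gamma> = Uv_factor(1)[OF hr0 order_refl c\<gamma>]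
    define Q1 where "Q1 \<omega> = (\<Sum>k<m r. of_real (h r) * (?U (Suc k) \<omega> * of_real (\<eta> (?y k \<omega>))))" for \<omega>
    define Q2 where "Q2 \<omega> = (\<Sum>k<m r. of_real (h r) * (?U (Suc k) \<omega> * of_real (\<gamma> (?y k \<omega>))))" for \<omega>
    have Qi: "integrable M Q1" "integrable M Q2" unfolding Q1_def[abs_def] Q2_def[abs_def]
      by (intro Bochner_Integration.integrable_sum integrable_mult_right U\<eta> U\<gamma>)+
    have "(\<integral>\<omega>. (\<Sum>k<m r. of_real (h r) * (?U (Suc k) \<omega> * of_real (F (?y k \<omega>) * \<Phi> (?y k \<omega>) - s2))) \<partial>M) = (\<integral>\<omega>. Q1 \<omega> + Q2 \<omega> \<partial>M)"
      unfolding Q1_def Q2_def sum.distrib[symmetric]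
      by (intro Bochner_Integration.integral_cong sum.cong refl) (simp add: \<eta>_def algebra_simps)
    also have "\<dots> = (\<integral>\<omega>. Q1 \<omega> \<partial>M) + (\<integral>\<omega>. Q2 \<omega> \<partial>M)" by (rule Bochner_Integration.integral_add[OF Qi])
    finally have eq: "(\<integral>\<omega>. (\<Sum>k<m r. of_real (h r) * (?U (Suc k) \<omega> * of_real (F (?y k \<omega>) * \<Phi> (?y k \<omega>) - s2))) \<partial>M) = (\<integral>\<omega>. Q1 \<omega> \<partial>M) + (\<integral>\<omega>. Q2 \<omega> \<partial>M)" .
    have "(\<integral>\<omega>. Q1 \<omega> \<partial>M) = (\<Sum>k<m r. of_real (h r) * (\<integral>\<omega>. ?U (Suc k) \<omega> * of_real (\<eta> (?y k \<omega>)) \<partial>M))"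
      unfolding Q1_def using U\<eta> by (subst Bochner_Integration.integral_sum) auto
    moreover have "cmod (\<Sum>k<m r. of_real (h r) * (\<integral>\<omega>. ?U (Suc k) \<omega> * of_real (\<eta> (?y k \<omega>)) \<partial>M)) \<le> (\<Sum>k<m r. h r * (B * \<epsilon>))"
    proof (rule sum_norm_le)
      fix k assume "k \<in> {..<m r}"
      then have k: "Suc k \<le> m r" by simp
      have "cmod (\<integral>\<omega>. ?U (Suc k) \<omega> * of_real (\<eta> (?y k \<omega>)) \<partial>M) \<le> B * (\<integral>x. \<bar>\<eta> x\<bar> \<partial>\<mu>)"
        using Uv_factor(2)[OF hr0 k c\<eta>, of a l k] by (simp add: B_def hm)
      also have "\<dots> \<le> B * \<epsilon>" using \<epsilon> B0 by (intro mult_left_mono) (simp_all add: \<eta>_def)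
      finally show "cmod (of_real (h r) * (\<integral>\<omega>. ?U (Suc k) \<omega> * of_real (\<eta> (?y k \<omega>)) \<partial>M)) \<le> h r * (B * \<epsilon>)"
        using hr0 by (simp add: norm_mult mult_left_mono)
    qed
    moreover have "(\<Sum>k<m r. h r * (B * \<epsilon>)) = T * (B * \<epsilon>)" by (simp add: hm[of r, symmetric])
    ultimately have q1: "cmod (\<integral>\<omega>. Q1 \<omega> \<partial>M) \<le> T * (B * \<epsilon>)" by (simp only:)
    have q2: "cmod (\<integral>\<omega>. Q2 \<omega> \<partial>M) \<le> real N * (B * sqrt (V r) + C * B\<^sup>2 * \<zeta> * b\<^sup>2)"
      using block_estimate[OF hr0 \<gamma>(1,3), where N = N and r = "n r" and a = a and l = l] hm[of r] hn[of r]
      by (simp add: Q2_def m_def B_def V_def \<zeta>_def mult.commute)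
    show ?thesis unfolding eq using norm_triangle_ineq[of "\<integral>\<omega>. Q1 \<omega> \<partial>M" "\<integral>\<omega>. Q2 \<omega> \<partial>M"] q1 q2 by linarith
  qed
  have fin: "cmod ((\<integral>\<omega>. Uv a l (h r) (m r) \<omega> \<partial>M) - 1) \<le>
    \<bar>a\<bar> * ((1 + B) * K) + B * R1 r + \<bar>a\<bar> * (B * R2 r)
    + a\<^sup>2 * (T * (B * \<epsilon>) + real N * (B * sqrt (V r) + C * B\<^sup>2 * \<zeta> * b\<^sup>2)) + \<bar>a\<bar> * \<bar>l\<bar> * T * (B * K)" for r
    using Uv_expectation[OF h0 l, of r "m r"] mult_left_mono[OF A4[of r], of "a\<^sup>2"]
    unfolding hm B_def[symmetric] K_def[symmetric] R1_def[symmetric] R2_def[symmetric] by simp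
  have rhs: "(\<lambda>r. \<bar>a\<bar> * ((1 + B) * K) + B * R1 r + \<bar>a\<bar> * (B * R2 r)
    + a\<^sup>2 * (T * (B * \<epsilon>) + real N * (B * sqrt (V r) + C * B\<^sup>2 * \<zeta> * b\<^sup>2)) + \<bar>a\<bar> * \<bar>l\<bar> * T * (B * K))
    \<longlonglongrightarrow> \<bar>a\<bar> * ((1 + B) * K) + B * 0 + \<bar>a\<bar> * (B * 0)
    + a\<^sup>2 * (T * (B * \<epsilon>) + real N * (B * sqrt (\<integral>\<omega>. (occ b \<gamma> \<omega>)\<^sup>2 \<partial>M) + C * B\<^sup>2 * \<zeta> * b\<^sup>2)) + \<bar>a\<bar> * \<bar>l\<bar> * T * (B * K)"
    unfolding R1_def R2_def V_def
    by (intro tendsto_intros remainder_limit[OF h0 hl hm] generator_limit[OF h0 hl hm] block_limit[OF h0 hl hn \<gamma>])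
  have lhs: "(\<lambda>r. cmod ((\<integral>\<omega>. Uv a l (h r) (m r) \<omega> \<partial>M) - 1)) \<longlonglongrightarrow> cmod ((\<integral>\<omega>. exp (Complex (l * T) (a * occ T F \<omega>)) \<partial>M) - 1)"
    by (intro tendsto_intros Uv_limit[OF h0 hl hm])
  from LIMSEQ_le[OF lhs rhs] fin show ?thesis by (simp add: K_def \<zeta>_def)
qed

text \<open>Exact centring is required, since the time averages of \<open>\<gamma>\<close> must tend
  to 0. Subtracting the mean of an approximant costs as much again as the approximation itself,
  hence the halves.\<close>

lemma centered_approximation:
  assumes \<epsilon>: "0 < \<epsilon>"
  shows "\<exists>\<gamma>\<in>Cb X. (\<integral>x. \<gamma> x \<partial>\<mu>) = 0 \<and> (\<integral>x. \<bar>F x * \<Phi> x - s2 - \<gamma> x\<bar> \<partial>\<mu>) \<le> \<epsilon>"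
proof -
  have met: "metrizable_space X" using pos by (simp add: C0_positive_def)
  have "0 < \<epsilon> / 2" using \<epsilon> by simp
  then obtain g where g: "g \<in> Cb X" "(\<integral>x. \<bar>F x * \<Phi> x - g x\<bar> \<partial>\<mu>) < \<epsilon> / 2"
    using Cb_dense_L1[OF met \<mu>.finite_measure_axioms sets_\<mu> F\<Phi>_integrable] by blast
  define c where "c = (\<integral>x. g x \<partial>\<mu>)"
  \<comment> \<open>The subtracted constant is cut off outside the space, as membership in
    \<open>Cb\<close> demands.\<close>
  define \<gamma> where "\<gamma> x = (if x \<in> topspace X then g x - c else 0)" for x
  have gi: "integrable \<mu> g" by (rule bounded_integrable[OF Cb_imp_Bb[OF g(1)]])
  obtain C where C: "0 < C" "\<And>x. \<bar>g x\<bar> \<le> C" using Cb_bounded[OF g(1)] by metis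
  have "\<gamma> \<in> Cb X"
  proof -
    have "continuous_map X euclideanreal (\<lambda>x. g x - c)" using g(1) by (intro continuous_map_diff) (auto simp: Cb_def)
    then have "continuous_map X euclideanreal \<gamma>" by (rule continuous_map_eq) (simp add: \<gamma>_def)
    moreover have "norm (\<gamma> x) \<le> C + \<bar>c\<bar>" for x using C(1) C(2)[of x] by (auto simp: \<gamma>_def)
    then have "bounded (range \<gamma>)" by (intro boundedI[of _ "C + \<bar>c\<bar>"]) auto
    ultimately show ?thesis by (auto simp: Cb_def \<gamma>_def)
  qed
  moreover have "(\<integral>x. \<gamma> x \<partial>\<mu>) = 0"
  proof -
    have "(\<integral>x. \<gamma> x \<partial>\<mu>) = (\<integral>x. g x - c \<partial>\<mu>)" by (rule Bochner_Integration.integral_cong) (auto simp: \<gamma>_def space_\<mu>)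
    also have "\<dots> = 0" using gi by (simp add: c_def \<mu>.prob_space)
    finally show ?thesis .
  qed
  moreover have "(\<integral>x. \<bar>F x * \<Phi> x - s2 - \<gamma> x\<bar> \<partial>\<mu>) \<le> \<epsilon>"
  proof -
    have di: "integrable \<mu> (\<lambda>x. \<bar>F x * \<Phi> x - g x\<bar>)" by (intro integrable_abs Bochner_Integration.integrable_diff F\<Phi>_integrable gi)
    have "\<bar>s2 - c\<bar> = \<bar>\<integral>x. F x * \<Phi> x - g x \<partial>\<mu>\<bar>"
      by (simp add: s2_def c_def Bochner_Integration.integral_diff[OF F\<Phi>_integrable gi])
    also have "\<dots> \<le> (\<integral>x. \<bar>F x * \<Phi> x - g x\<bar> \<partial>\<mu>)" by (rule integral_abs_bound)
    finally have sc: "\<bar>s2 - c\<bar> \<le> \<epsilon> / 2" using g(2) by simp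
    have "(\<integral>x. \<bar>F x * \<Phi> x - s2 - \<gamma> x\<bar> \<partial>\<mu>) = (\<integral>x. \<bar>F x * \<Phi> x - s2 - (g x - c)\<bar> \<partial>\<mu>)"
      by (rule Bochner_Integration.integral_cong) (auto simp: \<gamma>_def space_\<mu>)
    also have "\<dots> \<le> (\<integral>x. \<bar>F x * \<Phi> x - g x\<bar> + \<epsilon> / 2 \<partial>\<mu>)"
    proof (rule integral_mono)
      show "integrable \<mu> (\<lambda>x. \<bar>F x * \<Phi> x - s2 - (g x - c)\<bar>)" using F\<Phi>_integrable gi by auto
      show "integrable \<mu> (\<lambda>x. \<bar>F x * \<Phi> x - g x\<bar> + \<epsilon> / 2)" using di by auto
    qed (use sc in linarith)
    also have "\<dots> = (\<integral>x. \<bar>F x * \<Phi> x - g x\<bar> \<partial>\<mu>) + \<epsilon> / 2"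
      using di by (simp add: \<mu>.prob_space)
    finally show ?thesis using g(2) by simp
  qed
  ultimately show ?thesis by blast
qed

text \<open>Given \<open>\<epsilon>\<close>, ergodicity fixes a block length \<open>b0\<close>, and
  the number of blocks grows with time. Since \<open>a\<^sup>2 * T = \<theta>\<^sup>2\<close> stays
  bounded, the block averages contribute a multiple of \<open>\<epsilon>\<close>, while the boundary
  terms and the cost of unfreezing tend to 0 with \<open>a\<close> and \<open>l\<close>.\<close>

lemma char_limit:
  assumes \<tau>: "filterlim \<tau> at_top sequentially"
  shows "(\<lambda>k. \<integral>\<omega>. exp (Complex 0 (\<theta> / sqrt (\<tau> k) * occ (\<tau> k) F \<omega>)) \<partial>M) \<longlonglongrightarrow> of_real (exp (- (\<theta>\<^sup>2 * s2)))"
proof -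
  define \<kappa> where "\<kappa> = \<theta>\<^sup>2 * s2"
  define B where "B = exp \<bar>\<kappa>\<bar>"
  define K where "K = (\<integral>x. \<bar>\<Phi> x\<bar> \<partial>\<mu>)"
  define KF where "KF = (\<integral>x. \<bar>F x\<bar> \<partial>\<mu>)"
  define a where "a k = \<theta> / sqrt (\<tau> k)" for k
  define l where "l k = \<kappa> / \<tau> k" for k
  let ?E = "\<lambda>k. \<integral>\<omega>. exp (Complex 0 (a k * occ (\<tau> k) F \<omega>)) \<partial>M"
  have B0: "0 < B" by (simp add: B_def)
  have \<tau>0: "\<forall>\<^sub>F k in sequentially. 0 < \<tau> k" using \<tau> unfolding filterlim_at_top_dense by auto
  have a0: "a \<longlonglongrightarrow> 0"
    unfolding a_def by (rule real_tendsto_divide_at_top[OF tendsto_const filterlim_compose[OF sqrt_at_top \<tau>]])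
  have l0: "l \<longlonglongrightarrow> 0"
    unfolding l_def by (rule real_tendsto_divide_at_top[OF tendsto_const \<tau>])
  have "(\<lambda>k. of_real (exp \<kappa>) * ?E k) \<longlonglongrightarrow> 1"
  proof (rule tendsto_of_le_epsilon)
    fix \<epsilon> :: real assume \<epsilon>: "0 < \<epsilon>"
    obtain \<gamma> where \<gamma>: "\<gamma> \<in> Cb X" "(\<integral>x. \<gamma> x \<partial>\<mu>) = 0" "(\<integral>x. \<bar>F x * \<Phi> x - s2 - \<gamma> x\<bar> \<partial>\<mu>) \<le> \<epsilon>"
      using centered_approximation[OF \<epsilon>] by blast
    obtain C where C: "0 < C" "\<And>x. \<bar>\<gamma> x\<bar> \<le> C" using Cb_bounded[OF \<gamma>(1)] by metis
    have C0: "0 \<le> C" using C by simp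
    have "0 < \<epsilon>\<^sup>2" using \<epsilon> by simp
    then have "\<forall>\<^sub>F T in at_top. (\<integral>\<omega>. (1 / T * occ T \<gamma> \<omega> - (\<integral>x. \<gamma> x \<partial>\<mu>))\<^sup>2 \<partial>M) < \<epsilon>\<^sup>2"
      by (rule order_tendstoD(2)[OF ergodic_L2[OF \<gamma>(1)]])
    then obtain b1 where b1: "\<And>T. b1 \<le> T \<Longrightarrow> (\<integral>\<omega>. (1 / T * occ T \<gamma> \<omega>)\<^sup>2 \<partial>M) < \<epsilon>\<^sup>2"
      unfolding eventually_at_top_linorder \<gamma>(2) by auto
    \<comment> \<open>The maximum with 1 makes the block length positive.\<close>
    define b0 where "b0 = max b1 1"
    have b0: "0 < b0" "b1 \<le> b0" by (auto simp: b0_def)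
    \<comment> \<open>Everything that carries a free factor \<open>a k\<close> or
      \<open>l k\<close>. The factor \<open>2 * b0\<close> bounds the actual block length.\<close>
    define err where "err k = \<bar>a k\<bar> * ((1 + B) * K) + \<bar>a k\<bar> * \<bar>\<kappa>\<bar> * (B * K) + \<theta>\<^sup>2 * (C * B\<^sup>2 * (\<bar>a k\<bar> * KF + \<bar>l k\<bar>) * (2 * b0))" for k
    have "err \<longlonglongrightarrow> \<bar>0\<bar> * ((1 + B) * K) + \<bar>0\<bar> * \<bar>\<kappa>\<bar> * (B * K) + \<theta>\<^sup>2 * (C * B\<^sup>2 * (\<bar>0\<bar> * KF + \<bar>0\<bar>) * (2 * b0))"
      unfolding err_def by (intro tendsto_intros a0 l0)
    then have err0: "err \<longlonglongrightarrow> 0" by simp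
    have ev: "\<forall>\<^sub>F k in sequentially. b0 \<le> \<tau> k" using \<tau> unfolding filterlim_at_top by auto
    show "\<forall>\<^sub>F k in sequentially. cmod (of_real (exp \<kappa>) * ?E k - 1) \<le> (1 + 2 * \<theta>\<^sup>2 * B) * \<epsilon>"
      using ev \<tau>0 order_tendstoD(2)[OF err0 \<epsilon>]
    proof eventually_elim
      case (elim k)
      define T where "T = \<tau> k"
      have T: "0 < T" "b0 \<le> T" using elim by (auto simp: T_def)
      \<comment> \<open>Rounding down makes the blocks at least \<open>b0\<close> long, so the
        ergodic estimate applies, and at most twice that, so the cost of unfreezing stays
        bounded.\<close>
      define N where "N = nat \<lfloor>T / b0\<rfloor>"
      have "1 \<le> T / b0" using T b0 by simp
      then have fl: "1 \<le> \<lfloor>T / b0\<rfloor>" by simp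
      then have N: "0 < N" by (simp add: N_def)
      have rN: "real N = of_int \<lfloor>T / b0\<rfloor>" using fl by (simp add: N_def)
      define b where "b = T / real N"
      have Nb: "real N * b = T" using N by (simp add: b_def)
      have "real N \<le> T / b0" unfolding rN by linarith
      then have bge: "b0 \<le> b" using N b0 by (simp add: b_def field_simps)
      have "T / b0 < real N + 1" unfolding rN by linarith
      also have "\<dots> \<le> 2 * real N" using N by simp
      finally have "b \<le> 2 * b0" using N b0 by (simp add: b_def field_simps)
      have bpos: "0 < b" using bge b0 by simp
      have aT: "(a k)\<^sup>2 * T = \<theta>\<^sup>2" using T by (simp add: a_def T_def power_divide)
      have lT: "l k * T = \<kappa>" using T by (simp add: l_def T_def)
      have l: "l k = (a k)\<^sup>2 * s2" using T by (simp add: l_def \<kappa>_def a_def T_def power_divide)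
      have BT: "exp (\<bar>l k\<bar> * T) = B"
      proof -
        have "\<bar>l k\<bar> * T = \<bar>l k * T\<bar>" using T by (simp add: abs_mult)
        then show ?thesis using lT by (simp add: B_def)
      qed
      have W: "sqrt (\<integral>\<omega>. (occ b \<gamma> \<omega>)\<^sup>2 \<partial>M) \<le> b * \<epsilon>"
      proof -
        have "(\<integral>\<omega>. (1 / b * occ b \<gamma> \<omega>)\<^sup>2 \<partial>M) = (1 / b)\<^sup>2 * (\<integral>\<omega>. (occ b \<gamma> \<omega>)\<^sup>2 \<partial>M)" unfolding power_mult_distrib by simp
        then have "(1 / b)\<^sup>2 * (\<integral>\<omega>. (occ b \<gamma> \<omega>)\<^sup>2 \<partial>M) \<le> \<epsilon>\<^sup>2" using b1[of b] b0 bge by simp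
        then have "(\<integral>\<omega>. (occ b \<gamma> \<omega>)\<^sup>2 \<partial>M) \<le> (b * \<epsilon>)\<^sup>2" using bpos by (simp add: power_divide power_mult_distrib field_simps)
        then show ?thesis using bpos \<epsilon> by (intro real_le_lsqrt) auto
      qed
      define Z where "Z = (\<integral>x. cmod (zv (a k) (l k) x) \<partial>\<mu>)"
      have Z: "0 \<le> Z" "Z \<le> \<bar>a k\<bar> * KF + \<bar>l k\<bar>" using zv_bound[of "a k" "l k"] by (auto simp: Z_def KF_def)
      have Eeq: "(\<integral>\<omega>. exp (Complex (l k * T) (a k * occ T F \<omega>)) \<partial>M) = of_real (exp \<kappa>) * ?E k"
      proof -
        have "exp (Complex (l k * T) (a k * occ T F \<omega>)) = of_real (exp \<kappa>) * exp (Complex 0 (a k * occ T F \<omega>))" for \<omega>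
          unfolding lT exp_of_real[symmetric] mult_exp_exp by (rule arg_cong[where f = exp]) (simp add: complex_eq_iff)
        then show ?thesis by (simp add: T_def)
      qed
      have "cmod (of_real (exp \<kappa>) * ?E k - 1) \<le> \<bar>a k\<bar> * ((1 + B) * K)
        + (a k)\<^sup>2 * (T * (B * \<epsilon>) + real N * (B * sqrt (\<integral>\<omega>. (occ b \<gamma> \<omega>)\<^sup>2 \<partial>M) + C * B\<^sup>2 * Z * b\<^sup>2))
        + \<bar>a k\<bar> * \<bar>l k\<bar> * T * (B * K)"
        using fixed_time_bound[OF T(1) N l Cb_imp_Bb[OF \<gamma>(1)] C0 C(2) \<gamma>(3)] unfolding Eeq BT b_def[symmetric] K_def[symmetric] Z_def[symmetric] .
      also have "\<bar>a k\<bar> * \<bar>l k\<bar> * T * (B * K) = \<bar>a k\<bar> * \<bar>\<kappa>\<bar> * (B * K)"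
        using T lT by (simp add: mult.assoc[symmetric]) (metis abs_mult abs_of_pos mult.assoc)
      also have "(a k)\<^sup>2 * (T * (B * \<epsilon>) + real N * (B * sqrt (\<integral>\<omega>. (occ b \<gamma> \<omega>)\<^sup>2 \<partial>M) + C * B\<^sup>2 * Z * b\<^sup>2))
        \<le> (a k)\<^sup>2 * (T * (B * \<epsilon>) + real N * (B * (b * \<epsilon>) + C * B\<^sup>2 * (\<bar>a k\<bar> * KF + \<bar>l k\<bar>) * b\<^sup>2))"
        using W Z B0 C0 by (intro mult_left_mono add_mono mult_right_mono order_refl) auto
      also have "\<dots> = (a k)\<^sup>2 * T * (2 * B * \<epsilon> + C * B\<^sup>2 * (\<bar>a k\<bar> * KF + \<bar>l k\<bar>) * b)"
        by (simp add: Nb[symmetric] power2_eq_square algebra_simps)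
      also have "\<dots> \<le> \<theta>\<^sup>2 * (2 * B * \<epsilon> + C * B\<^sup>2 * (\<bar>a k\<bar> * KF + \<bar>l k\<bar>) * (2 * b0))"
        unfolding aT using \<open>b \<le> 2 * b0\<close> C0 Z by (intro mult_left_mono add_mono order_refl) auto
      \<comment> \<open>Two contributions of \<open>\<theta>\<^sup>2 * B * \<epsilon>\<close>
        remain: the approximation of \<open>F \<Phi>\<close> by \<open>\<gamma>\<close> and the
        block averages of \<open>\<gamma>\<close>. Eventually \<open>err k\<close> adds at most
        \<open>\<epsilon>\<close>.\<close>
      finally have "cmod (of_real (exp \<kappa>) * ?E k - 1) \<le> err k + \<theta>\<^sup>2 * (2 * B * \<epsilon>)"
        by (simp add: err_def algebra_simps)
      then show ?case using elim by (simp add: algebra_simps)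
    qed
  qed
  then have "(\<lambda>k. of_real (exp (- \<kappa>)) * (of_real (exp \<kappa>) * ?E k)) \<longlonglongrightarrow> of_real (exp (- \<kappa>)) * 1"
    by (intro tendsto_intros)
  moreover have "of_real (exp (- \<kappa>)) * (of_real (exp \<kappa>) * z) = z" for z :: complex
    by (simp add: mult.assoc[symmetric] exp_minus flip: of_real_mult)
  ultimately have "?E \<longlonglongrightarrow> of_real (exp (- \<kappa>))" by (simp only: mult_1_right)
  then show ?thesis by (simp only: a_def \<kappa>_def)
qed

text \<open>At \<open>\<theta> = 1\<close> the limit \<open>exp (- s2)\<close> is a limit of numbers
  of modulus at most 1.\<close>

lemma s2_nonneg: "0 \<le> s2"
proof -
  have "(\<lambda>k. \<integral>\<omega>. exp (Complex 0 (1 / sqrt (real k) * occ (real k) F \<omega>)) \<partial>M) \<longlonglongrightarrow> of_real (exp (- (1\<^sup>2 * s2)))"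
    by (rule char_limit[OF filterlim_real_sequentially])
  then have "(\<lambda>k. cmod (\<integral>\<omega>. exp (Complex 0 (1 / sqrt (real k) * occ (real k) F \<omega>)) \<partial>M)) \<longlonglongrightarrow> cmod (of_real (exp (- (1\<^sup>2 * s2))))"
    by (rule tendsto_norm)
  moreover have "cmod (\<integral>\<omega>. exp (Complex 0 (1 / sqrt (real k) * occ (real k) F \<omega>)) \<partial>M) \<le> 1" for k
  proof -
    have "cmod (\<integral>\<omega>. exp (Complex 0 (1 / sqrt (real k) * occ (real k) F \<omega>)) \<partial>M) \<le> (\<integral>\<omega>. cmod (exp (Complex 0 (1 / sqrt (real k) * occ (real k) F \<omega>))) \<partial>M)"
      by (rule integral_norm_bound)
    then show ?thesis by (simp add: prob_space)
  qed
  ultimately have "cmod (of_real (exp (- (1\<^sup>2 * s2)))) \<le> 1"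
    by (intro LIMSEQ_le_const2) auto
  then show ?thesis by simp
qed

theorem central_limit:
  assumes \<tau>: "filterlim \<tau> at_top sequentially"
  shows "weak_conv_m
    (\<lambda>k. distr M borel (\<lambda>\<omega>. sqrt (\<tau> k) * (1 / \<tau> k * occ (\<tau> k) F \<omega>)))
    (centered_normal (2 * s2))"
proof (rule levy_continuity)
  let ?D = "\<lambda>k. distr M borel (\<lambda>\<omega>. sqrt (\<tau> k) * (1 / \<tau> k * occ (\<tau> k) F \<omega>))"
  have om [measurable]: "occ T F \<in> borel_measurable M" for T using occ_integrable[OF F_integrable] by auto
  show "real_distribution (?D k)" for k by (intro real_distribution_distr) measurable
  interpret N: prob_space std_normal_distribution by (rule prob_space_normal_density) simp
  show "real_distribution (centered_normal (2 * s2))" unfolding centered_normal_def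
    by (rule N.real_distribution_distr) simp
  fix \<theta>
  have e: "char (?D k) \<theta> = (\<integral>\<omega>. exp (Complex 0 (\<theta> / sqrt (\<tau> k) * occ (\<tau> k) F \<omega>)) \<partial>M)" if "0 < \<tau> k" for k
  proof -
    have "\<i> * complex_of_real (\<theta> * (sqrt (\<tau> k) * (1 / \<tau> k * x))) = Complex 0 (\<theta> / sqrt (\<tau> k) * x)" for x
    proof -
      have "sqrt (\<tau> k) * (1 / \<tau> k * x) = x / sqrt (\<tau> k)" using that
        by (metis (no_types, lifting) divide_divide_eq_right less_imp_le mult.commute mult.right_neutral real_div_sqrt times_divide_eq_left times_divide_eq_right)
      then show ?thesis by (simp add: complex_eq_iff)
    qed
    then show ?thesis unfolding char_def by (subst integral_distr) auto
  qed
  have "(\<lambda>k. char (?D k) \<theta>) \<longlonglongrightarrow> of_real (exp (- (\<theta>\<^sup>2 * s2)))"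
  \<comment> \<open>The rescaling identity for the phase needs positive times, which holds from some
    index on.\<close>
  proof (rule Lim_transform_eventually[OF char_limit[OF \<tau>]])
    have "\<forall>\<^sub>F k in sequentially. 0 < \<tau> k" using \<tau> unfolding filterlim_at_top_dense by auto
    then show "\<forall>\<^sub>F k in sequentially. (\<integral>\<omega>. exp (Complex 0 (\<theta> / sqrt (\<tau> k) * occ (\<tau> k) F \<omega>)) \<partial>M) = char (?D k) \<theta>"
      by eventually_elim (rule e[symmetric])
  qed
  moreover have "char (centered_normal (2 * s2)) \<theta> = of_real (exp (- (\<theta>\<^sup>2 * s2)))"
  proof -
    have "char (centered_normal (2 * s2)) \<theta> = char std_normal_distribution (\<theta> * sqrt (2 * s2))"
      unfolding char_def centered_normal_def by (subst integral_distr) (auto simp: mult.assoc)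
    also have "\<dots> = of_real (exp (- ((\<theta> * sqrt (2 * s2))\<^sup>2) / 2))" by (simp add: char_std_normal_distribution)
    finally show ?thesis using s2_nonneg by (simp add: power_mult_distrib)
  qed
  ultimately show "(\<lambda>k. char (?D k) \<theta>) \<longlonglongrightarrow> char (centered_normal (2 * s2)) \<theta>" by simp
qed

end

section \<open>Generators on square-integrable functions\<close>

lemma sum_square_le:
  fixes y :: "'i \<Rightarrow> real"
  assumes "finite I" shows "(\<Sum>i\<in>I. y i)\<^sup>2 \<le> real (card I) * (\<Sum>i\<in>I. (y i)\<^sup>2)"
  using sum_squared_le_sum_of_squares[of y I] by (simp add: mult.commute)

text \<open>Cauchy-Schwarz in extended nonnegative form, as the difference quotients of
  \<open>L2_generator\<close> are not known to be square-integrable beforehand.\<close>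

lemma nn_integral_square_sum_le:
  assumes I: "finite I" and d: "\<And>i. i \<in> I \<Longrightarrow> d i \<in> borel_measurable M"
  shows "(\<integral>\<^sup>+x. ennreal ((\<Sum>i\<in>I. a i * d i x)\<^sup>2) \<partial>M)
    \<le> (\<Sum>i\<in>I. ennreal (real (card I) * (a i)\<^sup>2) * (\<integral>\<^sup>+x. ennreal ((d i x)\<^sup>2) \<partial>M))"
proof -
  have "(\<integral>\<^sup>+x. ennreal ((\<Sum>i\<in>I. a i * d i x)\<^sup>2) \<partial>M)
    \<le> (\<integral>\<^sup>+x. (\<Sum>i\<in>I. ennreal (real (card I) * (a i)\<^sup>2) * ennreal ((d i x)\<^sup>2)) \<partial>M)"
  proof (rule nn_integral_mono)
    fix x
    have "(\<Sum>i\<in>I. a i * d i x)\<^sup>2 \<le> (\<Sum>i\<in>I. real (card I) * (a i)\<^sup>2 * (d i x)\<^sup>2)"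
      using sum_square_le[OF I, of "\<lambda>i. a i * d i x"] by (simp add: sum_distrib_left power_mult_distrib mult.assoc)
    then have "ennreal ((\<Sum>i\<in>I. a i * d i x)\<^sup>2) \<le> ennreal (\<Sum>i\<in>I. real (card I) * (a i)\<^sup>2 * (d i x)\<^sup>2)" by (rule ennreal_leI)
    also have "\<dots> = (\<Sum>i\<in>I. ennreal (real (card I) * (a i)\<^sup>2 * (d i x)\<^sup>2))" by (rule sum_ennreal[symmetric]) simp
    also have "\<dots> = (\<Sum>i\<in>I. ennreal (real (card I) * (a i)\<^sup>2) * ennreal ((d i x)\<^sup>2))"
      by (intro sum.cong refl ennreal_mult) auto
    finally show "ennreal ((\<Sum>i\<in>I. a i * d i x)\<^sup>2) \<le> (\<Sum>i\<in>I. ennreal (real (card I) * (a i)\<^sup>2) * ennreal ((d i x)\<^sup>2))" .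
  qed
  also have "\<dots> = (\<Sum>i\<in>I. (\<integral>\<^sup>+x. ennreal (real (card I) * (a i)\<^sup>2) * ennreal ((d i x)\<^sup>2) \<partial>M))"
    using d by (intro nn_integral_sum) auto
  also have "\<dots> = (\<Sum>i\<in>I. ennreal (real (card I) * (a i)\<^sup>2) * (\<integral>\<^sup>+x. ennreal ((d i x)\<^sup>2) \<partial>M))"
    using d by (intro sum.cong refl nn_integral_cmult) auto
  finally show ?thesis .
qed

lemma sum_L2:
  assumes "finite I" "\<And>i. i \<in> I \<Longrightarrow> f i \<in> L2 \<mu>"
  shows "(\<lambda>x. \<Sum>i\<in>I. c i * f i x) \<in> L2 \<mu>"
  using assms
proof (induction I rule: finite_induct)
  case empty
  then show ?case by (simp add: L2_def)
next
  case (insert i I)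
  let ?g = "\<lambda>x. \<Sum>i\<in>I. c i * f i x"
  have g: "?g \<in> L2 \<mu>" using insert by auto
  have f: "(\<lambda>x. c i * f i x) \<in> L2 \<mu>" using insert(4)[of i] by (auto simp: L2_def power_mult_distrib)
  have "integrable \<mu> (\<lambda>x. ((c i * f i x)\<^sup>2 + (?g x)\<^sup>2) + 2 * (c i * f i x * ?g x))"
    using L2_mult_integrable[OF f g] f g by (intro Bochner_Integration.integrable_add integrable_mult_right) (auto simp: L2_def)
  moreover have "((c i * f i x)\<^sup>2 + (?g x)\<^sup>2) + 2 * (c i * f i x * ?g x) = (c i * f i x + ?g x)\<^sup>2" for x by (simp add: power2_sum)
  ultimately show ?case using insert(1,2) f g by (simp add: L2_def borel_measurable_add)
qed

context invariant_kernel
begin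

lemma L2_integrable: "f \<in> L2 \<mu> \<Longrightarrow> integrable \<mu> f"
  by (rule \<mu>.integral_abs_square_le(1)) (auto simp: L2_def)

text \<open>The semigroup is additive on square-integrable representatives only where every summand
  is kernel-integrable, hence almost everywhere.\<close>

lemma kernel_sum:
  assumes t: "0 \<le> t" and I: "finite I" and u: "\<And>i. i \<in> I \<Longrightarrow> u i \<in> L2 \<mu>"
  shows "AE x in \<mu>. P t (\<lambda>y. \<Sum>i\<in>I. a i * u i y) x = (\<Sum>i\<in>I. a i * P t (u i) x)"
proof -
  have "AE x in \<mu>. \<forall>i\<in>I. integrable (p t x) (u i)"
    using kernel_L1(1)[OF t L2_integrable[OF u]] by (intro AE_finite_allI[OF I])
  then show ?thesis
  proof (rule AE_mp, intro AE_I2 impI)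
    fix x assume "x \<in> space \<mu>" and i: "\<forall>i\<in>I. integrable (p t x) (u i)"
    then show "P t (\<lambda>y. \<Sum>i\<in>I. a i * u i y) x = (\<Sum>i\<in>I. a i * P t (u i) x)"
      by (simp add: space_\<mu> P_eq Bochner_Integration.integral_sum)
  qed
qed

text \<open>The quotient error of a combination is, almost everywhere, the same combination of the
  individual errors, and each of these tends to 0 in mean square.\<close>

lemma L2_generator_sum:
  assumes I: "finite I" and uv: "\<And>i. i \<in> I \<Longrightarrow> (u i, v i) \<in> L2_generator X p \<mu>"
  shows "(\<lambda>x. \<Sum>i\<in>I. a i * u i x, \<lambda>x. \<Sum>i\<in>I. a i * v i x) \<in> L2_generator X p \<mu>"
proof -
  have u: "u i \<in> L2 \<mu>" and v: "v i \<in> L2 \<mu>" if "i \<in> I" for i using uv[OF that] by (auto simp: L2_generator_def)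
  define d where "d t i x = (P t (u i) x - u i x) / t - v i x" for t i x
  have um: "u i \<in> borel_measurable (borel_of X)" and vm: "v i \<in> borel_measurable (borel_of X)" if "i \<in> I" for i
    using u[OF that] v[OF that] measurable_\<mu> by (auto simp: L2_def)
  have dm: "d t i \<in> borel_measurable \<mu>" if "0 < t" "i \<in> I" for t i
    unfolding d_def measurable_\<mu> using P_measurable[OF less_imp_le[OF that(1)] um[OF that(2)]] um[OF that(2)] vm[OF that(2)] by measurable
  let ?U = "\<lambda>x. \<Sum>i\<in>I. a i * u i x" and ?V = "\<lambda>x. \<Sum>i\<in>I. a i * v i x"
  let ?R = "\<lambda>t. \<Sum>i\<in>I. ennreal (real (card I) * (a i)\<^sup>2) * (\<integral>\<^sup>+x. ennreal ((d t i x)\<^sup>2) \<partial>\<mu>)"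
  have le: "(\<integral>\<^sup>+x. ennreal (((P t ?U x - ?U x) / t - ?V x)\<^sup>2) \<partial>\<mu>) \<le> ?R t" if t: "0 < t" for t
  proof -
    have ks: "AE x in \<mu>. P t ?U x = (\<Sum>i\<in>I. a i * P t (u i) x)"
      by (rule kernel_sum[OF less_imp_le[OF t] I u])
    have "(\<integral>\<^sup>+x. ennreal (((P t ?U x - ?U x) / t - ?V x)\<^sup>2) \<partial>\<mu>) = (\<integral>\<^sup>+x. ennreal ((\<Sum>i\<in>I. a i * d t i x)\<^sup>2) \<partial>\<mu>)"
    proof (rule nn_integral_cong_AE)
      show "AE x in \<mu>. ennreal (((P t ?U x - ?U x) / t - ?V x)\<^sup>2) = ennreal ((\<Sum>i\<in>I. a i * d t i x)\<^sup>2)"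
        using ks
      proof eventually_elim
        case (elim x)
        have "(\<Sum>i\<in>I. a i * d t i x) = (P t ?U x - ?U x) / t - ?V x"
          unfolding elim d_def by (simp add: sum_subtractf[symmetric] sum_divide_distrib algebra_simps diff_divide_distrib)
        then show ?case by simp
      qed
    qed
    also have "\<dots> \<le> ?R t" by (rule nn_integral_square_sum_le[OF I dm[OF t]])
    finally show ?thesis .
  qed
  have "(?R \<longlongrightarrow> (\<Sum>i\<in>I. ennreal (real (card I) * (a i)\<^sup>2) * 0)) (at_right 0)"
  proof (intro tendsto_sum ennreal_tendsto_cmult)
    fix i assume "i \<in> I"
    then show "((\<lambda>t. \<integral>\<^sup>+x. ennreal ((d t i x)\<^sup>2) \<partial>\<mu>) \<longlongrightarrow> 0) (at_right 0)"
      using uv by (simp add: L2_generator_def d_def)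
  qed (simp add: less_top[symmetric])
  then have R0: "(?R \<longlongrightarrow> 0) (at_right 0)" by simp
  have "((\<lambda>t. \<integral>\<^sup>+x. ennreal (((P t ?U x - ?U x) / t - ?V x)\<^sup>2) \<partial>\<mu>) \<longlongrightarrow> 0) (at_right 0)"
  proof (rule tendsto_sandwich[OF _ _ tendsto_const R0])
    show "\<forall>\<^sub>F t in at_right 0. (\<integral>\<^sup>+x. ennreal (((P t ?U x - ?U x) / t - ?V x)\<^sup>2) \<partial>\<mu>) \<le> ?R t"
      unfolding eventually_at_right_0 using le by (intro exI[of _ 1]) auto
  qed simp
  then show ?thesis using sum_L2[OF I u] sum_L2[OF I v] by (simp add: L2_generator_def)
qed

text \<open>Single-valuedness in the form needed: if \<open>u\<close> vanishes on the space, so does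
  \<open>P t u\<close>, and the difference quotients tending to \<open>v\<close> are identically
  0.\<close>

lemma L2_generator_zero:
  assumes uv: "(u, v) \<in> L2_generator X p \<mu>" and u0: "\<And>x. x \<in> topspace X \<Longrightarrow> u x = 0"
  shows "AE x in \<mu>. v x = 0"
proof -
  have vm: "v \<in> borel_measurable \<mu>" using uv by (simp add: L2_generator_def L2_def)
  have "P t u x = 0" if "0 \<le> t" "x \<in> topspace X" for t x
  proof -
    have "P t u x = (\<integral>y. 0 \<partial>p t x)" unfolding P_eq[OF that(2)]
      by (rule Bochner_Integration.integral_cong) (auto simp: kernel_space[OF that] u0)
    then show ?thesis by simp
  qed
  then have "(\<integral>\<^sup>+x. ennreal (((P t u x - u x) / t - v x)\<^sup>2) \<partial>\<mu>) = (\<integral>\<^sup>+x. ennreal ((v x)\<^sup>2) \<partial>\<mu>)" if "0 < t" for t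
    using that u0 by (intro nn_integral_cong) (simp add: space_\<mu>)
  then have "\<forall>\<^sub>F t in at_right 0. (\<integral>\<^sup>+x. ennreal (((P t u x - u x) / t - v x)\<^sup>2) \<partial>\<mu>) = (\<integral>\<^sup>+x. ennreal ((v x)\<^sup>2) \<partial>\<mu>)"
    unfolding eventually_at_right_0 by (intro exI[of _ 1]) auto
  then have "((\<lambda>t. \<integral>\<^sup>+x. ennreal (((P t u x - u x) / t - v x)\<^sup>2) \<partial>\<mu>) \<longlongrightarrow> (\<integral>\<^sup>+x. ennreal ((v x)\<^sup>2) \<partial>\<mu>)) (at_right 0)"
    by (rule tendsto_eventually)
  moreover have "((\<lambda>t. \<integral>\<^sup>+x. ennreal (((P t u x - u x) / t - v x)\<^sup>2) \<partial>\<mu>) \<longlongrightarrow> 0) (at_right 0)"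
    using uv by (simp add: L2_generator_def)
  ultimately have "(\<integral>\<^sup>+x. ennreal ((v x)\<^sup>2) \<partial>\<mu>) = 0"
    using tendsto_unique[OF trivial_limit_at_right_real] by blast
  then have "AE x in \<mu>. ennreal ((v x)\<^sup>2) = 0" using vm by (subst (asm) nn_integral_0_iff_AE) auto
  then show ?thesis by eventually_elim simp
qed

text \<open>
  One null set serves all coefficient families: on the product space the coefficients depend on the
  other coordinates.
\<close>

lemma L2_generator_uniform_null_set:
  assumes K: "finite K" and uv: "\<And>k. k \<in> K \<Longrightarrow> (u k, v k) \<in> L2_generator X p \<mu>"
  shows "\<exists>N\<in>null_sets \<mu>. \<forall>x\<in>topspace X - N. \<forall>a.
    (\<forall>y\<in>topspace X. (\<Sum>k\<in>K. a k * u k y) = 0) \<longrightarrow> (\<Sum>k\<in>K. a k * v k x) = 0"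
  using K uv
proof (induction K rule: finite_induct)
  case empty
  then show ?case by (intro bexI[of _ "{}"]) auto
next
  case (insert j K)
  from insert.IH[OF insert.prems[OF insertI2]] obtain N where N0: "N \<in> null_sets \<mu>"
    "\<forall>x\<in>topspace X - N. \<forall>a. (\<forall>y\<in>topspace X. (\<Sum>k\<in>K. a k * u k y) = 0) \<longrightarrow> (\<Sum>k\<in>K. a k * v k x) = 0"
    by blast
  then have N: "N \<in> null_sets \<mu>" "\<And>x a. x \<in> topspace X - N \<Longrightarrow>
    (\<And>y. y \<in> topspace X \<Longrightarrow> (\<Sum>k\<in>K. a k * u k y) = 0) \<Longrightarrow> (\<Sum>k\<in>K. a k * v k x) = 0" by simp_all
  show ?case
  \<comment> \<open>Either some relation among the \<open>u k\<close> involves \<open>j\<close>, and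
    is normalised there, or none does. In the first case one relation \<open>b\<close> is fixed and
    only its null set is added to that of \<open>K\<close>.\<close>
  proof (cases "\<exists>b. b j = 1 \<and> (\<forall>y\<in>topspace X. (\<Sum>k\<in>insert j K. b k * u k y) = 0)")
    case True
    then obtain b where b: "b j = (1::real)" "\<And>y. y \<in> topspace X \<Longrightarrow> (\<Sum>k\<in>insert j K. b k * u k y) = 0" by blast
    have fin: "finite (insert j K)" using insert(1) by simp
    have "AE x in \<mu>. (\<Sum>k\<in>insert j K. b k * v k x) = 0"
      by (rule L2_generator_zero[OF L2_generator_sum[OF fin insert(4)] b(2)])
    then obtain N' where N': "N' \<in> null_sets \<mu>" "{x \<in> space \<mu>. \<not> (\<Sum>k\<in>insert j K. b k * v k x) = 0} \<subseteq> N'"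
      unfolding eventually_ae_filter by blast
    have bv: "(\<Sum>k\<in>insert j K. b k * v k x) = 0" if "x \<in> topspace X - N'" for x
      using that N'(2) by (auto simp: space_\<mu>)
    show ?thesis
    proof (intro bexI[of _ "N \<union> N'"] ballI allI impI)
      show "N \<union> N' \<in> null_sets \<mu>" using N(1) N'(1) by auto
      fix x a assume x: "x \<in> topspace X - (N \<union> N')" and a: "\<forall>y\<in>topspace X. (\<Sum>k\<in>insert j K. a k * u k y) = 0"
      \<comment> \<open>Subtracting \<open>a j\<close> times \<open>b\<close> removes the index
        \<open>j\<close>, so every other relation reduces to one over \<open>K\<close>.\<close>
      have red: "(\<Sum>k\<in>insert j K. (a k - a j * b k) * w k) = (\<Sum>k\<in>K. (a k - a j * b k) * w k)" for w :: "_ \<Rightarrow> real"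
        using insert(1,2) b(1) by simp
      have lin: "(\<Sum>k\<in>insert j K. (a k - a j * b k) * w k) = (\<Sum>k\<in>insert j K. a k * w k) - a j * (\<Sum>k\<in>insert j K. b k * w k)" for w :: "_ \<Rightarrow> real"
        by (simp only: left_diff_distrib sum_subtractf sum_distrib_left mult.assoc)
      have "(\<Sum>k\<in>K. (a k - a j * b k) * v k x) = 0"
      proof (rule N(2))
        show "x \<in> topspace X - N" using x by auto
        fix y assume y: "y \<in> topspace X"
        show "(\<Sum>k\<in>K. (a k - a j * b k) * u k y) = 0"
          unfolding red[symmetric] lin using a y b(2)[OF y] by simp
      qed
      then show "(\<Sum>k\<in>insert j K. a k * v k x) = 0"
        unfolding red[symmetric] lin using bv[of x] x by simp
    qed
  next
    case False
    show ?thesis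
    proof (intro bexI[of _ N] ballI allI impI N(1))
      fix x a assume x: "x \<in> topspace X - N" and a: "\<forall>y\<in>topspace X. (\<Sum>k\<in>insert j K. a k * u k y) = 0"
      have aj: "a j = 0"
      proof (rule ccontr)
        assume nz: "a j \<noteq> 0"
        have "(\<Sum>k\<in>insert j K. (a k / a j) * u k y) = (\<Sum>k\<in>insert j K. a k * u k y) / a j" for y
          by (simp only: sum_divide_distrib times_divide_eq_left)
        then have "\<forall>y\<in>topspace X. (\<Sum>k\<in>insert j K. (a k / a j) * u k y) = 0" using a by simp
        moreover have "a j / a j = 1" using nz by simp
        ultimately have "\<exists>b. b j = 1 \<and> (\<forall>y\<in>topspace X. (\<Sum>k\<in>insert j K. b k * u k y) = 0)"
          by (intro exI[of _ "\<lambda>k. a k / a j"] conjI)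
        then show False using \<open>\<not> (\<exists>b. b j = 1 \<and> (\<forall>y\<in>topspace X. (\<Sum>k\<in>insert j K. b k * u k y) = 0))\<close> by contradiction
      qed
      have "(\<Sum>k\<in>K. a k * v k x) = 0"
        by (rule N(2)[OF x]) (use a aj insert(1,2) in auto)
      then show "(\<Sum>k\<in>insert j K. a k * v k x) = 0" using insert(1,2) aj by simp
    qed
  qed
qed

lemma indicator_L2_generator: "(indicator (topspace X), \<lambda>_. 0) \<in> L2_generator X p \<mu>"
proof -
  have "P t (indicator (topspace X)) x = 1" if "0 \<le> t" "x \<in> topspace X" for t x
  proof -
    interpret px: prob_space "p t x" by (rule kernel_prob[OF that])
    have "P t (indicator (topspace X)) x = (\<integral>y. 1 \<partial>p t x)" unfolding P_eq[OF that(2)]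
      by (rule Bochner_Integration.integral_cong) (auto simp: kernel_space[OF that])
    then show ?thesis by (simp add: px.prob_space)
  qed
  then have "(\<integral>\<^sup>+x. ennreal (((P t (indicator (topspace X)) x - indicator (topspace X) x) / t - 0)\<^sup>2) \<partial>\<mu>) = (\<integral>\<^sup>+x. 0 \<partial>\<mu>)" if "0 < t" for t
    using that by (intro nn_integral_cong) (simp add: space_\<mu>)
  then have "\<forall>\<^sub>F t in at_right 0. (\<integral>\<^sup>+x. ennreal (((P t (indicator (topspace X)) x - indicator (topspace X) x) / t - 0)\<^sup>2) \<partial>\<mu>) = 0"
    unfolding eventually_at_right_0 by (intro exI[of _ 1]) simp
  then have "((\<lambda>t. \<integral>\<^sup>+x. ennreal (((P t (indicator (topspace X)) x - indicator (topspace X) x) / t - 0)\<^sup>2) \<partial>\<mu>) \<longlongrightarrow> 0) (at_right 0)"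
    by (rule tendsto_eventually)
  moreover have "(indicator (topspace X) :: 'a \<Rightarrow> real) \<in> L2 \<mu>"
  proof -
    have t: "topspace X \<in> sets \<mu>" using sets.top[of \<mu>] space_\<mu> by simp
    have "(\<lambda>x. (indicator (topspace X) x :: real)\<^sup>2) = indicator (topspace X)" by (auto simp: indicator_def)
    then show ?thesis using t by (auto simp: L2_def less_top[symmetric] intro!: integrable_real_indicator)
  qed
  ultimately show ?thesis by (simp add: L2_generator_def L2_def)
qed

end

section \<open>Spans of operator graphs\<close>

lemma op_span_base: "b \<in> S \<Longrightarrow> b \<in> op_span S"
  unfolding op_span_def by (auto intro!: exI[of _ "1::nat"] exI[of _ "\<lambda>_. 1"] exI[of _ "\<lambda>_. b"])

lemma op_span_zero: "(\<lambda>_. 0, \<lambda>_. 0) \<in> op_span S"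
  unfolding op_span_def by (auto intro!: exI[of _ "0::nat"])

lemma op_span_cmult: assumes "(f, g) \<in> op_span S" shows "(\<lambda>x. r * f x, \<lambda>x. r * g x) \<in> op_span S"
proof -
  obtain m :: nat and c a where *: "f = (\<lambda>x. \<Sum>k<m. c k * fst (a k) x)" "g = (\<lambda>x. \<Sum>k<m. c k * snd (a k) x)" "\<forall>k<m. a k \<in> S"
    using assms unfolding op_span_def by blast
  then show ?thesis unfolding op_span_def
    by (auto intro!: exI[of _ m] exI[of _ "\<lambda>k. r * c k"] exI[of _ a] simp: sum_distrib_left mult.assoc)
qed

lemma op_span_add:
  assumes "(f, g) \<in> op_span S" "(f', g') \<in> op_span S"
  shows "(\<lambda>x. f x + f' x, \<lambda>x. g x + g' x) \<in> op_span S"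
proof -
  obtain m :: nat and c a where 1: "f = (\<lambda>x. \<Sum>k<m. c k * fst (a k) x)" "g = (\<lambda>x. \<Sum>k<m. c k * snd (a k) x)" "\<forall>k<m. a k \<in> S"
    using assms(1) unfolding op_span_def by blast
  obtain m' :: nat and c' a' where 2: "f' = (\<lambda>x. \<Sum>k<m'. c' k * fst (a' k) x)" "g' = (\<lambda>x. \<Sum>k<m'. c' k * snd (a' k) x)" "\<forall>k<m'. a' k \<in> S"
    using assms(2) unfolding op_span_def by blast
  define d where "d k = (if k < m then c k else c' (k - m))" for k
  define b where "b k = (if k < m then a k else a' (k - m))" for k
  have split: "(\<Sum>k<m + m'. d k * h (b k)) = (\<Sum>k<m. c k * h (a k)) + (\<Sum>k<m'. c' k * h (a' k))" for h :: "_ \<Rightarrow> real"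
  proof -
    have "(\<Sum>k<m + m'. d k * h (b k)) = (\<Sum>k<m. d k * h (b k)) + (\<Sum>k<m'. d (m + k) * h (b (m + k)))"
      by (induction m') auto
    then show ?thesis by (simp add: d_def b_def)
  qed
  have bS: "\<forall>k<m + m'. b k \<in> S" using 1(3) 2(3) by (auto simp: b_def)
  show ?thesis unfolding op_span_def
    using bS split[of "\<lambda>z. fst z _"] split[of "\<lambda>z. snd z _"] unfolding 1(1,2) 2(1,2)
    by (intro CollectI exI[of _ "m + m'"] exI[of _ d] exI[of _ b]) (auto simp: fun_eq_iff split[of "\<lambda>z. fst z _"] split[of "\<lambda>z. snd z _"])
qed

lemma op_span_sum:
  assumes "finite I" "\<And>i. i \<in> I \<Longrightarrow> (f i, g i) \<in> op_span S"
  shows "(\<lambda>x. \<Sum>i\<in>I. f i x, \<lambda>x. \<Sum>i\<in>I. g i x) \<in> op_span S"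
  using assms
proof (induction I rule: finite_induct)
  case empty
  then show ?case by (simp add: op_span_zero)
next
  case (insert i I)
  then show ?case using op_span_add[of "f i" "g i" S "\<lambda>x. \<Sum>i\<in>I. f i x" "\<lambda>x. \<Sum>i\<in>I. g i x"] by simp
qed

text \<open>Diagonal terms become the variances of the coordinates; the others are ordered as in
  \<open>cross_fun\<close>.\<close>

lemma sum_square_split:
  fixes h :: "nat \<Rightarrow> nat \<Rightarrow> real"
  shows "(\<Sum>i\<in>{1..n}. \<Sum>j\<in>{1..n}. h i j) = (\<Sum>i\<in>{1..n}. h i i) + (\<Sum>j\<in>{1..n}. \<Sum>i\<in>{1..<j}. h i j + h j i)"
proof (induction n)
  case (Suc n)
  have s: "{1..Suc n} = insert (Suc n) {1..n}" and s': "{Suc 0..<Suc n} = {Suc 0..n}" by auto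
  show ?case using Suc unfolding s by (simp add: sum.distrib s' del: sum.op_ivl_Suc)
qed simp

section \<open>Coupled processes\<close>

lemma uniform_limit_lift:
  assumes "uniform_limit UNIV a f sequentially"
  shows "uniform_limit UNIV (\<lambda>k. lift_fun n E i (a k)) (lift_fun n E i f) sequentially"
proof (rule uniform_limitI)
  fix e :: real assume e: "0 < e"
  from uniform_limitD[OF assms e]
  show "\<forall>\<^sub>F k in sequentially. \<forall>x\<in>UNIV. dist (lift_fun n E i (a k) x) (lift_fun n E i f x) < e"
    by eventually_elim (use e in \<open>auto simp: lift_fun_def\<close>)
qed

lemma coordinate_topspace: "x \<in> topspace (prod_space n E) \<Longrightarrow> i \<in> {1..n} \<Longrightarrow> x i \<in> topspace (E i)"
  by (auto simp: PiE_iff)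

lemma coordinate_borel_measurable:
  "i \<in> {1..n} \<Longrightarrow> (\<lambda>x. x i) \<in> borel_of (prod_space n E) \<rightarrow>\<^sub>M borel_of (E i)"
  by (rule continuous_map_borel_of[OF continuous_map_product_projection])

text \<open>The function is a tensor product with the constant 1 in all other variables, which is
  why \<open>with_const\<close> admits that factor. Only the \<open>i\<close>-th term of the
  derivation survives, and \<open>\<Gamma>\<close> adds nothing.\<close>

lemma lift_generator_coupled:
  assumes i: "i \<in> {1..n}" and g: "(f, g) \<in> generator (E i) (p i)" and \<Gamma>: "(lift_fun n E i f, \<lambda>_. 0) \<in> \<Gamma>"
  shows "(lift_fun n E i f, lift_fun n E i g) \<in> coupled_generator n E p \<Gamma>"
proof -
  define u where "u j = (if j = i then f else indicator (topspace (E j)))" for j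
  define v where "v j = (if j = i then g else (\<lambda>_. 0))" for j
  have "(\<Prod>j\<in>{1..n}. u j (x j)) = f (x i)" if x: "x \<in> topspace (prod_space n E)" for x
  proof -
    have "(\<Prod>j\<in>{1..n}. u j (x j)) = (\<Prod>j\<in>{i}. u j (x j))"
      by (rule prod.mono_neutral_right) (use i coordinate_topspace[OF x] in \<open>auto simp: u_def\<close>)
    then show ?thesis by (simp add: u_def)
  qed
  then have f: "lift_fun n E i f = (\<lambda>x. if x \<in> topspace (prod_space n E) then \<Prod>j\<in>{1..n}. u j (x j) else 0)"
    by (auto simp: lift_fun_def fun_eq_iff simp del: topspace_product_topology)
  have "(\<Sum>k\<in>{1..n}. v k (x k) * (\<Prod>j\<in>{1..n} - {k}. u j (x j))) = g (x i)" if x: "x \<in> topspace (prod_space n E)" for x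
  proof -
    have "(\<Sum>k\<in>{1..n}. v k (x k) * (\<Prod>j\<in>{1..n} - {k}. u j (x j))) = (\<Sum>k\<in>{i}. v k (x k) * (\<Prod>j\<in>{1..n} - {k}. u j (x j)))"
      by (rule sum.mono_neutral_right) (use i in \<open>auto simp: v_def\<close>)
    moreover have "(\<Prod>j\<in>{1..n} - {i}. u j (x j)) = 1"
      by (rule prod.neutral) (use coordinate_topspace[OF x] in \<open>auto simp: u_def\<close>)
    ultimately show ?thesis by (simp add: v_def)
  qed
  then have g': "lift_fun n E i g = (\<lambda>x. if x \<in> topspace (prod_space n E) then \<Sum>k\<in>{1..n}. v k (x k) * (\<Prod>j\<in>{1..n} - {k}. u j (x j)) else 0)"
    by (auto simp: lift_fun_def fun_eq_iff simp del: topspace_product_topology)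
  have "(lift_fun n E i f, lift_fun n E i g) \<in> tensor_sum n E (\<lambda>i. with_const (E i) (generator (E i) (p i)))"
    unfolding tensor_sum_def
  proof (rule op_span_base)
    show "(lift_fun n E i f, lift_fun n E i g) \<in> {(\<lambda>x. if x \<in> topspace (prod_space n E) then \<Prod>i\<in>{1..n}. u i (x i) else 0,
       \<lambda>x. if x \<in> topspace (prod_space n E)
           then \<Sum>i\<in>{1..n}. v i (x i) * (\<Prod>j\<in>{1..n} - {i}. u j (x j)) else 0)
      | u v. \<forall>i\<in>{1..n}. (u i, v i) \<in> with_const (E i) (generator (E i) (p i))}"
      unfolding f g' using g
      by (intro CollectI exI[of _ u] exI[of _ v] conjI refl) (auto simp: u_def v_def with_const_def)
  qed
  then show ?thesis unfolding coupled_generator_def op_sum_def using \<Gamma> by force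
qed

text \<open>\<open>\<Gamma>\<close> is known to annihilate only lifts of smooth compactly supported
  functions. The core property approximates every domain element by these in graph norm, and the
  closure absorbs the limit.\<close>

lemma lift_generator_closure:
  assumes i: "i \<in> {1..n}" and \<Gamma>: "\<Gamma> \<in> coupling_operators n E \<A> p"
    and core: "is_core (Ccinf (E i) (\<A> i)) (generator (E i) (p i))" and g: "(f, g) \<in> generator (E i) (p i)"
  shows "(lift_fun n E i f, lift_fun n E i g) \<in> op_closure (coupled_generator n E p \<Gamma>)"
proof -
  have "(f, g) \<in> op_closure (op_restrict (generator (E i) (p i)) (Ccinf (E i) (\<A> i)))"
    using core g by (simp add: is_core_def)
  then obtain a where a: "\<And>k::nat. a k \<in> op_restrict (generator (E i) (p i)) (Ccinf (E i) (\<A> i))"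
    "uniform_limit UNIV (\<lambda>k. fst (a k)) f sequentially" "uniform_limit UNIV (\<lambda>k. snd (a k)) g sequentially"
    unfolding op_closure_def by blast
  have "(lift_fun n E i (fst (a k)), lift_fun n E i (snd (a k))) \<in> coupled_generator n E p \<Gamma>" for k
  proof (rule lift_generator_coupled[OF i])
    show "(fst (a k), snd (a k)) \<in> generator (E i) (p i)" using a(1)[of k] by (auto simp: op_restrict_def)
    have "fst (a k) \<in> Ccinf (E i) (\<A> i)" using a(1)[of k] by (auto simp: op_restrict_def)
    then show "(lift_fun n E i (fst (a k)), \<lambda>_. 0) \<in> \<Gamma>" using \<Gamma> i by (auto simp: coupling_operators_def)
  qed
  then show ?thesis unfolding op_closure_def
    by (intro CollectI case_prodI exI[of _ "\<lambda>k. (lift_fun n E i (fst (a k)), lift_fun n E i (snd (a k)))"])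
       (simp add: uniform_limit_lift[OF a(2)] uniform_limit_lift[OF a(3)])
qed

lemma feller_process_kernel:
  assumes "C0_positive X" "feller_process X \<A> p" shows "feller_kernel X p"
proof -
  have "transition_kernel X p" using assms(2) by (simp add: feller_process_def)
  then show ?thesis
    using assms by (intro feller_kernel.intro markov_kernel.intro feller_kernel_axioms.intro) (auto simp: feller_process_def)
qed

text \<open>This is \<open>intertwining\<close> for the identity map. It is needed because
  ergodicity of \<open>\<Gamma>\<close> comes with a kernel of its own, which must be identified
  with the given \<open>q\<close>.\<close>

lemma generates_unique:
  assumes "feller_kernel X q" "feller_kernel X q'" "generates X A q" "generates X A q'"
    and t: "0 \<le> t" and x: "x \<in> topspace X"
  shows "q t x = q' t x"
proof -
  interpret Q: feller_kernel X q by fact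
  interpret Q': feller_kernel X q' by fact
  have "distr (q t x) (borel_of X) (\<lambda>y. y) = q' t x"
  proof (rule Q'.intertwining[OF Q.markov_kernel_axioms _ _ t x])
    fix f g y and s :: real assume fg: "(f, g) \<in> Q'.G" and s: "0 \<le> s" and y: "y \<in> topspace X"
    have "(f, g) \<in> A" using fg assms(4) by (auto simp: generates_def op_restrict_def)
    then have "Q.P s f y - f y = (LINT u:{0..s}|lborel. Q.P u g y)"
      using assms(3) s y by (auto simp: generates_def)
    then show "(\<integral>z. f z \<partial>q s y) - f y = (LINT u:{0..s}|lborel. \<integral>z. g z \<partial>q u y)"
      by (simp add: Q.P_eq[OF y])
  qed simp
  moreover have "distr (q t x) (borel_of X) (\<lambda>y. y) = q t x"
    by (rule distr_id2) (simp add: Q.kernel_sets[OF t x])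
  ultimately show ?thesis by simp
qed

lemma markov_process_cong:
  assumes X: "markov_process X q \<mu> M Y" and eq: "\<And>t x. 0 \<le> t \<Longrightarrow> x \<in> topspace X \<Longrightarrow> q t x = q' t x"
  shows "markov_process X q' \<mu> M Y"
proof -
  have Y: "Y s \<omega> \<in> topspace X" if "0 \<le> s" "\<omega> \<in> space M" for s \<omega>
    using X that measurable_space[of "Y s" M "borel_of X" \<omega>] by (auto simp: markov_process_def)
  have "AE \<omega> in M. real_cond_exp M (natural_filtration M X Y s) (\<lambda>\<omega>. indicator A (Y (s + t) \<omega>)) \<omega> = measure (q' t (Y s \<omega>)) A"
    if "0 \<le> s" "0 \<le> t" "A \<in> sets (borel_of X)" for s t A
  proof -
    have "AE \<omega> in M. real_cond_exp M (natural_filtration M X Y s) (\<lambda>\<omega>. indicator A (Y (s + t) \<omega>)) \<omega> = measure (q t (Y s \<omega>)) A"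
      using X that by (auto simp: markov_process_def)
    then show ?thesis by (rule AE_mp) (use eq[OF that(2) Y[OF that(1)]] in \<open>auto intro!: AE_I2\<close>)
  qed
  then show ?thesis using X by (simp add: markov_process_def)
qed

section \<open>The coupled process and its coordinates\<close>

locale coupled_process =
  fixes n :: nat and E :: "nat \<Rightarrow> 'a topology" and \<A> :: "nat \<Rightarrow> ('a, nat) chart set"
    and p :: "nat \<Rightarrow> real \<Rightarrow> 'a \<Rightarrow> 'a measure" and \<pi> :: "nat \<Rightarrow> 'a measure"
    and \<Gamma> :: "(nat \<Rightarrow> 'a) oper" and q :: "real \<Rightarrow> (nat \<Rightarrow> 'a) \<Rightarrow> (nat \<Rightarrow> 'a) measure"
    and \<pi>\<Gamma> :: "(nat \<Rightarrow> 'a) measure" and M :: "'w measure" and Y :: "real \<Rightarrow> 'w \<Rightarrow> nat \<Rightarrow> 'a"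
  assumes n: "1 \<le> n"
    and spaces: "\<And>i. i \<in> {1..n} \<Longrightarrow> locally_compact_Polish (E i)"
    and feller: "\<And>i. i \<in> {1..n} \<Longrightarrow> feller_process (E i) (\<A> i) (p i)"
    and core: "\<And>i. i \<in> {1..n} \<Longrightarrow> is_core (Ccinf (E i) (\<A> i)) (generator (E i) (p i))"
    and unique: "\<And>i \<mu>. i \<in> {1..n} \<Longrightarrow> invariant_for (E i) (generator (E i) (p i)) \<mu> \<longleftrightarrow> \<mu> = \<pi> i"
    and \<Gamma>: "\<Gamma> \<in> ergodic_coupling_operators n E \<A> p"
    and q_feller: "feller_process (prod_space n E) (prod_atlas n \<A>) q"
    and q_generated: "generates (prod_space n E) (op_closure (coupled_generator n E p \<Gamma>)) q"
    and \<pi>\<Gamma>: "invariant_for (prod_space n E) (op_closure (coupled_generator n E p \<Gamma>)) \<pi>\<Gamma>"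
    and Y: "markov_process (prod_space n E) q \<pi>\<Gamma> M Y"
begin

abbreviation "X \<equiv> prod_space n E"
abbreviation "A \<equiv> op_closure (coupled_generator n E p \<Gamma>)"

lemma C0_positive_E: "i \<in> {1..n} \<Longrightarrow> C0_positive (E i)"
  by (rule C0_positive_locally_compact_Polish[OF spaces])

lemma C0_positive_X: "C0_positive X"
  by (rule C0_positive_product[OF C0_positive_E])

lemma feller_E: "i \<in> {1..n} \<Longrightarrow> feller_kernel (E i) (p i)"
  by (rule feller_process_kernel[OF C0_positive_E feller])

lemma invariant_E: "i \<in> {1..n} \<Longrightarrow> invariant_for (E i) (generator (E i) (p i)) (\<pi> i)"
  using unique by blast

lemma invariant_kernel_E:
  assumes i: "i \<in> {1..n}" shows "invariant_kernel (E i) (p i) (\<pi> i)"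
proof -
  interpret P: feller_kernel "E i" "p i" by (rule feller_E[OF i])
  have pr: "prob_on (E i) (\<pi> i)" and z: "\<And>f g. (f, g) \<in> P.G \<Longrightarrow> (\<integral>x. g x \<partial>\<pi> i) = 0"
    using invariant_E[OF i] by (auto simp: invariant_for_def)
  show ?thesis
  proof (rule invariant_kernel.intro[OF P.markov_kernel_axioms], rule invariant_kernel_axioms.intro)
    show "prob_space (\<pi> i)" "sets (\<pi> i) = sets (borel_of (E i))" using pr by (auto simp: prob_on_def)
    show "\<pi> i \<bind> p i t = \<pi> i" if "0 \<le> t" for t by (rule P.invariant_measure[OF pr z that])
  qed
qed

sublocale Q: feller_kernel X q by (rule feller_process_kernel[OF C0_positive_X q_feller])

sublocale Q: stationary_process X q \<pi>\<Gamma> M Y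
proof (rule stationary_process.intro[OF Q.feller_kernel_axioms], rule stationary_process_axioms.intro[OF Y])
  have pr: "prob_on X \<pi>\<Gamma>" using \<pi>\<Gamma> by (simp add: invariant_for_def)
  have "Q.G \<subseteq> A" using q_generated by (auto simp: generates_def op_restrict_def)
  then have z: "(\<integral>x. g x \<partial>\<pi>\<Gamma>) = 0" if "(f, g) \<in> Q.G" for f g using that \<pi>\<Gamma> by (auto simp: invariant_for_def)
  show "\<pi>\<Gamma> \<bind> q t = \<pi>\<Gamma>" if "0 \<le> t" for t by (rule Q.invariant_measure[OF pr z that])
qed

lemma coupling: "\<Gamma> \<in> coupling_operators n E \<A> p"
  using \<Gamma> by (simp add: ergodic_coupling_operators_def)

lemma lift_in_A: "i \<in> {1..n} \<Longrightarrow> (f, g) \<in> generator (E i) (p i) \<Longrightarrow> (lift_fun n E i f, lift_fun n E i g) \<in> A"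
  using lift_generator_closure[OF _ coupling core] by blast

text \<open>Each coordinate of the coupled process moves by its own kernel, whatever the other
  coordinates are: lifts of domain elements lie in \<open>A\<close>, where Dynkin's formula holds,
  and \<open>intertwining\<close> applies to the projection.\<close>

lemma coordinate_kernel:
  assumes i: "i \<in> {1..n}" and t: "0 \<le> t" and x: "x \<in> topspace X"
  shows "distr (q t x) (borel_of (E i)) (\<lambda>y. y i) = p i t (x i)"
proof -
  interpret P: feller_kernel "E i" "p i" by (rule feller_E[OF i])
  show ?thesis
  proof (rule P.intertwining[OF Q.markov_kernel_axioms coordinate_borel_measurable[OF i] _ t x])
    fix f g y and s :: real assume fg: "(f, g) \<in> P.G" and s: "0 \<le> s" and y: "y \<in> topspace X"
    have lift: "Q.P u (lift_fun n E i h) y = (\<integral>z. h (z i) \<partial>q u y)" if "0 \<le> u" for h u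
      unfolding Q.P_eq[OF y] by (rule Bochner_Integration.integral_cong) (simp_all add: Q.kernel_space[OF that y] lift_fun_def del: topspace_product_topology)
    \<comment> \<open>Dynkin's formula comes from the second clause of \<open>generates\<close>,
      which also covers lifts that do not vanish at infinity.\<close>
    have "Q.P s (lift_fun n E i f) y - lift_fun n E i f y = (LINT u:{0..s}|lborel. Q.P u (lift_fun n E i g) y)"
      using q_generated lift_in_A[OF i fg] s y unfolding generates_def by blast
    also have "\<dots> = (LINT u:{0..s}|lborel. \<integral>z. g (z i) \<partial>q u y)"
    proof (rule set_lebesgue_integral_cong)
      show "\<forall>u. u \<in> {0..s} \<longrightarrow> Q.P u (lift_fun n E i g) y = (\<integral>z. g (z i) \<partial>q u y)"
        by (intro allI impI lift) simp
    qed simp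
    finally show "(\<integral>z. f (z i) \<partial>q s y) - f (y i) = (LINT u:{0..s}|lborel. \<integral>z. g (z i) \<partial>q u y)"
      using lift[OF s] y by (simp add: lift_fun_def del: topspace_product_topology)
  qed
qed

lemma coordinate_measurable_\<pi>\<Gamma>: "i \<in> {1..n} \<Longrightarrow> (\<lambda>x. x i) \<in> \<pi>\<Gamma> \<rightarrow>\<^sub>M borel_of (E i)"
  using coordinate_borel_measurable measurable_cong_sets[OF Q.sets_\<mu> refl] by blast

text \<open>Integrating lifts shows the image law to be annihilated by the coordinate generator, and
  the law with this property is unique.\<close>

lemma marginal:
  assumes i: "i \<in> {1..n}" shows "distr \<pi>\<Gamma> (borel_of (E i)) (\<lambda>x. x i) = \<pi> i"
proof -
  interpret P: feller_kernel "E i" "p i" by (rule feller_E[OF i])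
  note c = coordinate_measurable_\<pi>\<Gamma>[OF i]
  have "invariant_for (E i) (generator (E i) (p i)) (distr \<pi>\<Gamma> (borel_of (E i)) (\<lambda>x. x i))"
    unfolding invariant_for_def prob_on_def
  proof (intro conjI ballI)
    show "prob_space (distr \<pi>\<Gamma> (borel_of (E i)) (\<lambda>x. x i))" by (rule Q.\<mu>.prob_space_distr[OF c])
    fix fg assume "fg \<in> P.G"
    then obtain f g where fg: "fg = (f, g)" "(f, g) \<in> P.G" by (cases fg) auto
    have "(\<integral>x. g x \<partial>distr \<pi>\<Gamma> (borel_of (E i)) (\<lambda>x. x i)) = (\<integral>x. g (x i) \<partial>\<pi>\<Gamma>)"
      by (rule integral_distr[OF c C0_measurable[OF P.generator_C0(2)[OF fg(2)]]])
    also have "\<dots> = (\<integral>x. lift_fun n E i g x \<partial>\<pi>\<Gamma>)"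
      by (rule Bochner_Integration.integral_cong) (simp_all add: lift_fun_def Q.space_\<mu> del: topspace_product_topology)
    also have "\<dots> = 0" using \<pi>\<Gamma> lift_in_A[OF i fg(2)] by (auto simp: invariant_for_def)
    finally show "case fg of (f, g) \<Rightarrow> (\<integral>x. g x \<partial>distr \<pi>\<Gamma> (borel_of (E i)) (\<lambda>x. x i)) = 0" using fg by simp
  qed simp
  then show ?thesis using unique[OF i] by simp
qed

text \<open>Null sets in a single coordinate remain null under the coupling, by
  \<open>marginal\<close>; for null sets of the product law this may fail.\<close>

lemma AE_coordinate:
  assumes i: "i \<in> {1..n}" and R: "AE y in \<pi> i. R y" shows "AE x in \<pi>\<Gamma>. R (x i)"
proof -
  have "AE y in distr \<pi>\<Gamma> (borel_of (E i)) (\<lambda>x. x i). R y" unfolding marginal[OF i] by (rule R)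
  then show ?thesis by (rule AE_distrD[OF coordinate_measurable_\<pi>\<Gamma>[OF i]])
qed

lemma integral_coordinate:
  fixes g :: "'a \<Rightarrow> real"
  assumes i: "i \<in> {1..n}" and g: "g \<in> borel_measurable (\<pi> i)"
  shows "(\<integral>x. g (x i) \<partial>\<pi>\<Gamma>) = (\<integral>y. g y \<partial>\<pi> i)" "integrable \<pi>\<Gamma> (\<lambda>x. g (x i)) \<longleftrightarrow> integrable (\<pi> i) g"
proof -
  interpret I: invariant_kernel "E i" "p i" "\<pi> i" by (rule invariant_kernel_E[OF i])
  have gm: "g \<in> borel_measurable (borel_of (E i))" using g unfolding I.measurable_\<mu> .
  show "(\<integral>x. g (x i) \<partial>\<pi>\<Gamma>) = (\<integral>y. g y \<partial>\<pi> i)" "integrable \<pi>\<Gamma> (\<lambda>x. g (x i)) \<longleftrightarrow> integrable (\<pi> i) g"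
    using integral_distr[OF coordinate_measurable_\<pi>\<Gamma>[OF i] gm] integrable_distr_eq[OF coordinate_measurable_\<pi>\<Gamma>[OF i] gm]
    unfolding marginal[OF i] by auto
qed

lemma lift_measurable:
  assumes i: "i \<in> {1..n}" and g: "g \<in> borel_measurable (\<pi> i)"
  shows "lift_fun n E i g \<in> borel_measurable \<pi>\<Gamma>"
proof -
  interpret I: invariant_kernel "E i" "p i" "\<pi> i" by (rule invariant_kernel_E[OF i])
  have gm: "g \<in> borel_measurable (borel_of (E i))" using g unfolding I.measurable_\<mu> .
  have "lift_fun n E i g \<in> borel_measurable \<pi>\<Gamma> \<longleftrightarrow> (\<lambda>x. g (x i)) \<in> borel_measurable \<pi>\<Gamma>"
    by (rule measurable_cong) (simp add: lift_fun_def Q.space_\<mu> del: topspace_product_topology)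
  then show ?thesis using measurable_compose[OF coordinate_measurable_\<pi>\<Gamma>[OF i] gm] by simp
qed

lemma lift_eq: "x \<in> topspace X \<Longrightarrow> lift_fun n E i g x = g (x i)"
  by (simp add: lift_fun_def del: topspace_product_topology)

lemma lift_L2:
  assumes i: "i \<in> {1..n}" and g: "g \<in> L2 (\<pi> i)" shows "lift_fun n E i g \<in> L2 \<pi>\<Gamma>"
proof -
  have gm: "g \<in> borel_measurable (\<pi> i)" and g2: "integrable (\<pi> i) (\<lambda>x. (g x)\<^sup>2)" using g by (auto simp: L2_def)
  have "integrable \<pi>\<Gamma> (\<lambda>x. (lift_fun n E i g x)\<^sup>2) \<longleftrightarrow> integrable \<pi>\<Gamma> (\<lambda>x. (g (x i))\<^sup>2)"
    by (rule Bochner_Integration.integrable_cong) (simp_all add: lift_eq Q.space_\<mu> del: topspace_product_topology)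
  then show ?thesis using lift_measurable[OF i gm] integral_coordinate(2)[OF i, of "\<lambda>x. (g x)\<^sup>2"] gm g2 by (simp add: L2_def)
qed

lemma lift_semigroup:
  assumes i: "i \<in> {1..n}" and t: "0 \<le> t" and x: "x \<in> topspace X" and g: "g \<in> borel_measurable (\<pi> i)"
  shows "Q.P t (lift_fun n E i g) x = semigroup_of (E i) (p i) t g (x i)"
proof -
  interpret I: invariant_kernel "E i" "p i" "\<pi> i" by (rule invariant_kernel_E[OF i])
  have gm: "g \<in> borel_measurable (borel_of (E i))" using g unfolding I.measurable_\<mu> .
  have c: "(\<lambda>y. y i) \<in> q t x \<rightarrow>\<^sub>M borel_of (E i)"
    using coordinate_borel_measurable[OF i] measurable_cong_sets[OF Q.kernel_sets[OF t x] refl] by blast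
  have "Q.P t (lift_fun n E i g) x = (\<integral>y. g (y i) \<partial>q t x)"
    unfolding Q.P_eq[OF x] by (rule Bochner_Integration.integral_cong) (simp_all add: Q.kernel_space[OF t x] lift_eq del: topspace_product_topology)
  also have "\<dots> = (\<integral>y. g y \<partial>p i t (x i))" unfolding coordinate_kernel[OF i t x, symmetric] by (rule integral_distr[OF c gm, symmetric])
  finally show ?thesis using I.P_eq[OF coordinate_topspace[OF x i]] by simp
qed

text \<open>By \<open>coordinate_kernel\<close> and \<open>marginal\<close> the quotient error of a
  lift has the same mean square as the error in the coordinate.\<close>

lemma lift_L2_generator:
  assumes i: "i \<in> {1..n}" and uv: "(u, v) \<in> L2_generator (E i) (p i) (\<pi> i)"
  shows "(lift_fun n E i u, lift_fun n E i v) \<in> L2_generator X q \<pi>\<Gamma>"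
proof -
  interpret I: invariant_kernel "E i" "p i" "\<pi> i" by (rule invariant_kernel_E[OF i])
  have u: "u \<in> L2 (\<pi> i)" and v: "v \<in> L2 (\<pi> i)" using uv by (auto simp: L2_generator_def)
  have um: "u \<in> borel_measurable (\<pi> i)" and vm: "v \<in> borel_measurable (\<pi> i)" using u v by (auto simp: L2_def)
  have eq: "(\<integral>\<^sup>+x. ennreal (((Q.P t (lift_fun n E i u) x - lift_fun n E i u x) / t - lift_fun n E i v x)\<^sup>2) \<partial>\<pi>\<Gamma>)
    = (\<integral>\<^sup>+y. ennreal (((semigroup_of (E i) (p i) t u y - u y) / t - v y)\<^sup>2) \<partial>\<pi> i)" if t: "0 < t" for t
  proof -
    have m: "(\<lambda>y. ennreal (((semigroup_of (E i) (p i) t u y - u y) / t - v y)\<^sup>2)) \<in> borel_measurable (borel_of (E i))"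
      using I.P_measurable[OF less_imp_le[OF t]] um vm unfolding I.measurable_\<mu> by measurable
    have "(\<integral>\<^sup>+x. ennreal (((Q.P t (lift_fun n E i u) x - lift_fun n E i u x) / t - lift_fun n E i v x)\<^sup>2) \<partial>\<pi>\<Gamma>)
      = (\<integral>\<^sup>+x. ennreal (((semigroup_of (E i) (p i) t u (x i) - u (x i)) / t - v (x i))\<^sup>2) \<partial>\<pi>\<Gamma>)"
    proof (rule nn_integral_cong)
      fix x assume "x \<in> space \<pi>\<Gamma>"
      then have x: "x \<in> topspace X" by (simp only: Q.space_\<mu>)
      show "ennreal (((Q.P t (lift_fun n E i u) x - lift_fun n E i u x) / t - lift_fun n E i v x)\<^sup>2)
        = ennreal (((semigroup_of (E i) (p i) t u (x i) - u (x i)) / t - v (x i))\<^sup>2)"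
        unfolding lift_eq[OF x] lift_semigroup[OF i less_imp_le[OF t] x um] ..
    qed
    also have "\<dots> = (\<integral>\<^sup>+y. ennreal (((semigroup_of (E i) (p i) t u y - u y) / t - v y)\<^sup>2) \<partial>\<pi> i)"
      unfolding marginal[OF i, symmetric] by (rule nn_integral_distr[OF coordinate_measurable_\<pi>\<Gamma>[OF i], symmetric]) (use m in simp)
    finally show ?thesis .
  qed
  have "((\<lambda>t. \<integral>\<^sup>+y. ennreal (((semigroup_of (E i) (p i) t u y - u y) / t - v y)\<^sup>2) \<partial>\<pi> i) \<longlongrightarrow> 0) (at_right 0)"
    using uv by (simp add: L2_generator_def)
  then have "((\<lambda>t. \<integral>\<^sup>+x. ennreal (((Q.P t (lift_fun n E i u) x - lift_fun n E i u x) / t - lift_fun n E i v x)\<^sup>2) \<partial>\<pi>\<Gamma>) \<longlongrightarrow> 0) (at_right 0)"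
  proof (rule Lim_transform_eventually)
    show "\<forall>\<^sub>F t in at_right 0. (\<integral>\<^sup>+y. ennreal (((semigroup_of (E i) (p i) t u y - u y) / t - v y)\<^sup>2) \<partial>\<pi> i)
      = (\<integral>\<^sup>+x. ennreal (((Q.P t (lift_fun n E i u) x - lift_fun n E i u x) / t - lift_fun n E i v x)\<^sup>2) \<partial>\<pi>\<Gamma>)"
      unfolding eventually_at_right_0 by (intro exI[of _ 1] conjI allI impI eq[symmetric]) simp_all
  qed
  then show ?thesis using lift_L2[OF i u] lift_L2[OF i v] by (simp add: L2_generator_def)
qed

text \<open>The hypothesis on \<open>\<Gamma>\<close> supplies some kernel and some law. Uniqueness
  of the invariant law identifies the latter with \<open>\<pi>\<Gamma>\<close>,
  \<open>generates_unique\<close> the former with \<open>q\<close>.\<close>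

lemma coupled_time_average:
  assumes g: "g \<in> Cb X"
  shows "((\<lambda>T. \<integral>\<omega>. (1 / T * Q.occ T g \<omega> - (\<integral>x. g x \<partial>\<pi>\<Gamma>))\<^sup>2 \<partial>M) \<longlongrightarrow> 0) at_top"
proof (rule Q.time_average_L2[OF g])
  obtain q' \<mu> where q': "feller_process X (prod_atlas n \<A>) q'" "generates X A q'" "ergodic X A q' \<mu>"
    using \<Gamma> by (auto simp: ergodic_coupling_operators_def)
  have \<mu>: "\<mu> = \<pi>\<Gamma>" using q'(3) \<pi>\<Gamma> by (auto simp: ergodic_def)
  have qq: "q t x = q' t x" if "0 \<le> t" "x \<in> topspace X" for t x
    by (rule generates_unique[OF Q.feller_kernel_axioms feller_process_kernel[OF C0_positive_X q'(1)] q_generated q'(2) that])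
  fix R :: "(real \<Rightarrow> nat \<Rightarrow> 'a) measure" assume "markov_process X q \<pi>\<Gamma> R (\<lambda>t y. y t)"
  then have "markov_process X q' \<pi>\<Gamma> R (\<lambda>t y. y t)" by (rule markov_process_cong[OF _ qq])
  moreover have "prob_on X \<pi>\<Gamma>" using \<pi>\<Gamma> by (simp add: invariant_for_def)
  ultimately show "AE y in R. ((\<lambda>T. 1 / T * (LINT t:{0..T}|lborel. g (y t))) \<longlongrightarrow> (\<integral>x. g x \<partial>\<pi>\<Gamma>)) at_top"
    using q'(3) g unfolding ergodic_def \<mu> by blast
qed

end

section \<open>Tensor sums and the limit variance\<close>

context coupled_process
begin

abbreviation "L2gen \<equiv> (\<lambda>i. L2_generator (E i) (p i) (\<pi> i))"

text \<open>Needed to replace one representative of the image by another under the integral, which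
  requires both to be measurable.\<close>

lemma tensor_sum_measurable:
  assumes wg: "(w, g) \<in> tensor_sum n E L2gen" shows "g \<in> borel_measurable \<pi>\<Gamma>"
proof -
  obtain m :: nat and c a where g: "g = (\<lambda>x. \<Sum>k<m. c k * snd (a k) x)"
    and a: "\<And>k. k < m \<Longrightarrow> \<exists>u v. a k = (\<lambda>x. if x \<in> topspace X then \<Prod>i\<in>{1..n}. u i (x i) else 0,
       \<lambda>x. if x \<in> topspace X then \<Sum>i\<in>{1..n}. v i (x i) * (\<Prod>j\<in>{1..n} - {i}. u j (x j)) else 0)
       \<and> (\<forall>i\<in>{1..n}. (u i, v i) \<in> L2gen i)"
    using wg unfolding tensor_sum_def op_span_def by blast
  have cm: "(\<lambda>x. r (x i)) \<in> borel_measurable \<pi>\<Gamma>" if i: "i \<in> {1..n}" and r: "r \<in> L2 (\<pi> i)" for i r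
  proof -
    interpret I: invariant_kernel "E i" "p i" "\<pi> i" by (rule invariant_kernel_E[OF i])
    have "r \<in> borel_measurable (borel_of (E i))" using r I.measurable_\<mu> unfolding L2_def by blast
    then show ?thesis by (rule measurable_compose[OF coordinate_measurable_\<pi>\<Gamma>[OF i]])
  qed
  have "snd (a k) \<in> borel_measurable \<pi>\<Gamma>" if k: "k < m" for k
  proof -
    obtain u v where uv: "a k = (\<lambda>x. if x \<in> topspace X then \<Prod>i\<in>{1..n}. u i (x i) else 0,
       \<lambda>x. if x \<in> topspace X then \<Sum>i\<in>{1..n}. v i (x i) * (\<Prod>j\<in>{1..n} - {i}. u j (x j)) else 0)"
       "\<forall>i\<in>{1..n}. (u i, v i) \<in> L2gen i" using a[OF k] by blast
    have L: "u i \<in> L2 (\<pi> i)" "v i \<in> L2 (\<pi> i)" if "i \<in> {1..n}" for i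
      using uv(2) that unfolding L2_generator_def by blast+
    have "(\<lambda>x. \<Sum>i\<in>{1..n}. v i (x i) * (\<Prod>j\<in>{1..n} - {i}. u j (x j))) \<in> borel_measurable \<pi>\<Gamma>"
      by (intro borel_measurable_sum borel_measurable_times borel_measurable_prod cm L) blast+
    moreover have "snd (a k) \<in> borel_measurable \<pi>\<Gamma> \<longleftrightarrow> (\<lambda>x. \<Sum>i\<in>{1..n}. v i (x i) * (\<Prod>j\<in>{1..n} - {i}. u j (x j))) \<in> borel_measurable \<pi>\<Gamma>"
      unfolding uv(1) snd_conv by (rule measurable_cong) (simp only: Q.space_\<mu> if_True)
    ultimately show ?thesis by blast
  qed
  then show ?thesis unfolding g by (intro borel_measurable_sum borel_measurable_times borel_measurable_const) blast
qed

lemma tensor_sum_zero: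
  assumes wg: "(w, g) \<in> tensor_sum n E L2gen" and w0: "\<And>x. x \<in> topspace X \<Longrightarrow> w x = 0"
  shows "AE x in \<pi>\<Gamma>. g x = 0"
proof -
  obtain m :: nat and c a where wg': "w = (\<lambda>x. \<Sum>k<m. c k * fst (a k) x)" "g = (\<lambda>x. \<Sum>k<m. c k * snd (a k) x)"
    and a: "\<And>k. k < m \<Longrightarrow> \<exists>u v. a k = (\<lambda>x. if x \<in> topspace X then \<Prod>i\<in>{1..n}. u i (x i) else 0,
       \<lambda>x. if x \<in> topspace X then \<Sum>i\<in>{1..n}. v i (x i) * (\<Prod>j\<in>{1..n} - {i}. u j (x j)) else 0)
       \<and> (\<forall>i\<in>{1..n}. (u i, v i) \<in> L2gen i)"
    using wg unfolding tensor_sum_def op_span_def by blast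
  from a have "\<forall>k. \<exists>u v. k < m \<longrightarrow> a k = (\<lambda>x. if x \<in> topspace X then \<Prod>i\<in>{1..n}. u i (x i) else 0,
       \<lambda>x. if x \<in> topspace X then \<Sum>i\<in>{1..n}. v i (x i) * (\<Prod>j\<in>{1..n} - {i}. u j (x j)) else 0)
       \<and> (\<forall>i\<in>{1..n}. (u i, v i) \<in> L2gen i)" by blast
  then obtain u where "\<forall>k. \<exists>v. k < m \<longrightarrow> a k = (\<lambda>x. if x \<in> topspace X then \<Prod>i\<in>{1..n}. u k i (x i) else 0,
       \<lambda>x. if x \<in> topspace X then \<Sum>i\<in>{1..n}. v i (x i) * (\<Prod>j\<in>{1..n} - {i}. u k j (x j)) else 0)
       \<and> (\<forall>i\<in>{1..n}. (u k i, v i) \<in> L2gen i)" by (rule choice[THEN exE])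
  then obtain v where uv: "\<forall>k. k < m \<longrightarrow> a k = (\<lambda>x. if x \<in> topspace X then \<Prod>i\<in>{1..n}. u k i (x i) else 0,
       \<lambda>x. if x \<in> topspace X then \<Sum>i\<in>{1..n}. v k i (x i) * (\<Prod>j\<in>{1..n} - {i}. u k j (x j)) else 0)
       \<and> (\<forall>i\<in>{1..n}. (u k i, v k i) \<in> L2gen i)" by (rule choice[THEN exE])
  have w: "w x = (\<Sum>k<m. c k * (\<Prod>i\<in>{1..n}. u k i (x i)))" if "x \<in> topspace X" for x
    unfolding wg' using uv that by (intro sum.cong refl) simp
  have g: "g x = (\<Sum>k<m. c k * (\<Sum>i\<in>{1..n}. v k i (x i) * (\<Prod>j\<in>{1..n} - {i}. u k j (x j))))" if "x \<in> topspace X" for x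
    unfolding wg' using uv that by (intro sum.cong refl) simp
  \<comment> \<open>The null set is chosen before the coefficients; a choice after them would depend
    on the point.\<close>
  have "\<forall>i. \<exists>N. i \<in> {1..n} \<longrightarrow> N \<in> null_sets (\<pi> i) \<and> (\<forall>x\<in>topspace (E i) - N. \<forall>b.
      (\<forall>y\<in>topspace (E i). (\<Sum>k\<in>{..<m}. b k * u k i y) = 0) \<longrightarrow> (\<Sum>k\<in>{..<m}. b k * v k i x) = 0)"
  proof (rule allI)
    fix i
    show "\<exists>N. i \<in> {1..n} \<longrightarrow> N \<in> null_sets (\<pi> i) \<and> (\<forall>x\<in>topspace (E i) - N. \<forall>b.
      (\<forall>y\<in>topspace (E i). (\<Sum>k\<in>{..<m}. b k * u k i y) = 0) \<longrightarrow> (\<Sum>k\<in>{..<m}. b k * v k i x) = 0)"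
    proof (cases "i \<in> {1..n}")
      case True
      have "(u k i, v k i) \<in> L2gen i" if "k \<in> {..<m}" for k using uv that True by blast
      then show ?thesis
        using invariant_kernel.L2_generator_uniform_null_set[OF invariant_kernel_E[OF True], of "{..<m}" "\<lambda>k. u k i" "\<lambda>k. v k i"] by blast
    qed blast
  qed
  then obtain N where N: "\<forall>i. i \<in> {1..n} \<longrightarrow> N i \<in> null_sets (\<pi> i) \<and> (\<forall>x\<in>topspace (E i) - N i. \<forall>b.
      (\<forall>y\<in>topspace (E i). (\<Sum>k\<in>{..<m}. b k * u k i y) = 0) \<longrightarrow> (\<Sum>k\<in>{..<m}. b k * v k i x) = 0)"
    by (rule choice[THEN exE])
  have "AE x in \<pi>\<Gamma>. \<forall>i\<in>{1..n}. x i \<notin> N i"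
  proof (rule AE_finite_allI)
    fix i assume i: "i \<in> {1..n}"
    then have "N i \<in> null_sets (\<pi> i)" using N by blast
    then have "AE y in \<pi> i. y \<notin> N i" by (rule AE_not_in)
    then show "AE x in \<pi>\<Gamma>. x i \<notin> N i" by (rule AE_coordinate[OF i])
  qed simp
  then show ?thesis
  proof (rule AE_mp, intro AE_I2 impI)
    fix x assume "x \<in> space \<pi>\<Gamma>" and xN: "\<forall>i\<in>{1..n}. x i \<notin> N i"
    then have x: "x \<in> topspace X" by (simp only: Q.space_\<mu>)
    have "(\<Sum>k<m. c k * (v k i (x i) * (\<Prod>j\<in>{1..n} - {i}. u k j (x j)))) = 0" if i: "i \<in> {1..n}" for i
    proof -
      define b where "b k = c k * (\<Prod>j\<in>{1..n} - {i}. u k j (x j))" for k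
      have "(\<Sum>k<m. b k * u k i y) = 0" if y: "y \<in> topspace (E i)" for y
      proof -
        have xy: "x(i := y) \<in> topspace X" using x y i by (auto simp: PiE_iff extensional_def)
        have "(\<Sum>k<m. b k * u k i y) = w (x(i := y))"
          unfolding w[OF xy]
        proof (intro sum.cong refl)
          fix k
          have "(\<Prod>j\<in>{1..n}. u k j ((x(i := y)) j)) = u k i y * (\<Prod>j\<in>{1..n} - {i}. u k j ((x(i := y)) j))"
            by (subst prod.remove[OF _ i]) auto
          also have "(\<Prod>j\<in>{1..n} - {i}. u k j ((x(i := y)) j)) = (\<Prod>j\<in>{1..n} - {i}. u k j (x j))"
            by (intro prod.cong) auto
          finally show "b k * u k i y = c k * (\<Prod>j\<in>{1..n}. u k j ((x(i := y)) j))" by (simp only: b_def ac_simps)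
        qed
        then show ?thesis using w0[OF xy] by simp
      qed
      moreover have "x i \<in> topspace (E i) - N i" using coordinate_topspace[OF x i] xN i by blast
      ultimately have "(\<Sum>k<m. b k * v k i (x i)) = 0" using N i by blast
      then show ?thesis by (simp only: b_def ac_simps)
    qed
    then have "(\<Sum>i\<in>{1..n}. \<Sum>k<m. c k * (v k i (x i) * (\<Prod>j\<in>{1..n} - {i}. u k j (x j)))) = 0" by (intro sum.neutral) blast
    then show "g x = 0" unfolding g[OF x] sum_distrib_left by (subst sum.swap)
  qed
qed

text \<open>Two images of the same function differ by an image of 0. Hence the integral of
  \<open>L0\<xi>\<close> does not depend on the tensor representation chosen.\<close>

lemma tensor_sum_unique:
  assumes "(w, g) \<in> tensor_sum n E L2gen" "(w, g') \<in> tensor_sum n E L2gen"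
  shows "AE x in \<pi>\<Gamma>. g x = g' x"
proof -
  have "(\<lambda>x. w x + (-1) * w x, \<lambda>x. g x + (-1) * g' x) \<in> tensor_sum n E L2gen"
    using op_span_add[OF assms(1)[unfolded tensor_sum_def] op_span_cmult[OF assms(2)[unfolded tensor_sum_def], of "-1"]]
    by (simp only: tensor_sum_def)
  from tensor_sum_zero[OF this] have "AE x in \<pi>\<Gamma>. g x + (-1) * g' x = 0" by simp
  then show ?thesis by eventually_elim simp
qed

text \<open>The remaining factors are the constant 1, whose generator is 0, so the product rule
  leaves two terms.\<close>

lemma pair_in_tensor_sum:
  assumes ij: "i \<in> {1..n}" "j \<in> {1..n}" "i \<noteq> j" and ui: "(u, v) \<in> L2gen i" and uj: "(u', v') \<in> L2gen j"
  shows "(\<lambda>x. lift_fun n E i u x * lift_fun n E j u' x,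
     \<lambda>x. lift_fun n E i v x * lift_fun n E j u' x + lift_fun n E i u x * lift_fun n E j v' x) \<in> tensor_sum n E L2gen"
proof -
  define U where "U k = (if k = i then u else if k = j then u' else indicator (topspace (E k)))" for k
  define V where "V k = (if k = i then v else if k = j then v' else (\<lambda>_. 0))" for k
  have U1: "U k (x k) = 1" if "x \<in> topspace X" "k \<in> {1..n} - {i, j}" for x k
    using that coordinate_topspace[OF that(1), of k] by (simp add: U_def)
  have f: "(\<lambda>x. lift_fun n E i u x * lift_fun n E j u' x) = (\<lambda>x. if x \<in> topspace X then \<Prod>k\<in>{1..n}. U k (x k) else 0)"
  proof
    fix x
    show "lift_fun n E i u x * lift_fun n E j u' x = (if x \<in> topspace X then \<Prod>k\<in>{1..n}. U k (x k) else 0)"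
    proof (cases "x \<in> topspace X")
      case True
      have "(\<Prod>k\<in>{1..n}. U k (x k)) = (\<Prod>k\<in>{i, j}. U k (x k))"
        by (rule prod.mono_neutral_right) (use ij U1[OF True] in auto)
      also have "\<dots> = u (x i) * u' (x j)" using ij(3) by (simp add: U_def)
      finally show ?thesis using True by (simp only: lift_eq if_True)
    qed (simp add: lift_fun_def del: topspace_product_topology)
  qed
  have g: "(\<lambda>x. lift_fun n E i v x * lift_fun n E j u' x + lift_fun n E i u x * lift_fun n E j v' x)
    = (\<lambda>x. if x \<in> topspace X then \<Sum>k\<in>{1..n}. V k (x k) * (\<Prod>l\<in>{1..n} - {k}. U l (x l)) else 0)"
  proof
    fix x
    show "lift_fun n E i v x * lift_fun n E j u' x + lift_fun n E i u x * lift_fun n E j v' x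
      = (if x \<in> topspace X then \<Sum>k\<in>{1..n}. V k (x k) * (\<Prod>l\<in>{1..n} - {k}. U l (x l)) else 0)"
    proof (cases "x \<in> topspace X")
      case True
      have "(\<Sum>k\<in>{1..n}. V k (x k) * (\<Prod>l\<in>{1..n} - {k}. U l (x l))) = (\<Sum>k\<in>{i, j}. V k (x k) * (\<Prod>l\<in>{1..n} - {k}. U l (x l)))"
        by (rule sum.mono_neutral_right) (use ij in \<open>auto simp: V_def\<close>)
      also have "\<dots> = V i (x i) * (\<Prod>l\<in>{1..n} - {i}. U l (x l)) + V j (x j) * (\<Prod>l\<in>{1..n} - {j}. U l (x l))"
        using ij(3) by simp
      also have "(\<Prod>l\<in>{1..n} - {i}. U l (x l)) = (\<Prod>l\<in>{j}. U l (x l))"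
        by (rule prod.mono_neutral_right) (use ij U1[OF True] in auto)
      also have "(\<Prod>l\<in>{1..n} - {j}. U l (x l)) = (\<Prod>l\<in>{i}. U l (x l))"
        by (rule prod.mono_neutral_right) (use ij U1[OF True] in auto)
      also have "V i (x i) * (\<Prod>l\<in>{j}. U l (x l)) + V j (x j) * (\<Prod>l\<in>{i}. U l (x l)) = v (x i) * u' (x j) + u (x i) * v' (x j)"
        using ij(3) by (simp add: U_def V_def mult.commute)
      finally show ?thesis using True by (simp only: lift_eq if_True)
    qed (simp add: lift_fun_def del: topspace_product_topology)
  qed
  have UV: "\<forall>k\<in>{1..n}. (U k, V k) \<in> L2gen k"
    using ui uj invariant_kernel.indicator_L2_generator[OF invariant_kernel_E] by (auto simp: U_def V_def)
  show ?thesis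
    unfolding f g tensor_sum_def
    by (rule op_span_base) (use UV in blast)
qed

lemma average_L2_generator:
  assumes "\<And>i. i \<in> {1..n} \<Longrightarrow> (\<phi> i, \<lambda>x. - f i x) \<in> L2gen i"
  shows "(average_fun n E \<phi>, \<lambda>x. - average_fun n E f x) \<in> L2_generator X q \<pi>\<Gamma>"
proof -
  have *: "(\<lambda>x. \<Sum>i\<in>{1..n}. 1 / real n * lift_fun n E i (\<phi> i) x,
    \<lambda>x. \<Sum>i\<in>{1..n}. 1 / real n * lift_fun n E i (\<lambda>x. - f i x) x) \<in> L2_generator X q \<pi>\<Gamma>"
    by (rule Q.L2_generator_sum[where a = "\<lambda>_. 1 / real n", OF finite_atLeastAtMost lift_L2_generator[OF _ assms]])
  have e1: "(\<lambda>x. \<Sum>i\<in>{1..n}. 1 / real n * lift_fun n E i (\<phi> i) x) = average_fun n E \<phi>"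
    by (simp only: average_fun_def sum_distrib_left)
  have "lift_fun n E i (\<lambda>x. - f i x) x = - lift_fun n E i (f i) x" for i x
    by (simp add: lift_fun_def del: topspace_product_topology)
  then have e2: "(\<lambda>x. \<Sum>i\<in>{1..n}. 1 / real n * lift_fun n E i (\<lambda>x. - f i x) x) = (\<lambda>x. - average_fun n E f x)"
    by (simp only: average_fun_def sum_distrib_left sum_negf mult_minus_right)
  show ?thesis using * unfolding e1 e2 .
qed

text \<open>Expanding the product of the two averages gives a double sum of mixed integrals. Its
  diagonal lives on the marginals; its off-diagonal part is minus the integral of the image of
  \<open>cross_fun\<close>, computed by the product rule with \<open>-f i\<close> in place of the
  generator of \<open>\<phi> i\<close>.\<close>

lemma variance_identity:
  assumes f: "\<And>i. i \<in> {1..n} \<Longrightarrow> f i \<in> L2 (\<pi> i)" and \<phi>: "\<And>i. i \<in> {1..n} \<Longrightarrow> \<phi> i \<in> L2 (\<pi> i)"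
    and poisson: "\<And>i. i \<in> {1..n} \<Longrightarrow> (\<phi> i, \<lambda>x. - f i x) \<in> L2gen i"
    and L0\<xi>: "(cross_fun n E \<phi>, L0\<xi>) \<in> tensor_sum n E L2gen"
  shows "(\<integral>x. average_fun n E f x * average_fun n E \<phi> x \<partial>\<pi>\<Gamma>)
    = 1 / (real n)\<^sup>2 * (\<Sum>i\<in>{1..n}. \<integral>x. f i x * \<phi> i x \<partial>\<pi> i) - (\<integral>x. L0\<xi> x \<partial>\<pi>\<Gamma>)"
proof -
  let ?lf = "\<lambda>i. lift_fun n E i (f i)" and ?l\<phi> = "\<lambda>i. lift_fun n E i (\<phi> i)"
  define h where "h i j = (\<integral>x. ?lf i x * ?l\<phi> j x \<partial>\<pi>\<Gamma>)" for i j
  have int: "integrable \<pi>\<Gamma> (\<lambda>x. ?lf i x * ?l\<phi> j x)" if "i \<in> {1..n}" "j \<in> {1..n}" for i j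
    by (rule L2_mult_integrable[OF lift_L2[OF that(1) f[OF that(1)]] lift_L2[OF that(2) \<phi>[OF that(2)]]])
  have neg: "lift_fun n E i (\<lambda>x. - f i x) x = - ?lf i x" for i x
    by (simp add: lift_fun_def del: topspace_product_topology)
  \<comment> \<open>An explicit image of \<open>cross_fun\<close>; the given \<open>L0\<xi>\<close>
    equals it almost everywhere by \<open>tensor_sum_unique\<close>.\<close>
  define L where "L x = 1 / (real n)\<^sup>2 * (\<Sum>j\<in>{1..n}. \<Sum>i\<in>{1..<j}. - ?lf i x * ?l\<phi> j x + ?l\<phi> i x * - ?lf j x)" for x
  have "(cross_fun n E \<phi>, L) \<in> tensor_sum n E L2gen"
  proof -
    have "(\<lambda>x. ?l\<phi> i x * ?l\<phi> j x, \<lambda>x. - ?lf i x * ?l\<phi> j x + ?l\<phi> i x * - ?lf j x) \<in> tensor_sum n E L2gen"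
      if "j \<in> {1..n}" "i \<in> {1..<j}" for i j
    proof -
      have i: "i \<in> {1..n}" "i \<noteq> j" using that by auto
      show ?thesis using pair_in_tensor_sum[OF i(1) that(1) i(2) poisson[OF i(1)] poisson[OF that(1)]] unfolding neg .
    qed
    then have "(\<lambda>x. \<Sum>j\<in>{1..n}. \<Sum>i\<in>{1..<j}. ?l\<phi> i x * ?l\<phi> j x, \<lambda>x. \<Sum>j\<in>{1..n}. \<Sum>i\<in>{1..<j}. - ?lf i x * ?l\<phi> j x + ?l\<phi> i x * - ?lf j x) \<in> tensor_sum n E L2gen"
      unfolding tensor_sum_def by (intro op_span_sum) auto
    then show ?thesis unfolding tensor_sum_def cross_fun_def L_def by (rule op_span_cmult)
  qed
  from tensor_sum_unique[OF L0\<xi> this] have ae: "AE x in \<pi>\<Gamma>. L0\<xi> x = L x" .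
  have iL: "integrable \<pi>\<Gamma> (\<lambda>x. - ?lf i x * ?l\<phi> j x + ?l\<phi> i x * - ?lf j x)"
    and eL: "(\<integral>x. - ?lf i x * ?l\<phi> j x + ?l\<phi> i x * - ?lf j x \<partial>\<pi>\<Gamma>) = - (h i j + h j i)" if "j \<in> {1..n}" "i \<in> {1..<j}" for i j
  proof -
    have i: "i \<in> {1..n}" using that by auto
    have eq: "- ?lf i x * ?l\<phi> j x + ?l\<phi> i x * - ?lf j x = - (?lf i x * ?l\<phi> j x + ?lf j x * ?l\<phi> i x)" for x by simp
    show "integrable \<pi>\<Gamma> (\<lambda>x. - ?lf i x * ?l\<phi> j x + ?l\<phi> i x * - ?lf j x)"
      unfolding eq using int[OF i that(1)] int[OF that(1) i] by (intro integrable_minus Bochner_Integration.integrable_add)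
    show "(\<integral>x. - ?lf i x * ?l\<phi> j x + ?l\<phi> i x * - ?lf j x \<partial>\<pi>\<Gamma>) = - (h i j + h j i)"
      unfolding eq integral_minus h_def Bochner_Integration.integral_add[OF int[OF i that(1)] int[OF that(1) i]] ..
  qed
  have Li: "integrable \<pi>\<Gamma> L"
    unfolding L_def[abs_def] by (intro integrable_mult_right Bochner_Integration.integrable_sum iL)
  have "(\<integral>x. L x \<partial>\<pi>\<Gamma>) = 1 / (real n)\<^sup>2 * (\<Sum>j\<in>{1..n}. \<Sum>i\<in>{1..<j}. - (h i j + h j i))"
  proof -
    have "(\<integral>x. L x \<partial>\<pi>\<Gamma>) = 1 / (real n)\<^sup>2 * (\<integral>x. (\<Sum>j\<in>{1..n}. \<Sum>i\<in>{1..<j}. - ?lf i x * ?l\<phi> j x + ?l\<phi> i x * - ?lf j x) \<partial>\<pi>\<Gamma>)"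
      unfolding L_def by (rule integral_mult_right_zero)
    also have "(\<integral>x. (\<Sum>j\<in>{1..n}. \<Sum>i\<in>{1..<j}. - ?lf i x * ?l\<phi> j x + ?l\<phi> i x * - ?lf j x) \<partial>\<pi>\<Gamma>)
      = (\<Sum>j\<in>{1..n}. \<integral>x. (\<Sum>i\<in>{1..<j}. - ?lf i x * ?l\<phi> j x + ?l\<phi> i x * - ?lf j x) \<partial>\<pi>\<Gamma>)"
      by (intro Bochner_Integration.integral_sum Bochner_Integration.integrable_sum iL)
    also have "\<dots> = (\<Sum>j\<in>{1..n}. \<Sum>i\<in>{1..<j}. - (h i j + h j i))"
    proof (intro sum.cong refl)
      fix j assume j: "j \<in> {1..n}"
      have "(\<integral>x. (\<Sum>i\<in>{1..<j}. - ?lf i x * ?l\<phi> j x + ?l\<phi> i x * - ?lf j x) \<partial>\<pi>\<Gamma>)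
        = (\<Sum>i\<in>{1..<j}. \<integral>x. - ?lf i x * ?l\<phi> j x + ?l\<phi> i x * - ?lf j x \<partial>\<pi>\<Gamma>)"
        by (intro Bochner_Integration.integral_sum iL j)
      also have "\<dots> = (\<Sum>i\<in>{1..<j}. - (h i j + h j i))" by (intro sum.cong refl eL j)
      finally show "(\<integral>x. (\<Sum>i\<in>{1..<j}. - ?lf i x * ?l\<phi> j x + ?l\<phi> i x * - ?lf j x) \<partial>\<pi>\<Gamma>) = (\<Sum>i\<in>{1..<j}. - (h i j + h j i))" .
    qed
    finally show ?thesis .
  qed
  moreover have "(\<integral>x. L0\<xi> x \<partial>\<pi>\<Gamma>) = (\<integral>x. L x \<partial>\<pi>\<Gamma>)"
  proof (rule integral_cong_AE[OF _ _ ae])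
    show "L \<in> borel_measurable \<pi>\<Gamma>" using Li by (rule borel_measurable_integrable)
    show "L0\<xi> \<in> borel_measurable \<pi>\<Gamma>" by (rule tensor_sum_measurable[OF L0\<xi>])
  qed
  ultimately have L0: "(\<integral>x. L0\<xi> x \<partial>\<pi>\<Gamma>) = - (1 / (real n)\<^sup>2 * (\<Sum>j\<in>{1..n}. \<Sum>i\<in>{1..<j}. h i j + h j i))"
    by (simp only: sum_negf mult_minus_right)
  have hd: "h i i = (\<integral>x. f i x * \<phi> i x \<partial>\<pi> i)" if i: "i \<in> {1..n}" for i
  proof -
    have m: "(\<lambda>y. f i y * \<phi> i y) \<in> borel_measurable (\<pi> i)" using f[OF i] \<phi>[OF i] by (auto simp: L2_def)
    have "h i i = (\<integral>x. f i (x i) * \<phi> i (x i) \<partial>\<pi>\<Gamma>)" unfolding h_def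
      by (rule Bochner_Integration.integral_cong) (simp_all add: lift_eq Q.space_\<mu> del: topspace_product_topology)
    also have "\<dots> = (\<integral>x. f i x * \<phi> i x \<partial>\<pi> i)" by (rule integral_coordinate(1)[OF i m])
    finally show ?thesis .
  qed
  have "(\<integral>x. average_fun n E f x * average_fun n E \<phi> x \<partial>\<pi>\<Gamma>)
    = (\<integral>x. 1 / (real n)\<^sup>2 * (\<Sum>i\<in>{1..n}. \<Sum>j\<in>{1..n}. ?lf i x * ?l\<phi> j x) \<partial>\<pi>\<Gamma>)"
    by (rule Bochner_Integration.integral_cong[OF refl]) (simp add: average_fun_def power2_eq_square sum_product[symmetric])
  also have "\<dots> = 1 / (real n)\<^sup>2 * (\<integral>x. (\<Sum>i\<in>{1..n}. \<Sum>j\<in>{1..n}. ?lf i x * ?l\<phi> j x) \<partial>\<pi>\<Gamma>)" by (rule integral_mult_right_zero)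
  also have "(\<integral>x. (\<Sum>i\<in>{1..n}. \<Sum>j\<in>{1..n}. ?lf i x * ?l\<phi> j x) \<partial>\<pi>\<Gamma>) = (\<Sum>i\<in>{1..n}. \<integral>x. (\<Sum>j\<in>{1..n}. ?lf i x * ?l\<phi> j x) \<partial>\<pi>\<Gamma>)"
    by (intro Bochner_Integration.integral_sum Bochner_Integration.integrable_sum int)
  also have "\<dots> = (\<Sum>i\<in>{1..n}. \<Sum>j\<in>{1..n}. h i j)"
    unfolding h_def by (intro sum.cong refl Bochner_Integration.integral_sum int)
  also have "\<dots> = (\<Sum>i\<in>{1..n}. h i i) + (\<Sum>j\<in>{1..n}. \<Sum>i\<in>{1..<j}. h i j + h j i)" by (rule sum_square_split)
  also have "(\<Sum>i\<in>{1..n}. h i i) = (\<Sum>i\<in>{1..n}. \<integral>x. f i x * \<phi> i x \<partial>\<pi> i)" by (intro sum.cong refl hd)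
  finally show ?thesis unfolding L0 by (simp only: distrib_left diff_minus_eq_add)
qed

lemma average_integral:
  assumes "\<And>i. i \<in> {1..n} \<Longrightarrow> f i \<in> L20 (\<pi> i)"
  shows "(\<integral>x. average_fun n E f x \<partial>\<pi>\<Gamma>) = 0"
proof -
  have f: "f i \<in> L2 (\<pi> i)" "(\<integral>x. f i x \<partial>\<pi> i) = 0" if "i \<in> {1..n}" for i using assms[OF that] by (auto simp: L20_def)
  have i: "integrable \<pi>\<Gamma> (lift_fun n E i (f i))" if "i \<in> {1..n}" for i
    by (rule Q.L2_integrable[OF lift_L2[OF that f(1)[OF that]]])
  have z: "(\<integral>x. lift_fun n E i (f i) x \<partial>\<pi>\<Gamma>) = 0" if i: "i \<in> {1..n}" for i
  proof -
    have "(\<integral>x. lift_fun n E i (f i) x \<partial>\<pi>\<Gamma>) = (\<integral>x. f i (x i) \<partial>\<pi>\<Gamma>)"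
      by (rule Bochner_Integration.integral_cong) (simp_all add: lift_eq Q.space_\<mu> del: topspace_product_topology)
    also have "\<dots> = (\<integral>x. f i x \<partial>\<pi> i)" by (rule integral_coordinate(1)[OF i]) (use f(1)[OF i] in \<open>simp add: L2_def\<close>)
    finally show ?thesis using f(2)[OF i] by simp
  qed
  have "(\<integral>x. average_fun n E f x \<partial>\<pi>\<Gamma>) = 1 / real n * (\<integral>x. (\<Sum>i\<in>{1..n}. lift_fun n E i (f i) x) \<partial>\<pi>\<Gamma>)"
    unfolding average_fun_def by (rule integral_mult_right_zero)
  also have "(\<integral>x. (\<Sum>i\<in>{1..n}. lift_fun n E i (f i) x) \<partial>\<pi>\<Gamma>) = (\<Sum>i\<in>{1..n}. \<integral>x. lift_fun n E i (f i) x \<partial>\<pi>\<Gamma>)"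
    by (intro Bochner_Integration.integral_sum i)
  also have "\<dots> = 0" by (intro sum.neutral ballI z)
  finally show ?thesis by simp
qed

end

theorem theorem32:
  fixes n :: nat
    and E :: "nat \<Rightarrow> 'a topology"
    and \<A> :: "nat \<Rightarrow> ('a, nat) chart set"
    and p :: "nat \<Rightarrow> real \<Rightarrow> 'a \<Rightarrow> 'a measure"
    and \<pi> :: "nat \<Rightarrow> 'a measure"
    and f \<phi> :: "nat \<Rightarrow> 'a \<Rightarrow> real"
    and \<Gamma> :: "(nat \<Rightarrow> 'a) oper"
    and q :: "real \<Rightarrow> (nat \<Rightarrow> 'a) \<Rightarrow> (nat \<Rightarrow> 'a) measure"
    and \<pi>\<Gamma> :: "(nat \<Rightarrow> 'a) measure"
    and M :: "'w measure"
    and X :: "real \<Rightarrow> 'w \<Rightarrow> nat \<Rightarrow> 'a"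
    and L0\<xi> :: "(nat \<Rightarrow> 'a) \<Rightarrow> real"
    and \<sigma>F2 :: real
  assumes n: "1 \<le> n"
    and spaces: "\<And>i. i \<in> {1..n} \<Longrightarrow> locally_compact_Polish (E i) \<and> smooth_atlas (E i) (\<A> i)"
    and feller: "\<And>i. i \<in> {1..n} \<Longrightarrow> feller_process (E i) (\<A> i) (p i)"
    and core: "\<And>i. i \<in> {1..n} \<Longrightarrow> is_core (Ccinf (E i) (\<A> i)) (generator (E i) (p i))"
    and erg: "\<And>i. i \<in> {1..n} \<Longrightarrow> ergodic (E i) (generator (E i) (p i)) (p i) (\<pi> i)"
    and invertible: "\<And>i g. i \<in> {1..n} \<Longrightarrow> g \<in> L20 (\<pi> i) \<Longrightarrow>
          \<exists>\<psi>\<in>L20 (\<pi> i). (\<psi>, \<lambda>x. - g x) \<in> L2_generator (E i) (p i) (\<pi> i)"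
    and f: "\<And>i. i \<in> {1..n} \<Longrightarrow> f i \<in> L20 (\<pi> i)"
    and \<phi>: "\<And>i. i \<in> {1..n} \<Longrightarrow> \<phi> i \<in> L20 (\<pi> i)"
    and poisson: "\<And>i. i \<in> {1..n} \<Longrightarrow> (\<phi> i, \<lambda>x. - f i x) \<in> L2_generator (E i) (p i) (\<pi> i)"
    and \<Gamma>: "\<Gamma> \<in> ergodic_coupling_operators n E \<A> p"
    and q_feller: "feller_process (prod_space n E) (prod_atlas n \<A>) q"
    and q_generated: "generates (prod_space n E) (op_closure (coupled_generator n E p \<Gamma>)) q"
    and \<pi>\<Gamma>: "invariant_for (prod_space n E) (op_closure (coupled_generator n E p \<Gamma>)) \<pi>\<Gamma>"
    and X: "markov_process (prod_space n E) q \<pi>\<Gamma> M X"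
    and L0\<xi>: "(cross_fun n E \<phi>, L0\<xi>) \<in> tensor_sum n E (\<lambda>i. L2_generator (E i) (p i) (\<pi> i))"
    and \<sigma>F2: "\<sigma>F2 = 1 / (real n)\<^sup>2 * (\<Sum>i\<in>{1..n}. \<integral>x. f i x * \<phi> i x \<partial>\<pi> i) - (\<integral>x. L0\<xi> x \<partial>\<pi>\<Gamma>)"
  shows "0 \<le> \<sigma>F2 \<and>
    (\<forall>\<tau>. filterlim \<tau> at_top sequentially \<longrightarrow>
      weak_conv_m
        (\<lambda>k. distr M borel (\<lambda>\<omega>. sqrt (\<tau> k) *
           (1 / \<tau> k * (LINT t:{0..\<tau> k}|lborel. average_fun n E f (X t \<omega>))
             - (\<integral>x. average_fun n E f x \<partial>\<pi>\<Gamma>))))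
        (centered_normal (2 * \<sigma>F2)))"
proof -
  interpret C: coupled_process n E \<A> p \<pi> \<Gamma> q \<pi>\<Gamma> M X
  proof
    show "invariant_for (E i) (generator (E i) (p i)) \<mu> \<longleftrightarrow> \<mu> = \<pi> i" if "i \<in> {1..n}" for i \<mu>
      using erg[OF that] unfolding ergodic_def by blast
  qed (use n spaces feller core \<Gamma> q_feller q_generated \<pi>\<Gamma> X in blast)+
  have f2: "f i \<in> L2 (\<pi> i)" and \<phi>2: "\<phi> i \<in> L2 (\<pi> i)" if "i \<in> {1..n}" for i
    using f[OF that] \<phi>[OF that] by (auto simp: L20_def)
  interpret D: additive_functional "prod_space n E" q \<pi>\<Gamma> M X "average_fun n E f" "average_fun n E \<phi>"
    by (rule additive_functional.intro[OF C.Q.stationary_process_axioms additive_functional_axioms.intro])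
       (rule C.average_L2_generator[OF poisson], assumption, rule C.coupled_time_average)
  have s2: "D.s2 = \<sigma>F2"
    unfolding D.s2_def \<sigma>F2 by (rule C.variance_identity[OF f2 \<phi>2 poisson L0\<xi>])
  \<comment> \<open>The subtracted mean vanishes, so the uncentred form proved in
    \<open>central_limit\<close> is already the required one.\<close>
  have mean: "(\<integral>x. average_fun n E f x \<partial>\<pi>\<Gamma>) = 0" by (rule C.average_integral[OF f])
  show ?thesis
  proof (intro conjI allI impI)
    show "0 \<le> \<sigma>F2" using D.s2_nonneg unfolding s2 .
    fix \<tau> :: "nat \<Rightarrow> real" assume \<tau>: "filterlim \<tau> at_top sequentially"
    show "weak_conv_m
        (\<lambda>k. distr M borel (\<lambda>\<omega>. sqrt (\<tau> k) *
           (1 / \<tau> k * (LINT t:{0..\<tau> k}|lborel. average_fun n E f (X t \<omega>))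
             - (\<integral>x. average_fun n E f x \<partial>\<pi>\<Gamma>))))
        (centered_normal (2 * \<sigma>F2))"
      using D.central_limit[OF \<tau>]
      unfolding mean s2 C.Q.occ_def C.Q.set_integral_left_endpoint(1) diff_0_right .
  qed
qed
end
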